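(* Suppose $g_0\ge2$. There is a constant $\nu_0\in(0,1)$, determined only by the data $\{g_0,g_1,N,C_0,C_1\}$ and having property (P) of the context, such that for every constant $\theta_0>1$ there is a constant $\delta_1\in(0,1)$, determined only by $\theta_0$ and the data, for which the following holds. Let $\omega,R>0$, put $\Delta=\omega^2G\left(\frac{\omega}{2R}\right)^{-1}$, and let $u$ be a nonnegative weak supersolution of $u_t-\operatorname{div}\mathbf A(x,t,u,Du)=0$ in $Q=K_{2R}\times(-\theta_0\Delta,0)$. If there is $T_0\in[-\theta_0\Delta,-\Delta]$ such that $$\left|\left(K_{2R}\times(T_0,T_0+\Delta)\right)\cap\left\{u<\frac\omega2\right\}\right|\le\nu_0|K_{2R}|\Delta,$$ then $$\operatorname*{ess\,inf}_{\mathcal Q}u\ge\delta_1\omega,\qquad\text{where }\mathcal Q=Q_{\omega/2,R/2}\left(\tfrac12\right).$$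
   Context: Setting. $N\ge1$ is an integer, $1<g_0\le g_1<\infty$ and $C_0,C_1>0$ are constants. $g:[0,\infty)\to[0,\infty)$ is continuous and increasing, $G(\sigma)=\int_0^\sigma g(s)\,ds$, and $g_0G(\sigma)\le\sigma g(\sigma)\le g_1G(\sigma)$ for all $\sigma>0$. $\mathbf A(x,t,u,\xi)\in\mathbb R^N$ satisfies $\mathbf A(x,t,u,\xi)\cdot\xi\ge C_0G(|\xi|)$ and $|\mathbf A(x,t,u,\xi)|\le C_1g(|\xi|)$ for all arguments; $(x,t)\mapsto\mathbf A(x,t,u(x,t),Du(x,t))$ is understood to be measurable. $Du$ is the weak gradient in $x$. Constants depending only on the data depend on $g_0,g_1,N,C_0,C_1$ but not otherwise on $g,\mathbf A,u$ or the geometric parameters. Weak supersolutions. For open $\Omega\subset\mathbb R^{N+1}$, a function $u\in C_{\rm loc}(\Omega)$ (continuous in $\Omega$) with $\iint_\Omega G(|Du|)\,dx\,dt<\infty$ is a weak supersolution in $\Omega$ if $-\iint_\Omega u\varphi_t\,dx\,dt+\iint_\Omega\mathbf A(x,t,u,Du)\cdot D\varphi\,dx\,dt\ge0$ for all nonnegative $C^1$ functions $\varphi$ with compact support in $\Omega$. "In a cylinder" means in its interior. Notation. $K_\rho=\{x\in\mathbb R^N:\max_i|x_i|<\rho\}$. For positive $k,\rho,\theta$: $T_{k,\rho}(\theta)=\theta k^2G(k/\rho)^{-1}$, $Q_{k,\rho}(\theta)=K_\rho\times[-T_{k,\rho}(\theta),0]$, $Q_{k,\rho}=Q_{k,\rho}(1)$.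 Property (P) of $\nu_0$: for all $k,\rho>0$ and every nonnegative weak supersolution $u$ in $Q_{k,2\rho}$ with $|\{(x,t)\in Q_{k,2\rho}:u(x,t)<k\}|<\nu_0|Q_{k,2\rho}|$, one has $\operatorname{ess\,inf}_{Q_{k,\rho}}u\ge k/2$. *)

theory Defs
  imports "HOL-Analysis.Analysis" "HOL-Probability.Essential_Supremum"
begin

text \<open>
  A point of space-time is a pair \<open>(x, t)\<close> of type \<open>(real ^ 'n) \<times> real\<close>, with \<open>N = CARD('n)\<close>.
\<close>

type_synonym 'n space_time = "(real ^ 'n) \<times> real"
type_synonym 'n vector_field = "real ^ 'n \<Rightarrow> real \<Rightarrow> real \<Rightarrow> real ^ 'n \<Rightarrow> real ^ 'n"

definition primitive :: "(real \<Rightarrow> real) \<Rightarrow> real \<Rightarrow> real" where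
  "primitive g \<sigma> = integral {0..\<sigma>} g"

text \<open>Only the values of \<open>g\<close> on \<open>[0, \<infinity>)\<close> matter; ``increasing'' is not required to be strict.\<close>

definition growth_function :: "real \<Rightarrow> real \<Rightarrow> (real \<Rightarrow> real) \<Rightarrow> bool" where
  "growth_function g0 g1 g \<longleftrightarrow>
     continuous_on {0..} g \<and> mono_on {0..} g \<and> (\<forall>\<sigma>\<ge>0. 0 \<le> g \<sigma>) \<and>
     (\<forall>\<sigma>>0. g0 * primitive g \<sigma> \<le> \<sigma> * g \<sigma> \<and> \<sigma> * g \<sigma> \<le> g1 * primitive g \<sigma>)"

definition structure_conditions ::
  "real \<Rightarrow> real \<Rightarrow> (real \<Rightarrow> real) \<Rightarrow> 'n::finite vector_field \<Rightarrow> bool" where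
  "structure_conditions C0 C1 g A \<longleftrightarrow>
     (\<forall>x t r \<xi>. A x t r \<xi> \<bullet> \<xi> \<ge> C0 * primitive g (norm \<xi>) \<and>
                norm (A x t r \<xi>) \<le> C1 * g (norm \<xi>))"

text \<open>
  A test function is carried together with its full space-time gradient \<open>D\<close>:
  \<open>fst (D z)\<close> is the spatial gradient and \<open>snd (D z)\<close> the time derivative.
  Functions with compact support in \<open>\<Omega>\<close> are extended by zero to all of space-time.
\<close>

definition C1_test_function ::
  "'n::finite space_time set \<Rightarrow> ('n space_time \<Rightarrow> real) \<Rightarrow> ('n space_time \<Rightarrow> 'n space_time) \<Rightarrow> bool" where
  "C1_test_function \<Omega> \<phi> D \<longleftrightarrow>
     (\<forall>z. GDERIV \<phi> z :> D z) \<and> continuous_on UNIV D \<and>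
     compact (closure {z. \<phi> z \<noteq> 0}) \<and> closure {z. \<phi> z \<noteq> 0} \<subseteq> \<Omega>"

definition weak_spatial_gradient ::
  "'n::finite space_time set \<Rightarrow> ('n space_time \<Rightarrow> real) \<Rightarrow> ('n space_time \<Rightarrow> real ^ 'n) \<Rightarrow> bool" where
  "weak_spatial_gradient \<Omega> u Du \<longleftrightarrow>
     (\<forall>K. compact K \<and> K \<subseteq> \<Omega> \<longrightarrow> set_integrable lebesgue K Du) \<and>
     (\<forall>\<phi> D. C1_test_function \<Omega> \<phi> D \<longrightarrow>
        (LINT z:\<Omega>|lebesgue. u z *\<^sub>R fst (D z)) = - (LINT z:\<Omega>|lebesgue. \<phi> z *\<^sub>R Du z))"

text \<open>
  The weak gradient is unique up to a null set, and none of the conditions below depends on the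
  representative, so it may be introduced by an existential quantifier.  The two integrands in
  the last condition are integrable as a consequence of the other conditions and the structure
  conditions.
\<close>

definition weak_supersolution ::
  "(real \<Rightarrow> real) \<Rightarrow> 'n::finite vector_field \<Rightarrow> 'n space_time set \<Rightarrow> ('n space_time \<Rightarrow> real) \<Rightarrow> bool" where
  "weak_supersolution g A \<Omega> u \<longleftrightarrow>
     open \<Omega> \<and> continuous_on \<Omega> u \<and>
     (\<exists>Du. weak_spatial_gradient \<Omega> u Du \<and>
        set_integrable lebesgue \<Omega> (\<lambda>z. primitive g (norm (Du z))) \<and>
        (\<lambda>z. A (fst z) (snd z) (u z) (Du z)) \<in> borel_measurable (lebesgue_on \<Omega>) \<and>
        (\<forall>\<phi> D. C1_test_function \<Omega> \<phi> D \<and> (\<forall>z. 0 \<le> \<phi> z) \<longrightarrow>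
           - (LINT z:\<Omega>|lebesgue. u z * snd (D z))
           + (LINT z:\<Omega>|lebesgue. A (fst z) (snd z) (u z) (Du z) \<bullet> fst (D z)) \<ge> 0))"

definition cube :: "real \<Rightarrow> (real ^ 'n::finite) set" where
  "cube \<rho> = {x. \<forall>i. \<bar>x $ i\<bar> < \<rho>}"

definition intrinsic_time :: "(real \<Rightarrow> real) \<Rightarrow> real \<Rightarrow> real \<Rightarrow> real \<Rightarrow> real" where
  "intrinsic_time g k \<rho> \<theta> = \<theta> * k\<^sup>2 * inverse (primitive g (k / \<rho>))"

definition cylinder :: "(real \<Rightarrow> real) \<Rightarrow> real \<Rightarrow> real \<Rightarrow> real \<Rightarrow> 'n::finite space_time set" where
  "cylinder g k \<rho> \<theta> = cube \<rho> \<times> {- intrinsic_time g k \<rho> \<theta>..0}"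

definition ess_inf_on :: "'n::finite space_time set \<Rightarrow> ('n space_time \<Rightarrow> real) \<Rightarrow> ereal" where
  "ess_inf_on S u = - esssup (lebesgue_on S) (\<lambda>z. - ereal (u z))"

text \<open>
  The property that a constant \<open>\<nu>\<close> has to have for one given pair \<open>(g, A)\<close>.  The conditions on
  \<open>u\<close> are imposed in the interior of the cylinder; the bases, which belong to the cylinder as well,
  are null sets.
\<close>

definition property_P :: "(real \<Rightarrow> real) \<Rightarrow> 'n::finite vector_field \<Rightarrow> real \<Rightarrow> bool" where
  "property_P g A \<nu> \<longleftrightarrow>
     (\<forall>k>0. \<forall>\<rho>>0. \<forall>u.
        weak_supersolution g A (interior (cylinder g k (2 * \<rho>) 1)) u \<and>
        (\<forall>z\<in>interior (cylinder g k (2 * \<rho>) 1). 0 \<le> u z) \<and>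
        measure lebesgue {z \<in> cylinder g k (2 * \<rho>) 1. u z < k}
          < \<nu> * measure lebesgue (cylinder g k (2 * \<rho>) 1 :: 'n space_time set)
        \<longrightarrow> ess_inf_on (cylinder g k \<rho> 1) u \<ge> ereal (k / 2))"

end

theory Submission
  imports Defs
begin

text \<open>
  Testing the mollified supersolution inequality with \<open>p (u\<^sub>\<epsilon>) \<eta>\<close>, where \<open>p\<close> is nonincreasing, and letting
  \<open>\<epsilon> \<rightarrow> 0\<close> gives an energy inequality for \<open>u\<close> in which no time derivative of \<open>u\<close> occurs.  For truncations
  of \<open>u\<close> at a level \<open>k\<close> it controls both the time slices and the \<open>L\<^sup>1\<close> norm of spatial difference quotients,
  and a De Giorgi iteration based on these two quantities (instead of a Sobolev inequality) shows that
  \<open>u \<ge> k / 2\<close> on a smaller cylinder as soon as \<open>{u < k}\<close> occupies a small portion of a cylinder of length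
  \<open>1 / \<kappa>\<close>, \<open>\<kappa> = G (k / r) / k\<^sup>2\<close>.  If moreover \<open>u \<ge> k\<close> initially, no cutoff in time is needed and the length of
  the cylinder is arbitrary.

  Applied in the given slab this yields \<open>u \<ge> \<omega> / 4\<close> on \<open>K\<^sub>R\<close> during a time interval.  From there on, testing
  with the derivative of \<open>(ln\<^sup>+ ((k + s k) / (u + s k)))\<^sup>3\<close>, \<open>k = \<omega> / 4\<close>, bounds the measure of \<open>{u < s k}\<close> on
  every later time slice by a multiple of \<open>\<theta>\<^sub>0 / ln (1 + 1 / s)\<close>.  Because \<open>g\<^sub>0 \<ge> 2\<close> we have
  \<open>G (c \<sigma>) \<le> c\<^sup>2 G \<sigma>\<close> for \<open>c \<le> 1\<close>, so that \<open>\<kappa>\<close> does not grow when the level \<open>k\<close> is lowered to \<open>s k\<close>, and for small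
  \<open>s\<close> the iteration without time cutoff gives \<open>u \<ge> s k / 2\<close> up to the final time.
\<close>

section \<open>Continuity of translations in the mean\<close>

text \<open>\<open>G\<close> lies between powers but need not be one, and the gradient is known only
  through the integrability of \<open>G (norm V)\<close>. Monotonicity of \<open>g\<close> alone
  gives \<open>g a * b \<le> g a * a + g b * b\<close>; this replaces Young's inequality when a
  cutoff gradient is absorbed, and it also dominates the products of mollified gradients and fluxes
  in the limit. The gradient enters the iteration only through L^1: \<open>norm V\<close> is at most
  \<open>m * (1 + G (norm V) / G m)\<close>, and an L^1 bound for spatial translations together with
  a bound on time slices is what \<open>superlevel_measure_estimate\<close> consumes. Its averaging
  radius is free; choosing it small in terms of the step size makes the iteration decay
  geometrically. The integer \<open>n\<close>, at least 2 and at least \<open>g1\<close>, serves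
  twice: as growth exponent in \<open>G (c * \<sigma>) \<le> c ^ n * G \<sigma>\<close> and as power
  of the spatial cutoff, so that negative powers of the cutoff cancel. The growth condition admits
  \<open>g = 0\<close>; then \<open>inverse 0 = 0\<close> collapses the intrinsic cylinders and the
  claims become trivial.\<close>

lemma integral_lborel_translate:
  fixes f :: "'a::euclidean_space \<Rightarrow> 'b::{banach, second_countable_topology}"
  shows "(\<integral>z. f (z + v) \<partial>lborel) = (\<integral>z. f z \<partial>lborel)"
proof (cases "f \<in> borel_measurable borel")
  case True
  have "(\<integral>z. f z \<partial>lborel) = (\<integral>z. f z \<partial>distr lborel borel ((+) v))"
    by (simp add: lborel_distr_plus)
  also have "\<dots> = (\<integral>z. f (v + z) \<partial>lborel)"
    using True by (intro integral_distr) auto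
  finally show ?thesis by (simp add: add.commute)
next
  \<comment> \<open>Without measurability neither side is integrable, so both integrals take the
    default value 0.\<close>
  case False
  have "(\<lambda>z. f (z + v)) \<notin> borel_measurable borel"
  proof
    assume "(\<lambda>z. f (z + v)) \<in> borel_measurable borel"
    then have "(\<lambda>z. (\<lambda>z. f (z + v)) (z - v)) \<in> borel_measurable borel"
      by (rule measurable_compose[rotated]) simp
    then show False using False by simp
  qed
  then have "\<not> integrable lborel (\<lambda>z. f (z + v))" "\<not> integrable lborel f"
    using False borel_measurable_integrable by fastforce+
  then show ?thesis by (simp add: not_integrable_integral_eq)
qed

lemma integrable_lborel_translate:
  fixes f :: "'a::euclidean_space \<Rightarrow> 'b::{banach, second_countable_topology}"
  assumes "integrable lborel f"
  shows "integrable lborel (\<lambda>z. f (z + v))"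
proof -
  have "integrable (distr lborel borel ((+) v)) f"
    using assms by (simp add: lborel_distr_plus)
  then have "integrable lborel (\<lambda>z. f (v + z))"
    by (subst (asm) integrable_distr_eq) (use assms in auto)
  then show ?thesis by (simp add: add.commute)
qed

lemma nn_integral_lborel_translate:
  fixes f :: "'a::euclidean_space \<Rightarrow> ennreal"
  assumes [measurable]: "f \<in> borel_measurable borel"
  shows "(\<integral>\<^sup>+z. f (z + v) \<partial>lborel) = (\<integral>\<^sup>+z. f z \<partial>lborel)"
proof -
  have "(\<integral>\<^sup>+z. f z \<partial>lborel) = (\<integral>\<^sup>+z. f z \<partial>distr lborel borel ((+) v))"
    by (simp add: lborel_distr_plus)
  also have "\<dots> = (\<integral>\<^sup>+z. f (v + z) \<partial>lborel)"
    by (intro nn_integral_distr) auto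
  finally show ?thesis by (simp add: add.commute)
qed

lemma integral_lborel_reflect:
  fixes f :: "'a::euclidean_space \<Rightarrow> 'b::{banach, second_countable_topology}"
  assumes [measurable]: "f \<in> borel_measurable borel"
  shows "(\<integral>z. f (v - z) \<partial>lborel) = (\<integral>z. f z \<partial>lborel)"
proof -
  have 1: "lborel = distr lborel borel (\<lambda>z::'a. v - z)"
    using lborel_affine[of "-1" v] by (simp add: density_1)
  have "(\<integral>z. f z \<partial>lborel) = (\<integral>z. f z \<partial>distr lborel borel (\<lambda>z. v - z))"
    using 1 by simp
  also have "\<dots> = (\<integral>z. f (v - z) \<partial>lborel)"
    by (intro integral_distr) auto
  finally show ?thesis by simp
qed

definition L1_shift_continuous :: "('a::euclidean_space \<Rightarrow> 'b::{banach, second_countable_topology}) \<Rightarrow> bool" where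
  "L1_shift_continuous f \<longleftrightarrow>
     (\<forall>e>0. \<exists>d>0. \<forall>y. norm y < d \<longrightarrow> (\<integral>z. norm (f (z - y) - f z) \<partial>lborel) < e)"

lemma integrable_shift_diff:
  fixes f :: "'a::euclidean_space \<Rightarrow> 'b::{banach, second_countable_topology}"
  assumes "integrable lborel f"
  shows "integrable lborel (\<lambda>z. norm (f (z - y) - f z))"
  using integrable_lborel_translate[OF assms, of "- y"] assms by (intro integrable_norm) simp

text \<open>Three-epsilon argument: translation preserves the L^1 norm, so replacing
  \<open>f\<close> by \<open>g\<close> costs the same small amount at \<open>z\<close> and at
  \<open>z - y\<close>.\<close>

lemma L1_shift_continuous_approx:
  fixes f :: "'a::euclidean_space \<Rightarrow> 'b::{banach, second_countable_topology}"
  assumes f: "integrable lborel f"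
    and g: "\<And>e. e > 0 \<Longrightarrow> \<exists>g. integrable lborel g \<and> L1_shift_continuous g \<and> (\<integral>z. norm (f z - g z) \<partial>lborel) < e"
  shows "L1_shift_continuous f"
  unfolding L1_shift_continuous_def
proof (intro allI impI)
  fix e :: real assume "e > 0"
  then obtain g where g: "integrable lborel g" "L1_shift_continuous g" and gf: "(\<integral>z. norm (f z - g z) \<partial>lborel) < e / 3"
    using assms(2)[of "e/3"] by auto
  obtain d where d: "d > 0" "\<And>y. norm y < d \<Longrightarrow> (\<integral>z. norm (g (z - y) - g z) \<partial>lborel) < e / 3"
    using g(2) \<open>e > 0\<close> unfolding L1_shift_continuous_def by (meson divide_pos_pos zero_less_numeral)
  have "(\<integral>z. norm (f (z - y) - f z) \<partial>lborel) < e" if "norm y < d" for y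
  proof -
    have fg: "integrable lborel (\<lambda>z. norm (f z - g z))" using f g(1) by simp
    have fgt: "integrable lborel (\<lambda>z. norm (f (z - y) - g (z - y)))"
      using integrable_lborel_translate[OF fg, of "- y"] by simp
    have gg: "integrable lborel (\<lambda>z. norm (g (z - y) - g z))"
      by (rule integrable_shift_diff[OF g(1)])
    have "(\<integral>z. norm (f (z - y) - f z) \<partial>lborel) \<le>
      (\<integral>z. norm (f (z - y) - g (z - y)) + norm (g (z - y) - g z) + norm (f z - g z) \<partial>lborel)"
    proof (rule integral_mono)
      fix z
      have "f (z - y) - f z = (f (z - y) - g (z - y)) + (g (z - y) - g z) - (f z - g z)" by simp
      then show "norm (f (z - y) - f z) \<le> norm (f (z - y) - g (z - y)) + norm (g (z - y) - g z) + norm (f z - g z)"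
        using norm_triangle_ineq4[of "(f (z - y) - g (z - y)) + (g (z - y) - g z)" "f z - g z"]
          norm_triangle_ineq[of "f (z - y) - g (z - y)" "g (z - y) - g z"] by simp
    qed (use fg fgt gg integrable_shift_diff[OF f] in auto)
    also have "\<dots> = (\<integral>z. norm (f (z - y) - g (z - y)) \<partial>lborel) + (\<integral>z. norm (g (z - y) - g z) \<partial>lborel)
        + (\<integral>z. norm (f z - g z) \<partial>lborel)"
      using fg fgt gg by simp
    also have "(\<integral>z. norm (f (z - y) - g (z - y)) \<partial>lborel) = (\<integral>z. norm (f z - g z) \<partial>lborel)"
      using integral_lborel_translate[of "\<lambda>z. norm (f z - g z)" "- y"] by simp
    finally show ?thesis using d(2)[OF that] gf by linarith
  qed
  then show "\<exists>d>0. \<forall>y. norm y < d \<longrightarrow> (\<integral>z. norm (f (z - y) - f z) \<partial>lborel) < e"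
    using d(1) by blast
qed

text \<open>Dominated convergence is applied only to the points of \<open>U\<close> that the
  translate misses: openness makes them disappear pointwise, with the indicator of \<open>U\<close>
  as majorant. The points gained have the same measure because a translate has the same finite
  measure; hence the factor 2 in \<open>eq\<close>.\<close>

lemma L1_shift_continuous_indicator_open:
  fixes U :: "'a::euclidean_space set" and c :: "'b::{banach, second_countable_topology}"
  assumes U: "open U" "emeasure lborel U < \<infinity>"
  shows "L1_shift_continuous (\<lambda>z. indicator U z *\<^sub>R c)"
proof (rule ccontr)
  let ?i = "indicator U :: 'a \<Rightarrow> real"
  have int: "integrable lborel ?i" using U by (simp add: integrable_indicator_iff)
  assume "\<not> ?thesis"
  then obtain e where e: "e > 0"
    and "\<forall>d>0. \<exists>y. norm y < d \<and> \<not> (\<integral>z. norm (?i (z - y) *\<^sub>R c - ?i z *\<^sub>R c) \<partial>lborel) < e"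
    unfolding L1_shift_continuous_def by blast
  then have "\<exists>y. norm y < inverse (real (Suc m)) \<and> \<not> (\<integral>z. norm (?i (z - y) *\<^sub>R c - ?i z *\<^sub>R c) \<partial>lborel) < e" for m
    by simp
  then obtain y where y: "\<And>m. norm (y m) < inverse (real (Suc m))"
    and ye: "\<And>m. \<not> (\<integral>z. norm (?i (z - y m) *\<^sub>R c - ?i z *\<^sub>R c) \<partial>lborel) < e"
    by metis
  have y0: "y \<longlonglongrightarrow> 0"
    by (rule LIMSEQ_norm_0) (use y in \<open>simp add: divide_inverse\<close>)
  have lim: "(\<lambda>m. \<integral>z. max 0 (?i z - ?i (z - y m)) \<partial>lborel) \<longlonglongrightarrow> (\<integral>z. 0 \<partial>(lborel :: 'a measure))"
  proof (rule integral_dominated_convergence[where w = ?i])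
    show "AE z in lborel. (\<lambda>m. max 0 (?i z - ?i (z - y m))) \<longlonglongrightarrow> 0"
    proof (rule AE_I2)
      fix z
      show "(\<lambda>m. max 0 (?i z - ?i (z - y m))) \<longlonglongrightarrow> 0"
      proof (cases "z \<in> U")
        case True
        have "(\<lambda>m. z - y m) \<longlonglongrightarrow> z" using tendsto_diff[OF tendsto_const y0, of z] by simp
        then have "\<forall>\<^sub>F m in sequentially. z - y m \<in> U"
          using U(1) True topological_tendstoD by blast
        then have "\<forall>\<^sub>F m in sequentially. max 0 (?i z - ?i (z - y m)) = 0"
          by eventually_elim simp
        then show ?thesis by (simp add: tendsto_eventually)
      qed simp
    qed
  next
    show "integrable lborel ?i" by (rule int)
    have [measurable]: "U \<in> sets borel" using U(1) by simp
    show "\<And>m. (\<lambda>z. max 0 (?i z - ?i (z - y m))) \<in> borel_measurable lborel" by measurable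
    show "\<And>m. AE z in lborel. norm (max 0 (?i z - ?i (z - y m))) \<le> ?i z"
      by (rule AE_I2) (simp add: indicator_def)
  qed simp
  have eq: "(\<integral>z. norm (?i (z - y m) *\<^sub>R c - ?i z *\<^sub>R c) \<partial>lborel) = 2 * norm c * (\<integral>z. max 0 (?i z - ?i (z - y m)) \<partial>lborel)" for m
  proof -
    have it: "integrable lborel (\<lambda>z. ?i (z - y m))"
      using integrable_lborel_translate[OF int, of "- y m"] by simp
    have im: "integrable lborel (\<lambda>z. max 0 (?i z - ?i (z - y m)))"
      using int it by auto
    have "norm (?i (z - y m) *\<^sub>R c - ?i z *\<^sub>R c)
        = norm c * (2 * max 0 (?i z - ?i (z - y m)) - ?i z + ?i (z - y m))" for z
      by (auto simp: indicator_def)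
    then have "(\<integral>z. norm (?i (z - y m) *\<^sub>R c - ?i z *\<^sub>R c) \<partial>lborel)
       = norm c * (2 * (\<integral>z. max 0 (?i z - ?i (z - y m)) \<partial>lborel) - (\<integral>z. ?i z \<partial>lborel) + (\<integral>z. ?i (z - y m) \<partial>lborel))"
      using int it im by simp
    also have "(\<integral>z. ?i (z - y m) \<partial>lborel) = (\<integral>z. ?i z \<partial>lborel)"
      using integral_lborel_translate[of ?i "- y m"] by simp
    finally show ?thesis by simp
  qed
  have "(\<lambda>m. \<integral>z. norm (?i (z - y m) *\<^sub>R c - ?i z *\<^sub>R c) \<partial>lborel) \<longlonglongrightarrow> 2 * norm c * 0"
    unfolding eq by (intro tendsto_mult tendsto_const) (use lim in simp)
  then have "\<forall>\<^sub>F m in sequentially. (\<integral>z. norm (?i (z - y m) *\<^sub>R c - ?i z *\<^sub>R c) \<partial>lborel) < e"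
    using e order_tendstoD(2) by fastforce
  then show False using ye by (simp add: eventually_sequentially)
qed

text \<open>Induction over integrable functions. Indicators of Borel sets are reduced to open sets
  by outer regularity, and the limit step is dominated convergence followed by
  \<open>L1_shift_continuous_approx\<close>.\<close>

lemma L1_shift_continuous_integrable:
  fixes f :: "'a::euclidean_space \<Rightarrow> 'b::{banach, second_countable_topology}"
  assumes "integrable lborel f"
  shows "L1_shift_continuous f"
  using assms
proof (induction rule: integrable_induct)
  case (base A c)
  have iA: "integrable lborel (\<lambda>z. indicator A z *\<^sub>R c)"
    using base by (intro integrable_scaleR_left) (simp add: integrable_indicator_iff)
  show ?case
  proof (rule L1_shift_continuous_approx[OF iA])
    fix e :: real assume "e > 0"
    then have e': "e / (norm c + 1) > 0" by (simp add: add_nonneg_pos)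
    obtain U where U: "open U" "A \<subseteq> U" "U - A \<in> lmeasurable" "emeasure lebesgue (U - A) < ennreal (e / (norm c + 1))"
      using sets_lebesgue_outer_open[OF _ e', of A] base by auto
    have mA: "A \<in> sets borel" using base by simp
    have mU: "U \<in> sets borel" using U(1) by simp
    have emU: "emeasure lborel (U - A) < ennreal (e / (norm c + 1))"
      using U(4) mA mU by simp
    have "emeasure lborel U \<le> emeasure lborel (U - A) + emeasure lborel A"
      using mA mU emeasure_subadditive[of "U - A" lborel A] U(2) by (simp add: Un_absorb2)
    also have "\<dots> < \<infinity>" using base(2) order.strict_trans[OF emU ennreal_less_top] by (simp add: ennreal_add_less_top)
    finally have fU: "emeasure lborel U < \<infinity>" .
    have iU: "integrable lborel (\<lambda>z. indicator U z *\<^sub>R c)"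
      using mU fU by (intro integrable_scaleR_left) (simp add: integrable_indicator_iff)
    have "norm (indicator A z *\<^sub>R c - indicator U z *\<^sub>R c) = indicator (U - A) z * norm c" for z :: 'a
      using U(2) by (auto simp: indicator_def)
    then have eqm: "(\<integral>z. norm (indicator A z *\<^sub>R c - indicator U z *\<^sub>R c) \<partial>lborel) = measure lborel (U - A) * norm c"
      using mA mU by simp
    have mlt: "measure lborel (U - A) < e / (norm c + 1)"
    proof -
      have "emeasure lborel (U - A) = ennreal (measure lborel (U - A))"
        using emU by (intro emeasure_eq_ennreal_measure) auto
      then show ?thesis using emU by (simp add: ennreal_less_iff)
    qed
    have "measure lborel (U - A) * norm c \<le> e / (norm c + 1) * norm c"
      using mlt by (intro mult_right_mono) auto
    also have "\<dots> < e" using \<open>e > 0\<close> by (simp add: divide_less_eq add_nonneg_pos add_pos_nonneg algebra_simps not_less add_nonneg_nonneg)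
    finally have "(\<integral>z. norm (indicator A z *\<^sub>R c - indicator U z *\<^sub>R c) \<partial>lborel) < e" unfolding eqm .
    then show "\<exists>g. integrable lborel g \<and> L1_shift_continuous g \<and> (\<integral>z. norm (indicator A z *\<^sub>R c - g z) \<partial>lborel) < e"
      using iU L1_shift_continuous_indicator_open[OF U(1) fU, of c] by blast
  qed
next
  case (add f g)
  show ?case
    unfolding L1_shift_continuous_def
  proof (intro allI impI)
    fix e :: real assume "e > 0"
    then have e2: "e / 2 > 0" by simp
    obtain d1 where d1: "d1 > 0" "\<And>y. norm y < d1 \<Longrightarrow> (\<integral>z. norm (f (z - y) - f z) \<partial>lborel) < e / 2"
      using add.IH(1) e2 unfolding L1_shift_continuous_def by blast
    obtain d2 where d2: "d2 > 0" "\<And>y. norm y < d2 \<Longrightarrow> (\<integral>z. norm (g (z - y) - g z) \<partial>lborel) < e / 2"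
      using add.IH(2) e2 unfolding L1_shift_continuous_def by blast
    have "(\<integral>z. norm (f (z - y) + g (z - y) - (f z + g z)) \<partial>lborel) < e" if "norm y < min d1 d2" for y
    proof -
      have i: "integrable lborel (\<lambda>z. norm (f (z - y) - f z))" "integrable lborel (\<lambda>z. norm (g (z - y) - g z))"
        "integrable lborel (\<lambda>z. norm (f (z - y) + g (z - y) - (f z + g z)))"
        using integrable_shift_diff[of f y] integrable_shift_diff[of g y] integrable_shift_diff[of "\<lambda>z. f z + g z" y] add.hyps by auto
      have "(\<integral>z. norm (f (z - y) + g (z - y) - (f z + g z)) \<partial>lborel)
         \<le> (\<integral>z. norm (f (z - y) - f z) + norm (g (z - y) - g z) \<partial>lborel)"
        using i by (intro integral_mono Bochner_Integration.integrable_add norm_diff_triangle_ineq)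
      also have "\<dots> = (\<integral>z. norm (f (z - y) - f z) \<partial>lborel) + (\<integral>z. norm (g (z - y) - g z) \<partial>lborel)"
        using i by simp
      also have "\<dots> < e" using d1(2)[of y] d2(2)[of y] that by simp
      finally show ?thesis .
    qed
    then show "\<exists>d>0. \<forall>y. norm y < d \<longrightarrow> (\<integral>z. norm (f (z - y) + g (z - y) - (f z + g z)) \<partial>lborel) < e"
      using d1(1) d2(1) by (intro exI[of _ "min d1 d2"]) auto
  qed
next
  case (lim f s)
  show ?case
  proof (rule L1_shift_continuous_approx[OF lim.hyps(4)])
    fix e :: real assume "e > 0"
    have "(\<lambda>i. \<integral>z. norm (f z - s i z) \<partial>lborel) \<longlonglongrightarrow> (\<integral>z. 0 \<partial>(lborel :: 'a measure))"
    proof (rule integral_dominated_convergence[where w = "\<lambda>z. 3 * norm (f z)"])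
      have *: "(\<lambda>i. norm (f z - s i z)) \<longlonglongrightarrow> 0" for z
        using tendsto_norm[OF tendsto_diff[OF tendsto_const lim.hyps(2)[of z], of "f z"]] by simp
      then show "AE z in lborel. (\<lambda>i. norm (f z - s i z)) \<longlonglongrightarrow> 0" by simp
      have "norm (f z - s i z) \<le> 3 * norm (f z)" for i z
        using lim.hyps(3)[of z i] norm_triangle_ineq4[of "f z" "s i z"] by simp
      then show "\<And>i. AE z in lborel. norm (norm (f z - s i z)) \<le> 3 * norm (f z)" by simp
    qed (use lim.hyps(1,4) in auto)
    then have "\<forall>\<^sub>F i in sequentially. (\<integral>z. norm (f z - s i z) \<partial>lborel) < e"
      using \<open>e > 0\<close> order_tendstoD(2) by fastforce
    then obtain i where "(\<integral>z. norm (f z - s i z) \<partial>lborel) < e"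
      using eventually_happens trivial_limit_sequentially by blast
    then show "\<exists>g. integrable lborel g \<and> L1_shift_continuous g \<and> (\<integral>z. norm (f z - g z) \<partial>lborel) < e"
      using lim.hyps(1) lim.IH by blast
  qed
qed

section \<open>Continuously differentiable functions with compact support\<close>

text \<open>For exponents at least 2 the kink of the positive part is smoothed out. The truncations,
  the cutoffs and the mollifying kernel are all built from such powers, so no infinitely smooth bump
  functions occur.\<close>

lemma DERIV_pos_part_power:
  assumes "n \<ge> 2"
  shows "((\<lambda>x::real. max 0 x ^ n) has_real_derivative real n * max 0 x ^ (n - 1)) (at x)"
proof -
  consider "x > 0" | "x < 0" | "x = 0" by linarith
  then show ?thesis
  proof cases
    case 1
    have "((\<lambda>x::real. x ^ n) has_real_derivative real n * x ^ (n - 1)) (at x)"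
      by (auto intro!: derivative_eq_intros)
    then have "((\<lambda>x::real. max 0 x ^ n) has_real_derivative real n * x ^ (n - 1)) (at x)"
      by (rule has_field_derivative_transform_within_open[where S = "{0<..}"]) (use 1 in auto)
    then show ?thesis using 1 by simp
  next
    case 2
    have "((\<lambda>x::real. 0) has_real_derivative 0) (at x)" by simp
    then have "((\<lambda>x::real. max 0 x ^ n) has_real_derivative 0) (at x)"
      by (rule has_field_derivative_transform_within_open[where S = "{..<0}"]) (use 2 assms in \<open>auto simp: max_def\<close>)
    moreover have "real n * max 0 x ^ (n - 1) = 0" using 2 assms by simp
    ultimately show ?thesis by (simp only:)
  next
    case 3
    have "((\<lambda>h::real. max 0 h ^ n / h) \<longlongrightarrow> 0) (at 0)"
    proof (rule Lim_null_comparison)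
      have "norm (max 0 h ^ n / h) \<le> \<bar>h\<bar> ^ (n - 1)" for h :: real
      proof (cases "h > 0")
        case True
        then show ?thesis using assms by (cases n) auto
      next
        case False
        then have "max 0 h ^ n = 0" using assms by simp
        then show ?thesis by (simp only:) simp
      qed
      then show "\<forall>\<^sub>F h in at 0. norm (max 0 h ^ n / h) \<le> \<bar>h\<bar> ^ (n - 1)" by simp
      have "((\<lambda>h::real. \<bar>h\<bar> ^ (n - 1)) \<longlongrightarrow> \<bar>0\<bar> ^ (n - 1)) (at 0)"
        by (intro tendsto_intros)
      moreover have "\<bar>0::real\<bar> ^ (n - 1) = 0" using assms by simp
      ultimately show "((\<lambda>h::real. \<bar>h\<bar> ^ (n - 1)) \<longlongrightarrow> 0) (at 0)" by (simp only:)
    qed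
    moreover have "real n * max 0 x ^ (n - 1) = 0" "max 0 x ^ n = 0" using 3 assms by simp_all
    ultimately show ?thesis using 3 unfolding has_field_derivative_iff by (simp only: diff_zero add_0 diff_0_right)
  qed
qed

lemma continuous_compact_support_uniformly_continuous:
  fixes f :: "'a::euclidean_space \<Rightarrow> 'b::real_normed_vector"
  assumes c: "continuous_on UNIV f" and z: "\<And>z. norm z \<ge> r \<Longrightarrow> f z = 0"
  shows "uniformly_continuous_on UNIV f"
  unfolding uniformly_continuous_on_def
proof (intro allI impI)
  fix e :: real assume "e > 0"
  have "uniformly_continuous_on (cball 0 (r + 1)) f"
    by (intro compact_uniformly_continuous continuous_on_subset[OF c]) auto
  then obtain d where d: "d > 0" "\<And>x y. x \<in> cball 0 (r + 1) \<Longrightarrow> y \<in> cball 0 (r + 1) \<Longrightarrow> dist y x < d \<Longrightarrow> dist (f y) (f x) < e"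
    using \<open>e > 0\<close> unfolding uniformly_continuous_on_def by meson
  \<comment> \<open>Distance below 1 keeps both points in the ball of radius \<open>r + 1\<close> as
    soon as one of them has norm below \<open>r\<close>; otherwise both values vanish.\<close>
  have "dist (f y) (f x) < e" if "dist y x < min d 1" for x y
  proof (cases "norm x < r \<or> norm y < r")
    case True
    have "norm x \<le> norm y + dist y x" "norm y \<le> norm x + dist y x"
      using norm_triangle_ineq2[of x y] norm_triangle_ineq2[of y x] by (simp_all add: dist_norm norm_minus_commute)
    then have "norm x \<le> r + 1" "norm y \<le> r + 1" using True that by auto
    then show ?thesis using d(2)[of x y] that by simp
  next
    case False
    then show ?thesis using z[of x] z[of y] \<open>e > 0\<close> by simp
  qed
  then show "\<exists>d>0. \<forall>x\<in>UNIV. \<forall>x'\<in>UNIV. dist x' x < d \<longrightarrow> dist (f x') (f x) < e"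
    using d(1) by (intro exI[of _ "min d 1"]) auto
qed

lemma continuous_compact_support_bounded:
  fixes f :: "'a::euclidean_space \<Rightarrow> 'b::real_normed_vector"
  assumes c: "continuous_on UNIV f" and z: "\<And>z. norm z \<ge> r \<Longrightarrow> f z = 0"
  obtains B where "B > 0" "\<forall>z. norm (f z) \<le> B"
proof -
  have "bounded (f ` cball 0 r)"
    by (intro compact_imp_bounded compact_continuous_image continuous_on_subset[OF c]) auto
  then obtain B where B: "B > 0" "\<And>z. z \<in> cball 0 r \<Longrightarrow> norm (f z) \<le> B"
    unfolding bounded_pos by auto
  have "norm (f z) \<le> B" for z
    using B z[of z] by (cases "norm z \<ge> r") auto
  then show thesis using that B(1) by blast
qed

text \<open>Global counterpart of \<open>C1_test_function\<close>: the support is merely bounded,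
  and its position relative to a domain is stated separately where it matters.\<close>

definition C1_compact :: "('a::euclidean_space \<Rightarrow> real) \<Rightarrow> ('a \<Rightarrow> 'a) \<Rightarrow> bool" where
  "C1_compact F DF \<longleftrightarrow> (\<forall>z. GDERIV F z :> DF z) \<and> continuous_on UNIV DF \<and> bounded {z. F z \<noteq> 0}"

lemma C1_compact_GDERIV: "C1_compact F DF \<Longrightarrow> GDERIV F z :> DF z"
  by (simp add: C1_compact_def)

lemma C1_compact_grad_continuous: "C1_compact F DF \<Longrightarrow> continuous_on S DF"
  unfolding C1_compact_def by (rule continuous_on_subset[of UNIV]) simp_all

lemma GDERIV_unique:
  assumes "GDERIV f z :> a" "GDERIV f z :> b"
  shows "a = b"
proof -
  have "(\<lambda>h. h \<bullet> a) = (\<lambda>h. h \<bullet> b)"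
    using assms unfolding gderiv_def by (rule has_derivative_unique)
  then show ?thesis by (metis inner_commute vector_eq_ldot)
qed

lemma GDERIV_zero_open:
  assumes "GDERIV F z :> D" "open S" "z \<in> S" "\<And>y. y \<in> S \<Longrightarrow> F y = 0"
  shows "D = 0"
proof (rule GDERIV_unique[OF assms(1)])
  have "((\<lambda>_. 0::real) has_derivative (\<lambda>h. h \<bullet> (0::'a))) (at z)" by simp
  then show "GDERIV F z :> 0"
    unfolding gderiv_def by (rule has_derivative_transform_within_open[OF _ assms(2,3)]) (use assms(4) in simp)
qed

lemma GDERIV_continuous_on:
  assumes "\<And>z. GDERIV F z :> DF z"
  shows "continuous_on S F"
  using assms unfolding gderiv_def
  by (meson continuous_at_imp_continuous_on has_derivative_continuous)

lemma C1_compact_radius: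
  assumes "C1_compact F DF"
  obtains r where "r > 0" "\<forall>z. norm z \<ge> r \<longrightarrow> F z = 0" "\<forall>z. norm z \<ge> r \<longrightarrow> DF z = 0"
proof -
  obtain s where s: "s > 0" "\<And>z. F z \<noteq> 0 \<Longrightarrow> norm z \<le> s"
    using assms unfolding C1_compact_def bounded_pos by auto
  show thesis
  proof (rule that[of "s + 1"])
    show "s + 1 > 0" using s by simp
    have 1: "F z = 0" if "norm z \<ge> s + 1" for z using s(2)[of z] that by force
    have 2: "DF z = 0" if "norm z \<ge> s + 1" for z
    proof (rule GDERIV_zero_open[where S = "- cball 0 s" and z = z and F = F])
      show "GDERIV F z :> DF z" by (rule C1_compact_GDERIV[OF assms])
    qed (use that s(2) in auto)
    show "\<forall>z. norm z \<ge> s + 1 \<longrightarrow> F z = 0" "\<forall>z. norm z \<ge> s + 1 \<longrightarrow> DF z = 0"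
      using 1 2 by simp_all
  qed
qed

lemma C1_compact_continuous: "C1_compact F DF \<Longrightarrow> continuous_on S F"
  by (rule GDERIV_continuous_on) (rule C1_compact_GDERIV)

lemma C1_compact_measurable [measurable_dest]:
  assumes "C1_compact F DF"
  shows "F \<in> borel_measurable borel" "DF \<in> borel_measurable borel"
  by (rule borel_measurable_continuous_onI, rule C1_compact_continuous[OF assms])
    (rule borel_measurable_continuous_onI, rule C1_compact_grad_continuous[OF assms])

lemma continuous_compact_support_integrable:
  fixes f :: "'a::euclidean_space \<Rightarrow> 'b::{banach, second_countable_topology}"
  assumes c: "continuous_on UNIV f" and z: "\<And>z. norm z \<ge> r \<Longrightarrow> f z = 0"
  shows "integrable lborel f"
proof -
  have "set_integrable lborel (cball 0 r) f"
    unfolding set_integrable_def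
    by (rule borel_integrable_compact) (auto intro: continuous_on_subset[OF c])
  moreover have "(\<lambda>x. indicator (cball 0 r) x *\<^sub>R f x) = f"
    using z by (force simp: indicator_def)
  ultimately show ?thesis unfolding set_integrable_def by simp
qed

lemma C1_compact_integrable:
  assumes "C1_compact F DF"
  shows "integrable lborel F" "integrable lborel DF" "integrable lborel (\<lambda>z. DF z \<bullet> v)"
proof -
  obtain r where "r > 0" and r': "\<forall>z. norm z \<ge> r \<longrightarrow> F z = 0" "\<forall>z. norm z \<ge> r \<longrightarrow> DF z = 0"
    by (rule C1_compact_radius[OF assms])
  note r = r'[rule_format]
  show "integrable lborel F"
    by (rule continuous_compact_support_integrable[OF C1_compact_continuous[OF assms] r(1)])
  show 2: "integrable lborel DF"
    by (rule continuous_compact_support_integrable[OF C1_compact_grad_continuous[OF assms] r(2)])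
  show "integrable lborel (\<lambda>z. DF z \<bullet> v)" using 2 by simp
qed

section \<open>Difference quotients of continuously differentiable functions\<close>

lemma GDERIV_line:
  assumes "GDERIV F (z + t *\<^sub>R v) :> D"
  shows "((\<lambda>t. F (z + t *\<^sub>R v)) has_real_derivative v \<bullet> D) (at t within S)"
proof -
  have 1: "((\<lambda>t. z + t *\<^sub>R v) has_derivative (\<lambda>h. h *\<^sub>R v)) (at t within S)"
    by (auto intro!: derivative_eq_intros)
  have 2: "(F has_derivative (\<lambda>h. h \<bullet> D)) (at (z + t *\<^sub>R v))"
    using assms unfolding gderiv_def .
  have 3: "(\<lambda>h. (h *\<^sub>R v) \<bullet> D) = (*) (v \<bullet> D)" by (simp add: fun_eq_iff)
  show ?thesis
    using has_derivative_compose[OF 1 2] unfolding has_field_derivative_def 3 .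
qed

lemma GDERIV_mean_value:
  assumes "\<And>z. GDERIV F z :> DF z"
  shows "\<exists>t. 0 < t \<and> t < 1 \<and> F (z + v) - F z = v \<bullet> DF (z + t *\<^sub>R v)"
proof -
  have "\<exists>t. 0 < t \<and> t < 1 \<and> F (z + 1 *\<^sub>R v) - F (z + 0 *\<^sub>R v) = (1 - 0) * (v \<bullet> DF (z + t *\<^sub>R v))"
    by (rule MVT2) (use GDERIV_line[OF assms] in auto)
  then show ?thesis by simp
qed

lemma GDERIV_difference_quotient:
  assumes "GDERIV F z :> D"
  shows "(\<lambda>m. real (Suc m) * (F (z + (1 / real (Suc m)) *\<^sub>R v) - F z)) \<longlonglongrightarrow> v \<bullet> D"
proof -
  have "((\<lambda>t. F (z + t *\<^sub>R v)) has_real_derivative v \<bullet> D) (at 0)"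
    by (rule GDERIV_line) (use assms in simp)
  then have *: "((\<lambda>h. (F (z + h *\<^sub>R v) - F z) / h) \<longlongrightarrow> v \<bullet> D) (at 0)"
    by (simp add: has_field_derivative_iff)
  have "filterlim (\<lambda>m. 1 / real (Suc m)) (at 0) sequentially"
    by (rule filterlim_atI) (use LIMSEQ_inverse_real_of_nat in \<open>auto simp: inverse_eq_divide\<close>)
  from filterlim_compose[OF * this] show ?thesis
    by (simp add: mult.commute)
qed

text \<open>By the mean value theorem the quotients are bounded by \<open>norm v * B\<close>, and
  they vanish outside a ball enlarged by \<open>norm v\<close>, since no increment is longer than
  \<open>v\<close>. One majorant thus serves all \<open>m\<close>.\<close>

lemma C1_compact_difference_quotient_bound:
  assumes "C1_compact F DF"
  obtains w where "integrable lborel w"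
    "\<forall>m z. \<bar>real (Suc m) * (F (z + (1 / real (Suc m)) *\<^sub>R v) - F z)\<bar> \<le> w z"
proof -
  obtain r where r': "r > 0" "\<forall>z. norm z \<ge> r \<longrightarrow> F z = 0" "\<forall>z. norm z \<ge> r \<longrightarrow> DF z = 0"
    by (rule C1_compact_radius[OF assms])
  note r = r'[rule_format]
  note D = C1_compact_GDERIV[OF assms] C1_compact_grad_continuous[OF assms]
  obtain B where B': "B > 0" "\<forall>z. norm (DF z) \<le> B"
    by (rule continuous_compact_support_bounded[OF D(2) r(3)])
  note B = B'[rule_format]
  show thesis
  proof (rule that)
    let ?w = "\<lambda>z. (norm v * B) * indicator (cball 0 (r + norm v)) z :: real"
    show "integrable lborel ?w" by (intro integrable_mult_right) (simp add: integrable_indicator_iff emeasure_compact_finite[unfolded infinity_ennreal_def])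
    have "\<bar>real (Suc m) * (F (z + (1 / real (Suc m)) *\<^sub>R v) - F z)\<bar> \<le> ?w z" for m z
    proof -
    let ?v = "(1 / real (Suc m)) *\<^sub>R v"
    have nv: "norm ?v \<le> norm v" by (simp add: field_simps)
    show ?thesis
    proof (cases "norm z \<le> r + norm v")
      case True
      obtain t where "0 < t" "t < 1" and t: "F (z + ?v) - F z = ?v \<bullet> DF (z + t *\<^sub>R ?v)"
        using GDERIV_mean_value[of F DF z ?v, OF D(1)] by auto
      have "real (Suc m) * (F (z + ?v) - F z) = v \<bullet> DF (z + t *\<^sub>R ?v)"
        unfolding t by (simp add: field_simps)
      also have "\<bar>\<dots>\<bar> \<le> norm v * norm (DF (z + t *\<^sub>R ?v))" by (rule Cauchy_Schwarz_ineq2)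
      also have "\<dots> \<le> norm v * B" by (intro mult_left_mono B) auto
      finally show ?thesis using True by simp
    next
      case False
      then have "norm z \<ge> r" using norm_ge_zero[of v] by linarith
      moreover have "norm (z + ?v) \<ge> r" using norm_diff_ineq[of z ?v] nv False by linarith
      ultimately have "F z = 0" "F (z + ?v) = 0" using r(2) by blast+
      then show ?thesis using B by simp
    qed
    qed
    then show "\<forall>m z. \<bar>real (Suc m) * (F (z + (1 / real (Suc m)) *\<^sub>R v) - F z)\<bar> \<le> ?w z" by blast
  qed
qed

text \<open>Each difference quotient has integral 0 by translation invariance, and the quotients
  converge dominatedly. Every later integration by parts reduces to this fact.\<close>

lemma C1_compact_integral_deriv:
  assumes "C1_compact F DF"
  shows "(\<integral>z. v \<bullet> DF z \<partial>lborel) = 0"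
proof -
  obtain w where w': "integrable lborel w"
    "\<forall>m z. \<bar>real (Suc m) * (F (z + (1 / real (Suc m)) *\<^sub>R v) - F z)\<bar> \<le> w z"
    by (rule C1_compact_difference_quotient_bound[OF assms])
  note w = w'[rule_format]
  note [measurable] = C1_compact_measurable[OF assms]
  have "(\<lambda>m. \<integral>z. real (Suc m) * (F (z + (1 / real (Suc m)) *\<^sub>R v) - F z) \<partial>lborel) \<longlonglongrightarrow> (\<integral>z. v \<bullet> DF z \<partial>lborel)"
  proof (rule integral_dominated_convergence[OF _ _ w(1)])
    show "AE z in lborel. (\<lambda>m. real (Suc m) * (F (z + (1 / real (Suc m)) *\<^sub>R v) - F z)) \<longlonglongrightarrow> v \<bullet> DF z"
      by (intro AE_I2 GDERIV_difference_quotient C1_compact_GDERIV[OF assms])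
    show "\<And>m. AE z in lborel. norm (real (Suc m) * (F (z + (1 / real (Suc m)) *\<^sub>R v) - F z)) \<le> w z"
      using w(2) by (intro AE_I2) simp
  qed measurable
  moreover have "(\<integral>z. real (Suc m) * (F (z + (1 / real (Suc m)) *\<^sub>R v) - F z) \<partial>lborel) = 0" for m
    using C1_compact_integrable(1)[OF assms] integrable_lborel_translate[OF C1_compact_integrable(1)[OF assms], of "(1 / real (Suc m)) *\<^sub>R v"]
      integral_lborel_translate[of F "(1 / real (Suc m)) *\<^sub>R v"]
    by (subst integral_mult_right_zero) (simp add: Bochner_Integration.integral_diff)
  ultimately show ?thesis using LIMSEQ_unique[OF _ tendsto_const[of 0]] by simp
qed

text \<open>The shift by \<open>v\<close> is split into \<open>Suc m\<close> equal shifts. By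
  translation invariance every piece has the same L^1 size, so the sum is the L^1 norm of a
  difference quotient, whose limit is the right-hand side.\<close>

lemma C1_compact_integral_shift:
  assumes "C1_compact F DF"
  shows "(\<integral>z. \<bar>F (z + v) - F z\<bar> \<partial>lborel) \<le> (\<integral>z. \<bar>v \<bullet> DF z\<bar> \<partial>lborel)"
proof -
  obtain w where w': "integrable lborel w"
    "\<forall>m z. \<bar>real (Suc m) * (F (z + (1 / real (Suc m)) *\<^sub>R v) - F z)\<bar> \<le> w z"
    by (rule C1_compact_difference_quotient_bound[OF assms])
  note w = w'[rule_format]
  note [measurable] = C1_compact_measurable[OF assms]
  note iF = C1_compact_integrable(1)[OF assms]
  have "(\<lambda>m. \<integral>z. \<bar>real (Suc m) * (F (z + (1 / real (Suc m)) *\<^sub>R v) - F z)\<bar> \<partial>lborel) \<longlonglongrightarrow> (\<integral>z. \<bar>v \<bullet> DF z\<bar> \<partial>lborel)"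
  proof (rule integral_dominated_convergence[OF _ _ w(1)])
    show "AE z in lborel. (\<lambda>m. \<bar>real (Suc m) * (F (z + (1 / real (Suc m)) *\<^sub>R v) - F z)\<bar>) \<longlonglongrightarrow> \<bar>v \<bullet> DF z\<bar>"
      by (intro AE_I2 tendsto_rabs GDERIV_difference_quotient C1_compact_GDERIV[OF assms])
    show "\<And>m. AE z in lborel. norm \<bar>real (Suc m) * (F (z + (1 / real (Suc m)) *\<^sub>R v) - F z)\<bar> \<le> w z"
      using w(2) by (intro AE_I2) simp
  qed measurable
  moreover have "(\<integral>z. \<bar>F (z + v) - F z\<bar> \<partial>lborel) \<le> (\<integral>z. \<bar>real (Suc m) * (F (z + (1 / real (Suc m)) *\<^sub>R v) - F z)\<bar> \<partial>lborel)" for m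
  proof -
    let ?v = "(1 / real (Suc m)) *\<^sub>R v"
    let ?f = "\<lambda>i z. F (z + real i *\<^sub>R ?v)"
    have if': "integrable lborel (?f i)" for i by (rule integrable_lborel_translate[OF iF])
    have "(\<integral>z. \<bar>F (z + v) - F z\<bar> \<partial>lborel) \<le> (\<integral>z. (\<Sum>i<Suc m. \<bar>?f (Suc i) z - ?f i z\<bar>) \<partial>lborel)"
    proof (rule integral_mono)
      fix z
      have "F (z + v) - F z = ?f (Suc m) z - ?f 0 z" by simp
      also have "\<dots> = (\<Sum>i<Suc m. ?f (Suc i) z - ?f i z)" by (rule sum_lessThan_telescope[symmetric])
      finally show "\<bar>F (z + v) - F z\<bar> \<le> (\<Sum>i<Suc m. \<bar>?f (Suc i) z - ?f i z\<bar>)"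
        by (simp only: sum_abs)
    qed (use if' iF integrable_lborel_translate[OF iF] in \<open>auto simp del: of_nat_Suc\<close>)
    also have "\<dots> = (\<Sum>i<Suc m. \<integral>z. \<bar>?f (Suc i) z - ?f i z\<bar> \<partial>lborel)"
      using if' by (intro Bochner_Integration.integral_sum) (auto simp del: of_nat_Suc)
    also have "\<dots> = (\<Sum>i<Suc m. \<integral>z. \<bar>F (z + ?v) - F z\<bar> \<partial>lborel)"
    proof (rule sum.cong[OF refl])
      fix i
      have eq: "?f (Suc i) z = F ((z + real i *\<^sub>R ?v) + ?v)" for z
        by (simp only: of_nat_Suc scaleR_left_distrib scaleR_one add.assoc add.commute add.left_commute)
      show "(\<integral>z. \<bar>?f (Suc i) z - ?f i z\<bar> \<partial>lborel) = (\<integral>z. \<bar>F (z + ?v) - F z\<bar> \<partial>lborel)"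
        unfolding eq using integral_lborel_translate[of "\<lambda>z. \<bar>F (z + ?v) - F z\<bar>" "real i *\<^sub>R ?v"] .
    qed
    also have "\<dots> = (\<integral>z. \<bar>real (Suc m) * (F (z + ?v) - F z)\<bar> \<partial>lborel)"
      by (simp add: abs_mult del: of_nat_Suc)
    finally show ?thesis .
  qed
  ultimately show ?thesis by (intro LIMSEQ_le_const) auto
qed

text \<open>The majorants may vary with \<open>m\<close> as long as they converge in L^1. Products
  of mollifications are controlled by mollifications of a fixed function, which is exactly this
  situation.\<close>

lemma integral_generalized_dominated_convergence:
  fixes f :: "nat \<Rightarrow> 'a \<Rightarrow> real"
  assumes [measurable]: "\<And>m. f m \<in> borel_measurable M" "g \<in> borel_measurable M"
    and h: "\<And>m. integrable M (h m)" "integrable M H"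
    and lim: "AE x in M. (\<lambda>m. f m x) \<longlonglongrightarrow> g x"
    and L1: "(\<lambda>m. \<integral>x. \<bar>h m x - H x\<bar> \<partial>M) \<longlonglongrightarrow> 0"
    and bound: "\<And>m. AE x in M. \<bar>f m x\<bar> \<le> h m x"
    and boundg: "AE x in M. \<bar>g x\<bar> \<le> H x"
  shows "(\<lambda>m. \<integral>x. f m x \<partial>M) \<longlonglongrightarrow> (\<integral>x. g x \<partial>M)"
proof -
  note [measurable] = borel_measurable_integrable[OF h(1)] borel_measurable_integrable[OF h(2)]
  text \<open>Truncating at the limit bound reduces the claim to ordinary dominated convergence.\<close>
  let ?t = "\<lambda>m x. max (- H x) (min (H x) (f m x))"
  have 1: "(\<lambda>m. \<integral>x. ?t m x \<partial>M) \<longlonglongrightarrow> (\<integral>x. g x \<partial>M)"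
  proof (rule integral_dominated_convergence[OF _ _ h(2)])
    show "AE x in M. (\<lambda>m. ?t m x) \<longlonglongrightarrow> g x"
      using lim boundg
    proof eventually_elim
      case (elim x)
      have "(\<lambda>m. ?t m x) \<longlonglongrightarrow> max (- H x) (min (H x) (g x))"
        by (intro tendsto_max tendsto_min tendsto_const elim)
      also have "max (- H x) (min (H x) (g x)) = g x" using elim(2) by auto
      finally show ?case .
    qed
    show "\<And>m. AE x in M. norm (?t m x) \<le> H x"
      using boundg by (rule AE_mp) (auto intro!: AE_I2)
  qed measurable
  have it: "integrable M (?t m)" for m
  proof (rule Bochner_Integration.integrable_bound[OF h(2)])
    show "AE x in M. norm (?t m x) \<le> norm (H x)"
      using boundg by eventually_elim auto
  qed measurable
  have if': "integrable M (f m)" for m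
  proof (rule Bochner_Integration.integrable_bound[OF h(1)[of m]])
    show "AE x in M. norm (f m x) \<le> norm (h m x)"
      using bound[of m] by eventually_elim auto
  qed measurable
  have 2: "(\<lambda>m. (\<integral>x. f m x \<partial>M) - (\<integral>x. ?t m x \<partial>M)) \<longlonglongrightarrow> 0"
  proof (rule Lim_null_comparison[OF always_eventually L1], rule allI)
    fix m
    have "norm ((\<integral>x. f m x \<partial>M) - (\<integral>x. ?t m x \<partial>M)) = norm (\<integral>x. f m x - ?t m x \<partial>M)"
      using it if' by simp
    also have "\<dots> \<le> (\<integral>x. norm (f m x - ?t m x) \<partial>M)" by (rule integral_norm_bound)
    also have "\<dots> \<le> (\<integral>x. \<bar>h m x - H x\<bar> \<partial>M)"
    proof (rule integral_mono_AE)
      show "AE x in M. norm (f m x - ?t m x) \<le> \<bar>h m x - H x\<bar>"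
        using bound[of m] boundg by eventually_elim (auto simp: max_def min_def)
    qed (use h it if' in auto)
    finally show "norm ((\<integral>x. f m x \<partial>M) - (\<integral>x. ?t m x \<partial>M)) \<le> (\<integral>x. \<bar>h m x - H x\<bar> \<partial>M)" .
  qed
  from tendsto_add[OF 2 1] show ?thesis by simp
qed

section \<open>Mollification\<close>

definition convolve :: "('a::euclidean_space \<Rightarrow> real) \<Rightarrow> ('a \<Rightarrow> 'b::{banach, second_countable_topology}) \<Rightarrow> 'a \<Rightarrow> 'b" where
  "convolve J f z = (\<integral>y. J (z - y) *\<^sub>R f y \<partial>lborel)"

definition convolve_grad :: "('a::euclidean_space \<Rightarrow> 'a) \<Rightarrow> ('a \<Rightarrow> real) \<Rightarrow> 'a \<Rightarrow> 'a" where
  "convolve_grad DJ f z = (\<integral>y. f y *\<^sub>R DJ (z - y) \<partial>lborel)"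

lemma convolve_integrable:
  fixes f :: "'a::euclidean_space \<Rightarrow> 'b::{banach, second_countable_topology}"
  assumes "C1_compact J DJ" "integrable lborel f"
  shows "integrable lborel (\<lambda>y. J (z - y) *\<^sub>R f y)"
proof -
  obtain r where r': "r > 0" "\<forall>z. norm z \<ge> r \<longrightarrow> J z = 0" "\<forall>z. norm z \<ge> r \<longrightarrow> DJ z = 0"
    by (rule C1_compact_radius[OF assms(1)])
  note r = r'[rule_format]
  obtain B where B': "B > 0" "\<forall>z. norm (J z) \<le> B"
    by (rule continuous_compact_support_bounded[OF C1_compact_continuous[OF assms(1)] r(2)])
  note B = B'[rule_format]
  note [measurable] = C1_compact_measurable[OF assms(1)] borel_measurable_integrable[OF assms(2)]
  show ?thesis
  proof (rule Bochner_Integration.integrable_bound)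
    show "integrable lborel (\<lambda>y. B * norm (f y))" using assms(2) by simp
    have "norm (J (z - y) *\<^sub>R f y) \<le> norm (B * norm (f y))" for y
      using B(2)[of "z - y"] B(1) by (simp add: mult_right_mono)
    then show "AE y in lborel. norm (J (z - y) *\<^sub>R f y) \<le> norm (B * norm (f y))" by simp
  qed measurable
qed

lemma convolve_grad_integrable:
  assumes "C1_compact J DJ" "integrable lborel f"
  shows "integrable lborel (\<lambda>y. f y *\<^sub>R DJ (z - y))"
proof -
  obtain r where r': "r > 0" "\<forall>z. norm z \<ge> r \<longrightarrow> J z = 0" "\<forall>z. norm z \<ge> r \<longrightarrow> DJ z = 0"
    by (rule C1_compact_radius[OF assms(1)])
  note r = r'[rule_format]
  obtain B where B': "B > 0" "\<forall>z. norm (DJ z) \<le> B"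
    by (rule continuous_compact_support_bounded[OF C1_compact_grad_continuous[OF assms(1)] r(3)])
  note B = B'[rule_format]
  note [measurable] = C1_compact_measurable[OF assms(1)] borel_measurable_integrable[OF assms(2)]
  show ?thesis
  proof (rule Bochner_Integration.integrable_bound)
    show "integrable lborel (\<lambda>y. B * norm (f y))" using assms(2) by simp
    have "norm (f y *\<^sub>R DJ (z - y)) \<le> norm (B * norm (f y))" for y
      using B(2)[of "z - y"] B(1) by (simp add: mult.commute[of B] mult_left_mono)
    then show "AE y in lborel. norm (f y *\<^sub>R DJ (z - y)) \<le> norm (B * norm (f y))" by simp
  qed measurable
qed

lemma C1_compact_uniform:
  assumes "C1_compact J DJ" "e > 0"
  obtains d where "d > 0" "\<forall>x y. norm (x - y) < d \<longrightarrow> norm (DJ x - DJ y) < e"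
proof -
  obtain r where r': "r > 0" "\<forall>z. norm z \<ge> r \<longrightarrow> J z = 0" "\<forall>z. norm z \<ge> r \<longrightarrow> DJ z = 0"
    by (rule C1_compact_radius[OF assms(1)])
  note r = r'[rule_format]
  have "uniformly_continuous_on UNIV DJ"
    by (rule continuous_compact_support_uniformly_continuous[OF C1_compact_grad_continuous[OF assms(1)] r(3)])
  then obtain d where d: "d > 0" "\<forall>x\<in>UNIV. \<forall>x'\<in>UNIV. dist x' x < d \<longrightarrow> dist (DJ x') (DJ x) < e"
    using assms(2) unfolding uniformly_continuous_on_def by meson
  show thesis by (rule that[OF d(1)]) (use d(2) in \<open>simp add: dist_norm\<close>)
qed

lemma convolve_grad_continuous:
  assumes J: "C1_compact J DJ" and f: "integrable lborel f"
  shows "continuous_on UNIV (convolve_grad DJ f)"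
  unfolding continuous_on_iff
proof (intro ballI allI impI)
  fix x :: 'a and e :: real assume "e > 0"
  \<comment> \<open>The summand 1 keeps \<open>M\<close> positive when \<open>f\<close> vanishes
    almost everywhere and leaves room for a strict inequality.\<close>
  define M where "M = (\<integral>y. \<bar>f y\<bar> \<partial>lborel) + 1"
  have M: "M > 0" unfolding M_def by (simp add: add_nonneg_pos)
  obtain d where d': "d > 0" "\<forall>x y. norm (x - y) < d \<longrightarrow> norm (DJ x - DJ y) < e / M"
    by (rule C1_compact_uniform[OF J divide_pos_pos[OF \<open>e > 0\<close> M]])
  note d = d'[rule_format]
  have "dist (convolve_grad DJ f x') (convolve_grad DJ f x) < e" if "dist x' x < d" for x'
  proof -
    note i = convolve_grad_integrable[OF J f]
    have eq: "convolve_grad DJ f x' - convolve_grad DJ f x = (\<integral>y. f y *\<^sub>R DJ (x' - y) - f y *\<^sub>R DJ (x - y) \<partial>lborel)"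
      unfolding convolve_grad_def using i by simp
    have "norm (convolve_grad DJ f x' - convolve_grad DJ f x) \<le> (\<integral>y. norm (f y *\<^sub>R DJ (x' - y) - f y *\<^sub>R DJ (x - y)) \<partial>lborel)"
      unfolding eq by (rule integral_norm_bound)
    also have "\<dots> \<le> (\<integral>y. (e / M) * \<bar>f y\<bar> \<partial>lborel)"
    proof (rule integral_mono)
      fix y
      have "norm (DJ (x' - y) - DJ (x - y)) \<le> e / M"
        using d(2)[of "x' - y" "x - y"] that by (simp add: dist_norm)
      then show "norm (f y *\<^sub>R DJ (x' - y) - f y *\<^sub>R DJ (x - y)) \<le> (e / M) * \<bar>f y\<bar>"
        using mult_right_mono[of "norm (DJ (x' - y) - DJ (x - y))" "e / M" "\<bar>f y\<bar>"]
        by (simp add: mult.commute[of "\<bar>f y\<bar>"] flip: scaleR_diff_right)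
    qed (use i f in auto)
    also have "\<dots> = (e / M) * (M - 1)" using f by (simp add: M_def)
    also have "\<dots> < e" using M \<open>e > 0\<close> by (simp add: field_simps)
    finally show ?thesis by (simp add: dist_norm)
  qed
  then show "\<exists>d>0. \<forall>x'\<in>UNIV. dist x' x < d \<longrightarrow> dist (convolve_grad DJ f x') (convolve_grad DJ f x) < e"
    using d(1) by blast
qed

text \<open>The mean value theorem turns the increment of \<open>J\<close> into \<open>DJ\<close> at
  an intermediate point, and uniform continuity of \<open>DJ\<close> makes the error small relative
  to \<open>norm (y - z)\<close> for all integration points simultaneously.\<close>

lemma convolve_GDERIV:
  assumes J: "C1_compact J DJ" and f: "integrable lborel f"
  shows "GDERIV (convolve J f) z :> convolve_grad DJ f z"
  unfolding gderiv_def has_derivative_at_alt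
proof (intro conjI allI impI)
  show "bounded_linear (\<lambda>h. h \<bullet> convolve_grad DJ f z)" by (rule bounded_linear_inner_left)
  fix e :: real assume "e > 0"
  note GJ = C1_compact_GDERIV[OF J]
  define M where "M = (\<integral>y. \<bar>f y\<bar> \<partial>lborel) + 1"
  have M: "M > 0" unfolding M_def by (simp add: add_nonneg_pos)
  obtain d where d': "d > 0" "\<forall>x y. norm (x - y) < d \<longrightarrow> norm (DJ x - DJ y) < e / M"
    by (rule C1_compact_uniform[OF J divide_pos_pos[OF \<open>e > 0\<close> M]])
  note d = d'[rule_format]
  note i = convolve_integrable[OF J f] and ig = convolve_grad_integrable[OF J f]
  have "norm (convolve J f y - convolve J f z - (y - z) \<bullet> convolve_grad DJ f z) \<le> e * norm (y - z)"
    if "norm (y - z) < d" for y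
  proof -
    let ?h = "y - z"
    let ?E = "\<lambda>x. J (y - x) * f x - J (z - x) * f x - ?h \<bullet> (f x *\<^sub>R DJ (z - x))"
    have iE: "integrable lborel ?E"
      using i[of y] i[of z] ig[of z] by (intro Bochner_Integration.integrable_diff integrable_inner_right) auto
    have eq: "convolve J f y - convolve J f z - ?h \<bullet> convolve_grad DJ f z = (\<integral>x. ?E x \<partial>lborel)"
      unfolding convolve_def convolve_grad_def using i[of y] i[of z] ig[of z]
      by (simp del: inner_scaleR_right add: integral_inner_right)
    have "norm (convolve J f y - convolve J f z - ?h \<bullet> convolve_grad DJ f z) \<le> (\<integral>x. norm (?E x) \<partial>lborel)"
      unfolding eq by (rule integral_norm_bound)
    also have "\<dots> \<le> (\<integral>x. (e / M * norm ?h) * \<bar>f x\<bar> \<partial>lborel)"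
    proof (rule integral_mono)
      show "integrable lborel (\<lambda>x. norm (?E x))" by (rule integrable_norm[OF iE])
      show "integrable lborel (\<lambda>x. (e / M * norm ?h) * \<bar>f x\<bar>)" using f by simp
    next
      fix x
      define w where "w = z - x"
      have "\<exists>t. 0 < t \<and> t < 1 \<and> J (w + ?h) - J w = ?h \<bullet> DJ (w + t *\<^sub>R ?h)"
        by (rule GDERIV_mean_value[OF GJ])
      then obtain t where t: "0 < t" "t < 1" "J (w + ?h) - J w = ?h \<bullet> DJ (w + t *\<^sub>R ?h)"
        by blast
      have wy: "w + ?h = y - x" by (simp add: w_def)
      have "?E x = f x * (J (w + ?h) - J w - ?h \<bullet> DJ w)"
        unfolding wy w_def[symmetric] inner_scaleR_right by (simp add: right_diff_distrib mult.commute)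
      also have "\<dots> = f x * (?h \<bullet> (DJ (w + t *\<^sub>R ?h) - DJ w))"
        unfolding t(3) inner_diff_right ..
      also have "\<bar>\<dots>\<bar> \<le> \<bar>f x\<bar> * (norm ?h * norm (DJ (w + t *\<^sub>R ?h) - DJ w))"
        unfolding abs_mult by (intro mult_left_mono Cauchy_Schwarz_ineq2) auto
      also have "\<dots> \<le> \<bar>f x\<bar> * (norm ?h * (e / M))"
      proof (intro mult_left_mono less_imp_le[OF d(2)])
        have "norm (t *\<^sub>R ?h) \<le> norm ?h" using t by (simp add: mult_left_le_one_le)
        then show "norm (w + t *\<^sub>R ?h - w) < d" using that by simp
      qed auto
      finally show "norm (?E x) \<le> (e / M * norm ?h) * \<bar>f x\<bar>" by (simp add: mult_ac)
    qed
    also have "\<dots> = (e / M * norm ?h) * (M - 1)" using f by (simp add: M_def)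
    also have "\<dots> \<le> e * norm ?h" using M \<open>e > 0\<close> by (simp add: field_simps)
    finally show ?thesis .
  qed
  then show "\<exists>d>0. \<forall>y. norm (y - z) < d \<longrightarrow>
      norm (convolve J f y - convolve J f z - (y - z) \<bullet> convolve_grad DJ f z) \<le> e * norm (y - z)"
    using d(1) by blast
qed

lemma C1_compact_mult:
  assumes F: "C1_compact F DF" and H: "\<And>z. GDERIV H z :> DH z" "continuous_on UNIV DH"
  shows "C1_compact (\<lambda>z. F z * H z) (\<lambda>z. F z *\<^sub>R DH z + H z *\<^sub>R DF z)"
  unfolding C1_compact_def
proof (intro conjI allI)
  show "GDERIV (\<lambda>z. F z * H z) z :> F z *\<^sub>R DH z + H z *\<^sub>R DF z" for z
    by (intro GDERIV_mult C1_compact_GDERIV[OF F] H(1))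
  show "continuous_on UNIV (\<lambda>z. F z *\<^sub>R DH z + H z *\<^sub>R DF z)"
    by (intro continuous_intros C1_compact_continuous[OF F] GDERIV_continuous_on[OF H(1)] H(2) C1_compact_grad_continuous[OF F])
  show "bounded {z. F z * H z \<noteq> 0}"
    by (rule bounded_subset[of "{z. F z \<noteq> 0}"]) (use F in \<open>simp add: C1_compact_def\<close>, auto)
qed

text \<open>The mollifying kernel only has to be continuously differentiable, so a truncated quadratic suffices.\<close>

definition bump :: "real \<Rightarrow> 'a::euclidean_space \<Rightarrow> real" where
  "bump e z = (max 0 (e\<^sup>2 - z \<bullet> z))\<^sup>2"

definition mollifier :: "real \<Rightarrow> 'a::euclidean_space \<Rightarrow> real" where
  "mollifier e z = bump e z / (\<integral>y. bump e y \<partial>(lborel :: 'a measure))"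

definition mollifier_grad :: "real \<Rightarrow> 'a::euclidean_space \<Rightarrow> 'a" where
  "mollifier_grad e z = (- (4 * max 0 (e\<^sup>2 - z \<bullet> z)) / (\<integral>y. bump e y \<partial>(lborel :: 'a measure))) *\<^sub>R z"

lemma GDERIV_norm_square: "GDERIV (\<lambda>z. z \<bullet> z) z :> 2 *\<^sub>R z"
  unfolding gderiv_def by (auto intro!: derivative_eq_intros simp: inner_commute)

lemma GDERIV_pos_part_power:
  assumes "GDERIV F z :> D" "n \<ge> 2"
  shows "GDERIV (\<lambda>z. max 0 (F z) ^ n) z :> (real n * max 0 (F z) ^ (n - 1)) *\<^sub>R D"
  by (rule GDERIV_DERIV_compose[OF assms(1) DERIV_pos_part_power[OF assms(2)]])

lemma bump_zero: "norm z \<ge> e \<Longrightarrow> e > 0 \<Longrightarrow> bump e z = 0"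
  unfolding bump_def by (simp add: dot_square_norm power_mono)

lemma bump_C1_compact:
  assumes "e > 0"
  shows "C1_compact (bump e) (\<lambda>z. - (4 * max 0 (e\<^sup>2 - z \<bullet> z)) *\<^sub>R z)"
  unfolding C1_compact_def
proof (intro conjI allI)
  fix z :: 'a
  have "GDERIV (\<lambda>z. e\<^sup>2 - z \<bullet> z) z :> 0 - 2 *\<^sub>R z"
    by (intro GDERIV_diff GDERIV_const GDERIV_norm_square)
  from GDERIV_pos_part_power[OF this, of 2]
  show "GDERIV (bump e) z :> - (4 * max 0 (e\<^sup>2 - z \<bullet> z)) *\<^sub>R z"
    unfolding bump_def[abs_def] by simp
next
  show "continuous_on UNIV (\<lambda>z::'a. - (4 * max 0 (e\<^sup>2 - z \<bullet> z)) *\<^sub>R z)"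
    by (intro continuous_intros)
  have "{z. bump e z \<noteq> 0} \<subseteq> cball 0 e" using bump_zero[of e] assms by force
  then show "bounded {z::'a. bump e z \<noteq> 0}" using bounded_cball bounded_subset by blast
qed

lemma bump_integral_pos:
  assumes "e > 0"
  shows "(\<integral>y. bump e y \<partial>(lborel :: 'a::euclidean_space measure)) > 0"
proof -
  note i = C1_compact_integrable(1)[OF bump_C1_compact[OF assms], where 'a = 'a]
  let ?c = "(3 / 4 * e\<^sup>2)\<^sup>2"
  have "0 < ?c * measure lborel (ball (0::'a) (e/2))"
    using assms content_ball_pos[of "e/2" "0::'a"] by simp
  also have "\<dots> = (\<integral>y. ?c * indicator (ball (0::'a) (e/2)) y \<partial>lborel)" by simp
  also have "\<dots> \<le> (\<integral>y. bump e y \<partial>(lborel :: 'a measure))"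
  proof (rule integral_mono)
    show "integrable lborel (\<lambda>y. ?c * indicator (ball (0::'a) (e/2)) y)"
      by (intro integrable_mult_right) (simp add: integrable_indicator_iff emeasure_bounded_finite[unfolded infinity_ennreal_def])
    fix y :: 'a
    show "?c * indicator (ball (0::'a) (e/2)) y \<le> bump e y"
    proof (cases "norm y < e / 2")
      case True
      then have "y \<bullet> y \<le> (e/2)\<^sup>2" by (simp add: dot_square_norm power_mono)
      then have "3 / 4 * e\<^sup>2 \<le> e\<^sup>2 - y \<bullet> y" by (simp add: power2_eq_square)
      then have "3 / 4 * e\<^sup>2 \<le> max 0 (e\<^sup>2 - y \<bullet> y)" by linarith
      then have "?c \<le> bump e y" unfolding bump_def by (intro power_mono) auto
      then show ?thesis using True by simp
    qed (simp add: bump_def)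
  qed (rule i)
  finally show ?thesis .
qed

lemma mollifier_C1_compact:
  assumes "e > 0"
  shows "C1_compact (mollifier e) (mollifier_grad e)"
proof -
  let ?I = "\<integral>y. bump e y \<partial>(lborel :: 'a measure)"
  have "C1_compact (\<lambda>z. bump e z * (1 / ?I)) (\<lambda>z. bump e z *\<^sub>R 0 + (1 / ?I) *\<^sub>R (- (4 * max 0 (e\<^sup>2 - z \<bullet> z)) *\<^sub>R z))"
    by (rule C1_compact_mult[OF bump_C1_compact[OF assms]]) (auto intro: GDERIV_const)
  then show ?thesis
    unfolding mollifier_def[abs_def] mollifier_grad_def[abs_def] by (simp add: field_simps)
qed

lemma mollifier_nonneg: "mollifier e z \<ge> 0"
  unfolding mollifier_def bump_def by (intro divide_nonneg_nonneg integral_nonneg) auto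

lemma mollifier_zero: "norm z \<ge> e \<Longrightarrow> e > 0 \<Longrightarrow> mollifier e z = 0"
  unfolding mollifier_def by (simp add: bump_zero)

lemma mollifier_integral:
  assumes "e > 0"
  shows "(\<integral>z. mollifier e z \<partial>(lborel :: 'a::euclidean_space measure)) = 1"
  unfolding mollifier_def using less_imp_neq[OF bump_integral_pos[OF assms, where 'a = 'a]] by simp

section \<open>Convergence of mollifications in the mean and almost everywhere\<close>

lemma convolve_alt:
  fixes f :: "'a::euclidean_space \<Rightarrow> 'b::{banach, second_countable_topology}"
  assumes "C1_compact J DJ" "integrable lborel f"
  shows "convolve J f z = (\<integral>y. J y *\<^sub>R f (z - y) \<partial>lborel)"
    and "integrable lborel (\<lambda>y. J y *\<^sub>R f (z - y))"
proof -
  note [measurable] = C1_compact_measurable[OF assms(1)] borel_measurable_integrable[OF assms(2)]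
  have 1: "lborel = distr lborel borel (\<lambda>y::'a. z - y)"
    using lborel_affine[of "-1" z] by (simp add: density_1)
  have "integrable (distr lborel borel (\<lambda>y::'a. z - y)) (\<lambda>y. J (z - y) *\<^sub>R f y)"
    using convolve_integrable[OF assms, of z] 1 by simp
  then show "integrable lborel (\<lambda>y. J y *\<^sub>R f (z - y))"
    by (subst (asm) integrable_distr_eq) auto
  show "convolve J f z = (\<integral>y. J y *\<^sub>R f (z - y) \<partial>lborel)"
    using integral_lborel_reflect[of "\<lambda>y. J (z - y) *\<^sub>R f y" z] unfolding convolve_def by simp
qed

lemma convolve_measurable [measurable]:
  fixes f :: "'a::euclidean_space \<Rightarrow> 'b::{banach, second_countable_topology}"
  assumes [measurable]: "J \<in> borel_measurable borel" "f \<in> borel_measurable borel"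
  shows "convolve J f \<in> borel_measurable borel"
  unfolding convolve_def[abs_def] by measurable

text \<open>The error is at most an average of \<open>norm (f (z - y) - f z)\<close> over
  \<open>norm y < \<epsilon>\<close>, and Tonelli's theorem exchanges this average with the integral
  in \<open>z\<close>. Nonnegative integrals are used because integrability of the mollification is
  only deduced from this bound.\<close>

lemma convolve_mollifier_L1_nn:
  fixes f :: "'a::euclidean_space \<Rightarrow> 'b::{banach, second_countable_topology}"
  assumes f: "integrable lborel f" and "\<epsilon> > 0"
    and d: "\<And>y. norm y < \<epsilon> \<Longrightarrow> (\<integral>z. norm (f (z - y) - f z) \<partial>lborel) \<le> e" and "e \<ge> 0"
  shows "(\<integral>\<^sup>+z. ennreal (norm (convolve (mollifier \<epsilon>) f z - f z)) \<partial>lborel) \<le> ennreal e"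
proof -
  let ?J = "mollifier \<epsilon> :: 'a \<Rightarrow> real"
  note J = mollifier_C1_compact[OF \<open>\<epsilon> > 0\<close>, where 'a = 'a]
  note [measurable] = C1_compact_measurable[OF J] borel_measurable_integrable[OF f]
  note iJ = C1_compact_integrable(1)[OF J]
  have "ennreal (norm (convolve ?J f z - f z)) \<le> (\<integral>\<^sup>+y. ennreal (?J y * norm (f (z - y) - f z)) \<partial>lborel)" for z
  proof -
    have i: "integrable lborel (\<lambda>y. ?J y *\<^sub>R f (z - y))" "integrable lborel (\<lambda>y. ?J y *\<^sub>R f z)"
      using convolve_alt(2)[OF J f] iJ by auto
    have "f z = (\<integral>y. ?J y *\<^sub>R f z \<partial>lborel)"
      using iJ mollifier_integral[OF \<open>\<epsilon> > 0\<close>, where 'a = 'a] by simp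
    then have "convolve ?J f z - f z = (\<integral>y. ?J y *\<^sub>R f (z - y) \<partial>lborel) - (\<integral>y. ?J y *\<^sub>R f z \<partial>lborel)"
      using convolve_alt(1)[OF J f, of z] by simp
    also have "\<dots> = (\<integral>y. ?J y *\<^sub>R (f (z - y) - f z) \<partial>lborel)"
      using i by (simp add: scaleR_diff_right)
    also have "ennreal (norm \<dots>) \<le> (\<integral>\<^sup>+y. ennreal (norm (?J y *\<^sub>R (f (z - y) - f z))) \<partial>lborel)"
      using i by (intro integral_norm_bound_ennreal) (simp add: scaleR_diff_right)
    finally show ?thesis by (simp add: mollifier_nonneg)
  qed
  then have "(\<integral>\<^sup>+z. ennreal (norm (convolve ?J f z - f z)) \<partial>lborel)
      \<le> (\<integral>\<^sup>+z. (\<integral>\<^sup>+y. ennreal (?J y * norm (f (z - y) - f z)) \<partial>lborel) \<partial>lborel)"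
    by (intro nn_integral_mono) auto
  also have "\<dots> = (\<integral>\<^sup>+y. (\<integral>\<^sup>+z. ennreal (?J y * norm (f (z - y) - f z)) \<partial>lborel) \<partial>lborel)"
    by (rule lborel_pair.Fubini'[symmetric]) measurable
  also have "\<dots> \<le> (\<integral>\<^sup>+y. ennreal (?J y) * ennreal e \<partial>lborel)"
  proof (rule nn_integral_mono)
    fix y :: 'a
    show "(\<integral>\<^sup>+z. ennreal (?J y * norm (f (z - y) - f z)) \<partial>lborel) \<le> ennreal (?J y) * ennreal e"
    proof (cases "norm y < \<epsilon>")
      case True
      have "(\<integral>\<^sup>+z. ennreal (?J y * norm (f (z - y) - f z)) \<partial>lborel)
          = ennreal (?J y) * (\<integral>\<^sup>+z. ennreal (norm (f (z - y) - f z)) \<partial>lborel)"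
        by (simp add: ennreal_mult mollifier_nonneg nn_integral_cmult)
      also have "(\<integral>\<^sup>+z. ennreal (norm (f (z - y) - f z)) \<partial>lborel) = ennreal (\<integral>z. norm (f (z - y) - f z) \<partial>lborel)"
        by (intro nn_integral_eq_integral integrable_shift_diff[OF f]) auto
      also have "\<dots> \<le> ennreal e" using d[OF True] by (rule ennreal_leI)
      finally show ?thesis by (simp add: mult_left_mono)
    next
      case False
      then show ?thesis using \<open>\<epsilon> > 0\<close> by (simp add: mollifier_zero)
    qed
  qed
  also have "\<dots> = (\<integral>\<^sup>+y. ennreal (?J y) \<partial>lborel) * ennreal e"
    by (rule nn_integral_multc) simp
  also have "(\<integral>\<^sup>+y. ennreal (?J y) \<partial>lborel) = 1"
    using nn_integral_eq_integral[OF iJ] mollifier_integral[OF \<open>\<epsilon> > 0\<close>, where 'a = 'a]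
    by (simp add: mollifier_nonneg)
  finally show ?thesis by simp
qed

lemma convolve_mollifier_integrable:
  fixes f :: "'a::euclidean_space \<Rightarrow> 'b::{banach, second_countable_topology}"
  assumes f: "integrable lborel f" and "\<epsilon> > 0"
  shows "integrable lborel (\<lambda>z. convolve (mollifier \<epsilon>) f z)"
proof -
  note J = mollifier_C1_compact[OF \<open>\<epsilon> > 0\<close>, where 'a = 'a]
  note [measurable] = C1_compact_measurable[OF J] borel_measurable_integrable[OF f]
  let ?e = "2 * (\<integral>z. norm (f z) \<partial>lborel)"
  have le: "(\<integral>z. norm (f (z - y) - f z) \<partial>lborel) \<le> ?e" for y
  proof -
    have it: "integrable lborel (\<lambda>z. f (z - y))" using integrable_lborel_translate[OF f, of "- y"] by simp
    have "(\<integral>z. norm (f (z - y) - f z) \<partial>lborel) \<le> (\<integral>z. norm (f (z - y)) + norm (f z) \<partial>lborel)"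
      using f it integrable_shift_diff[OF f] by (intro integral_mono norm_triangle_ineq4) auto
    also have "\<dots> = ?e"
      using f it integral_lborel_translate[of "\<lambda>z. norm (f z)" "- y"] by simp
    finally show ?thesis .
  qed
  have "(\<integral>\<^sup>+z. ennreal (norm (convolve (mollifier \<epsilon>) f z - f z)) \<partial>lborel) \<le> ennreal ?e"
    by (rule convolve_mollifier_L1_nn[OF f \<open>\<epsilon> > 0\<close> le]) auto
  then have "integrable lborel (\<lambda>z. convolve (mollifier \<epsilon>) f z - f z)"
    unfolding integrable_iff_bounded by (auto simp: le_less_trans[OF _ ennreal_less_top])
  from Bochner_Integration.integrable_add[OF this f] show ?thesis by simp
qed

text \<open>Continuity of translations makes the L^1 errors at most \<open>1 / Suc m\<close>, and a
  subsequence then converges almost everywhere. The bound by \<open>\<delta>\<close> later keeps the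
  kernels inside the domain.\<close>

lemma mollification_sequence:
  fixes f :: "'a::euclidean_space \<Rightarrow> 'b::{banach, second_countable_topology}"
  assumes f: "integrable lborel f" and "\<delta> > 0"
  obtains \<epsilon> :: "nat \<Rightarrow> real" where "\<forall>m. 0 < \<epsilon> m \<and> \<epsilon> m < \<delta>"
    "AE z in lborel. (\<lambda>m. convolve (mollifier (\<epsilon> m)) f z) \<longlonglongrightarrow> f z"
    "(\<lambda>m. \<integral>z. norm (convolve (mollifier (\<epsilon> m)) f z - f z) \<partial>lborel) \<longlonglongrightarrow> 0"
proof -
  have "\<exists>\<epsilon>. 0 < \<epsilon> \<and> \<epsilon> < \<delta> \<and> (\<integral>z. norm (convolve (mollifier \<epsilon>) f z - f z) \<partial>lborel) \<le> inverse (real (Suc m))" for m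
  proof -
    obtain d where d: "d > 0" "\<And>y. norm y < d \<Longrightarrow> (\<integral>z. norm (f (z - y) - f z) \<partial>lborel) < inverse (real (Suc m))"
      using L1_shift_continuous_integrable[OF f, unfolded L1_shift_continuous_def, rule_format, of "inverse (real (Suc m))"]
      by auto
    define \<epsilon> where "\<epsilon> = min d (\<delta> / 2)"
    have \<epsilon>: "0 < \<epsilon>" "\<epsilon> < \<delta>" using d(1) \<open>\<delta> > 0\<close> by (auto simp: \<epsilon>_def)
    have "(\<integral>\<^sup>+z. ennreal (norm (convolve (mollifier \<epsilon>) f z - f z)) \<partial>lborel) \<le> ennreal (inverse (real (Suc m)))"
      by (rule convolve_mollifier_L1_nn[OF f \<epsilon>(1)]) (use less_imp_le[OF d(2)] in \<open>auto simp: \<epsilon>_def\<close>)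
    then have "(\<integral>z. norm (convolve (mollifier \<epsilon>) f z - f z) \<partial>lborel) \<le> inverse (real (Suc m))"
      by (subst (asm) nn_integral_eq_integral) (use f convolve_mollifier_integrable[OF f \<epsilon>(1)] in auto)
    then show ?thesis using \<epsilon> by blast
  qed
  then obtain \<epsilon> where \<epsilon>: "\<And>m. 0 < \<epsilon> m" "\<And>m. \<epsilon> m < \<delta>"
    "\<And>m. (\<integral>z. norm (convolve (mollifier (\<epsilon> m)) f z - f z) \<partial>lborel) \<le> inverse (real (Suc m))"
    using choice[of "\<lambda>m \<epsilon>. 0 < \<epsilon> \<and> \<epsilon> < \<delta> \<and> (\<integral>z. norm (convolve (mollifier \<epsilon>) f z - f z) \<partial>lborel) \<le> inverse (real (Suc m))"] by blast
  have L1: "(\<lambda>m. \<integral>z. norm (convolve (mollifier (\<epsilon> m)) f z - f z) \<partial>lborel) \<longlonglongrightarrow> 0"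
    by (rule Lim_null_comparison[OF _ LIMSEQ_inverse_real_of_nat]) (use \<epsilon>(3) in auto)
  obtain r where r: "strict_mono r" "AE z in lborel. (\<lambda>m. convolve (mollifier (\<epsilon> (r m))) f z - f z) \<longlonglongrightarrow> 0"
    using tendsto_L1_AE_subseq[OF _ L1] f convolve_mollifier_integrable[OF f \<epsilon>(1)] by auto
  show thesis
  proof (rule that[of "\<lambda>m. \<epsilon> (r m)"])
    show "AE z in lborel. (\<lambda>m. convolve (mollifier (\<epsilon> (r m))) f z) \<longlonglongrightarrow> f z"
      using r(2) by eventually_elim (simp add: LIM_zero_iff)
    show "(\<lambda>m. \<integral>z. norm (convolve (mollifier (\<epsilon> (r m))) f z - f z) \<partial>lborel) \<longlonglongrightarrow> 0"
      using LIMSEQ_subseq_LIMSEQ[OF L1 r(1)] by (simp add: o_def)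
  qed (use \<epsilon> in auto)
qed

text \<open>\<open>f\<close> is merely integrable, so the product rule is applied to
  \<open>\<psi>\<close> times the mollification, whose derivative in direction \<open>v\<close>
  integrates to 0.\<close>

lemma convolve_grad_by_parts:
  assumes J: "C1_compact J DJ" and f: "integrable lborel f" and \<psi>: "C1_compact \<psi> D\<psi>"
  shows "(\<integral>z. \<psi> z * (v \<bullet> convolve_grad DJ f z) \<partial>lborel) = - (\<integral>z. (v \<bullet> D\<psi> z) * convolve J f z \<partial>lborel)"
    and "integrable lborel (\<lambda>z. \<psi> z * (v \<bullet> convolve_grad DJ f z))"
proof -
  have C: "continuous_on UNIV (convolve_grad DJ f)" by (rule convolve_grad_continuous[OF J f])
  have G: "\<And>z. GDERIV (convolve J f) z :> convolve_grad DJ f z" by (rule convolve_GDERIV[OF J f])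
  have P: "C1_compact (\<lambda>z. \<psi> z * convolve J f z) (\<lambda>z. \<psi> z *\<^sub>R convolve_grad DJ f z + convolve J f z *\<^sub>R D\<psi> z)"
    by (rule C1_compact_mult[OF \<psi> G C])
  obtain r where "r > 0" and r': "\<forall>z. norm z \<ge> r \<longrightarrow> \<psi> z = 0" "\<forall>z. norm z \<ge> r \<longrightarrow> D\<psi> z = 0"
    by (rule C1_compact_radius[OF \<psi>])
  note r = r'[rule_format]
  note c\<psi> = C1_compact_continuous[OF \<psi>] C1_compact_grad_continuous[OF \<psi>]
  show i1: "integrable lborel (\<lambda>z. \<psi> z * (v \<bullet> convolve_grad DJ f z))"
    by (rule continuous_compact_support_integrable[of _ r]) (intro continuous_intros c\<psi> C, simp add: r(1))
  have i2: "integrable lborel (\<lambda>z. (v \<bullet> D\<psi> z) * convolve J f z)"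
    by (rule continuous_compact_support_integrable[of _ r])
      (intro continuous_intros c\<psi> GDERIV_continuous_on[OF G], simp add: r(2))
  have "0 = (\<integral>z. v \<bullet> (\<psi> z *\<^sub>R convolve_grad DJ f z + convolve J f z *\<^sub>R D\<psi> z) \<partial>lborel)"
    using C1_compact_integral_deriv[OF P] by simp
  also have "\<dots> = (\<integral>z. \<psi> z * (v \<bullet> convolve_grad DJ f z) + (v \<bullet> D\<psi> z) * convolve J f z \<partial>lborel)"
    by (simp add: inner_add_right mult.commute)
  also have "\<dots> = (\<integral>z. \<psi> z * (v \<bullet> convolve_grad DJ f z) \<partial>lborel) + (\<integral>z. (v \<bullet> D\<psi> z) * convolve J f z \<partial>lborel)"
    using i1 i2 by simp
  finally show "(\<integral>z. \<psi> z * (v \<bullet> convolve_grad DJ f z) \<partial>lborel) = - (\<integral>z. (v \<bullet> D\<psi> z) * convolve J f z \<partial>lborel)"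
    by simp
qed

lemma DERIV_nonneg_continuous_on:
  assumes "\<And>v::real. v \<ge> 0 \<Longrightarrow> (F has_real_derivative F' v) (at v)"
  shows "continuous_on {0..} F"
  by (rule continuous_at_imp_continuous_on) (use assms DERIV_isCont in auto)

lemma integrable_Pair:
  fixes f :: "'a \<Rightarrow> 'b::{banach, second_countable_topology}" and g :: "'a \<Rightarrow> 'c::{banach, second_countable_topology}"
  assumes "integrable M f" "integrable M g"
  shows "integrable M (\<lambda>x. (f x, g x))"
proof -
  have 1: "bounded_linear (\<lambda>x::'b. (x, 0::'c))" "bounded_linear (\<lambda>x::'c. (0::'b, x))"
    by (auto intro!: bounded_linear_Pair bounded_linear_zero bounded_linear_ident)
  have "integrable M (\<lambda>x. (f x, 0) + (0, g x))"
    using integrable_bounded_linear[OF 1(1) assms(1)] integrable_bounded_linear[OF 1(2) assms(2)]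
    by (rule Bochner_Integration.integrable_add)
  then show ?thesis by simp
qed

text \<open>Lets several functions be mollified as one vector-valued function, so that a single
  sequence of radii works for all of them.\<close>

lemma convolve_Pair:
  fixes f :: "'a::euclidean_space \<Rightarrow> 'b::{banach, second_countable_topology}" and g :: "'a \<Rightarrow> 'c::{banach, second_countable_topology}"
  assumes J: "C1_compact J DJ" and f: "integrable lborel f" and g: "integrable lborel g"
  shows "convolve J (\<lambda>x. (f x, g x)) z = (convolve J f z, convolve J g z)"
proof -
  have i: "integrable lborel (\<lambda>y. J (z - y) *\<^sub>R (f y, g y))"
    by (rule convolve_integrable[OF J integrable_Pair[OF f g]])
  have "fst (convolve J (\<lambda>x. (f x, g x)) z) = convolve J f z"
    unfolding convolve_def integral_bounded_linear[OF bounded_linear_fst i, symmetric] by simp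
  moreover have "snd (convolve J (\<lambda>x. (f x, g x)) z) = convolve J g z"
    unfolding convolve_def integral_bounded_linear[OF bounded_linear_snd i, symmetric] by simp
  ultimately show ?thesis by (simp add: prod_eq_iff)
qed

lemma convolve_mono_norm:
  fixes f :: "'a::euclidean_space \<Rightarrow> 'b::{banach, second_countable_topology}"
  shows "norm (convolve (mollifier e) f z) \<le> convolve (mollifier e) (\<lambda>y. norm (f y)) z"
proof -
  have "norm (convolve (mollifier e) f z) \<le> (\<integral>y. norm (mollifier e (z - y) *\<^sub>R f y) \<partial>lborel)"
    unfolding convolve_def by (rule integral_norm_bound)
  then show ?thesis by (simp add: convolve_def mollifier_nonneg)
qed

lemma mollifier_shift_integral:
  fixes z :: "'a::euclidean_space"
  assumes "e > 0"
  shows "integrable lborel (\<lambda>y. mollifier e (z - y))" "(\<integral>y. mollifier e (z - y) \<partial>lborel) = 1"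
proof -
  note J = mollifier_C1_compact[OF assms, where 'a = 'a]
  note [measurable] = C1_compact_measurable[OF J]
  show 1: "(\<integral>y. mollifier e (z - y) \<partial>lborel) = 1"
    by (subst integral_lborel_reflect) (auto simp: mollifier_integral[OF assms])
  show "integrable lborel (\<lambda>y. mollifier e (z - y))"
    using 1 not_integrable_integral_eq by fastforce
qed

lemma convolve_range:
  assumes e: "e > 0" and f: "integrable lborel f" and r: "\<And>y. a \<le> f y" "\<And>y. f y \<le> b"
  shows "a \<le> convolve (mollifier e) f z" "convolve (mollifier e) f z \<le> (b::real)"
proof -
  note i = convolve_integrable[OF mollifier_C1_compact[OF e] f, of z]
  have "a = (\<integral>y. mollifier e (z - y) * a \<partial>lborel)" using mollifier_shift_integral[OF e, of z] by simp
  also have "\<dots> \<le> (\<integral>y. mollifier e (z - y) * f y \<partial>lborel)"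
    using i mollifier_shift_integral(1)[OF e, of z] by (intro integral_mono mult_left_mono r mollifier_nonneg) auto
  finally show "a \<le> convolve (mollifier e) f z" by (simp add: convolve_def)
  have "(\<integral>y. mollifier e (z - y) * f y \<partial>lborel) \<le> (\<integral>y. mollifier e (z - y) * b \<partial>lborel)"
    using i mollifier_shift_integral(1)[OF e, of z] by (intro integral_mono mult_left_mono r mollifier_nonneg) auto
  also have "\<dots> = b" using mollifier_shift_integral[OF e, of z] by simp
  finally show "convolve (mollifier e) f z \<le> b" by (simp add: convolve_def)
qed

text \<open>A product of two averages is dominated by one average, without any conjugate function.\<close>

lemma convolve_product_bound:
  fixes a b h :: "'a::euclidean_space \<Rightarrow> real"
  assumes e: "e > 0" and i: "integrable lborel a" "integrable lborel b" "integrable lborel h"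
    and nn: "\<And>y. 0 \<le> a y" and ab: "\<And>y y'. a y * b y' \<le> h y + h y'"
  shows "convolve (mollifier e) a z * convolve (mollifier e) b z \<le> 2 * convolve (mollifier e) h z"
proof -
  let ?J = "mollifier e :: 'a \<Rightarrow> real"
  note J = mollifier_C1_compact[OF e, where 'a = 'a]
  note sI = mollifier_shift_integral[OF e, of z]
  have ia: "integrable lborel (\<lambda>y. ?J (z - y) * a y)" and ib: "integrable lborel (\<lambda>y. ?J (z - y) * b y)"
    and ih: "integrable lborel (\<lambda>y. ?J (z - y) * h y)"
    using convolve_integrable[OF J i(1), of z] convolve_integrable[OF J i(2), of z] convolve_integrable[OF J i(3), of z] by auto
  let ?A = "convolve ?J a z" and ?B = "convolve ?J b z" and ?H = "convolve ?J h z"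
  have 1: "a y * ?B \<le> h y + ?H" for y
  proof -
    have "a y * ?B = (\<integral>y'. ?J (z - y') * (a y * b y') \<partial>lborel)"
      unfolding convolve_def by (subst integral_mult_right_zero[symmetric]) (simp add: mult_ac)
    also have "\<dots> \<le> (\<integral>y'. ?J (z - y') * (h y + h y') \<partial>lborel)"
    proof (rule integral_mono)
      show "integrable lborel (\<lambda>y'. ?J (z - y') * (a y * b y'))"
        using integrable_mult_right[OF ib, of "a y"] by (simp add: mult_ac)
      show "integrable lborel (\<lambda>y'. ?J (z - y') * (h y + h y'))"
        using ih sI(1) by (simp add: distrib_left)
      show "?J (z - y') * (a y * b y') \<le> ?J (z - y') * (h y + h y')" for y'
        by (intro mult_left_mono ab mollifier_nonneg)
    qed
    also have "\<dots> = h y + ?H"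
      using ih sI by (simp add: distrib_left convolve_def)
    finally show ?thesis .
  qed
  have "?A * ?B = (\<integral>y. ?J (z - y) * (a y * ?B) \<partial>lborel)"
    unfolding convolve_def[of _ a] by (subst integral_mult_left_zero[symmetric]) (simp add: mult_ac)
  also have "\<dots> \<le> (\<integral>y. ?J (z - y) * (h y + ?H) \<partial>lborel)"
  proof (rule integral_mono)
    show "integrable lborel (\<lambda>y. ?J (z - y) * (a y * ?B))"
      using integrable_mult_left[OF ia, of ?B] by (simp add: mult_ac)
    show "integrable lborel (\<lambda>y. ?J (z - y) * (h y + ?H))"
      using ih sI(1) by (simp add: distrib_left)
    show "?J (z - y) * (a y * ?B) \<le> ?J (z - y) * (h y + ?H)" for y
      by (intro mult_left_mono 1 mollifier_nonneg)
  qed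
  also have "\<dots> = ?H + ?H"
    using ih sI by (simp add: distrib_left convolve_def)
  finally show ?thesis by simp
qed

section \<open>The energy inequality under mollification\<close>

text \<open>
  Here \<open>W\<close> stands for \<open>A(x, t, u, Du)\<close> and \<open>V\<close> for \<open>Du\<close>.  The integrable \<open>h\<close> dominates their mixed products
  at different points, which makes the products of two mollifications converge although \<open>V\<close> and \<open>W\<close>
  need not lie in dual Lebesgue spaces.
\<close>

locale mollified_supersolution =
  fixes U h :: "'n::finite space_time \<Rightarrow> real" and V W :: "'n space_time \<Rightarrow> real ^ 'n"
    and S :: "'n space_time set" and \<delta> M :: real
    and \<eta> :: "'n space_time \<Rightarrow> real" and D\<eta> :: "'n space_time \<Rightarrow> 'n space_time"
  assumes iU: "integrable lborel U" and iV: "integrable lborel V" and iW: "integrable lborel W"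
    and ih: "integrable lborel h"
    and U0: "\<And>z. 0 \<le> U z" and UM: "\<And>z. U z \<le> M"
    and Wh: "\<And>y y'. norm (W y) * norm (V y') \<le> h y + h y'"
    and \<delta>: "\<delta> > 0"
    and grad: "\<And>\<epsilon> z. 0 < \<epsilon> \<Longrightarrow> \<epsilon> < \<delta> \<Longrightarrow> z \<in> S \<Longrightarrow>
        fst (convolve_grad (mollifier_grad \<epsilon>) U z) = convolve (mollifier \<epsilon>) V z"
    and super: "\<And>\<epsilon> z. 0 < \<epsilon> \<Longrightarrow> \<epsilon> < \<delta> \<Longrightarrow> z \<in> S \<Longrightarrow>
        (\<integral>y. W y \<bullet> fst (mollifier_grad \<epsilon> (z - y)) \<partial>lborel) \<le> snd (convolve_grad (mollifier_grad \<epsilon>) U z)"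
    and \<eta>: "C1_compact \<eta> D\<eta>" and \<eta>S: "\<And>z. \<eta> z \<noteq> 0 \<Longrightarrow> z \<in> S"
begin

abbreviation "UU \<epsilon> \<equiv> convolve (mollifier \<epsilon>) U"
abbreviation "VV \<epsilon> \<equiv> convolve (mollifier \<epsilon>) V"
abbreviation "WW \<epsilon> \<equiv> convolve (mollifier \<epsilon>) W"
abbreviation "HH \<epsilon> \<equiv> convolve (mollifier \<epsilon>) h"
abbreviation "DU \<epsilon> \<equiv> convolve_grad (mollifier_grad \<epsilon>) U"

lemma meas [measurable]:
  "U \<in> borel_measurable borel" "V \<in> borel_measurable borel" "W \<in> borel_measurable borel" "h \<in> borel_measurable borel"
  "\<eta> \<in> borel_measurable borel" "D\<eta> \<in> borel_measurable borel"
  using borel_measurable_integrable[OF iU] borel_measurable_integrable[OF iV] borel_measurable_integrable[OF iW]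
    borel_measurable_integrable[OF ih] C1_compact_measurable[OF \<eta>] by auto

lemma UU_range: "0 < \<epsilon> \<Longrightarrow> 0 \<le> UU \<epsilon> z" "0 < \<epsilon> \<Longrightarrow> UU \<epsilon> z \<le> M"
  using convolve_range[OF _ iU U0 UM] by auto

lemma UU_GDERIV: "0 < \<epsilon> \<Longrightarrow> GDERIV (UU \<epsilon>) z :> DU \<epsilon> z"
  by (rule convolve_GDERIV[OF mollifier_C1_compact iU])

lemma UU_cont: "0 < \<epsilon> \<Longrightarrow> continuous_on T (UU \<epsilon>)"
  by (rule GDERIV_continuous_on[OF UU_GDERIV])

lemma DU_cont: "0 < \<epsilon> \<Longrightarrow> continuous_on UNIV (DU \<epsilon>)"
  by (rule convolve_grad_continuous[OF mollifier_C1_compact iU])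

lemma UU_compose_cont: "0 < \<epsilon> \<Longrightarrow> continuous_on {0..} F \<Longrightarrow> continuous_on UNIV (\<lambda>z. F (UU \<epsilon> z))"
  by (rule continuous_on_compose2[OF _ UU_cont]) (use UU_range(1) in auto)

text \<open>Derivatives of \<open>F\<close> are required only at \<open>v \<ge> 0\<close>, where
  every mollification of the nonnegative \<open>U\<close> takes its values; this admits functions
  such as logarithms.\<close>

lemma truncation_C1:
  assumes \<epsilon>: "0 < \<epsilon>" and F: "\<And>v. v \<ge> 0 \<Longrightarrow> (F has_real_derivative F' v) (at v)" "continuous_on {0..} F'"
  shows "C1_compact (\<lambda>z. \<eta> z * F (UU \<epsilon> z)) (\<lambda>z. \<eta> z *\<^sub>R (F' (UU \<epsilon> z) *\<^sub>R DU \<epsilon> z) + F (UU \<epsilon> z) *\<^sub>R D\<eta> z)"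
proof (rule C1_compact_mult[OF \<eta>])
  show "GDERIV (\<lambda>z. F (UU \<epsilon> z)) z :> F' (UU \<epsilon> z) *\<^sub>R DU \<epsilon> z" for z
    by (rule GDERIV_DERIV_compose[OF UU_GDERIV[OF \<epsilon>] F(1)[OF UU_range(1)[OF \<epsilon>]]])
  have "continuous_on UNIV (\<lambda>z. F' (UU \<epsilon> z))"
    by (rule continuous_on_compose2[OF F(2) UU_cont[OF \<epsilon>]]) (use UU_range(1)[OF \<epsilon>] in auto)
  then show "continuous_on UNIV (\<lambda>z. F' (UU \<epsilon> z) *\<^sub>R DU \<epsilon> z)"
    by (intro continuous_intros DU_cont[OF \<epsilon>])
qed

text \<open>The flux \<open>W\<close> is only integrable, so its divergence is formed with the
  derivative on the kernel. Componentwise this is the derivative of the mollified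
  \<open>W $ i\<close> in the direction \<open>?e i\<close>, to which
  \<open>convolve_grad_by_parts\<close> applies.\<close>

lemma divergence_by_parts:
  assumes \<epsilon>: "0 < \<epsilon>" and \<psi>: "C1_compact \<psi> D\<psi>"
  shows "(\<integral>z. \<psi> z * (\<integral>y. W y \<bullet> fst (mollifier_grad \<epsilon> (z - y)) \<partial>lborel) \<partial>lborel)
     = - (\<integral>z. fst (D\<psi> z) \<bullet> WW \<epsilon> z \<partial>lborel)"
    and "integrable lborel (\<lambda>z. \<psi> z * (\<integral>y. W y \<bullet> fst (mollifier_grad \<epsilon> (z - y)) \<partial>lborel))"
    and "integrable lborel (\<lambda>z. fst (D\<psi> z) \<bullet> WW \<epsilon> z)"
proof -
  note J = mollifier_C1_compact[OF \<epsilon>, where 'a = "'n space_time"]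
  let ?e = "\<lambda>i::'n. (axis i 1 :: real ^ 'n, 0 :: real)"
  have iWi: "integrable lborel (\<lambda>y. W y $ i)" for i
    by (rule integrable_bounded_linear[OF bounded_linear_vec_nth iW])
  have sum: "(\<integral>y. W y \<bullet> fst (mollifier_grad \<epsilon> (z - y)) \<partial>lborel)
      = (\<Sum>i\<in>UNIV. ?e i \<bullet> convolve_grad (mollifier_grad \<epsilon>) (\<lambda>y. W y $ i) z)" for z
  proof -
    have 1: "?e i \<bullet> convolve_grad (mollifier_grad \<epsilon>) (\<lambda>y. W y $ i) z
        = (\<integral>y. W y $ i * fst (mollifier_grad \<epsilon> (z - y)) $ i \<partial>lborel)" for i
    proof -
      have "?e i \<bullet> convolve_grad (mollifier_grad \<epsilon>) (\<lambda>y. W y $ i) z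
        = (\<integral>y. ?e i \<bullet> (W y $ i *\<^sub>R mollifier_grad \<epsilon> (z - y)) \<partial>lborel)"
        unfolding convolve_grad_def
        by (rule integral_inner_right[symmetric]) (rule convolve_grad_integrable[OF J iWi])
      also have "\<dots> = (\<integral>y. W y $ i * fst (mollifier_grad \<epsilon> (z - y)) $ i \<partial>lborel)"
        by (simp add: inner_prod_def inner_axis')
      finally show ?thesis .
    qed
    have 2: "integrable lborel (\<lambda>y. W y $ i * fst (mollifier_grad \<epsilon> (z - y)) $ i)" for i
      using integrable_bounded_linear[OF bounded_linear_compose[OF bounded_linear_vec_nth[of i] bounded_linear_fst]
          convolve_grad_integrable[OF J iWi[of i], of z]] by simp
    have "(\<integral>y. W y \<bullet> fst (mollifier_grad \<epsilon> (z - y)) \<partial>lborel)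
      = (\<integral>y. (\<Sum>i\<in>UNIV. W y $ i * fst (mollifier_grad \<epsilon> (z - y)) $ i) \<partial>lborel)"
      by (simp add: inner_vec_def)
    also have "\<dots> = (\<Sum>i\<in>UNIV. \<integral>y. W y $ i * fst (mollifier_grad \<epsilon> (z - y)) $ i \<partial>lborel)"
      by (rule Bochner_Integration.integral_sum) (rule 2)
    finally show ?thesis unfolding 1 .
  qed
  have WWi: "convolve (mollifier \<epsilon>) (\<lambda>y. W y $ i) z = WW \<epsilon> z $ i" for i z
    unfolding convolve_def
    using integral_bounded_linear[OF bounded_linear_vec_nth[of i] convolve_integrable[OF J iW, of z]] by simp
  note parts = convolve_grad_by_parts[OF J iWi \<psi>]
  have "continuous_on UNIV (WW \<epsilon>)"
    unfolding continuous_on_componentwise[where f = "WW \<epsilon>"] Basis_vec_def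
    using GDERIV_continuous_on[OF convolve_GDERIV[OF J iWi], of UNIV] by (auto simp: WWi inner_axis)
  note cont = this
  obtain r where "r > 0" and r': "\<forall>z. norm z \<ge> r \<longrightarrow> \<psi> z = 0" "\<forall>z. norm z \<ge> r \<longrightarrow> D\<psi> z = 0"
    by (rule C1_compact_radius[OF \<psi>])
  show i3: "integrable lborel (\<lambda>z. fst (D\<psi> z) \<bullet> WW \<epsilon> z)"
    by (rule continuous_compact_support_integrable[of _ r])
      (intro continuous_intros cont C1_compact_grad_continuous[OF \<psi>], simp add: r'(2))
  have i4: "integrable lborel (\<lambda>z. (?e i \<bullet> D\<psi> z) * WW \<epsilon> z $ i)" for i
    by (rule continuous_compact_support_integrable[of _ r])
      (intro continuous_intros cont C1_compact_grad_continuous[OF \<psi>], simp add: r'(2))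
  show "integrable lborel (\<lambda>z. \<psi> z * (\<integral>y. W y \<bullet> fst (mollifier_grad \<epsilon> (z - y)) \<partial>lborel))"
    unfolding sum sum_distrib_left by (intro Bochner_Integration.integrable_sum parts(2))
  have "(\<integral>z. \<psi> z * (\<integral>y. W y \<bullet> fst (mollifier_grad \<epsilon> (z - y)) \<partial>lborel) \<partial>lborel)
      = (\<Sum>i\<in>UNIV. \<integral>z. \<psi> z * (?e i \<bullet> convolve_grad (mollifier_grad \<epsilon>) (\<lambda>y. W y $ i) z) \<partial>lborel)"
    unfolding sum sum_distrib_left by (intro Bochner_Integration.integral_sum parts(2))
  also have "\<dots> = (\<Sum>i\<in>UNIV. - (\<integral>z. (?e i \<bullet> D\<psi> z) * WW \<epsilon> z $ i \<partial>lborel))"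
    by (simp only: parts(1) WWi)
  also have "\<dots> = - (\<integral>z. (\<Sum>i\<in>UNIV. (?e i \<bullet> D\<psi> z) * WW \<epsilon> z $ i) \<partial>lborel)"
    using i4 by (simp add: sum_negf Bochner_Integration.integral_sum)
  also have "(\<lambda>z. \<Sum>i\<in>UNIV. (?e i \<bullet> D\<psi> z) * WW \<epsilon> z $ i) = (\<lambda>z. fst (D\<psi> z) \<bullet> WW \<epsilon> z)"
    by (simp add: inner_prod_def inner_axis') (simp add: inner_vec_def)
  finally show "(\<integral>z. \<psi> z * (\<integral>y. W y \<bullet> fst (mollifier_grad \<epsilon> (z - y)) \<partial>lborel) \<partial>lborel)
     = - (\<integral>z. fst (D\<psi> z) \<bullet> WW \<epsilon> z \<partial>lborel)" .
qed

text \<open>After mollification the supersolution property is a pointwise inequality between the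
  divergence of \<open>WW \<epsilon>\<close> and the time derivative of
  \<open>UU \<epsilon>\<close>, which can be multiplied by the nonnegative
  \<open>p (UU \<epsilon>) * \<eta>\<close>. Since \<open>p = - \<Phi>'\<close>, the time term is an
  exact derivative and can be moved onto \<open>\<eta>\<close>.\<close>

lemma mollified_energy:
  assumes \<epsilon>: "0 < \<epsilon>" "\<epsilon> < \<delta>"
    and \<Phi>: "\<And>v. v \<ge> 0 \<Longrightarrow> (\<Phi> has_real_derivative - p v) (at v)"
    and p: "\<And>v. v \<ge> 0 \<Longrightarrow> (p has_real_derivative - q v) (at v)" "continuous_on {0..} q"
    and pnn: "\<And>v. v \<ge> 0 \<Longrightarrow> p v \<ge> 0" and \<eta>nn: "\<And>z. \<eta> z \<ge> 0"
  shows "(\<integral>z. q (UU \<epsilon> z) * \<eta> z * (VV \<epsilon> z \<bullet> WW \<epsilon> z) - p (UU \<epsilon> z) * (fst (D\<eta> z) \<bullet> WW \<epsilon> z) \<partial>lborel)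
      \<le> (\<integral>z. \<Phi> (UU \<epsilon> z) * snd (D\<eta> z) \<partial>lborel)"
proof -
  let ?\<psi> = "\<lambda>z. \<eta> z * p (UU \<epsilon> z)"
  let ?D = "\<lambda>z. \<eta> z *\<^sub>R (- q (UU \<epsilon> z) *\<^sub>R DU \<epsilon> z) + p (UU \<epsilon> z) *\<^sub>R D\<eta> z"
  have \<psi>: "C1_compact ?\<psi> ?D"
    by (rule truncation_C1[OF \<epsilon>(1) p(1)]) (auto intro: continuous_intros p(2))
  have cp: "continuous_on {0..} p"
    by (rule DERIV_nonneg_continuous_on[OF p(1)])
  have P: "C1_compact (\<lambda>z. \<eta> z * \<Phi> (UU \<epsilon> z)) (\<lambda>z. \<eta> z *\<^sub>R (- p (UU \<epsilon> z) *\<^sub>R DU \<epsilon> z) + \<Phi> (UU \<epsilon> z) *\<^sub>R D\<eta> z)"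
    by (rule truncation_C1[OF \<epsilon>(1) \<Phi>]) (auto intro: continuous_intros cp)
  obtain r where "r > 0" and r': "\<forall>z. norm z \<ge> r \<longrightarrow> \<eta> z = 0" "\<forall>z. norm z \<ge> r \<longrightarrow> D\<eta> z = 0"
    by (rule C1_compact_radius[OF \<eta>])
  have cc: "continuous_on UNIV (\<lambda>z. p (UU \<epsilon> z))" "continuous_on UNIV (\<lambda>z. \<Phi> (UU \<epsilon> z))"
    using UU_compose_cont[OF \<epsilon>(1)] cp DERIV_nonneg_continuous_on[OF \<Phi>] by blast+
  note c\<eta> = C1_compact_continuous[OF \<eta>] C1_compact_grad_continuous[OF \<eta>]
  have i1: "integrable lborel (\<lambda>z. ?\<psi> z * snd (DU \<epsilon> z))"
    by (rule continuous_compact_support_integrable[of _ r])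
      (intro continuous_intros cc c\<eta> DU_cont[OF \<epsilon>(1)], simp add: r'(1))
  have i2: "integrable lborel (\<lambda>z. \<Phi> (UU \<epsilon> z) * snd (D\<eta> z))"
    by (rule continuous_compact_support_integrable[of _ r])
      (intro continuous_intros cc c\<eta>, simp add: r'(2))
  have "0 = (\<integral>z. (0, 1) \<bullet> (\<eta> z *\<^sub>R (- p (UU \<epsilon> z) *\<^sub>R DU \<epsilon> z) + \<Phi> (UU \<epsilon> z) *\<^sub>R D\<eta> z) \<partial>lborel)"
    using C1_compact_integral_deriv[OF P] by simp
  also have "\<dots> = (\<integral>z. \<Phi> (UU \<epsilon> z) * snd (D\<eta> z) - ?\<psi> z * snd (DU \<epsilon> z) \<partial>lborel)"
    by (simp add: inner_prod_def)
  also have "\<dots> = (\<integral>z. \<Phi> (UU \<epsilon> z) * snd (D\<eta> z) \<partial>lborel) - (\<integral>z. ?\<psi> z * snd (DU \<epsilon> z) \<partial>lborel)"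
    using i1 i2 by simp
  finally have time: "(\<integral>z. ?\<psi> z * snd (DU \<epsilon> z) \<partial>lborel) = (\<integral>z. \<Phi> (UU \<epsilon> z) * snd (D\<eta> z) \<partial>lborel)"
    by simp
  note div = divergence_by_parts[OF \<epsilon>(1) \<psi>]
  \<comment> \<open>\<open>grad\<close> is available where \<open>\<eta>\<close> is nonzero;
    elsewhere the factor \<open>\<eta> z\<close> removes both gradients.\<close>
  have fD: "fst (?D z) \<bullet> WW \<epsilon> z = - (q (UU \<epsilon> z) * \<eta> z * (VV \<epsilon> z \<bullet> WW \<epsilon> z) - p (UU \<epsilon> z) * (fst (D\<eta> z) \<bullet> WW \<epsilon> z))" for z
  proof (cases "\<eta> z = 0")
    case False
    then have "fst (DU \<epsilon> z) = VV \<epsilon> z" by (intro grad \<epsilon> \<eta>S)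
    then show ?thesis by (simp add: inner_add_left inner_diff_left)
  qed simp
  have "(\<integral>z. q (UU \<epsilon> z) * \<eta> z * (VV \<epsilon> z \<bullet> WW \<epsilon> z) - p (UU \<epsilon> z) * (fst (D\<eta> z) \<bullet> WW \<epsilon> z) \<partial>lborel)
     = - (\<integral>z. fst (?D z) \<bullet> WW \<epsilon> z \<partial>lborel)"
    unfolding fD integral_minus by (rule minus_minus[symmetric])
  also have "\<dots> = (\<integral>z. ?\<psi> z * (\<integral>y. W y \<bullet> fst (mollifier_grad \<epsilon> (z - y)) \<partial>lborel) \<partial>lborel)"
    by (rule div(1)[symmetric])
  also have "\<dots> \<le> (\<integral>z. ?\<psi> z * snd (DU \<epsilon> z) \<partial>lborel)"
  proof (rule integral_mono[OF div(2) i1])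
    fix z
    show "?\<psi> z * (\<integral>y. W y \<bullet> fst (mollifier_grad \<epsilon> (z - y)) \<partial>lborel) \<le> ?\<psi> z * snd (DU \<epsilon> z)"
    proof (cases "\<eta> z = 0")
      case False
      then show ?thesis
        by (intro mult_left_mono super \<epsilon> \<eta>S mult_nonneg_nonneg \<eta>nn pnn UU_range)
    qed simp
  qed
  finally show ?thesis unfolding time .
qed

text \<open>The shift \<open>(y, 0)\<close> is purely spatial, so the time derivative of the
  mollified function, over which there is no control, never appears.\<close>

lemma mollified_translation:
  assumes \<epsilon>: "0 < \<epsilon>" "\<epsilon> < \<delta>"
    and F: "\<And>v. v \<ge> 0 \<Longrightarrow> (F has_real_derivative F' v) (at v)" "continuous_on {0..} F'"
  shows "(\<integral>z. \<bar>\<eta> (z + (y, 0)) * F (UU \<epsilon> (z + (y, 0))) - \<eta> z * F (UU \<epsilon> z)\<bar> \<partial>lborel)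
     \<le> (\<integral>z. \<bar>\<eta> z * F' (UU \<epsilon> z) * (y \<bullet> VV \<epsilon> z) + F (UU \<epsilon> z) * (y \<bullet> fst (D\<eta> z))\<bar> \<partial>lborel)"
proof -
  note T = truncation_C1[OF \<epsilon>(1) F]
  have "(y, 0) \<bullet> (\<eta> z *\<^sub>R (F' (UU \<epsilon> z) *\<^sub>R DU \<epsilon> z) + F (UU \<epsilon> z) *\<^sub>R D\<eta> z)
     = \<eta> z * F' (UU \<epsilon> z) * (y \<bullet> VV \<epsilon> z) + F (UU \<epsilon> z) * (y \<bullet> fst (D\<eta> z))" for z
  proof (cases "\<eta> z = 0")
    case False
    then have "fst (DU \<epsilon> z) = VV \<epsilon> z" by (intro grad \<epsilon> \<eta>S)
    then show ?thesis by (simp add: inner_prod_def inner_add_right)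
  qed (simp add: inner_prod_def)
  note eq = this
  show ?thesis using C1_compact_integral_shift[OF T, of "(y, 0)"] unfolding eq .
qed

lemma truncation_bound:
  assumes "continuous_on {0..} (F :: real \<Rightarrow> real)"
  obtains B where "B > 0" "\<forall>v\<in>{0..M}. \<bar>F v\<bar> \<le> B"
proof -
  have "bounded (F ` {0..M})"
    by (intro compact_imp_bounded compact_continuous_image continuous_on_subset[OF assms]) auto
  then show thesis using that unfolding bounded_pos by auto
qed

lemma good_sequence:
  obtains \<epsilon> :: "nat \<Rightarrow> real" where "\<forall>m. 0 < \<epsilon> m \<and> \<epsilon> m < \<delta>"
    "AE z in lborel. (\<lambda>m. UU (\<epsilon> m) z) \<longlonglongrightarrow> U z \<and> (\<lambda>m. VV (\<epsilon> m) z) \<longlonglongrightarrow> V z \<and> (\<lambda>m. WW (\<epsilon> m) z) \<longlonglongrightarrow> W z"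
    "(\<lambda>m. \<integral>z. norm (VV (\<epsilon> m) z - V z) \<partial>lborel) \<longlonglongrightarrow> 0"
    "(\<lambda>m. \<integral>z. norm (WW (\<epsilon> m) z - W z) \<partial>lborel) \<longlonglongrightarrow> 0"
    "(\<lambda>m. \<integral>z. \<bar>HH (\<epsilon> m) z - h z\<bar> \<partial>lborel) \<longlonglongrightarrow> 0"
proof -
  let ?f = "\<lambda>z. (U z, V z, W z, h z)"
  have i: "integrable lborel ?f" by (intro integrable_Pair iU iV iW ih)
  obtain \<epsilon> where \<epsilon>': "\<forall>m::nat. 0 < \<epsilon> m \<and> \<epsilon> m < \<delta>"
    and ae: "AE z in lborel. (\<lambda>m. convolve (mollifier (\<epsilon> m)) ?f z) \<longlonglongrightarrow> ?f z"
    and L1: "(\<lambda>m. \<integral>z. norm (convolve (mollifier (\<epsilon> m)) ?f z - ?f z) \<partial>lborel) \<longlonglongrightarrow> 0"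
    by (rule mollification_sequence[OF i \<delta>])
  have \<epsilon>: "0 < \<epsilon> m" "\<epsilon> m < \<delta>" for m using \<epsilon>' by auto
  have cf: "convolve (mollifier (\<epsilon> m)) ?f z = (UU (\<epsilon> m) z, VV (\<epsilon> m) z, WW (\<epsilon> m) z, HH (\<epsilon> m) z)" for m z
    using \<epsilon>(1)[of m] by (simp add: convolve_Pair[OF mollifier_C1_compact] integrable_Pair iU iV iW ih)
  have int: "integrable lborel (\<lambda>z. norm (convolve (mollifier (\<epsilon> m)) ?f z - ?f z))" for m
    by (intro integrable_norm Bochner_Integration.integrable_diff i convolve_mollifier_integrable[OF i \<epsilon>(1)])
  note [measurable] = C1_compact_measurable(1)[OF mollifier_C1_compact[OF \<epsilon>(1)]]
  have dom: "(\<lambda>m. \<integral>z. k m z \<partial>lborel) \<longlonglongrightarrow> 0"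
    if "\<And>m. k m \<in> borel_measurable lborel"
      "\<And>m z. 0 \<le> k m z \<and> k m z \<le> norm (convolve (mollifier (\<epsilon> m)) ?f z - ?f z)" for k :: "nat \<Rightarrow> 'n space_time \<Rightarrow> real"
  proof (rule Lim_null_comparison[OF always_eventually L1], rule allI)
    fix m
    have "integrable lborel (k m)"
      by (rule Bochner_Integration.integrable_bound[OF int[of m] that(1)]) (use that(2) in auto)
    then have "(\<integral>z. k m z \<partial>lborel) \<le> (\<integral>z. norm (convolve (mollifier (\<epsilon> m)) ?f z - ?f z) \<partial>lborel)"
      by (intro integral_mono int) (use that(2) in auto)
    moreover have "0 \<le> (\<integral>z. k m z \<partial>lborel)" using that(2) by (intro Bochner_Integration.integral_nonneg) auto
    ultimately show "norm (\<integral>z. k m z \<partial>lborel) \<le> (\<integral>z. norm (convolve (mollifier (\<epsilon> m)) ?f z - ?f z) \<partial>lborel)"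
      by simp
  qed
  have n: "norm b \<le> norm (a, b, c, d)" "norm c \<le> norm (a, b, c, d)" "norm d \<le> norm (a, b, c, d)"
    for a d :: real and b c :: "real ^ 'n"
  proof -
    have 1: "norm (b, c, d) \<le> norm (a, b, c, d)" by (rule norm_snd_le)
    have 2: "norm (c, d) \<le> norm (b, c, d)" by (rule norm_snd_le)
    have "norm b \<le> norm (b, c, d)" by (rule norm_fst_le)
    then show "norm b \<le> norm (a, b, c, d)" using 1 by simp
    have "norm c \<le> norm (c, d)" by (rule norm_fst_le)
    then show "norm c \<le> norm (a, b, c, d)" using 1 2 by simp
    have "norm d \<le> norm (c, d)" by (rule norm_snd_le)
    then show "norm d \<le> norm (a, b, c, d)" using 1 2 by simp
  qed
  show thesis
  proof (rule that[of \<epsilon>])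
    show "\<forall>m. 0 < \<epsilon> m \<and> \<epsilon> m < \<delta>" using \<epsilon> by blast
    show "AE z in lborel. (\<lambda>m. UU (\<epsilon> m) z) \<longlonglongrightarrow> U z \<and> (\<lambda>m. VV (\<epsilon> m) z) \<longlonglongrightarrow> V z \<and> (\<lambda>m. WW (\<epsilon> m) z) \<longlonglongrightarrow> W z"
      using ae unfolding cf
    proof eventually_elim
      case (elim z)
      show ?case
        using tendsto_fst[OF elim] tendsto_fst[OF tendsto_snd[OF elim]] tendsto_fst[OF tendsto_snd[OF tendsto_snd[OF elim]]]
        by simp
    qed
    show "(\<lambda>m. \<integral>z. norm (VV (\<epsilon> m) z - V z) \<partial>lborel) \<longlonglongrightarrow> 0"
      by (rule dom) (measurable, simp only: cf diff_Pair n norm_ge_zero simp_thms)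
    show "(\<lambda>m. \<integral>z. norm (WW (\<epsilon> m) z - W z) \<partial>lborel) \<longlonglongrightarrow> 0"
      by (rule dom) (measurable, simp only: cf diff_Pair n norm_ge_zero simp_thms)
    show "(\<lambda>m. \<integral>z. \<bar>HH (\<epsilon> m) z - h z\<bar> \<partial>lborel) \<longlonglongrightarrow> 0"
      unfolding real_norm_def[symmetric]
      by (rule dom) (measurable, simp only: cf diff_Pair n norm_ge_zero simp_thms)
  qed
qed

lemma UU_limit:
  assumes F: "continuous_on {0..} (F :: real \<Rightarrow> real)" and \<epsilon>: "\<forall>m. 0 < \<epsilon> m \<and> \<epsilon> m < \<delta>"
    and lim: "(\<lambda>m. UU (\<epsilon> m) z) \<longlonglongrightarrow> U z"
  shows "(\<lambda>m. F (UU (\<epsilon> m) z)) \<longlonglongrightarrow> F (U z)"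
  by (rule continuous_on_tendsto_compose[OF F lim]) (use U0 UU_range(1) \<epsilon> in auto)

lemma meas_D\<eta> [measurable]: "D\<eta> \<in> borel \<rightarrow>\<^sub>M borel \<Otimes>\<^sub>M borel"
  unfolding borel_prod by (rule meas(6))

lemma moll_meas: "0 < \<epsilon> \<Longrightarrow> mollifier \<epsilon> \<in> borel_measurable borel"
  by (rule C1_compact_measurable(1)[OF mollifier_C1_compact])

lemma compose_meas:
  assumes F: "continuous_on {0..} (F :: real \<Rightarrow> real)"
  shows "(\<lambda>z. F (U z)) \<in> borel_measurable borel" "0 < \<epsilon> \<Longrightarrow> (\<lambda>z. F (UU \<epsilon> z)) \<in> borel_measurable borel"
proof -
  have "continuous_on UNIV (\<lambda>v. F (max 0 v))"
    by (rule continuous_on_compose2[OF F]) (auto intro!: continuous_intros)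
  then have [measurable]: "(\<lambda>v. F (max 0 v)) \<in> borel_measurable borel" by (rule borel_measurable_continuous_onI)
  have 1: "F (U z) = (\<lambda>v. F (max 0 v)) (U z)" for z using U0[of z] by (simp add: max_def)
  show "(\<lambda>z. F (U z)) \<in> borel_measurable borel" unfolding 1 by measurable
  assume e: "0 < \<epsilon>"
  note [measurable] = moll_meas[OF e]
  have 2: "F (UU \<epsilon> z) = (\<lambda>v. F (max 0 v)) (UU \<epsilon> z)" for z using UU_range(1)[OF e, of z] by (simp add: max_def)
  show "(\<lambda>z. F (UU \<epsilon> z)) \<in> borel_measurable borel" unfolding 2 by measurable
qed

text \<open>Mollified values of \<open>U\<close> stay in \<open>{0..M}\<close>, so all composed
  factors are bounded. The critical term is the product of \<open>VV\<close> and \<open>WW\<close>: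
  each factor is only known to converge in L^1, but \<open>convolve_product_bound\<close> bounds the
  product by twice \<open>HH\<close>, which converges in L^1, so generalized dominated convergence
  applies.\<close>

lemma energy_limit:
  assumes \<Phi>: "\<And>v. v \<ge> 0 \<Longrightarrow> (\<Phi> has_real_derivative - p v) (at v)"
    and p: "\<And>v. v \<ge> 0 \<Longrightarrow> (p has_real_derivative - q v) (at v)" "continuous_on {0..} q"
    and pnn: "\<And>v. v \<ge> 0 \<Longrightarrow> p v \<ge> 0" and \<eta>nn: "\<And>z. \<eta> z \<ge> 0"
  shows "(\<integral>z. q (U z) * \<eta> z * (V z \<bullet> W z) - p (U z) * (fst (D\<eta> z) \<bullet> W z) \<partial>lborel)
      \<le> (\<integral>z. \<Phi> (U z) * snd (D\<eta> z) \<partial>lborel)"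
proof -
  obtain \<epsilon> :: "nat \<Rightarrow> real" where \<epsilon>: "\<forall>m. 0 < \<epsilon> m \<and> \<epsilon> m < \<delta>"
    and ae: "AE z in lborel. (\<lambda>m. UU (\<epsilon> m) z) \<longlonglongrightarrow> U z \<and> (\<lambda>m. VV (\<epsilon> m) z) \<longlonglongrightarrow> V z \<and> (\<lambda>m. WW (\<epsilon> m) z) \<longlonglongrightarrow> W z"
    and L1V: "(\<lambda>m. \<integral>z. norm (VV (\<epsilon> m) z - V z) \<partial>lborel) \<longlonglongrightarrow> 0"
    and L1W: "(\<lambda>m. \<integral>z. norm (WW (\<epsilon> m) z - W z) \<partial>lborel) \<longlonglongrightarrow> 0"
    and L1H: "(\<lambda>m. \<integral>z. \<bar>HH (\<epsilon> m) z - h z\<bar> \<partial>lborel) \<longlonglongrightarrow> 0"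
    by (rule good_sequence)
  have e0: "0 < \<epsilon> m" "\<epsilon> m < \<delta>" for m using \<epsilon> by auto
  note [measurable] = moll_meas[OF e0(1)]
  have cp: "continuous_on {0..} p" by (rule DERIV_nonneg_continuous_on[OF p(1)])
  have c\<Phi>: "continuous_on {0..} \<Phi>" by (rule DERIV_nonneg_continuous_on[OF \<Phi>])
  note [measurable] = compose_meas(1)[OF cp] compose_meas(1)[OF c\<Phi>] compose_meas(1)[OF p(2)]
    compose_meas(2)[OF cp e0(1)] compose_meas(2)[OF c\<Phi> e0(1)] compose_meas(2)[OF p(2) e0(1)]
  obtain Bp where Bp: "Bp > 0" "\<forall>v\<in>{0..M}. \<bar>p v\<bar> \<le> Bp" by (rule truncation_bound[OF cp])
  obtain Bq where Bq: "Bq > 0" "\<forall>v\<in>{0..M}. \<bar>q v\<bar> \<le> Bq" by (rule truncation_bound[OF p(2)])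
  obtain Bf where Bf: "Bf > 0" "\<forall>v\<in>{0..M}. \<bar>\<Phi> v\<bar> \<le> Bf" by (rule truncation_bound[OF c\<Phi>])
  obtain r where "r > 0" and r': "\<forall>z. norm z \<ge> r \<longrightarrow> \<eta> z = 0" "\<forall>z. norm z \<ge> r \<longrightarrow> D\<eta> z = 0"
    by (rule C1_compact_radius[OF \<eta>])
  note r = r'[rule_format]
  obtain B where B: "B > 0" "\<forall>z. norm (\<eta> z) \<le> B"
    by (rule continuous_compact_support_bounded[OF C1_compact_continuous[OF \<eta>] r(1)])
  obtain B' where B': "B' > 0" "\<forall>z. norm (D\<eta> z) \<le> B'"
    by (rule continuous_compact_support_bounded[OF C1_compact_grad_continuous[OF \<eta>] r(2)])
  have fB': "norm (fst (D\<eta> z)) \<le> B'" for z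
    using B'(2) norm_fst_le[of "fst (D\<eta> z)" "snd (D\<eta> z)"] by (metis order_trans prod.collapse)
  have U_in: "U z \<in> {0..M}" "UU (\<epsilon> m) z \<in> {0..M}" for z m
    using U0 UM UU_range[OF e0(1)] by auto
  let ?C1 = "Bq * B * 2" and ?C2 = "Bp * B'"
  have C: "?C1 \<ge> 0" "?C2 \<ge> 0" using Bq B Bp B' by auto
  have prod_bound: "\<bar>x * y * (v \<bullet> w) - c * (d \<bullet> w)\<bar> \<le> ?C1 * H + ?C2 * norm w"
    if "\<bar>x\<bar> \<le> Bq" "\<bar>y\<bar> \<le> B" "norm w * norm v \<le> 2 * H" "\<bar>c\<bar> \<le> Bp" "norm d \<le> B'"
    for x y c H :: real and v w d :: "real ^ 'n"
  proof -
    have "\<bar>x * y * (v \<bullet> w)\<bar> \<le> (Bq * B) * (2 * H)"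
      unfolding abs_mult
    proof (intro mult_mono)
      show "\<bar>v \<bullet> w\<bar> \<le> 2 * H" using Cauchy_Schwarz_ineq2[of v w] that(3) by (simp add: mult.commute)
    qed (use that Bq B in auto)
    moreover have "\<bar>c * (d \<bullet> w)\<bar> \<le> Bp * (B' * norm w)"
      unfolding abs_mult
    proof (intro mult_mono)
      show "\<bar>d \<bullet> w\<bar> \<le> B' * norm w"
        using Cauchy_Schwarz_ineq2[of d w] mult_right_mono[OF that(5), of "norm w"] by simp
    qed (use that Bp in auto)
    ultimately show ?thesis by (simp add: abs_if split: if_splits)
  qed
  have 1: "(\<lambda>m. \<integral>z. q (UU (\<epsilon> m) z) * \<eta> z * (VV (\<epsilon> m) z \<bullet> WW (\<epsilon> m) z) - p (UU (\<epsilon> m) z) * (fst (D\<eta> z) \<bullet> WW (\<epsilon> m) z) \<partial>lborel)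
     \<longlonglongrightarrow> (\<integral>z. q (U z) * \<eta> z * (V z \<bullet> W z) - p (U z) * (fst (D\<eta> z) \<bullet> W z) \<partial>lborel)"
  proof (rule integral_generalized_dominated_convergence[where h = "\<lambda>m z. ?C1 * HH (\<epsilon> m) z + ?C2 * norm (WW (\<epsilon> m) z)"
        and H = "\<lambda>z. ?C1 * h z + ?C2 * norm (W z)"])
    show ih': "integrable lborel (\<lambda>z. ?C1 * HH (\<epsilon> m) z + ?C2 * norm (WW (\<epsilon> m) z))" for m
      by (intro Bochner_Integration.integrable_add integrable_mult_right integrable_norm convolve_mollifier_integrable ih iW e0)
    show iH: "integrable lborel (\<lambda>z. ?C1 * h z + ?C2 * norm (W z))"
      by (intro Bochner_Integration.integrable_add integrable_mult_right integrable_norm ih iW)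
    show "AE z in lborel. (\<lambda>m. q (UU (\<epsilon> m) z) * \<eta> z * (VV (\<epsilon> m) z \<bullet> WW (\<epsilon> m) z) - p (UU (\<epsilon> m) z) * (fst (D\<eta> z) \<bullet> WW (\<epsilon> m) z))
      \<longlonglongrightarrow> q (U z) * \<eta> z * (V z \<bullet> W z) - p (U z) * (fst (D\<eta> z) \<bullet> W z)"
      using ae
    proof eventually_elim
      case (elim z)
      then show ?case
        by (intro tendsto_intros UU_limit[OF p(2) \<epsilon>] UU_limit[OF cp \<epsilon>]) auto
    qed
    show "AE z in lborel. \<bar>q (UU (\<epsilon> m) z) * \<eta> z * (VV (\<epsilon> m) z \<bullet> WW (\<epsilon> m) z) - p (UU (\<epsilon> m) z) * (fst (D\<eta> z) \<bullet> WW (\<epsilon> m) z)\<bar>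
       \<le> ?C1 * HH (\<epsilon> m) z + ?C2 * norm (WW (\<epsilon> m) z)" for m
    proof (rule AE_I2, rule prod_bound)
      fix z
      have "norm (WW (\<epsilon> m) z) * norm (VV (\<epsilon> m) z)
          \<le> convolve (mollifier (\<epsilon> m)) (\<lambda>y. norm (W y)) z * convolve (mollifier (\<epsilon> m)) (\<lambda>y. norm (V y)) z"
        by (intro mult_mono convolve_mono_norm order_trans[OF norm_ge_zero convolve_mono_norm]) auto
      also have "\<dots> \<le> 2 * HH (\<epsilon> m) z"
        by (rule convolve_product_bound[OF e0(1)]) (auto intro: iW iV ih Wh)
      finally show "norm (WW (\<epsilon> m) z) * norm (VV (\<epsilon> m) z) \<le> 2 * HH (\<epsilon> m) z" .
    qed (use Bq B Bp fB' U_in in auto)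
    show "AE z in lborel. \<bar>q (U z) * \<eta> z * (V z \<bullet> W z) - p (U z) * (fst (D\<eta> z) \<bullet> W z)\<bar> \<le> ?C1 * h z + ?C2 * norm (W z)"
    proof (rule AE_I2, rule prod_bound)
      fix z show "norm (W z) * norm (V z) \<le> 2 * h z" using Wh[of z z] by simp
    qed (use Bq B Bp fB' U_in in auto)
    show "(\<lambda>m. \<integral>z. \<bar>?C1 * HH (\<epsilon> m) z + ?C2 * norm (WW (\<epsilon> m) z) - (?C1 * h z + ?C2 * norm (W z))\<bar> \<partial>lborel) \<longlonglongrightarrow> 0"
    proof (rule Lim_null_comparison)
      have "(\<lambda>m. ?C1 * (\<integral>z. \<bar>HH (\<epsilon> m) z - h z\<bar> \<partial>lborel) + ?C2 * (\<integral>z. norm (WW (\<epsilon> m) z - W z) \<partial>lborel)) \<longlonglongrightarrow> ?C1 * 0 + ?C2 * 0"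
        by (intro tendsto_intros L1H L1W)
      then show "(\<lambda>m. ?C1 * (\<integral>z. \<bar>HH (\<epsilon> m) z - h z\<bar> \<partial>lborel) + ?C2 * (\<integral>z. norm (WW (\<epsilon> m) z - W z) \<partial>lborel)) \<longlonglongrightarrow> 0"
        by (simp only: mult_zero_right add_0_right)
      have "norm (\<integral>z. \<bar>?C1 * HH (\<epsilon> m) z + ?C2 * norm (WW (\<epsilon> m) z) - (?C1 * h z + ?C2 * norm (W z))\<bar> \<partial>lborel)
         \<le> ?C1 * (\<integral>z. \<bar>HH (\<epsilon> m) z - h z\<bar> \<partial>lborel) + ?C2 * (\<integral>z. norm (WW (\<epsilon> m) z - W z) \<partial>lborel)" (is "norm ?L \<le> ?R") for m
      proof -
        have iHd: "integrable lborel (\<lambda>z. \<bar>HH (\<epsilon> m) z - h z\<bar>)"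
          by (intro integrable_abs Bochner_Integration.integrable_diff convolve_mollifier_integrable ih e0)
        have iWd: "integrable lborel (\<lambda>z. norm (WW (\<epsilon> m) z - W z))"
          by (intro integrable_norm Bochner_Integration.integrable_diff convolve_mollifier_integrable iW e0)
        have "?L \<le> (\<integral>z. ?C1 * \<bar>HH (\<epsilon> m) z - h z\<bar> + ?C2 * norm (WW (\<epsilon> m) z - W z) \<partial>lborel)"
        proof (rule integral_mono)
          show "integrable lborel (\<lambda>z. \<bar>?C1 * HH (\<epsilon> m) z + ?C2 * norm (WW (\<epsilon> m) z) - (?C1 * h z + ?C2 * norm (W z))\<bar>)"
            by (intro integrable_abs Bochner_Integration.integrable_diff ih' iH)
          show "integrable lborel (\<lambda>z. ?C1 * \<bar>HH (\<epsilon> m) z - h z\<bar> + ?C2 * norm (WW (\<epsilon> m) z - W z))"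
            by (intro Bochner_Integration.integrable_add integrable_mult_right iHd iWd)
          fix z
          have "?C1 * HH (\<epsilon> m) z + ?C2 * norm (WW (\<epsilon> m) z) - (?C1 * h z + ?C2 * norm (W z))
             = ?C1 * (HH (\<epsilon> m) z - h z) + ?C2 * (norm (WW (\<epsilon> m) z) - norm (W z))"
            by (simp only: right_diff_distrib)
          also have "\<bar>\<dots>\<bar> \<le> \<bar>?C1 * (HH (\<epsilon> m) z - h z)\<bar> + \<bar>?C2 * (norm (WW (\<epsilon> m) z) - norm (W z))\<bar>"
            by (rule abs_triangle_ineq)
          also have "\<dots> = ?C1 * \<bar>HH (\<epsilon> m) z - h z\<bar> + ?C2 * \<bar>norm (WW (\<epsilon> m) z) - norm (W z)\<bar>"
            using C by (simp only: abs_mult[of ?C1] abs_mult[of ?C2] abs_of_nonneg)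
          also have "\<dots> \<le> ?C1 * \<bar>HH (\<epsilon> m) z - h z\<bar> + ?C2 * norm (WW (\<epsilon> m) z - W z)"
            by (intro add_left_mono mult_left_mono norm_triangle_ineq3 C)
          finally show "\<bar>?C1 * HH (\<epsilon> m) z + ?C2 * norm (WW (\<epsilon> m) z) - (?C1 * h z + ?C2 * norm (W z))\<bar>
            \<le> ?C1 * \<bar>HH (\<epsilon> m) z - h z\<bar> + ?C2 * norm (WW (\<epsilon> m) z - W z)" .
        qed
        also have "\<dots> = (\<integral>z. ?C1 * \<bar>HH (\<epsilon> m) z - h z\<bar> \<partial>lborel) + (\<integral>z. ?C2 * norm (WW (\<epsilon> m) z - W z) \<partial>lborel)"
          by (rule Bochner_Integration.integral_add) (intro integrable_mult_right iHd iWd)+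
        also have "\<dots> = ?R" by (simp only: integral_mult_right_zero)
        finally show ?thesis by simp
      qed
      then show "\<forall>\<^sub>F m in sequentially. norm (\<integral>z. \<bar>?C1 * HH (\<epsilon> m) z + ?C2 * norm (WW (\<epsilon> m) z) - (?C1 * h z + ?C2 * norm (W z))\<bar> \<partial>lborel)
         \<le> ?C1 * (\<integral>z. \<bar>HH (\<epsilon> m) z - h z\<bar> \<partial>lborel) + ?C2 * (\<integral>z. norm (WW (\<epsilon> m) z - W z) \<partial>lborel)"
        by (intro always_eventually allI)
    qed
  qed measurable
  have iD: "integrable lborel (\<lambda>z. Bf * norm (D\<eta> z))"
    by (intro integrable_mult_right integrable_norm C1_compact_integrable(2)[OF \<eta>])
  have 2: "(\<lambda>m. \<integral>z. \<Phi> (UU (\<epsilon> m) z) * snd (D\<eta> z) \<partial>lborel) \<longlonglongrightarrow> (\<integral>z. \<Phi> (U z) * snd (D\<eta> z) \<partial>lborel)"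
  proof (rule integral_dominated_convergence[OF _ _ iD])
    show "AE z in lborel. (\<lambda>m. \<Phi> (UU (\<epsilon> m) z) * snd (D\<eta> z)) \<longlonglongrightarrow> \<Phi> (U z) * snd (D\<eta> z)"
      using ae by eventually_elim (intro tendsto_intros UU_limit[OF c\<Phi> \<epsilon>], auto)
    have "norm (\<Phi> (UU (\<epsilon> m) z) * snd (D\<eta> z)) \<le> Bf * norm (D\<eta> z)" for m z
      using Bf(2)[rule_format, OF U_in(2)[of m z]] norm_snd_le[of "snd (D\<eta> z)" "fst (D\<eta> z)"] Bf(1)
      by (auto simp: abs_mult intro!: mult_mono)
    then show "AE z in lborel. norm (\<Phi> (UU (\<epsilon> m) z) * snd (D\<eta> z)) \<le> Bf * norm (D\<eta> z)" for m by simp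
  qed measurable
  show ?thesis
    by (rule LIMSEQ_le[OF 1 2]) (use mollified_energy[OF e0 \<Phi> p pnn \<eta>nn] in auto)
qed

lemma translation_limit:
  assumes F: "\<And>v. v \<ge> 0 \<Longrightarrow> (F has_real_derivative F' v) (at v)" "continuous_on {0..} F'"
  shows "(\<integral>z. \<bar>\<eta> (z + (y, 0)) * F (U (z + (y, 0))) - \<eta> z * F (U z)\<bar> \<partial>lborel)
     \<le> (\<integral>z. \<bar>\<eta> z * F' (U z) * (y \<bullet> V z) + F (U z) * (y \<bullet> fst (D\<eta> z))\<bar> \<partial>lborel)"
proof -
  obtain \<epsilon> :: "nat \<Rightarrow> real" where \<epsilon>: "\<forall>m. 0 < \<epsilon> m \<and> \<epsilon> m < \<delta>"
    and ae: "AE z in lborel. (\<lambda>m. UU (\<epsilon> m) z) \<longlonglongrightarrow> U z \<and> (\<lambda>m. VV (\<epsilon> m) z) \<longlonglongrightarrow> V z \<and> (\<lambda>m. WW (\<epsilon> m) z) \<longlonglongrightarrow> W z"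
    and L1V: "(\<lambda>m. \<integral>z. norm (VV (\<epsilon> m) z - V z) \<partial>lborel) \<longlonglongrightarrow> 0"
    and L1W: "(\<lambda>m. \<integral>z. norm (WW (\<epsilon> m) z - W z) \<partial>lborel) \<longlonglongrightarrow> 0"
    and L1H: "(\<lambda>m. \<integral>z. \<bar>HH (\<epsilon> m) z - h z\<bar> \<partial>lborel) \<longlonglongrightarrow> 0"
    by (rule good_sequence)
  have e0: "0 < \<epsilon> m" "\<epsilon> m < \<delta>" for m using \<epsilon> by auto
  note [measurable] = moll_meas[OF e0(1)]
  have cF: "continuous_on {0..} F" by (rule DERIV_nonneg_continuous_on[OF F(1)])
  note [measurable] = compose_meas(1)[OF cF] compose_meas(1)[OF F(2)]
    compose_meas(2)[OF cF e0(1)] compose_meas(2)[OF F(2) e0(1)]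
  obtain Bf where Bf: "Bf > 0" "\<forall>v\<in>{0..M}. \<bar>F v\<bar> \<le> Bf" by (rule truncation_bound[OF cF])
  obtain Bq where Bq: "Bq > 0" "\<forall>v\<in>{0..M}. \<bar>F' v\<bar> \<le> Bq" by (rule truncation_bound[OF F(2)])
  obtain r where "r > 0" and r': "\<forall>z. norm z \<ge> r \<longrightarrow> \<eta> z = 0" "\<forall>z. norm z \<ge> r \<longrightarrow> D\<eta> z = 0"
    by (rule C1_compact_radius[OF \<eta>])
  note r = r'[rule_format]
  obtain B where B: "B > 0" "\<forall>z. norm (\<eta> z) \<le> B"
    by (rule continuous_compact_support_bounded[OF C1_compact_continuous[OF \<eta>] r(1)])
  have U_in: "U z \<in> {0..M}" "UU (\<epsilon> m) z \<in> {0..M}" for z m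
    using U0 UM UU_range[OF e0(1)] by auto
  \<comment> \<open>Translates of null sets are null, so the convergence also holds almost
    everywhere at the shifted argument.\<close>
  have shift: "AE z in lborel. (\<lambda>m. UU (\<epsilon> m) (z + (y, 0))) \<longlonglongrightarrow> U (z + (y, 0))"
  proof -
    have "AE z in distr lborel borel ((+) (y, 0)). (\<lambda>m. UU (\<epsilon> m) z) \<longlonglongrightarrow> U z"
      using ae unfolding lborel_distr_plus by eventually_elim simp
    from AE_distrD[OF _ this] show ?thesis by (simp add: add.commute)
  qed
  let ?C1 = "B * Bq * norm y" and ?C2 = "Bf * norm y"
  have C: "?C1 \<ge> 0" using B Bq by auto
  have prod_bound: "\<bar>\<bar>e * x * (y \<bullet> v) + c * (y \<bullet> d)\<bar>\<bar> \<le> ?C1 * norm v + ?C2 * norm d"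
    if "\<bar>x\<bar> \<le> Bq" "\<bar>e\<bar> \<le> B" "\<bar>c\<bar> \<le> Bf" for x e c :: real and v d :: "real ^ 'n"
  proof -
    have "\<bar>e * x * (y \<bullet> v)\<bar> \<le> (B * Bq) * (norm y * norm v)"
      unfolding abs_mult by (intro mult_mono Cauchy_Schwarz_ineq2) (use that B Bq in auto)
    moreover have "\<bar>c * (y \<bullet> d)\<bar> \<le> Bf * (norm y * norm d)"
      unfolding abs_mult by (intro mult_mono Cauchy_Schwarz_ineq2) (use that Bf in auto)
    ultimately show ?thesis by (simp add: abs_if mult_ac split: if_splits)
  qed
  have iD: "integrable lborel (\<lambda>z. fst (D\<eta> z))"
    by (rule integrable_bounded_linear[OF bounded_linear_fst C1_compact_integrable(2)[OF \<eta>]])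
  have 1: "(\<lambda>m. \<integral>z. \<bar>\<eta> z * F' (UU (\<epsilon> m) z) * (y \<bullet> VV (\<epsilon> m) z) + F (UU (\<epsilon> m) z) * (y \<bullet> fst (D\<eta> z))\<bar> \<partial>lborel)
     \<longlonglongrightarrow> (\<integral>z. \<bar>\<eta> z * F' (U z) * (y \<bullet> V z) + F (U z) * (y \<bullet> fst (D\<eta> z))\<bar> \<partial>lborel)"
  proof (rule integral_generalized_dominated_convergence[where h = "\<lambda>m z. ?C1 * norm (VV (\<epsilon> m) z) + ?C2 * norm (fst (D\<eta> z))"
        and H = "\<lambda>z. ?C1 * norm (V z) + ?C2 * norm (fst (D\<eta> z))"])
    show "integrable lborel (\<lambda>z. ?C1 * norm (VV (\<epsilon> m) z) + ?C2 * norm (fst (D\<eta> z)))" for m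
      by (intro Bochner_Integration.integrable_add integrable_mult_right integrable_norm convolve_mollifier_integrable iV e0 iD)
    show "integrable lborel (\<lambda>z. ?C1 * norm (V z) + ?C2 * norm (fst (D\<eta> z)))"
      by (intro Bochner_Integration.integrable_add integrable_mult_right integrable_norm iV iD)
    show "AE z in lborel. (\<lambda>m. \<bar>\<eta> z * F' (UU (\<epsilon> m) z) * (y \<bullet> VV (\<epsilon> m) z) + F (UU (\<epsilon> m) z) * (y \<bullet> fst (D\<eta> z))\<bar>)
      \<longlonglongrightarrow> \<bar>\<eta> z * F' (U z) * (y \<bullet> V z) + F (U z) * (y \<bullet> fst (D\<eta> z))\<bar>"
      using ae
    proof eventually_elim
      case (elim z)
      then show ?case
        by (intro tendsto_intros UU_limit[OF F(2) \<epsilon>] UU_limit[OF cF \<epsilon>]) auto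
    qed
    show "AE z in lborel. \<bar>\<bar>\<eta> z * F' (UU (\<epsilon> m) z) * (y \<bullet> VV (\<epsilon> m) z) + F (UU (\<epsilon> m) z) * (y \<bullet> fst (D\<eta> z))\<bar>\<bar>
       \<le> ?C1 * norm (VV (\<epsilon> m) z) + ?C2 * norm (fst (D\<eta> z))" for m
      by (rule AE_I2, rule prod_bound) (use Bq B Bf U_in in auto)
    show "AE z in lborel. \<bar>\<bar>\<eta> z * F' (U z) * (y \<bullet> V z) + F (U z) * (y \<bullet> fst (D\<eta> z))\<bar>\<bar>
       \<le> ?C1 * norm (V z) + ?C2 * norm (fst (D\<eta> z))"
      by (rule AE_I2, rule prod_bound) (use Bq B Bf U_in in auto)
    show "(\<lambda>m. \<integral>z. \<bar>?C1 * norm (VV (\<epsilon> m) z) + ?C2 * norm (fst (D\<eta> z)) - (?C1 * norm (V z) + ?C2 * norm (fst (D\<eta> z)))\<bar> \<partial>lborel) \<longlonglongrightarrow> 0"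
    proof (rule Lim_null_comparison)
      have "(\<lambda>m. ?C1 * (\<integral>z. norm (VV (\<epsilon> m) z - V z) \<partial>lborel)) \<longlonglongrightarrow> ?C1 * 0"
        by (intro tendsto_intros L1V)
      then show "(\<lambda>m. ?C1 * (\<integral>z. norm (VV (\<epsilon> m) z - V z) \<partial>lborel)) \<longlonglongrightarrow> 0"
        by (simp only: mult_zero_right)
      have "norm (\<integral>z. \<bar>?C1 * norm (VV (\<epsilon> m) z) + ?C2 * norm (fst (D\<eta> z)) - (?C1 * norm (V z) + ?C2 * norm (fst (D\<eta> z)))\<bar> \<partial>lborel)
         \<le> ?C1 * (\<integral>z. norm (VV (\<epsilon> m) z - V z) \<partial>lborel)" (is "norm ?L \<le> ?R") for m
      proof -
        have iVm: "integrable lborel (VV (\<epsilon> m))" by (intro convolve_mollifier_integrable iV e0)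
        have e: "\<bar>?C1 * norm (VV (\<epsilon> m) z) + ?C2 * norm (fst (D\<eta> z)) - (?C1 * norm (V z) + ?C2 * norm (fst (D\<eta> z)))\<bar>
           = ?C1 * \<bar>norm (VV (\<epsilon> m) z) - norm (V z)\<bar>" for z
          using C by (simp only: add_diff_cancel_right right_diff_distrib[symmetric] abs_mult[of ?C1] abs_of_nonneg)
        have "?L = ?C1 * (\<integral>z. \<bar>norm (VV (\<epsilon> m) z) - norm (V z)\<bar> \<partial>lborel)" unfolding e by simp
        also have "\<dots> \<le> ?R"
          by (intro mult_left_mono[OF integral_mono C] integrable_abs integrable_norm Bochner_Integration.integrable_diff iVm iV norm_triangle_ineq3)
        finally show ?thesis by simp
      qed
      then show "\<forall>\<^sub>F m in sequentially. norm (\<integral>z. \<bar>?C1 * norm (VV (\<epsilon> m) z) + ?C2 * norm (fst (D\<eta> z)) - (?C1 * norm (V z) + ?C2 * norm (fst (D\<eta> z)))\<bar> \<partial>lborel)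
         \<le> ?C1 * (\<integral>z. norm (VV (\<epsilon> m) z - V z) \<partial>lborel)"
        by (intro always_eventually allI)
    qed
  qed measurable
  let ?b = "\<lambda>z. Bf * (\<bar>\<eta> (z + (y, 0))\<bar> + \<bar>\<eta> z\<bar>)"
  have ib: "integrable lborel ?b"
    by (intro integrable_mult_right Bochner_Integration.integrable_add integrable_abs
        integrable_lborel_translate C1_compact_integrable(1)[OF \<eta>])
  have 2: "(\<lambda>m. \<integral>z. \<bar>\<eta> (z + (y, 0)) * F (UU (\<epsilon> m) (z + (y, 0))) - \<eta> z * F (UU (\<epsilon> m) z)\<bar> \<partial>lborel)
     \<longlonglongrightarrow> (\<integral>z. \<bar>\<eta> (z + (y, 0)) * F (U (z + (y, 0))) - \<eta> z * F (U z)\<bar> \<partial>lborel)"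
  proof (rule integral_dominated_convergence[OF _ _ ib])
    show "AE z in lborel. (\<lambda>m. \<bar>\<eta> (z + (y, 0)) * F (UU (\<epsilon> m) (z + (y, 0))) - \<eta> z * F (UU (\<epsilon> m) z)\<bar>)
      \<longlonglongrightarrow> \<bar>\<eta> (z + (y, 0)) * F (U (z + (y, 0))) - \<eta> z * F (U z)\<bar>"
      using ae shift by eventually_elim (intro tendsto_intros UU_limit[OF cF \<epsilon>], auto)
    have "norm \<bar>\<eta> (z + (y, 0)) * F (UU (\<epsilon> m) (z + (y, 0))) - \<eta> z * F (UU (\<epsilon> m) z)\<bar> \<le> ?b z" for m z
    proof -
      have "\<bar>\<eta> w * F (UU (\<epsilon> m) w)\<bar> \<le> Bf * \<bar>\<eta> w\<bar>" for w
        using mult_left_mono[OF Bf(2)[rule_format, OF U_in(2)[of m w]], of "\<bar>\<eta> w\<bar>"] by (simp add: abs_mult mult.commute)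
      from this[of z] this[of "z + (y, 0)"] show ?thesis by (simp add: distrib_left)
    qed
    then show "AE z in lborel. norm \<bar>\<eta> (z + (y, 0)) * F (UU (\<epsilon> m) (z + (y, 0))) - \<eta> z * F (UU (\<epsilon> m) z)\<bar> \<le> ?b z" for m by simp
  qed measurable
  show ?thesis
    by (rule LIMSEQ_le[OF 2 1]) (use mollified_translation[OF e0 F] in auto)
qed

end

section \<open>Local energy inequalities for weak supersolutions\<close>

lemma growth_functionD:
  assumes "growth_function g0 g1 g"
  shows "continuous_on {0..} g" "mono_on {0..} g" "\<sigma> \<ge> 0 \<Longrightarrow> 0 \<le> g \<sigma>"
    "\<sigma> > 0 \<Longrightarrow> g0 * primitive g \<sigma> \<le> \<sigma> * g \<sigma>" "\<sigma> > 0 \<Longrightarrow> \<sigma> * g \<sigma> \<le> g1 * primitive g \<sigma>"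
  using assms unfolding growth_function_def by auto

lemma primitive_0 [simp]: "primitive g 0 = 0"
  by (simp add: primitive_def)

lemma growth_integrable:
  assumes "growth_function g0 g1 g"
  shows "g integrable_on {0..b}"
  by (rule integrable_continuous_real) (rule continuous_on_subset[OF growth_functionD(1)[OF assms]], auto)

lemma primitive_nonneg:
  assumes "growth_function g0 g1 g"
  shows "0 \<le> primitive g \<sigma>"
  unfolding primitive_def
  by (rule integral_nonneg[OF growth_integrable[OF assms]]) (use growth_functionD(3)[OF assms] in auto)

lemma primitive_mono:
  assumes "growth_function g0 g1 g" "\<sigma> \<le> \<tau>"
  shows "primitive g \<sigma> \<le> primitive g \<tau>"
  unfolding primitive_def
  by (rule integral_subset_le) (use assms growth_integrable[OF assms(1)] growth_functionD(3)[OF assms(1)] in auto)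

lemma primitive_DERIV:
  assumes "growth_function g0 g1 g" "\<sigma> > 0"
  shows "(primitive g has_real_derivative g \<sigma>) (at \<sigma>)"
proof -
  have "((\<lambda>x. integral {0..x} g) has_real_derivative g \<sigma>) (at \<sigma> within {0..\<sigma> + 1})"
    by (rule integral_has_real_derivative)
      (use assms continuous_on_subset[OF growth_functionD(1)[OF assms(1)]] in auto)
  then show ?thesis
    unfolding primitive_def[abs_def] using assms(2) by (subst (asm) at_within_interior) (auto simp: interior_cbox)
qed

lemma primitive_continuous:
  assumes "growth_function g0 g1 g"
  shows "continuous_on {0..} (primitive g)"
proof -
  have "continuous_on {0..b} (primitive g)" for b
    unfolding primitive_def[abs_def] by (rule indefinite_integral_continuous_1[OF growth_integrable[OF assms]])
  have "continuous (at x within {0..}) (primitive g)" if "x \<ge> 0" for x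
  proof -
    have "continuous (at x within {0..x + 1}) (primitive g)"
      using \<open>\<And>b. continuous_on {0..b} (primitive g)\<close> that by (simp add: continuous_on_eq_continuous_within)
    moreover have "at x within {0..x + 1} = at x within {0..}"
      by (rule at_within_nhd[of x "{..<x + 1}"]) (use that in auto)
    ultimately show ?thesis by simp
  qed
  then show ?thesis by (simp add: continuous_on_eq_continuous_within)
qed

lemma continuous_nonneg_compose_measurable:
  fixes F :: "real \<Rightarrow> real"
  assumes F: "continuous_on {0..} F" and [measurable]: "f \<in> borel_measurable M" and nn: "\<And>z. 0 \<le> f z"
  shows "(\<lambda>z. F (f z)) \<in> borel_measurable M"
proof -
  have "continuous_on UNIV (\<lambda>v. F (max 0 v))"
    by (rule continuous_on_compose2[OF F]) (auto intro!: continuous_intros)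
  then have [measurable]: "(\<lambda>v. F (max 0 v)) \<in> borel_measurable borel" by (rule borel_measurable_continuous_onI)
  have 1: "F (f z) = (\<lambda>v. F (max 0 v)) (f z)" for z using nn[of z] by (simp add: max_def)
  show "(\<lambda>z. F (f z)) \<in> borel_measurable M" unfolding 1 by measurable
qed

text \<open>The weak gradient and the flux are only Lebesgue measurable, while convolutions and
  product measures are handled on \<open>lborel\<close>.\<close>

lemma lebesgue_vector_borel_representative:
  fixes f :: "'a::euclidean_space \<Rightarrow> real ^ 'n::finite"
  assumes "f \<in> borel_measurable lebesgue"
  obtains f' where "f' \<in> borel_measurable borel" "AE z in lborel. f z = f' z"
proof -
  have ex: "\<exists>g\<in>borel_measurable lborel. AE z in lborel. f z $ i = g z" for i
  proof (rule completion_ex_borel_measurable_real)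
    have "(\<lambda>z. f z \<bullet> axis i 1) \<in> borel_measurable lebesgue" using assms by measurable
    then show "(\<lambda>z. f z $ i) \<in> borel_measurable lebesgue" by (simp add: inner_axis)
  qed
  then have "\<forall>i. \<exists>g. g \<in> borel_measurable lborel \<and> (AE z in lborel. f z $ i = g z)" by blast
  from choice[OF this] obtain g where "\<forall>i. g i \<in> borel_measurable lborel \<and> (AE z in lborel. f z $ i = g i z)" ..
  then have g: "g i \<in> borel_measurable lborel" "AE z in lborel. f z $ i = g i z" for i by auto
  show thesis
  proof (rule that[of "\<lambda>z. \<chi> i. g i z"])
    show "(\<lambda>z. \<chi> i. g i z) \<in> borel_measurable borel"
    proof (subst borel_measurable_euclidean_space, rule ballI)
      fix b :: "real ^ 'n" assume "b \<in> Basis"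
      then obtain i where "b = axis i 1" by (auto simp: Basis_vec_def)
      then show "(\<lambda>z. (\<chi> i. g i z) \<bullet> b) \<in> borel_measurable borel" using g(1)[of i] by (simp add: inner_axis)
    qed
    have "AE z in lborel. \<forall>i\<in>UNIV. f z $ i = g i z" by (rule AE_finite_allI) (use g(2) in auto)
    then show "AE z in lborel. f z = (\<chi> i. g i z)" by eventually_elim (simp add: vec_eq_iff)
  qed
qed

text \<open>
  Everything that the iteration uses about a supersolution \<open>u\<close> on a compact set \<open>K\<close>: the energy inequality
  obtained by testing with \<open>p u \<eta>\<close>, where \<open>p\<close> is nonincreasing with \<open>p = - \<Phi>'\<close> and \<open>q = - p'\<close>, and the
  \<open>L\<^sup>1\<close> estimate of spatial difference quotients of truncations.
\<close>

definition local_gradient ::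
  "real \<Rightarrow> real \<Rightarrow> (real \<Rightarrow> real) \<Rightarrow> ('n::finite space_time \<Rightarrow> real) \<Rightarrow> 'n space_time set \<Rightarrow> ('n space_time \<Rightarrow> real ^ 'n) \<Rightarrow> bool" where
  "local_gradient C0 C1 g u K V \<longleftrightarrow>
     V \<in> borel_measurable borel \<and> integrable lborel V \<and> integrable lborel (\<lambda>z. primitive g (norm (V z))) \<and>
     (\<forall>\<Phi> p q \<eta> D\<eta>.
        (\<forall>v\<ge>0. (\<Phi> has_real_derivative - p v) (at v)) \<and> (\<forall>v\<ge>0. (p has_real_derivative - q v) (at v)) \<and>
        continuous_on {0..} q \<and> (\<forall>v\<ge>0. 0 \<le> p v) \<and> (\<forall>v\<ge>0. 0 \<le> q v) \<and>
        C1_compact \<eta> D\<eta> \<and> (\<forall>z. 0 \<le> \<eta> z) \<and> closure {z. \<eta> z \<noteq> 0} \<subseteq> interior K \<longrightarrow>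
        C0 * (\<integral>z. q (u z) * primitive g (norm (V z)) * \<eta> z \<partial>lborel)
          \<le> (\<integral>z. \<Phi> (u z) * snd (D\<eta> z) \<partial>lborel) + C1 * (\<integral>z. p (u z) * g (norm (V z)) * norm (fst (D\<eta> z)) \<partial>lborel)) \<and>
     (\<forall>F F' \<eta> D\<eta> y.
        (\<forall>v\<ge>0. (F has_real_derivative F' v) (at v)) \<and> continuous_on {0..} F' \<and>
        C1_compact \<eta> D\<eta> \<and> closure {z. \<eta> z \<noteq> 0} \<subseteq> interior K \<longrightarrow>
        (\<integral>z. \<bar>\<eta> (z + (y, 0)) * F (u (z + (y, 0))) - \<eta> z * F (u z)\<bar> \<partial>lborel)
          \<le> (\<integral>z. \<bar>\<eta> z * F' (u z) * (y \<bullet> V z) + F (u z) * (y \<bullet> fst (D\<eta> z))\<bar> \<partial>lborel))"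

lemma C1_compact_closure:
  assumes "C1_compact \<eta> D\<eta>"
  shows "compact (closure {z. \<eta> z \<noteq> 0})" "z \<notin> closure {z. \<eta> z \<noteq> 0} \<Longrightarrow> \<eta> z = 0"
    "z \<notin> closure {z. \<eta> z \<noteq> 0} \<Longrightarrow> D\<eta> z = 0"
proof -
  show "compact (closure {z. \<eta> z \<noteq> 0})" using assms by (simp add: C1_compact_def)
  have out: "\<eta> y = 0" if "y \<notin> closure {z. \<eta> z \<noteq> 0}" for y
    using that closure_subset[of "{z. \<eta> z \<noteq> 0}"] by blast
  then show "\<eta> z = 0" if "z \<notin> closure {z. \<eta> z \<noteq> 0}" using that .
  show "D\<eta> z = 0" if "z \<notin> closure {z. \<eta> z \<noteq> 0}"
  proof (rule GDERIV_zero_open[OF C1_compact_GDERIV[OF assms]])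
    show "open (- closure {z. \<eta> z \<noteq> 0})" by (rule open_Compl[OF closed_closure])
    show "z \<in> - closure {z. \<eta> z \<noteq> 0}" using that by blast
    show "\<eta> y = 0" if "y \<in> - closure {z. \<eta> z \<noteq> 0}" for y by (rule out) (use that in blast)
  qed
qed

lemma mollifier_test_function:
  fixes z :: "'n::finite space_time"
  assumes \<epsilon>: "0 < \<epsilon>" and sub: "cball z \<epsilon> \<subseteq> \<Omega>"
  shows "C1_test_function \<Omega> (\<lambda>y. mollifier \<epsilon> (z - y)) (\<lambda>y. - mollifier_grad \<epsilon> (z - y))"
  unfolding C1_test_function_def
proof (intro conjI allI)
  note J = mollifier_C1_compact[OF \<epsilon>, where 'a = "'n space_time"]
  fix y
  have 1: "((\<lambda>y. z - y) has_derivative (\<lambda>h. - h)) (at y)"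
    by (auto intro!: derivative_eq_intros)
  have 2: "(mollifier \<epsilon> has_derivative (\<lambda>h. h \<bullet> mollifier_grad \<epsilon> (z - y))) (at (z - y))"
    using C1_compact_GDERIV[OF J, of "z - y"] unfolding gderiv_def .
  show "GDERIV (\<lambda>y. mollifier \<epsilon> (z - y)) y :> - mollifier_grad \<epsilon> (z - y)"
    using has_derivative_compose[OF 1 2] unfolding gderiv_def by simp
  show "continuous_on UNIV (\<lambda>y. - mollifier_grad \<epsilon> (z - y))"
    by (intro continuous_on_minus continuous_on_compose2[OF C1_compact_grad_continuous[OF J, of UNIV]] continuous_intros) auto
  have "{y. mollifier \<epsilon> (z - y) \<noteq> 0} \<subseteq> cball z \<epsilon>"
    using mollifier_zero[of \<epsilon>] \<epsilon> by (force simp: dist_norm)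
  then have cl: "closure {y. mollifier \<epsilon> (z - y) \<noteq> 0} \<subseteq> cball z \<epsilon>"
    by (rule closure_minimal) simp
  then show "closure {y. mollifier \<epsilon> (z - y) \<noteq> 0} \<subseteq> \<Omega>" using sub by blast
  show "compact (closure {y. mollifier \<epsilon> (z - y) \<noteq> 0})"
    unfolding compact_closure by (rule bounded_subset[OF bounded_cball order_trans[OF closure_subset cl]])
qed

lemma mollifier_shift_zero:
  assumes "0 < \<epsilon>" "y \<notin> cball z \<epsilon>"
  shows "mollifier \<epsilon> (z - y) = 0" "mollifier_grad \<epsilon> (z - y) = 0"
proof -
  have "norm (z - y) \<ge> \<epsilon>" using assms(2) by (simp add: dist_norm)
  then show "mollifier \<epsilon> (z - y) = 0" by (rule mollifier_zero[OF _ assms(1)])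
  have "\<epsilon>\<^sup>2 \<le> (z - y) \<bullet> (z - y)"
    using \<open>norm (z - y) \<ge> \<epsilon>\<close> assms(1) by (simp add: dot_square_norm power_mono)
  then show "mollifier_grad \<epsilon> (z - y) = 0" unfolding mollifier_grad_def by simp
qed

text \<open>If \<open>b \<le> a\<close> the first summand suffices, otherwise monotonicity of
  \<open>g\<close> makes the second one suffice. This takes the place of Young's inequality with the
  conjugate function of \<open>G\<close>.\<close>

lemma growth_product_bound:
  assumes gf: "growth_function g0 g1 g" and "0 \<le> a" "0 \<le> b"
  shows "g a * b \<le> g a * a + g b * b"
proof (cases "b \<le> a")
  case True
  then have "g a * b \<le> g a * a" using growth_functionD(3)[OF gf assms(2)] by (intro mult_left_mono)
  moreover have "0 \<le> g b * b" using growth_functionD(3)[OF gf assms(3)] assms(3) by simp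
  ultimately show ?thesis by simp
next
  case False
  then have "g a \<le> g b" using mono_onD[OF growth_functionD(2)[OF gf]] assms by simp
  then have "g a * b \<le> g b * b" using assms by (intro mult_right_mono)
  moreover have "0 \<le> g a * a" using growth_functionD(3)[OF gf assms(2)] assms(2) by simp
  ultimately show ?thesis by simp
qed

lemma growth_mult_le_primitive:
  assumes gf: "growth_function g0 g1 g" and "0 \<le> a"
  shows "g a * a \<le> g1 * primitive g a"
  using growth_functionD(5)[OF gf, of a] assms(2) by (cases "a = 0") (auto simp: mult.commute)

lemma structure_representatives:
  fixes A :: "'n::finite vector_field"
  assumes gf: "growth_function g0 g1 g" and sc: "structure_conditions C0 C1 g A"
    and C: "0 < C0" "0 < C1"
    and K: "compact K" "K \<subseteq> \<Omega>" "open \<Omega>"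
    and iDu: "set_integrable lebesgue K Du"
    and iG: "set_integrable lebesgue \<Omega> (\<lambda>z. primitive g (norm (Du z)))"
    and mA: "(\<lambda>z. A (fst z) (snd z) (u z) (Du z)) \<in> borel_measurable (lebesgue_on \<Omega>)"
  obtains V W where "V \<in> borel_measurable borel" "W \<in> borel_measurable borel"
    "AE z in lborel. V z = indicator K z *\<^sub>R Du z"
    "AE z in lborel. W z = indicator K z *\<^sub>R A (fst z) (snd z) (u z) (Du z)"
    "\<forall>z. C0 * primitive g (norm (V z)) \<le> V z \<bullet> W z"
    "\<forall>z. norm (W z) \<le> C1 * g (norm (V z))"
    "\<forall>z. z \<notin> K \<longrightarrow> V z = 0 \<and> W z = 0"
    "integrable lborel V" "integrable lborel W"
    "integrable lborel (\<lambda>z. primitive g (norm (V z)))"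
proof -
  have mK: "K \<in> sets borel" using K(1) by (simp add: borel_closed compact_imp_closed)
  have m\<Omega>: "\<Omega> \<in> sets lebesgue" using K(3) by simp
  let ?DK = "\<lambda>z. indicator K z *\<^sub>R Du z" and ?A = "\<lambda>z. A (fst z) (snd z) (u z) (Du z)"
  have iDK: "integrable lebesgue ?DK" using iDu unfolding set_integrable_def .
  then have mDK: "?DK \<in> borel_measurable lebesgue" by (rule borel_measurable_integrable)
  have mA\<Omega>: "(\<lambda>z. indicator \<Omega> z *\<^sub>R ?A z) \<in> borel_measurable lebesgue"
    using mA m\<Omega> by (subst (asm) borel_measurable_restrict_space_iff) auto
  have mAK: "(\<lambda>z. indicator K z *\<^sub>R ?A z) \<in> borel_measurable lebesgue"
  proof -
    have "(\<lambda>z. indicator K z *\<^sub>R (indicator \<Omega> z *\<^sub>R ?A z)) \<in> borel_measurable lebesgue"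
      by (rule borel_measurable_scaleR[OF _ mA\<Omega>]) (rule borel_measurable_indicator, use mK in simp)
    moreover have "(\<lambda>z. indicator K z *\<^sub>R (indicator \<Omega> z *\<^sub>R ?A z)) = (\<lambda>z. indicator K z *\<^sub>R ?A z)"
      using K(2) by (auto simp: indicator_def fun_eq_iff)
    ultimately show ?thesis by (simp only:)
  qed
  obtain V0 where V0 [measurable]: "V0 \<in> borel_measurable borel" and aeV: "AE z in lborel. ?DK z = V0 z"
    by (rule lebesgue_vector_borel_representative[OF mDK])
  obtain W0 where W0 [measurable]: "W0 \<in> borel_measurable borel" and aeW: "AE z in lborel. indicator K z *\<^sub>R ?A z = W0 z"
    by (rule lebesgue_vector_borel_representative[OF mAK])
  have [measurable]: "(\<lambda>z. primitive g (norm (V0 z))) \<in> borel_measurable borel" "(\<lambda>z. g (norm (V0 z))) \<in> borel_measurable borel"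
    by (rule continuous_nonneg_compose_measurable[OF primitive_continuous[OF gf]], measurable)
      (rule continuous_nonneg_compose_measurable[OF growth_functionD(1)[OF gf]], measurable)
  \<comment> \<open>The structure conditions hold for the representatives only almost everywhere. On
    the exceptional set both are reset to 0, where the conditions hold trivially, so that they
    become available at every point.\<close>
  define good where "good z \<longleftrightarrow> z \<in> K \<and> C0 * primitive g (norm (V0 z)) \<le> V0 z \<bullet> W0 z \<and> norm (W0 z) \<le> C1 * g (norm (V0 z))" for z
  have [measurable]: "Measurable.pred borel good" unfolding good_def[abs_def] using mK by measurable
  define V where "V z = (if good z then V0 z else 0)" for z
  define W where "W z = (if good z then W0 z else 0)" for z
  have mV [measurable]: "V \<in> borel_measurable borel" and mW [measurable]: "W \<in> borel_measurable borel"
    unfolding V_def[abs_def] W_def[abs_def] by measurable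
  have good: "AE z in lborel. z \<in> K \<longrightarrow> good z"
    using aeV aeW
  proof eventually_elim
    case (elim z)
    show ?case
    proof
      assume z: "z \<in> K"
      then have "V0 z = Du z" "W0 z = ?A z" using elim by auto
      then show "good z" using z sc unfolding good_def structure_conditions_def by (simp add: inner_commute)
    qed
  qed
  have eV: "AE z in lborel. V z = ?DK z"
    using good aeV by eventually_elim (auto simp: V_def good_def)
  have eW: "AE z in lborel. W z = indicator K z *\<^sub>R ?A z"
    using good aeW by eventually_elim (auto simp: W_def good_def)
  have n1: "C0 * primitive g (norm (V z)) \<le> V z \<bullet> W z" for z
    by (simp add: V_def W_def good_def)
  have n2: "norm (W z) \<le> C1 * g (norm (V z))" for z
    using growth_functionD(3)[OF gf, of 0] C(2) by (simp add: V_def W_def good_def)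
  have n3: "z \<notin> K \<longrightarrow> V z = 0 \<and> W z = 0" for z by (simp add: V_def W_def good_def)
  have eV': "AE z in lebesgue. V z = ?DK z" by (rule AE_completion[OF eV])
  have iV: "integrable lborel V"
  proof (subst integrable_completion[symmetric])
    have "V \<in> borel_measurable lebesgue" by (rule measurable_completion) simp
    then show "integrable lebesgue V"
      by (subst integrable_cong_AE[OF _ mDK eV']) (use iDK in auto)
  qed simp
  have mGV [measurable]: "(\<lambda>z. primitive g (norm (V z))) \<in> borel_measurable borel" "(\<lambda>z. g (norm (V z))) \<in> borel_measurable borel"
    by (rule continuous_nonneg_compose_measurable[OF primitive_continuous[OF gf]], measurable)
      (rule continuous_nonneg_compose_measurable[OF growth_functionD(1)[OF gf]], measurable)
  have iGV: "integrable lborel (\<lambda>z. primitive g (norm (V z)))"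
  proof (subst integrable_completion[symmetric])
    show "integrable lebesgue (\<lambda>z. primitive g (norm (V z)))"
    proof (rule Bochner_Integration.integrable_bound[OF iG[unfolded set_integrable_def]])
      show "(\<lambda>z. primitive g (norm (V z))) \<in> borel_measurable lebesgue"
        by (rule measurable_completion) simp
      show "AE z in lebesgue. norm (primitive g (norm (V z))) \<le> norm (indicator \<Omega> z *\<^sub>R primitive g (norm (Du z)))"
        using eV'
      proof eventually_elim
        case (elim z)
        then show ?case using K(2) by (auto simp: indicator_def)
      qed
    qed
  qed simp
  have iW: "integrable lborel W"
  proof (rule Bochner_Integration.integrable_bound)
    show "integrable lborel (\<lambda>z. C1 * (g 1 * indicator K z + g1 * primitive g (norm (V z))))"
      using iGV mK emeasure_compact_finite[OF K(1)]
      by (intro integrable_mult_right Bochner_Integration.integrable_add) (auto simp: integrable_indicator_iff)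
    have "norm (W z) \<le> C1 * (g 1 * indicator K z + g1 * primitive g (norm (V z)))" for z
    proof (cases "z \<in> K")
      case True
      \<comment> \<open>The product bound with \<open>b = 1\<close> controls \<open>g\<close> by a
        constant plus a multiple of \<open>G\<close>, which makes the flux integrable on the compact
        set \<open>K\<close>.\<close>
      have "g (norm (V z)) \<le> g 1 + g (norm (V z)) * norm (V z)"
        using growth_product_bound[OF gf, of "norm (V z)" 1] by simp
      also have "\<dots> \<le> g 1 + g1 * primitive g (norm (V z))"
        using growth_mult_le_primitive[OF gf, of "norm (V z)"] by simp
      finally have "C1 * g (norm (V z)) \<le> C1 * (g 1 * indicator K z + g1 * primitive g (norm (V z)))"
        using True C(2) by simp
      then show ?thesis using n2[of z] by linarith
    qed (simp add: n3)
    moreover have "a \<le> norm b" if "a \<le> b" for a b :: real using that by simp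
    ultimately show "AE z in lborel. norm (W z) \<le> norm (C1 * (g 1 * indicator K z + g1 * primitive g (norm (V z))))"
      by blast
  qed simp
  show thesis by (rule that[OF mV mW eV eW]) (use n1 n2 n3 iV iW iGV in auto)
qed

lemma set_lebesgue_integral_eq_lborel:
  fixes f F :: "'a::euclidean_space \<Rightarrow> 'b::{banach, second_countable_topology}"
  assumes F: "F \<in> borel_measurable borel"
    and f: "(\<lambda>z. indicator \<Omega> z *\<^sub>R f z) \<in> borel_measurable lebesgue"
    and ae: "AE z in lborel. indicator \<Omega> z *\<^sub>R f z = F z"
  shows "(LINT z:\<Omega>|lebesgue. f z) = (\<integral>z. F z \<partial>lborel)"
proof -
  have F': "F \<in> borel_measurable lborel" using F by simp
  have "(LINT z:\<Omega>|lebesgue. f z) = (\<integral>z. F z \<partial>lebesgue)"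
    unfolding set_lebesgue_integral_def
    by (rule integral_cong_AE[OF f measurable_completion[OF F'] AE_completion[OF ae]])
  also have "\<dots> = (\<integral>z. F z \<partial>lborel)" by (rule integral_completion[OF F'])
  finally show ?thesis .
qed

text \<open>Both weak formulations are tested with the kernel centred at \<open>z\<close>, as a
  function of \<open>y\<close>; its gradient in \<open>y\<close> is
  \<open>- mollifier_grad \<epsilon> (z - y)\<close>. The closed ball around \<open>z\<close> has to
  lie in \<open>K\<close>, so that the kernel is admissible and \<open>U\<close> agrees with
  \<open>u\<close> on its support.\<close>

lemma mollified_identities:
  fixes u :: "'n::finite space_time \<Rightarrow> real" and A :: "'n vector_field"
  assumes K: "compact K" "K \<subseteq> \<Omega>" and u: "continuous_on K u"
    and Vm: "V \<in> borel_measurable borel" and Wm: "W \<in> borel_measurable borel"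
    and eV: "AE z in lborel. V z = indicator K z *\<^sub>R Du z"
    and eW: "AE z in lborel. W z = indicator K z *\<^sub>R A (fst z) (snd z) (u z) (Du z)"
    and iV: "integrable lborel V" and iW: "integrable lborel W"
    and iDu: "set_integrable lebesgue K Du"
    and mA: "(\<lambda>z. indicator K z *\<^sub>R A (fst z) (snd z) (u z) (Du z)) \<in> borel_measurable lebesgue"
    and wg: "weak_spatial_gradient \<Omega> u Du"
    and sup: "\<forall>\<phi> D. C1_test_function \<Omega> \<phi> D \<and> (\<forall>z. 0 \<le> \<phi> z) \<longrightarrow>
           - (LINT z:\<Omega>|lebesgue. u z * snd (D z))
           + (LINT z:\<Omega>|lebesgue. A (fst z) (snd z) (u z) (Du z) \<bullet> fst (D z)) \<ge> 0"
    and \<epsilon>: "0 < \<epsilon>" and z: "cball z \<epsilon> \<subseteq> K"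
  defines "U \<equiv> \<lambda>z. indicator K z * u z"
  shows "fst (convolve_grad (mollifier_grad \<epsilon>) U z) = convolve (mollifier \<epsilon>) V z"
    and "(\<integral>y. W y \<bullet> fst (mollifier_grad \<epsilon> (z - y)) \<partial>lborel) \<le> snd (convolve_grad (mollifier_grad \<epsilon>) U z)"
proof -
  note J = mollifier_C1_compact[OF \<epsilon>, where 'a = "'n space_time"]
  have mK: "K \<in> sets borel" using K(1) by (simp add: borel_closed compact_imp_closed)
  have U_alt: "U = (\<lambda>z. indicator K z *\<^sub>R u z)" by (simp add: U_def)
  have iU: "integrable lborel U"
    unfolding U_alt by (rule borel_integrable_compact[OF K(1) u])
  have mU: "U \<in> borel_measurable borel" using borel_measurable_integrable[OF iU] by simp
  let ?\<phi> = "\<lambda>y. mollifier \<epsilon> (z - y)" and ?G = "\<lambda>y. mollifier_grad \<epsilon> (z - y)"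
  have test: "C1_test_function \<Omega> ?\<phi> (\<lambda>y. - ?G y)"
    by (rule mollifier_test_function[OF \<epsilon>]) (use z K(2) in blast)
  have out: "?\<phi> y = 0" "?G y = 0" if "y \<notin> K" for y
    using mollifier_shift_zero[OF \<epsilon>, of y z] that z by blast+
  note [measurable] = C1_compact_measurable[OF J] mU Vm Wm
  have mG: "(\<lambda>y. ?G y) \<in> borel_measurable borel" by measurable
  have c: "continuous_on UNIV (mollifier_grad \<epsilon> :: 'n space_time \<Rightarrow> _)" by (rule C1_compact_grad_continuous[OF J])
  have mfG: "(\<lambda>y. fst (?G y)) \<in> borel_measurable borel" "(\<lambda>y. snd (?G y)) \<in> borel_measurable borel"
    by (rule borel_measurable_continuous_onI; intro continuous_intros continuous_on_compose2[OF c]; auto)+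
  note [measurable] = mfG
  have "?G \<in> borel_measurable borel" by (rule mG)
  note igU = convolve_grad_integrable[OF J iU, of z]
  have f1: "fst (convolve_grad (mollifier_grad \<epsilon>) U z) = (\<integral>y. U y *\<^sub>R fst (?G y) \<partial>lborel)"
    unfolding convolve_grad_def using integral_bounded_linear[OF bounded_linear_fst igU] by simp
  have s1: "snd (convolve_grad (mollifier_grad \<epsilon>) U z) = (\<integral>y. U y * snd (?G y) \<partial>lborel)"
    unfolding convolve_grad_def using integral_bounded_linear[OF bounded_linear_snd igU] by simp
  have KO: "indicator \<Omega> y *\<^sub>R x = indicator K y *\<^sub>R x" if "y \<notin> K \<Longrightarrow> x = 0" for y and x :: "'x::real_vector"
    using that K(2) by (auto simp: indicator_def)
  have L: "f \<in> borel_measurable lebesgue" if "f \<in> borel_measurable borel" for f :: "'n space_time \<Rightarrow> 'x::topological_space"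
    using that by (intro measurable_completion) simp
  have 1: "(LINT y:\<Omega>|lebesgue. u y *\<^sub>R fst (- ?G y)) = (\<integral>y. - (U y *\<^sub>R fst (?G y)) \<partial>lborel)"
  proof (rule set_lebesgue_integral_eq_lborel)
    show m: "(\<lambda>y. - (U y *\<^sub>R fst (?G y))) \<in> borel_measurable borel" by measurable
    have e: "indicator \<Omega> y *\<^sub>R (u y *\<^sub>R fst (- ?G y)) = - (U y *\<^sub>R fst (?G y))" for y
      using out(2)[of y] K(2) by (auto simp: indicator_def U_def)
    show "(\<lambda>y. indicator \<Omega> y *\<^sub>R (u y *\<^sub>R fst (- ?G y))) \<in> borel_measurable lebesgue" unfolding e by (rule L[OF m])
    show "AE y in lborel. indicator \<Omega> y *\<^sub>R (u y *\<^sub>R fst (- ?G y)) = - (U y *\<^sub>R fst (?G y))" unfolding e by simp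
  qed
  have 2: "(LINT y:\<Omega>|lebesgue. ?\<phi> y *\<^sub>R Du y) = (\<integral>y. ?\<phi> y *\<^sub>R V y \<partial>lborel)"
  proof (rule set_lebesgue_integral_eq_lborel)
    show m: "(\<lambda>y. ?\<phi> y *\<^sub>R V y) \<in> borel_measurable borel" by measurable
    have e: "indicator \<Omega> y *\<^sub>R (?\<phi> y *\<^sub>R Du y) = ?\<phi> y *\<^sub>R (indicator K y *\<^sub>R Du y)" for y
      using out(1)[of y] K(2) by (auto simp: indicator_def)
    have "?\<phi> \<in> borel_measurable borel" by measurable
    then show "(\<lambda>y. indicator \<Omega> y *\<^sub>R (?\<phi> y *\<^sub>R Du y)) \<in> borel_measurable lebesgue"
      unfolding e by (rule borel_measurable_scaleR[OF L borel_measurable_integrable[OF iDu[unfolded set_integrable_def]]])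
    show "AE y in lborel. indicator \<Omega> y *\<^sub>R (?\<phi> y *\<^sub>R Du y) = ?\<phi> y *\<^sub>R V y"
      unfolding e using eV by eventually_elim simp
  qed
  have "(LINT y:\<Omega>|lebesgue. u y *\<^sub>R fst (- ?G y)) = - (LINT y:\<Omega>|lebesgue. ?\<phi> y *\<^sub>R Du y)"
    using wg test unfolding weak_spatial_gradient_def by blast
  then show "fst (convolve_grad (mollifier_grad \<epsilon>) U z) = convolve (mollifier \<epsilon>) V z"
    unfolding 1 2 f1 convolve_def by simp
  have 3: "(LINT y:\<Omega>|lebesgue. u y * snd (- ?G y)) = (\<integral>y. - (U y * snd (?G y)) \<partial>lborel)"
  proof (rule set_lebesgue_integral_eq_lborel)
    show m: "(\<lambda>y. - (U y * snd (?G y))) \<in> borel_measurable borel" by measurable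
    have e: "indicator \<Omega> y *\<^sub>R (u y * snd (- ?G y)) = - (U y * snd (?G y))" for y
      using out(2)[of y] K(2) by (auto simp: indicator_def U_def)
    show "(\<lambda>y. indicator \<Omega> y *\<^sub>R (u y * snd (- ?G y))) \<in> borel_measurable lebesgue" unfolding e by (rule L[OF m])
    show "AE y in lborel. indicator \<Omega> y *\<^sub>R (u y * snd (- ?G y)) = - (U y * snd (?G y))" unfolding e by simp
  qed
  have 4: "(LINT y:\<Omega>|lebesgue. A (fst y) (snd y) (u y) (Du y) \<bullet> fst (- ?G y)) = (\<integral>y. - (W y \<bullet> fst (?G y)) \<partial>lborel)"
  proof (rule set_lebesgue_integral_eq_lborel)
    show m: "(\<lambda>y. - (W y \<bullet> fst (?G y))) \<in> borel_measurable borel" by measurable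
    have e: "indicator \<Omega> y *\<^sub>R (A (fst y) (snd y) (u y) (Du y) \<bullet> fst (- ?G y))
        = - ((indicator K y *\<^sub>R A (fst y) (snd y) (u y) (Du y)) \<bullet> fst (?G y))" for y
      using out(2)[of y] K(2) by (auto simp: indicator_def)
    show "(\<lambda>y. indicator \<Omega> y *\<^sub>R (A (fst y) (snd y) (u y) (Du y) \<bullet> fst (- ?G y))) \<in> borel_measurable lebesgue"
      unfolding e by (intro borel_measurable_uminus borel_measurable_inner mA L mfG)
    show "AE y in lborel. indicator \<Omega> y *\<^sub>R (A (fst y) (snd y) (u y) (Du y) \<bullet> fst (- ?G y)) = - (W y \<bullet> fst (?G y))"
      unfolding e using eW by eventually_elim simp
  qed
  have "- (LINT y:\<Omega>|lebesgue. u y * snd (- ?G y)) + (LINT y:\<Omega>|lebesgue. A (fst y) (snd y) (u y) (Du y) \<bullet> fst (- ?G y)) \<ge> 0"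
    using sup[rule_format, of ?\<phi> "\<lambda>y. - ?G y"] test mollifier_nonneg by blast
  then show "(\<integral>y. W y \<bullet> fst (mollifier_grad \<epsilon> (z - y)) \<partial>lborel) \<le> snd (convolve_grad (mollifier_grad \<epsilon>) U z)"
    unfolding 3 4 s1 by simp
qed

text \<open>\<open>energy_limit\<close> still contains the flux. Coercivity on the left and the
  bound by \<open>C1 * g\<close> in the cutoff term leave an inequality between \<open>u\<close> and
  its gradient alone. One \<open>V\<close> serves all truncations and all cutoffs supported in the
  interior of \<open>K\<close>.\<close>

theorem supersolution_local_gradient:
  fixes u :: "'n::finite space_time \<Rightarrow> real" and A :: "'n vector_field"
  assumes gf: "growth_function g0 g1 g" and sc: "structure_conditions C0 C1 g A"
    and C: "0 < C0" "0 < C1"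
    and ws: "weak_supersolution g A \<Omega> u" and nn: "\<forall>z\<in>\<Omega>. 0 \<le> u z"
    and K: "compact K" "K \<subseteq> \<Omega>"
  obtains V where "local_gradient C0 C1 g u K V"
proof -
  obtain Du where o\<Omega>: "open \<Omega>" and cu: "continuous_on \<Omega> u" and wg: "weak_spatial_gradient \<Omega> u Du"
    and iG: "set_integrable lebesgue \<Omega> (\<lambda>z. primitive g (norm (Du z)))"
    and mA: "(\<lambda>z. A (fst z) (snd z) (u z) (Du z)) \<in> borel_measurable (lebesgue_on \<Omega>)"
    and sup: "\<forall>\<phi> D. C1_test_function \<Omega> \<phi> D \<and> (\<forall>z. 0 \<le> \<phi> z) \<longrightarrow>
           - (LINT z:\<Omega>|lebesgue. u z * snd (D z))
           + (LINT z:\<Omega>|lebesgue. A (fst z) (snd z) (u z) (Du z) \<bullet> fst (D z)) \<ge> 0"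
    using ws unfolding weak_supersolution_def by blast
  have iDu: "set_integrable lebesgue K Du" using wg K unfolding weak_spatial_gradient_def by blast
  obtain V W where mV [measurable]: "V \<in> borel_measurable borel" and mW [measurable]: "W \<in> borel_measurable borel"
    and eV: "AE z in lborel. V z = indicator K z *\<^sub>R Du z"
    and eW: "AE z in lborel. W z = indicator K z *\<^sub>R A (fst z) (snd z) (u z) (Du z)"
    and VW: "\<forall>z. C0 * primitive g (norm (V z)) \<le> V z \<bullet> W z"
    and Wg: "\<forall>z. norm (W z) \<le> C1 * g (norm (V z))"
    and V0: "\<forall>z. z \<notin> K \<longrightarrow> V z = 0 \<and> W z = 0"
    and iV: "integrable lborel V" and iW: "integrable lborel W"
    and iGV: "integrable lborel (\<lambda>z. primitive g (norm (V z)))"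
    by (rule structure_representatives[OF gf sc C K o\<Omega> iDu iG mA])
  have mAK: "(\<lambda>z. indicator K z *\<^sub>R A (fst z) (snd z) (u z) (Du z)) \<in> borel_measurable lebesgue"
  proof -
    have "W \<in> borel_measurable lebesgue" by (rule measurable_completion) simp
    moreover have "AE z in lebesgue. W z = indicator K z *\<^sub>R A (fst z) (snd z) (u z) (Du z)"
      by (rule AE_completion[OF eW])
    ultimately show ?thesis by (rule borel_measurable_AE)
  qed
  have cuK: "continuous_on K u" by (rule continuous_on_subset[OF cu K(2)])
  \<comment> \<open>The jump of \<open>U\<close> at the boundary of \<open>K\<close> does no harm:
    cutoffs are supported in the interior, and the mollification radii stay below the distance of
    their supports to the complement.\<close>
  define U where "U = (\<lambda>z. indicator K z * u z)"
  have iU: "integrable lborel U"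
    using borel_integrable_compact[OF K(1) cuK] by (simp add: U_def)
  have "bounded (u ` K)" by (intro compact_imp_bounded compact_continuous_image cuK K(1))
  then obtain M where M: "M > 0" "\<forall>z\<in>K. \<bar>u z\<bar> \<le> M" unfolding bounded_pos by auto
  have U0: "0 \<le> U z" for z using nn K(2) by (auto simp: U_def indicator_def)
  have UM: "U z \<le> M" for z using M by (auto simp: U_def indicator_def abs_le_iff)
  have mGV [measurable]: "(\<lambda>z. primitive g (norm (V z))) \<in> borel_measurable borel" "(\<lambda>z. g (norm (V z))) \<in> borel_measurable borel"
    by (rule continuous_nonneg_compose_measurable[OF primitive_continuous[OF gf]], measurable)
      (rule continuous_nonneg_compose_measurable[OF growth_functionD(1)[OF gf]], measurable)
  let ?h = "\<lambda>z. C1 * (g (norm (V z)) * norm (V z))"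
  have ih: "integrable lborel ?h"
  proof (intro integrable_mult_right, rule Bochner_Integration.integrable_bound)
    show "integrable lborel (\<lambda>z. g1 * primitive g (norm (V z)))" using iGV by simp
    have "norm (g (norm (V z)) * norm (V z)) \<le> norm (g1 * primitive g (norm (V z)))" for z
      using growth_mult_le_primitive[OF gf, of "norm (V z)"] growth_functionD(3)[OF gf, of "norm (V z)"] by simp
    then show "AE z in lborel. norm (g (norm (V z)) * norm (V z)) \<le> norm (g1 * primitive g (norm (V z)))" by simp
  qed measurable
  have Wh: "norm (W y) * norm (V y') \<le> ?h y + ?h y'" for y y'
  proof -
    have "norm (W y) * norm (V y') \<le> C1 * (g (norm (V y)) * norm (V y'))"
      using mult_right_mono[OF Wg[rule_format, of y], of "norm (V y')"] by simp
    also have "\<dots> \<le> C1 * (g (norm (V y)) * norm (V y) + g (norm (V y')) * norm (V y'))"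
      using C(2) by (intro mult_left_mono growth_product_bound[OF gf]) auto
    finally show ?thesis by (simp add: distrib_left)
  qed
  have local_mollification: "\<exists>\<delta>. mollified_supersolution U ?h V W (closure {z. \<eta> z \<noteq> 0}) \<delta> M \<eta> D\<eta>"
    if \<eta>: "C1_compact \<eta> D\<eta>" "closure {z. \<eta> z \<noteq> 0} \<subseteq> interior K" for \<eta> D\<eta>
  proof -
    obtain \<delta> where \<delta>: "\<delta> > 0" "(\<Union>z\<in>closure {z. \<eta> z \<noteq> 0}. cball z \<delta>) \<subseteq> interior K"
      by (rule compact_subset_open_imp_cball_epsilon_subset[OF C1_compact_closure(1)[OF \<eta>(1)] open_interior \<eta>(2)])
    have ball: "cball z \<epsilon> \<subseteq> K" if "\<epsilon> < \<delta>" "z \<in> closure {z. \<eta> z \<noteq> 0}" for z \<epsilon>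
    proof -
      have "cball z \<epsilon> \<subseteq> cball z \<delta>" using that(1) by (intro subset_cball) simp
      also have "\<dots> \<subseteq> interior K" using \<delta>(2) that(2) by blast
      also have "\<dots> \<subseteq> K" by (rule interior_subset)
      finally show ?thesis .
    qed
    have "mollified_supersolution U ?h V W (closure {z. \<eta> z \<noteq> 0}) \<delta> M \<eta> D\<eta>"
    proof
      fix \<epsilon> z assume *: "0 < \<epsilon>" "\<epsilon> < \<delta>" "z \<in> closure {z. \<eta> z \<noteq> 0}"
      note mi = mollified_identities[OF K cuK mV mW eV eW iV iW iDu mAK wg sup *(1) ball[OF *(2,3)], folded U_def]
      show "fst (convolve_grad (mollifier_grad \<epsilon>) U z) = convolve (mollifier \<epsilon>) V z" by (rule mi(1))
      show "(\<integral>y. W y \<bullet> fst (mollifier_grad \<epsilon> (z - y)) \<partial>lborel) \<le> snd (convolve_grad (mollifier_grad \<epsilon>) U z)" by (rule mi(2))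
    next
      fix z assume "\<eta> z \<noteq> 0" then show "z \<in> closure {z. \<eta> z \<noteq> 0}" using closure_subset[of "{z. \<eta> z \<noteq> 0}"] by blast
    qed (fact iU iV iW ih U0 UM Wh \<delta>(1) \<eta>(1))+
    then show ?thesis by blast
  qed
  have Uu: "U z = u z" if "z \<in> K" for z using that by (simp add: U_def)
  have outK: "\<eta> z = 0" "D\<eta> z = 0" if "C1_compact \<eta> D\<eta>" "closure {z. \<eta> z \<noteq> 0} \<subseteq> interior K" "z \<notin> K" for \<eta> D\<eta> and z :: "'n space_time"
  proof -
    have "z \<notin> closure {z. \<eta> z \<noteq> 0}" using that(2,3) interior_subset[of K] by blast
    then show "\<eta> z = 0" "D\<eta> z = 0" by (rule C1_compact_closure[OF that(1)])+
  qed
  have energy: "C0 * (\<integral>z. q (u z) * primitive g (norm (V z)) * \<eta> z \<partial>lborel)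
          \<le> (\<integral>z. \<Phi> (u z) * snd (D\<eta> z) \<partial>lborel) + C1 * (\<integral>z. p (u z) * g (norm (V z)) * norm (fst (D\<eta> z)) \<partial>lborel)"
    if \<Phi>: "\<forall>v\<ge>0. (\<Phi> has_real_derivative - p v) (at v)" and p: "\<forall>v\<ge>0. (p has_real_derivative - q v) (at v)"
      and q: "continuous_on {0..} q" and pnn: "\<forall>v\<ge>0. 0 \<le> p v" and qnn: "\<forall>v\<ge>0. 0 \<le> q v"
      and \<eta>: "C1_compact \<eta> D\<eta>" and \<eta>nn: "\<forall>z. 0 \<le> \<eta> z" and sub: "closure {z. \<eta> z \<noteq> 0} \<subseteq> interior K"
    for \<Phi> p q :: "real \<Rightarrow> real" and \<eta> D\<eta>
  proof -
    obtain \<delta> where "mollified_supersolution U ?h V W (closure {z. \<eta> z \<noteq> 0}) \<delta> M \<eta> D\<eta>" using local_mollification[OF \<eta> sub] by blast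
    then interpret mollified_supersolution U ?h V W "closure {z. \<eta> z \<noteq> 0}" \<delta> M \<eta> D\<eta> .
    have cp: "continuous_on {0..} p" by (rule DERIV_nonneg_continuous_on) (use p in blast)
    note [measurable] = compose_meas(1)[OF cp] compose_meas(1)[OF q]
    obtain Bp where Bp: "Bp > 0" "\<forall>v\<in>{0..M}. \<bar>p v\<bar> \<le> Bp" by (rule truncation_bound[OF cp])
    obtain Bq where Bq: "Bq > 0" "\<forall>v\<in>{0..M}. \<bar>q v\<bar> \<le> Bq" by (rule truncation_bound[OF q])
    obtain r where "r > 0" and r': "\<forall>z. norm z \<ge> r \<longrightarrow> \<eta> z = 0" "\<forall>z. norm z \<ge> r \<longrightarrow> D\<eta> z = 0"
      by (rule C1_compact_radius[OF \<eta>])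
    note r = r'[rule_format]
    obtain B where B: "B > 0" "\<forall>z. norm (\<eta> z) \<le> B"
      by (rule continuous_compact_support_bounded[OF C1_compact_continuous[OF \<eta>] r(1)])
    obtain B' where B': "B' > 0" "\<forall>z. norm (D\<eta> z) \<le> B'"
      by (rule continuous_compact_support_bounded[OF C1_compact_grad_continuous[OF \<eta>] r(2)])
    have fB': "norm (fst (D\<eta> z)) \<le> B'" for z
      using order_trans[OF norm_fst_le[of "fst (D\<eta> z)" "snd (D\<eta> z)"], of B'] B'(2) by simp
    have Uin: "U z \<in> {0..M}" for z using U0 UM by auto
    have a1: "0 \<le> q (U z) \<and> q (U z) \<le> Bq" "0 \<le> p (U z) \<and> p (U z) \<le> Bp" for z
      using Bq(2) Bp(2) Uin[of z] qnn pnn by (auto simp: abs_le_iff)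
    have e0: "0 \<le> \<eta> z \<and> \<eta> z \<le> B" for z using B(2)[rule_format, of z] \<eta>nn[rule_format, of z] by simp
    have iI: "integrable lborel (\<lambda>z. q (U z) * primitive g (norm (V z)) * \<eta> z)"
    proof (rule Bochner_Integration.integrable_bound)
      show "integrable lborel (\<lambda>z. (Bq * B) * primitive g (norm (V z)))" using iGV by simp
      have "norm (q (U z) * primitive g (norm (V z)) * \<eta> z) \<le> norm ((Bq * B) * primitive g (norm (V z)))" for z
      proof -
        have "q (U z) * \<eta> z \<le> Bq * B" using a1(1)[of z] e0[of z] by (intro mult_mono) auto
        from mult_right_mono[OF this primitive_nonneg[OF gf, of "norm (V z)"]]
        show ?thesis using a1(1)[of z] e0[of z] primitive_nonneg[OF gf, of "norm (V z)"] Bq(1) B(1)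
          by (simp add: abs_mult mult_ac)
      qed
      then show "AE z in lborel. norm (q (U z) * primitive g (norm (V z)) * \<eta> z) \<le> norm ((Bq * B) * primitive g (norm (V z)))" by simp
    qed measurable
    have mD: "(\<lambda>z. fst (D\<eta> z)) \<in> borel_measurable borel"
      by (rule borel_measurable_continuous_onI, intro continuous_intros C1_compact_grad_continuous[OF \<eta>])
    note [measurable] = mD
    have iII: "integrable lborel (\<lambda>z. p (U z) * g (norm (V z)) * norm (fst (D\<eta> z)))"
    proof (rule Bochner_Integration.integrable_bound)
      show "integrable lborel (\<lambda>z. Bp * (g 1 * norm (D\<eta> z) + B' * g1 * primitive g (norm (V z))))"
        using iGV C1_compact_integrable(2)[OF \<eta>] by simp
      have "norm (p (U z) * g (norm (V z)) * norm (fst (D\<eta> z))) \<le> norm (Bp * (g 1 * norm (D\<eta> z) + B' * g1 * primitive g (norm (V z))))" for z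
      proof -
        have g2: "0 \<le> g (norm (V z))" "0 \<le> g 1" using growth_functionD(3)[OF gf] by simp_all
        have "0 \<le> g (norm (V z)) * norm (V z)" using g2(1) by simp
        then have g3: "0 \<le> g1 * primitive g (norm (V z))"
          using growth_mult_le_primitive[OF gf norm_ge_zero[of "V z"]] by linarith
        have "g (norm (V z)) \<le> g 1 + g1 * primitive g (norm (V z))"
          using growth_product_bound[OF gf norm_ge_zero[of "V z"], of 1] growth_mult_le_primitive[OF gf norm_ge_zero[of "V z"]]
          by simp
        note g = this g2 g3
        have "g (norm (V z)) * norm (fst (D\<eta> z)) \<le> (g 1 + g1 * primitive g (norm (V z))) * norm (fst (D\<eta> z))"
          using g by (intro mult_right_mono) auto
        also have "\<dots> = g 1 * norm (fst (D\<eta> z)) + g1 * primitive g (norm (V z)) * norm (fst (D\<eta> z))"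
          by (simp add: distrib_right)
        also have "\<dots> \<le> g 1 * norm (D\<eta> z) + g1 * primitive g (norm (V z)) * B'"
          using g(3,4) fB'[of z] norm_fst_le[of "fst (D\<eta> z)" "snd (D\<eta> z)"] by (intro add_mono mult_left_mono) auto
        finally have x: "g (norm (V z)) * norm (fst (D\<eta> z)) \<le> g 1 * norm (D\<eta> z) + B' * g1 * primitive g (norm (V z))"
          by (simp add: mult_ac)
        have y: "0 \<le> g (norm (V z)) * norm (fst (D\<eta> z))" using g(2) by simp
        have "p (U z) * (g (norm (V z)) * norm (fst (D\<eta> z))) \<le> Bp * (g 1 * norm (D\<eta> z) + B' * g1 * primitive g (norm (V z)))"
          by (rule mult_mono) (use x y a1(2)[of z] Bp(1) in auto)
        then show ?thesis using a1(2)[of z] g(2) by (simp add: mult.assoc)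
      qed
      then show "AE z in lborel. norm (p (U z) * g (norm (V z)) * norm (fst (D\<eta> z))) \<le> norm (Bp * (g 1 * norm (D\<eta> z) + B' * g1 * primitive g (norm (V z))))" by simp
    qed measurable
    have iE: "integrable lborel (\<lambda>z. q (U z) * \<eta> z * (V z \<bullet> W z) - p (U z) * (fst (D\<eta> z) \<bullet> W z))"
    proof (rule Bochner_Integration.integrable_bound)
      show "integrable lborel (\<lambda>z. (Bq * B) * (2 * ?h z) + (Bp * B') * norm (W z))"
        by (intro Bochner_Integration.integrable_add integrable_mult_right integrable_norm iW ih[simplified])
           (use ih in simp)
      have "norm (q (U z) * \<eta> z * (V z \<bullet> W z) - p (U z) * (fst (D\<eta> z) \<bullet> W z)) \<le> norm ((Bq * B) * (2 * ?h z) + (Bp * B') * norm (W z))" for z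
      proof -
        have x: "\<bar>q (U z) * \<eta> z * (V z \<bullet> W z)\<bar> \<le> (Bq * B) * (2 * ?h z)"
          unfolding abs_mult[of "q (U z) * \<eta> z"]
        proof (intro mult_mono)
          show "\<bar>V z \<bullet> W z\<bar> \<le> 2 * ?h z" using Cauchy_Schwarz_ineq2[of "V z" "W z"] Wh[of z z] by (simp add: mult.commute)
          show "\<bar>q (U z) * \<eta> z\<bar> \<le> Bq * B" using a1(1)[of z] e0[of z] by (simp add: abs_mult mult_mono)
        qed (use Bq B in auto)
        have y: "\<bar>p (U z) * (fst (D\<eta> z) \<bullet> W z)\<bar> \<le> Bp * (B' * norm (W z))"
          unfolding abs_mult
        proof (intro mult_mono)
          show "\<bar>fst (D\<eta> z) \<bullet> W z\<bar> \<le> B' * norm (W z)"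
            using Cauchy_Schwarz_ineq2[of "fst (D\<eta> z)" "W z"] mult_right_mono[OF fB'[of z], of "norm (W z)"] by simp
        qed (use a1(2)[of z] Bp(1) in auto)
        have "\<bar>a - b\<bar> \<le> \<bar>c + d\<bar>" if "\<bar>a\<bar> \<le> c" "\<bar>b\<bar> \<le> d" for a b c d :: real using that by linarith
        from this[OF x y] show ?thesis by (simp only: real_norm_def mult.assoc)
      qed
      then show "AE z in lborel. norm (q (U z) * \<eta> z * (V z \<bullet> W z) - p (U z) * (fst (D\<eta> z) \<bullet> W z)) \<le> norm ((Bq * B) * (2 * ?h z) + (Bp * B') * norm (W z))" by simp
    qed measurable
    have eq1: "q (u z) * primitive g (norm (V z)) * \<eta> z = q (U z) * primitive g (norm (V z)) * \<eta> z" for z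
      using Uu[of z] outK(1)[OF \<eta> sub, of z] by (cases "z \<in> K") auto
    have eq2: "\<Phi> (u z) * snd (D\<eta> z) = \<Phi> (U z) * snd (D\<eta> z)" for z
      using Uu[of z] outK(2)[OF \<eta> sub, of z] by (cases "z \<in> K") auto
    have eq3: "p (u z) * g (norm (V z)) * norm (fst (D\<eta> z)) = p (U z) * g (norm (V z)) * norm (fst (D\<eta> z))" for z
      using Uu[of z] outK(2)[OF \<eta> sub, of z] by (cases "z \<in> K") auto
    have "C0 * (\<integral>z. q (U z) * primitive g (norm (V z)) * \<eta> z \<partial>lborel) - C1 * (\<integral>z. p (U z) * g (norm (V z)) * norm (fst (D\<eta> z)) \<partial>lborel)
        = (\<integral>z. C0 * (q (U z) * primitive g (norm (V z)) * \<eta> z) - C1 * (p (U z) * g (norm (V z)) * norm (fst (D\<eta> z))) \<partial>lborel)"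
      using iI iII by simp
    also have "\<dots> \<le> (\<integral>z. q (U z) * \<eta> z * (V z \<bullet> W z) - p (U z) * (fst (D\<eta> z) \<bullet> W z) \<partial>lborel)"
    proof (rule integral_mono[OF _ iE])
      show "integrable lborel (\<lambda>z. C0 * (q (U z) * primitive g (norm (V z)) * \<eta> z) - C1 * (p (U z) * g (norm (V z)) * norm (fst (D\<eta> z))))"
        using iI iII by simp
      fix z
      have x: "(q (U z) * \<eta> z) * (C0 * primitive g (norm (V z))) \<le> (q (U z) * \<eta> z) * (V z \<bullet> W z)"
        using VW[rule_format, of z] a1(1)[of z] e0[of z] by (intro mult_left_mono) auto
      have "fst (D\<eta> z) \<bullet> W z \<le> norm (fst (D\<eta> z)) * (C1 * g (norm (V z)))"
        using order_trans[OF norm_cauchy_schwarz mult_left_mono[OF Wg[rule_format, of z] norm_ge_zero[of "fst (D\<eta> z)"]]] .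
      then have y: "p (U z) * (fst (D\<eta> z) \<bullet> W z) \<le> p (U z) * (norm (fst (D\<eta> z)) * (C1 * g (norm (V z))))"
        using a1(2)[of z] by (intro mult_left_mono) auto
      show "C0 * (q (U z) * primitive g (norm (V z)) * \<eta> z) - C1 * (p (U z) * g (norm (V z)) * norm (fst (D\<eta> z)))
         \<le> q (U z) * \<eta> z * (V z \<bullet> W z) - p (U z) * (fst (D\<eta> z) \<bullet> W z)"
        using x y by (simp add: mult_ac)
    qed
    also have "\<dots> \<le> (\<integral>z. \<Phi> (U z) * snd (D\<eta> z) \<partial>lborel)"
      by (rule energy_limit) (use \<Phi> p q pnn \<eta>nn in auto)
    finally show ?thesis unfolding eq1 eq2 eq3 by simp
  qed
  have trans: "(\<integral>z. \<bar>\<eta> (z + (y, 0)) * F (u (z + (y, 0))) - \<eta> z * F (u z)\<bar> \<partial>lborel)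
          \<le> (\<integral>z. \<bar>\<eta> z * F' (u z) * (y \<bullet> V z) + F (u z) * (y \<bullet> fst (D\<eta> z))\<bar> \<partial>lborel)"
    if F: "\<forall>v\<ge>0. (F has_real_derivative F' v) (at v)" "continuous_on {0..} F'"
      and \<eta>: "C1_compact \<eta> D\<eta>" and sub: "closure {z. \<eta> z \<noteq> 0} \<subseteq> interior K"
    for F F' :: "real \<Rightarrow> real" and \<eta> D\<eta> y
  proof -
    obtain \<delta> where "mollified_supersolution U ?h V W (closure {z. \<eta> z \<noteq> 0}) \<delta> M \<eta> D\<eta>" using local_mollification[OF \<eta> sub] by blast
    then interpret mollified_supersolution U ?h V W "closure {z. \<eta> z \<noteq> 0}" \<delta> M \<eta> D\<eta> .
    have eq1: "\<eta> z * F (u z) = \<eta> z * F (U z)" for z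
      using Uu[of z] outK(1)[OF \<eta> sub, of z] by (cases "z \<in> K") auto
    have eq2: "\<eta> z * F' (u z) * (y \<bullet> V z) + F (u z) * (y \<bullet> fst (D\<eta> z)) = \<eta> z * F' (U z) * (y \<bullet> V z) + F (U z) * (y \<bullet> fst (D\<eta> z))" for z
      using Uu[of z] outK[OF \<eta> sub, of z] by (cases "z \<in> K") auto
    show ?thesis unfolding eq1 eq2 by (rule translation_limit) (use F in auto)
  qed
  show thesis
    by (rule that[of V]) (unfold local_gradient_def, intro conjI allI impI mV iV iGV; (elim conjE)?; (rule energy | rule trans); assumption)
qed

section \<open>Growth conditions and cutoff functions\<close>

text \<open>The real exponent \<open>g1\<close> is replaced by an integer upper bound, since the
  same \<open>n\<close> is used as power of the cutoff functions, which has to be at least 2 for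
  continuous differentiability.\<close>

locale growth =
  fixes g0 g1 :: real and g :: "real \<Rightarrow> real" and n :: nat
  assumes gf: "growth_function g0 g1 g" and g0: "2 \<le> g0" and g1: "g1 \<le> real n" and n2: "2 \<le> n"
begin

abbreviation "G \<equiv> primitive g"

lemma G_nonneg: "0 \<le> G \<sigma>" by (rule primitive_nonneg[OF gf])

lemma G_mono: "\<sigma> \<le> \<tau> \<Longrightarrow> G \<sigma> \<le> G \<tau>" by (rule primitive_mono[OF gf])

lemma g_nonneg: "0 \<le> \<sigma> \<Longrightarrow> 0 \<le> g \<sigma>" by (rule growth_functionD(3)[OF gf])

lemma g_upper: "0 \<le> \<sigma> \<Longrightarrow> g \<sigma> * \<sigma> \<le> real n * G \<sigma>"
  using growth_mult_le_primitive[OF gf, of \<sigma>] mult_right_mono[OF g1 G_nonneg[of \<sigma>]] by linarith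

lemma g_lower: "0 < \<sigma> \<Longrightarrow> 2 * G \<sigma> \<le> \<sigma> * g \<sigma>"
  using growth_functionD(4)[OF gf, of \<sigma>] mult_right_mono[OF g0 G_nonneg[of \<sigma>]] by linarith

text \<open>\<open>G x / x ^ n\<close> is nonincreasing because
  \<open>x * g x \<le> n * G x\<close>.\<close>

lemma G_scale_up:
  assumes "1 \<le> c" "0 \<le> \<sigma>"
  shows "G (c * \<sigma>) \<le> c ^ n * G \<sigma>"
proof (cases "\<sigma> = 0")
  case False
  then have s: "0 < \<sigma>" using assms by simp
  have "G (c * \<sigma>) / (c * \<sigma>) ^ n \<le> G \<sigma> / \<sigma> ^ n"
  proof (rule DERIV_nonpos_imp_nonincreasing[where f = "\<lambda>x. G x / x ^ n"])
    show "\<sigma> \<le> c * \<sigma>" using assms by (simp add: mult_le_cancel_right1)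
    fix x assume "\<sigma> \<le> x"
    then have x: "0 < x" using s by simp
    have "((\<lambda>x. G x / x ^ n) has_real_derivative (g x * x ^ n - G x * (real n * x ^ (n - 1))) / (x ^ n * x ^ n)) (at x)"
      using x by (auto intro!: derivative_eq_intros primitive_DERIV[OF gf])
    moreover have "(g x * x ^ n - G x * (real n * x ^ (n - 1))) / (x ^ n * x ^ n) \<le> 0"
    proof (rule divide_nonpos_nonneg)
      have "g x * x ^ n = x ^ (n - 1) * (g x * x)" using n2 by (cases n) auto
      also have "\<dots> \<le> x ^ (n - 1) * (real n * G x)" using x by (intro mult_left_mono g_upper) auto
      finally show "g x * x ^ n - G x * (real n * x ^ (n - 1)) \<le> 0" by (simp add: mult_ac)
    qed (use x in simp)
    ultimately show "\<exists>y. ((\<lambda>x. G x / x ^ n) has_real_derivative y) (at x) \<and> y \<le> 0" by blast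
  qed
  then show ?thesis using s assms by (simp add: field_simps power_mult_distrib)
qed simp

text \<open>\<open>G x / x\<^sup>2\<close> is nondecreasing because
  \<open>2 * G x \<le> x * g x\<close>; this is where \<open>2 \<le> g0\<close> enters.\<close>

lemma G_scale_down:
  assumes "0 \<le> c" "c \<le> 1" "0 \<le> \<sigma>"
  shows "G (c * \<sigma>) \<le> c\<^sup>2 * G \<sigma>"
proof (cases "\<sigma> = 0 \<or> c = 0")
  case False
  then have s: "0 < c * \<sigma>" "0 < c" "0 < \<sigma>" using assms by auto
  have "G (c * \<sigma>) / (c * \<sigma>)\<^sup>2 \<le> G \<sigma> / \<sigma>\<^sup>2"
  proof (rule DERIV_nonneg_imp_nondecreasing[where f = "\<lambda>x. G x / x\<^sup>2"])
    show "c * \<sigma> \<le> \<sigma>" using assms by (simp add: mult_left_le_one_le)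
    fix x assume "c * \<sigma> \<le> x"
    then have x: "0 < x" by (rule less_le_trans[OF s(1)])
    have "((\<lambda>x. G x / x\<^sup>2) has_real_derivative (g x * x\<^sup>2 - G x * (2 * x)) / (x\<^sup>2 * x\<^sup>2)) (at x)"
      using x by (auto intro!: derivative_eq_intros primitive_DERIV[OF gf])
    moreover have "0 \<le> (g x * x\<^sup>2 - G x * (2 * x)) / (x\<^sup>2 * x\<^sup>2)"
    proof (rule divide_nonneg_nonneg)
      have "x * (2 * G x) \<le> x * (x * g x)" using x by (intro mult_left_mono g_lower) auto
      then show "0 \<le> g x * x\<^sup>2 - G x * (2 * x)" by (simp add: power2_eq_square mult_ac)
    qed simp
    ultimately show "\<exists>y. ((\<lambda>x. G x / x\<^sup>2) has_real_derivative y) (at x) \<and> 0 \<le> y" by blast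
  qed
  then show ?thesis using s assms by (simp add: field_simps power_mult_distrib)
qed auto

text \<open>The product bound at \<open>b / \<delta>\<close>, multiplied by \<open>\<delta>\<close>:
  the parameter sits in front of both terms, and the price is the enlarged argument of
  \<open>G\<close>.\<close>

lemma young:
  assumes "0 \<le> a" "0 \<le> b" "0 < \<delta>"
  shows "g a * b \<le> \<delta> * real n * (G a + G (b / \<delta>))"
proof -
  have "g a * (b / \<delta>) \<le> g a * a + g (b / \<delta>) * (b / \<delta>)"
    using assms by (intro growth_product_bound[OF gf]) auto
  also have "\<dots> \<le> real n * G a + real n * G (b / \<delta>)"
    using assms by (intro add_mono g_upper) auto
  finally show ?thesis using assms(3) by (simp add: field_simps)
qed

text \<open>Up to \<open>m\<close> the linear term suffices; beyond \<open>m\<close>,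
  \<open>G_scale_down\<close> gives \<open>G m / m \<le> G a / a\<close>. At the natural scale
  \<open>m = k / r\<close> this bounds the L^1 norm of the gradient by the energy.\<close>

lemma linear_le_G:
  assumes "0 \<le> a" "0 < m" "0 < G m"
  shows "a \<le> m * (1 + G a / G m)"
proof (cases "a \<le> m")
  case True
  have "0 \<le> m * (G a / G m)" using assms G_nonneg[of a] by simp
  then show ?thesis using True by (simp add: distrib_left)
next
  case False
  then have "m / a \<le> 1" "0 < a" using assms by auto
  then have "G (m / a * a) \<le> (m / a)\<^sup>2 * G a" using assms by (intro G_scale_down) auto
  also have "\<dots> \<le> (m / a) * G a"
    using mult_left_le_one_le[of "m / a" "m / a"] \<open>m / a \<le> 1\<close> \<open>0 < a\<close> assms(2)
    by (intro mult_right_mono G_nonneg) (simp only: power2_eq_square, simp)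
  finally have "G m \<le> (m / a) * G a" using \<open>0 < a\<close> by simp
  then have "a * G m \<le> m * G a" using \<open>0 < a\<close> by (simp add: field_simps)
  then have "a \<le> m * (G a / G m)" using assms(3) by (simp add: field_simps)
  then show ?thesis using assms(2) by (simp add: distrib_left)
qed

text \<open>With \<open>b = p / q * (n * L) / \<zeta>\<close> the product \<open>p * g a * d\<close>
  is at most \<open>q * \<zeta> ^ n * \<kappa> * (g a * b)\<close>, which \<open>young\<close>
  splits. The factor \<open>1 / \<zeta>\<close> inside \<open>G\<close> costs the power
  \<open>n\<close> of \<open>1 / \<zeta>\<close>, compensated by the cutoff. The factor
  \<open>p / (q * k) \<le> 1\<close> is pulled out of \<open>G\<close> quadratically and leaves
  \<open>p\<^sup>2 / q \<le> e\<close>. This explains the two conditions that tie \<open>p\<close>,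
  \<open>q\<close>, \<open>e\<close> and \<open>k\<close> together.\<close>

lemma caccioppoli_pointwise:
  assumes C: "0 < C0" "0 < C1" and \<delta>: "0 < \<delta>" "C1 * \<delta> * real n \<le> C0 / 2"
    and pq: "0 \<le> p" "0 \<le> q" "0 \<le> e" "p \<le> k * q" "p\<^sup>2 \<le> e * q"
    and \<zeta>: "0 \<le> \<zeta>" "\<zeta> \<le> 1" and \<kappa>: "0 \<le> \<kappa>" and L: "0 \<le> L"
    and d: "0 \<le> d" "d \<le> real n * L * \<zeta> ^ (n - 1) * \<kappa>" and a: "0 \<le> a" and k: "0 < k"
  shows "C1 * (p * g a * d) \<le> C0 / 2 * (q * G a * (\<zeta> ^ n * \<kappa>))
     + C0 / 2 * (G (k * (real n * L / \<delta>)) / k\<^sup>2) * (e * \<kappa> * (if 0 < \<zeta> then 1 else 0))"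
proof (cases "\<zeta> = 0 \<or> q = 0")
  case True
  have "p * d = 0"
  proof (cases "q = 0")
    case True then show ?thesis using pq by simp
  next
    case False
    then have "\<zeta> = 0" using True by simp
    then have "d = 0" using d n2 by (simp add: power_0_left)
    then show ?thesis by simp
  qed
  then have "C1 * (p * g a * d) = 0" by (simp add: mult.assoc mult.left_commute[of p])
  moreover have "0 \<le> C0 / 2 * (q * G a * (\<zeta> ^ n * \<kappa>))" using C pq G_nonneg \<zeta> \<kappa> by simp
  moreover have "0 \<le> C0 / 2 * (G (k * (real n * L / \<delta>)) / k\<^sup>2) * (e * \<kappa> * (if 0 < \<zeta> then 1 else 0))"
    using C pq G_nonneg \<kappa> k by simp
  ultimately show ?thesis by linarith
next
  case False
  then have z: "0 < \<zeta>" and q: "0 < q" using \<zeta> pq by auto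
  define b where "b = p / q * (real n * L) / \<zeta>"
  have b0: "0 \<le> b" using pq L z by (simp add: b_def)
  have zn: "\<zeta> ^ n = \<zeta> ^ (n - 1) * \<zeta>" using n2 by (cases n) auto
  have "p * g a * d \<le> p * g a * (real n * L * \<zeta> ^ (n - 1) * \<kappa>)"
    using d pq g_nonneg[OF a] by (intro mult_left_mono) auto
  also have "\<dots> = q * \<zeta> ^ n * \<kappa> * (g a * b)"
    using z q unfolding zn b_def by (simp add: field_simps)
  also have "\<dots> \<le> q * \<zeta> ^ n * \<kappa> * (\<delta> * real n * (G a + G (b / \<delta>)))"
    using q z \<kappa> by (intro mult_left_mono young a b0 \<delta>) auto
  finally have 1: "p * g a * d \<le> \<delta> * real n * (q * G a * (\<zeta> ^ n * \<kappa>) + q * \<zeta> ^ n * \<kappa> * G (b / \<delta>))"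
    by (simp add: algebra_simps)
  define c where "c = p / (q * k)"
  have c: "0 \<le> c" "c \<le> 1" using pq q k by (auto simp: c_def field_simps)
  let ?m = "k * (real n * L / \<delta>)"
  have m: "0 \<le> ?m" using k L \<delta> by simp
  have b\<delta>: "b / \<delta> = (1 / \<zeta>) * (c * ?m)" using k by (simp add: b_def c_def field_simps)
  have "G (b / \<delta>) \<le> (1 / \<zeta>) ^ n * G (c * ?m)"
    unfolding b\<delta> by (rule G_scale_up[OF _ mult_nonneg_nonneg[OF c(1) m]]) (use z \<zeta> in simp)
  also have "\<dots> \<le> (1 / \<zeta>) ^ n * (c\<^sup>2 * G ?m)"
    using z by (intro mult_left_mono G_scale_down c m) auto
  finally have "\<zeta> ^ n * G (b / \<delta>) \<le> c\<^sup>2 * G ?m" using z by (simp add: field_simps power_divide)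
  then have "q * \<kappa> * (\<zeta> ^ n * G (b / \<delta>)) \<le> q * \<kappa> * (c\<^sup>2 * G ?m)"
    using q \<kappa> by (intro mult_left_mono) auto
  also have "\<dots> = (p\<^sup>2 / q) * (G ?m / k\<^sup>2) * \<kappa>" using q by (simp add: c_def power2_eq_square field_simps)
  also have "\<dots> \<le> e * (G ?m / k\<^sup>2) * \<kappa>"
    using pq q G_nonneg \<kappa> by (intro mult_right_mono) (auto simp: field_simps)
  finally have 2: "q * \<zeta> ^ n * \<kappa> * G (b / \<delta>) \<le> G ?m / k\<^sup>2 * (e * \<kappa>)" by (simp add: mult_ac)
  have X: "0 \<le> q * G a * (\<zeta> ^ n * \<kappa>) + G ?m / k\<^sup>2 * (e * \<kappa>)" using q z \<kappa> G_nonneg pq by simp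
  have "C1 * (p * g a * d) \<le> C1 * (\<delta> * real n * (q * G a * (\<zeta> ^ n * \<kappa>) + G ?m / k\<^sup>2 * (e * \<kappa>)))"
    using 1 2 C \<delta> by (intro mult_left_mono order_trans[OF 1] add_left_mono) auto
  also have "\<dots> = (C1 * \<delta> * real n) * (q * G a * (\<zeta> ^ n * \<kappa>) + G ?m / k\<^sup>2 * (e * \<kappa>))" by simp
  also have "\<dots> \<le> C0 / 2 * (q * G a * (\<zeta> ^ n * \<kappa>) + G ?m / k\<^sup>2 * (e * \<kappa>))"
    using \<delta>(2) X by (rule mult_right_mono)
  finally show ?thesis using z by (simp add: distrib_left)
qed

end

text \<open>A truncated paraboloid supported in the ball of radius \<open>s\<close> but normalized
  by \<open>r\<close>: while \<open>s\<close> runs through the shrinking radii of the iteration, the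
  gradient bound \<open>2 / r\<close> stays the same. It is not 1 on a smaller ball; a lower bound
  there is enough.\<close>

definition ball_cutoff :: "'a::euclidean_space \<Rightarrow> real \<Rightarrow> real \<Rightarrow> 'a \<Rightarrow> real" where
  "ball_cutoff x0 s r x = max 0 ((s\<^sup>2 - (x - x0) \<bullet> (x - x0)) / r\<^sup>2)"

lemma ball_cutoff_range:
  assumes "0 < s" "s \<le> r"
  shows "0 \<le> ball_cutoff x0 s r x" "ball_cutoff x0 s r x \<le> 1" "0 < ball_cutoff x0 s r x \<longleftrightarrow> x \<in> ball x0 s"
proof -
  show "0 \<le> ball_cutoff x0 s r x" by (simp add: ball_cutoff_def)
  have "s\<^sup>2 \<le> r\<^sup>2" using assms by (intro power_mono) auto
  then have "s\<^sup>2 - (x - x0) \<bullet> (x - x0) \<le> r\<^sup>2" using inner_ge_zero[of "x - x0"] by linarith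
  then show "ball_cutoff x0 s r x \<le> 1" using assms by (simp add: ball_cutoff_def divide_le_eq)
  have "0 < ball_cutoff x0 s r x \<longleftrightarrow> (norm (x - x0))\<^sup>2 < s\<^sup>2"
    using assms by (auto simp: ball_cutoff_def less_max_iff_disj zero_less_divide_iff dot_square_norm)
  also have "\<dots> \<longleftrightarrow> norm (x - x0) < s" using assms by (auto intro: power2_less_imp_less power_strict_mono)
  finally show "0 < ball_cutoff x0 s r x \<longleftrightarrow> x \<in> ball x0 s" by (simp add: dist_norm norm_minus_commute)
qed

lemma continuous_on_ball_cutoff [continuous_intros]:
  "continuous_on S f \<Longrightarrow> continuous_on S (\<lambda>x. ball_cutoff x0 s r (f x))"
  unfolding ball_cutoff_def divide_inverse by (intro continuous_intros)

definition cutoff :: "nat \<Rightarrow> real ^ 'n::finite \<Rightarrow> real \<Rightarrow> real \<Rightarrow> (real \<Rightarrow> real) \<Rightarrow> 'n space_time \<Rightarrow> real" where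
  "cutoff n x0 s r \<tau> z = ball_cutoff x0 s r (fst z) ^ n * \<tau> (snd z)"

definition cutoff_grad :: "nat \<Rightarrow> real ^ 'n::finite \<Rightarrow> real \<Rightarrow> real \<Rightarrow> (real \<Rightarrow> real) \<Rightarrow> (real \<Rightarrow> real) \<Rightarrow> 'n space_time \<Rightarrow> 'n space_time" where
  "cutoff_grad n x0 s r \<tau> \<tau>' z =
     ((- (2 * real n / r\<^sup>2) * ball_cutoff x0 s r (fst z) ^ (n - 1) * \<tau> (snd z)) *\<^sub>R (fst z - x0),
      ball_cutoff x0 s r (fst z) ^ n * \<tau>' (snd z))"

lemma cutoff_C1_compact:
  fixes x0 :: "real ^ 'n::finite"
  assumes n: "2 \<le> n" and s: "0 < s" "s \<le> r"
    and \<tau>: "\<And>t. (\<tau> has_real_derivative \<tau>' t) (at t)" "continuous_on UNIV \<tau>'"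
    and supp: "\<And>t. t \<notin> {tb..te} \<Longrightarrow> \<tau> t = 0"
  shows "C1_compact (cutoff n x0 s r \<tau>) (cutoff_grad n x0 s r \<tau> \<tau>')"
    and "closure {z. cutoff n x0 s r \<tau> z \<noteq> 0} \<subseteq> cball x0 s \<times> {tb..te}"
proof -
  have "{z. cutoff n x0 s r \<tau> z \<noteq> 0} \<subseteq> cball x0 s \<times> {tb..te}"
  proof
    fix z assume "z \<in> {z. cutoff n x0 s r \<tau> z \<noteq> 0}"
    then have "ball_cutoff x0 s r (fst z) \<noteq> 0" "\<tau> (snd z) \<noteq> 0" using n by (auto simp: cutoff_def)
    then have "fst z \<in> ball x0 s" "snd z \<in> {tb..te}"
      using ball_cutoff_range(1,3)[OF s, of x0 "fst z"] supp[of "snd z"] by fastforce+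
    then show "z \<in> cball x0 s \<times> {tb..te}" by (simp add: mem_Times_iff)
  qed
  moreover have "compact (cball x0 s \<times> {tb..te})" by (intro compact_Times compact_cball compact_Icc)
  ultimately show cl: "closure {z. cutoff n x0 s r \<tau> z \<noteq> 0} \<subseteq> cball x0 s \<times> {tb..te}"
    by (intro closure_minimal compact_imp_closed)
  show "C1_compact (cutoff n x0 s r \<tau>) (cutoff_grad n x0 s r \<tau> \<tau>')"
    unfolding C1_compact_def
  proof (intro conjI allI)
    have "bounded (cball x0 s \<times> {tb..te})" by (intro bounded_Times bounded_cball bounded_closed_interval)
    then show "bounded {z. cutoff n x0 s r \<tau> z \<noteq> 0}"
      by (rule bounded_subset) (rule order_trans[OF closure_subset cl])
    have c\<tau>: "continuous_on UNIV \<tau>" by (rule continuous_at_imp_continuous_on) (use \<tau>(1) DERIV_isCont in blast)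
    show "continuous_on UNIV (cutoff_grad n x0 s r \<tau> \<tau>')"
      unfolding cutoff_grad_def[abs_def]
      by (intro continuous_intros continuous_on_compose2[OF c\<tau>] continuous_on_compose2[OF \<tau>(2)]) auto
    fix z :: "'n space_time"
    have 1: "GDERIV (\<lambda>z. (s\<^sup>2 - (fst z - x0) \<bullet> (fst z - x0)) / r\<^sup>2) z :> ((- 2 / r\<^sup>2) *\<^sub>R (fst z - x0), 0::real)"
    proof -
      have "((\<lambda>z. s\<^sup>2 - (fst z - x0) \<bullet> (fst z - x0)) has_derivative (\<lambda>h. - 2 * (fst h \<bullet> (fst z - x0)))) (at z)"
        by (auto intro!: derivative_eq_intros simp: inner_commute inner_diff_left inner_diff_right)
      from has_derivative_mult_left[OF this, of "inverse (r\<^sup>2)"]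
      show ?thesis unfolding gderiv_def by (simp add: inner_prod_def divide_inverse mult_ac)
    qed
    have 2: "GDERIV (\<lambda>z. \<tau> (snd z)) z :> (0 :: real ^ 'n, \<tau>' (snd z))"
    proof -
      have "((\<lambda>z::'n space_time. snd z) has_derivative snd) (at z)" by (auto intro!: derivative_eq_intros)
      from has_derivative_compose[OF this \<tau>(1)[of "snd z", unfolded has_field_derivative_def]]
      show ?thesis unfolding gderiv_def by (simp add: inner_prod_def mult.commute)
    qed
    from GDERIV_mult[OF GDERIV_pos_part_power[OF 1 n] 2]
    show "GDERIV (cutoff n x0 s r \<tau>) z :> cutoff_grad n x0 s r \<tau> \<tau>' z"
      unfolding cutoff_def[abs_def] cutoff_grad_def ball_cutoff_def
      by (rule GDERIV_subst) (simp add: prod_eq_iff field_simps)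
  qed
qed

lemma cutoff_grad_bound:
  assumes s: "0 < s" "s \<le> r" and \<tau>: "0 \<le> \<tau> (snd z)" and n: "2 \<le> n"
  shows "norm (fst (cutoff_grad n x0 s r \<tau> \<tau>' z)) \<le> real n * (2 / r) * ball_cutoff x0 s r (fst z) ^ (n - 1) * \<tau> (snd z)"
proof (cases "fst z \<in> ball x0 s")
  case True
  then have le: "norm (fst z - x0) \<le> r" using s by (simp add: dist_norm norm_minus_commute)
  have "norm (fst (cutoff_grad n x0 s r \<tau> \<tau>' z)) = (2 * real n / r\<^sup>2) * ball_cutoff x0 s r (fst z) ^ (n - 1) * \<tau> (snd z) * norm (fst z - x0)"
    using \<tau> ball_cutoff_range(1)[OF s, of x0 "fst z"] by (simp add: cutoff_grad_def abs_mult)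
  also have "\<dots> \<le> (2 * real n / r\<^sup>2) * ball_cutoff x0 s r (fst z) ^ (n - 1) * \<tau> (snd z) * r"
    using \<tau> ball_cutoff_range(1)[OF s, of x0 "fst z"] by (intro mult_left_mono le) auto
  also have "\<dots> = real n * (2 / r) * ball_cutoff x0 s r (fst z) ^ (n - 1) * \<tau> (snd z)"
    using s by (simp add: power2_eq_square field_simps)
  finally show ?thesis .
next
  case False
  then have "ball_cutoff x0 s r (fst z) = 0" using ball_cutoff_range[OF s, of x0 "fst z"] by linarith
  then have "ball_cutoff x0 s r (fst z) ^ (n - 1) = 0" using n by (simp add: power_0_left)
  then show ?thesis by (simp only: cutoff_grad_def fst_conv mult_zero_left mult_zero_right scaleR_zero_left norm_zero order_refl)
qed

section \<open>Superlevel sets and difference quotients\<close>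

lemma lborel_integral_product:
  fixes \<phi> :: "'a::euclidean_space \<Rightarrow> real" and \<psi> :: "'b::euclidean_space \<Rightarrow> real"
  assumes \<phi>: "integrable lborel \<phi>" and \<psi>: "integrable lborel \<psi>"
  shows "integrable lborel (\<lambda>z. \<phi> (fst z) * \<psi> (snd z))"
    and "(\<integral>z. \<phi> (fst z) * \<psi> (snd z) \<partial>lborel) = (\<integral>x. \<phi> x \<partial>lborel) * (\<integral>y. \<psi> y \<partial>lborel)"
proof -
  note [measurable] = borel_measurable_integrable[OF \<phi>] borel_measurable_integrable[OF \<psi>]
  have i: "integrable (lborel \<Otimes>\<^sub>M lborel) (\<lambda>z. \<phi> (fst z) * \<psi> (snd z))"
  proof (rule lborel_pair.Fubini_integrable)
    show "(\<lambda>z. \<phi> (fst z) * \<psi> (snd z)) \<in> borel_measurable (lborel \<Otimes>\<^sub>M lborel)" by measurable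
    show "integrable lborel (\<lambda>x. \<integral>y. norm (\<phi> (fst (x, y)) * \<psi> (snd (x, y))) \<partial>lborel)"
      using \<phi> by (simp add: abs_mult)
    show "AE x in lborel. integrable lborel (\<lambda>y. \<phi> (fst (x, y)) * \<psi> (snd (x, y)))"
      using \<psi> by simp
  qed
  then show "integrable lborel (\<lambda>z. \<phi> (fst z) * \<psi> (snd z))" by (simp add: lborel_prod)
  have "(\<integral>z. \<phi> (fst z) * \<psi> (snd z) \<partial>lborel) = (\<integral>x. \<integral>y. \<phi> x * \<psi> y \<partial>lborel \<partial>lborel)"
    using lborel_pair.integral_fst'[OF i] by (simp add: lborel_prod)
  also have "\<dots> = (\<integral>x. \<phi> x \<partial>lborel) * (\<integral>y. \<psi> y \<partial>lborel)" by simp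
  finally show "(\<integral>z. \<phi> (fst z) * \<psi> (snd z) \<partial>lborel) = (\<integral>x. \<phi> x \<partial>lborel) * (\<integral>y. \<psi> y \<partial>lborel)" .
qed

text \<open>
  The substitute for a Sobolev inequality: at the scale \<open>\<rho>\<close> at which spatial averages of \<open>f\<close> drop below
  half the level \<open>s\<close>, the superlevel set is controlled by the difference quotients of \<open>f\<close>.
\<close>

lemma superlevel_measure_estimate:
  fixes f :: "'n::finite space_time \<Rightarrow> real"
  assumes f [measurable]: "f \<in> borel_measurable borel" and f0: "\<And>z. 0 \<le> f z" and fi: "integrable lborel f"
    and \<rho>: "0 < \<rho>" and X: "0 \<le> X"
    and shift: "\<And>y. (\<integral>z. \<bar>f (z + (y, 0)) - f z\<bar> \<partial>lborel) \<le> norm y * X"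
    and slice: "\<And>t. (\<integral>\<^sup>+x. ennreal (f (x, t)) \<partial>lborel) \<le> ennreal Y" and Y: "0 \<le> Y"
    and S [measurable]: "S \<in> sets borel" and Ss: "\<And>z. z \<in> S \<Longrightarrow> s \<le> f z" and s: "0 < s"
    and small: "Y \<le> s / 2 * measure lborel (ball (0 :: real ^ 'n) \<rho>)"
  shows "measure lborel S * (s / 2) \<le> \<rho> * X"
proof -
  let ?B = "ball (0 :: real ^ 'n) \<rho>"
  define m where "m = measure lborel ?B"
  have m0: "0 < m" unfolding m_def using \<rho> by (rule content_ball_pos)
  have mB: "emeasure lborel ?B = ennreal m"
    unfolding m_def by (rule emeasure_eq_ennreal_measure) (use emeasure_lborel_ball_finite[of "0 :: real ^ 'n" \<rho>] in simp)
  let ?P = "\<lambda>z. \<integral>\<^sup>+y. indicator ?B y * ennreal \<bar>f (z + (y, 0)) - f z\<bar> \<partial>lborel"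
  have m1: "(\<lambda>(z, y). indicator ?B y * ennreal \<bar>f (z + (y, 0)) - f z\<bar>) \<in> borel_measurable (lborel \<Otimes>\<^sub>M lborel)"
  proof -
    have "(\<lambda>p :: 'n space_time \<times> (real ^ 'n). fst p + (snd p, 0)) \<in> borel_measurable borel"
      by (intro borel_measurable_continuous_onI continuous_intros)
    then have "(\<lambda>p :: 'n space_time \<times> (real ^ 'n). f (fst p + (snd p, 0))) \<in> borel_measurable borel"
      by (rule measurable_compose[OF _ f])
    moreover have "(\<lambda>p :: 'n space_time \<times> (real ^ 'n). f (fst p)) \<in> borel_measurable borel"
      by (rule measurable_compose[OF _ f]) (intro borel_measurable_continuous_onI continuous_intros)
    moreover have "(\<lambda>p :: 'n space_time \<times> (real ^ 'n). indicator ?B (snd p) :: ennreal) \<in> borel_measurable borel"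
    proof (rule measurable_compose[of snd _ borel])
      show "snd \<in> borel_measurable (borel :: ('n space_time \<times> (real ^ 'n)) measure)"
        by (intro borel_measurable_continuous_onI continuous_on_snd continuous_on_id)
    qed (rule borel_measurable_indicator, simp)
    ultimately have "(\<lambda>p :: 'n space_time \<times> (real ^ 'n). indicator ?B (snd p) * ennreal \<bar>f (fst p + (snd p, 0)) - f (fst p)\<bar>) \<in> borel_measurable borel"
      by measurable
    then show ?thesis by (simp add: lborel_prod case_prod_beta')
  qed
  \<comment> \<open>Integrating in \<open>z\<close> first, each shift \<open>y\<close> of length
    below \<open>\<rho>\<close> contributes at most \<open>\<rho> * X\<close>.\<close>
  have up: "(\<integral>\<^sup>+z. ?P z \<partial>lborel) \<le> ennreal (m * (\<rho> * X))"
  proof -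
    have "(\<integral>\<^sup>+z. ?P z \<partial>lborel) = (\<integral>\<^sup>+y. (\<integral>\<^sup>+z. indicator ?B y * ennreal \<bar>f (z + (y, 0)) - f z\<bar> \<partial>lborel) \<partial>lborel)"
      by (rule lborel_pair.Fubini'[OF m1, symmetric])
    also have "\<dots> \<le> (\<integral>\<^sup>+y. ennreal (\<rho> * X) * indicator ?B y \<partial>lborel)"
    proof (rule nn_integral_mono)
      fix y :: "real ^ 'n"
      show "(\<integral>\<^sup>+z. indicator ?B y * ennreal \<bar>f (z + (y, 0)) - f z\<bar> \<partial>lborel) \<le> ennreal (\<rho> * X) * indicator ?B y"
      proof (cases "y \<in> ?B")
        case True
        have i: "integrable lborel (\<lambda>z. \<bar>f (z + (y, 0)) - f z\<bar>)"
          by (intro integrable_abs Bochner_Integration.integrable_diff integrable_lborel_translate fi)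
        have "(\<integral>\<^sup>+z. ennreal \<bar>f (z + (y, 0)) - f z\<bar> \<partial>lborel) = ennreal (\<integral>z. \<bar>f (z + (y, 0)) - f z\<bar> \<partial>lborel)"
          by (rule nn_integral_eq_integral[OF i]) simp
        also have "\<dots> \<le> ennreal (\<rho> * X)"
        proof (rule ennreal_leI)
          have "norm y * X \<le> \<rho> * X" using True X by (intro mult_right_mono) auto
          then show "(\<integral>z. \<bar>f (z + (y, 0)) - f z\<bar> \<partial>lborel) \<le> \<rho> * X" using shift[of y] by linarith
        qed
        finally show ?thesis using True by simp
      qed simp
    qed
    also have "\<dots> = ennreal (\<rho> * X) * ennreal m" by (subst nn_integral_cmult_indicator) (simp_all add: mB)
    also have "\<dots> = ennreal (m * (\<rho> * X))" using X \<rho> m0 by (simp add: ennreal_mult[symmetric] mult.commute)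
    finally show ?thesis .
  qed
  \<comment> \<open>At a point of \<open>S\<close> the value \<open>s\<close> is split into the
    oscillation and the shifted value of \<open>f\<close>. The shifted values integrate to at most
    the slice bound \<open>Y\<close>, that is to half of \<open>s * m\<close>, so the oscillation
    accounts for the other half.\<close>
  have low: "ennreal (s * m / 2) \<le> ?P z" if z: "z \<in> S" for z
  proof -
    have "ennreal (s * m) = (\<integral>\<^sup>+y. ennreal s * indicator ?B y \<partial>lborel)"
      using s m0 by (subst nn_integral_cmult_indicator) (simp_all add: mB ennreal_mult)
    also have "\<dots> \<le> (\<integral>\<^sup>+y. indicator ?B y * ennreal \<bar>f (z + (y, 0)) - f z\<bar> + ennreal (f (z + (y, 0))) \<partial>lborel)"
    proof (rule nn_integral_mono)
      fix y :: "real ^ 'n"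
      have "s \<le> \<bar>f (z + (y, 0)) - f z\<bar> + f (z + (y, 0))" using Ss[OF z] by linarith
      then have "ennreal s \<le> ennreal \<bar>f (z + (y, 0)) - f z\<bar> + ennreal (f (z + (y, 0)))"
        using f0 by (simp add: ennreal_plus[symmetric] ennreal_leI del: ennreal_plus)
      then show "ennreal s * indicator ?B y \<le> indicator ?B y * ennreal \<bar>f (z + (y, 0)) - f z\<bar> + ennreal (f (z + (y, 0)))"
        by (cases "y \<in> ?B") auto
    qed
    also have "\<dots> = ?P z + (\<integral>\<^sup>+y. ennreal (f (z + (y, 0))) \<partial>lborel)"
    proof (rule nn_integral_add)
      have "(\<lambda>y. z + (y, 0::real)) \<in> borel_measurable borel" by (intro borel_measurable_continuous_onI continuous_intros)
      from measurable_compose[OF this f] have mf [measurable]: "(\<lambda>y. f (z + (y, 0))) \<in> borel_measurable borel" .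
      have [measurable]: "?B \<in> sets borel" by simp
      show "(\<lambda>y. indicator ?B y * ennreal \<bar>f (z + (y, 0)) - f z\<bar>) \<in> borel_measurable lborel" by measurable
      show "(\<lambda>y. ennreal (f (z + (y, 0)))) \<in> borel_measurable lborel" by measurable
    qed
    also have "(\<integral>\<^sup>+y. ennreal (f (z + (y, 0))) \<partial>lborel) = (\<integral>\<^sup>+x. ennreal (f (x, snd z)) \<partial>lborel)"
    proof -
      have "(\<lambda>x. (x, snd z)) \<in> borel_measurable (borel :: (real ^ 'n) measure)" by (intro borel_measurable_continuous_onI continuous_intros)
      note [measurable] = measurable_compose[OF this f]
      have "z + (y, 0) = (y + fst z, snd z)" for y by (simp add: prod_eq_iff)
      then show ?thesis using nn_integral_lborel_translate[of "\<lambda>x. ennreal (f (x, snd z))" "fst z"] by simp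
    qed
    also have "?P z + (\<integral>\<^sup>+x. ennreal (f (x, snd z)) \<partial>lborel) \<le> ?P z + ennreal (s * m / 2)"
    proof (intro add_left_mono order_trans[OF slice] ennreal_leI)
      show "Y \<le> s * m / 2" using small by (simp add: m_def)
    qed
    finally have "ennreal (s * m) \<le> ?P z + ennreal (s * m / 2)" .
    moreover have "ennreal (s * m) = ennreal (s * m / 2) + ennreal (s * m / 2)"
      using s m0 by (subst ennreal_plus[symmetric]) auto
    ultimately have "ennreal (s * m / 2) + ennreal (s * m / 2) \<le> ?P z + ennreal (s * m / 2)"
      by simp
    then show ?thesis by (simp add: ennreal_add_left_cancel_le add.commute)
  qed
  have "ennreal (s * m / 2) * emeasure lborel S = (\<integral>\<^sup>+z. ennreal (s * m / 2) * indicator S z \<partial>lborel)"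
    by (rule nn_integral_cmult_indicator[symmetric]) simp
  also have "\<dots> \<le> (\<integral>\<^sup>+z. ?P z \<partial>lborel)"
    by (rule nn_integral_mono) (use low in \<open>auto simp: indicator_def\<close>)
  also note up
  finally have main: "ennreal (s * m / 2) * emeasure lborel S \<le> ennreal (m * (\<rho> * X))" .
  have "emeasure lborel S \<noteq> \<infinity>"
  proof
    assume "emeasure lborel S = \<infinity>"
    then have "ennreal (s * m / 2) * emeasure lborel S = \<infinity>"
      using s m0 by (simp add: ennreal_mult_eq_top_iff)
    then show False using main by (simp add: top_unique)
  qed
  then have eS: "emeasure lborel S = ennreal (measure lborel S)" by (intro emeasure_eq_ennreal_measure) simp
  have "ennreal (s * m / 2 * measure lborel S) \<le> ennreal (m * (\<rho> * X))"
    using main s m0 unfolding eS by (subst ennreal_mult) auto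
  then have "s * m / 2 * measure lborel S \<le> m * (\<rho> * X)"
    using X \<rho> m0 by (subst (asm) ennreal_le_iff) auto
  then have "m * (measure lborel S * (s / 2)) \<le> m * (\<rho> * X)" by (simp add: mult_ac)
  then show ?thesis using m0 by simp
qed

text \<open>A monotone continuously differentiable transition from 0 to 1 on the unit interval: the
  inner squared positive part flattens it at 1, the outer one at 0.\<close>

definition smooth_step :: "real \<Rightarrow> real" where
  "smooth_step x = (max 0 (1 - (max 0 (1 - x))\<^sup>2))\<^sup>2"

lemma smooth_step_range: "0 \<le> smooth_step x" "smooth_step x \<le> 1"
proof -
  show "0 \<le> smooth_step x" by (simp add: smooth_step_def)
  have "max 0 (1 - (max 0 (1 - x))\<^sup>2) \<le> 1" by simp
  then show "smooth_step x \<le> 1" unfolding smooth_step_def by (intro power_le_one) auto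
qed

lemma smooth_step_eq: "1 \<le> x \<Longrightarrow> smooth_step x = 1" "x \<le> 0 \<Longrightarrow> smooth_step x = 0"
proof -
  show "1 \<le> x \<Longrightarrow> smooth_step x = 1" by (simp add: smooth_step_def)
  assume "x \<le> 0"
  then have "1\<^sup>2 \<le> (max 0 (1 - x))\<^sup>2" by (intro power_mono) auto
  then show "smooth_step x = 0" by (simp add: smooth_step_def)
qed

lemma smooth_step_DERIV:
  "(smooth_step has_real_derivative (4 * max 0 (1 - (max 0 (1 - x))\<^sup>2) * max 0 (1 - x))) (at x)"
proof -
  have "((\<lambda>x. 1 - x) has_real_derivative - 1) (at x)"
    by (auto intro!: derivative_eq_intros)
  note d1 = DERIV_chain2[OF DERIV_pos_part_power[of 2] this]
  have "((\<lambda>x. 1 - max 0 (1 - x) ^ 2) has_real_derivative 0 - real 2 * max 0 (1 - x) ^ (2 - 1) * - 1) (at x)"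
    by (rule DERIV_diff[OF DERIV_const d1]) simp
  from DERIV_chain2[OF DERIV_pos_part_power[of 2] this]
  show ?thesis unfolding smooth_step_def[abs_def] by (simp add: mult.assoc)
qed

lemma top_cutoff:
  fixes a b :: real
  assumes "a < b"
  obtains \<theta> \<theta>' where "\<forall>t. (\<theta> has_real_derivative \<theta>' t) (at t)" "continuous_on UNIV \<theta>'"
    "\<forall>t. 0 \<le> \<theta> t \<and> \<theta> t \<le> 1 \<and> \<theta>' t \<le> 0" "\<forall>t\<le>a. \<theta> t = 1" "\<forall>t\<ge>b. \<theta> t = 0"
    "\<forall>t. t \<notin> {a..b} \<longrightarrow> \<theta>' t = 0"
proof -
  let ?y = "\<lambda>t. (b - t) / (b - a)"
  let ?\<theta> = "\<lambda>t. smooth_step (?y t)"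
  let ?\<theta>' = "\<lambda>t. 4 * max 0 (1 - (max 0 (1 - ?y t))\<^sup>2) * max 0 (1 - ?y t) * (- 1 / (b - a))"
  have d: "(?\<theta> has_real_derivative ?\<theta>' t) (at t)" for t
  proof -
    have "(?y has_real_derivative - 1 / (b - a)) (at t)"
      using assms by (auto intro!: derivative_eq_intros simp: divide_simps)
    from DERIV_chain2[OF smooth_step_DERIV this] show ?thesis .
  qed
  show thesis
  proof (rule that[of ?\<theta> ?\<theta>'])
    show "\<forall>t. (?\<theta> has_real_derivative ?\<theta>' t) (at t)" using d by blast
    show "continuous_on UNIV ?\<theta>'" using assms by (intro continuous_intros) auto
    have "?\<theta>' t \<le> 0" for t
      by (rule mult_nonneg_nonpos) (use assms in \<open>auto intro!: mult_nonneg_nonneg\<close>)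
    then show "\<forall>t. 0 \<le> ?\<theta> t \<and> ?\<theta> t \<le> 1 \<and> ?\<theta>' t \<le> 0" using smooth_step_range by simp
    show "\<forall>t\<le>a. ?\<theta> t = 1" using assms by (auto intro!: smooth_step_eq(1) simp: field_simps)
    show "\<forall>t\<ge>b. ?\<theta> t = 0" using assms by (auto intro!: smooth_step_eq(2) simp: divide_le_0_iff)
    have "?\<theta>' t = 0" if "t \<notin> {a..b}" for t
    proof (cases "t < a")
      case True
      then have "1 \<le> ?y t" using assms by (simp add: field_simps)
      then have "max 0 (1 - ?y t) = 0" by simp
      then show ?thesis by (simp only: mult_zero_left mult_zero_right)
    next
      case False
      then have "?y t \<le> 0" using that assms by (simp add: divide_le_0_iff)
      then have "1\<^sup>2 \<le> (max 0 (1 - ?y t))\<^sup>2" by (intro power_mono) auto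
      then have "max 0 (1 - (max 0 (1 - ?y t))\<^sup>2) = 0" by simp
      then show ?thesis by (simp only: mult_zero_left mult_zero_right)
    qed
    then show "\<forall>t. t \<notin> {a..b} \<longrightarrow> ?\<theta>' t = 0" by blast
  qed
qed

text \<open>\<open>- \<theta>'\<close> is a probability density on \<open>{a..b}\<close>; with
  \<open>b\<close> close to \<open>a\<close> it acts as an approximate point mass in time.\<close>

lemma top_cutoff_mass:
  fixes a b :: real
  assumes "a < b" and d: "\<forall>t. (\<theta> has_real_derivative \<theta>' t) (at t)" and c: "continuous_on UNIV \<theta>'"
    and v: "\<forall>t\<le>a. \<theta> t = 1" "\<forall>t\<ge>b. \<theta> t = 0" "\<forall>t. t \<notin> {a..b} \<longrightarrow> \<theta>' t = 0"
  shows "integrable lborel (\<lambda>t. - \<theta>' t)" "(\<integral>t. - \<theta>' t \<partial>lborel) = 1"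
proof -
  have "has_bochner_integral lborel (\<lambda>x. \<theta>' x * indicator {a..b} x) (\<theta> b - \<theta> a)"
    by (rule has_bochner_integral_FTC_Icc_real)
      (use assms(1) d c in \<open>auto simp: continuous_on_eq_continuous_at\<close>)
  moreover have "(\<lambda>x. \<theta>' x * indicator {a..b} x) = \<theta>'" using v(3) by (auto simp: indicator_def fun_eq_iff)
  ultimately have "has_bochner_integral lborel \<theta>' (- 1)" using v assms(1) by simp
  then show "integrable lborel (\<lambda>t. - \<theta>' t)" "(\<integral>t. - \<theta>' t \<partial>lborel) = 1"
    by (auto simp: has_bochner_integral_iff)
qed

section \<open>Energy estimates on cylinders\<close>

text \<open>The Young parameter \<open>\<delta>\<close> with
  \<open>C1 * \<delta> * n = C0 / 2\<close>, so that half of the coercive term survives the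
  absorption.\<close>

definition young_const :: "real \<Rightarrow> real \<Rightarrow> nat \<Rightarrow> real" where
  "young_const C0 C1 n = C0 / (2 * C1 * real n)"

text \<open>The power arises when \<open>G\<close> at \<open>(2 * n / \<delta>) * (k / r)\<close> is
  compared with \<open>G (k / r)\<close> by \<open>G_scale_up\<close>, whose factor has to be at
  least 1.\<close>

definition energy_const :: "real \<Rightarrow> real \<Rightarrow> nat \<Rightarrow> real" where
  "energy_const C0 C1 n = C0 / 2 * (max 1 (2 * real n / young_const C0 C1 n)) ^ n"

lemma energy_const_pos: "0 < C0 \<Longrightarrow> 0 < energy_const C0 C1 n"
proof -
  assume "0 < C0"
  moreover have "0 < (max 1 (2 * real n / young_const C0 C1 n)) ^ n" by (rule zero_less_power) simp
  ultimately show ?thesis unfolding energy_const_def by simp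
qed

locale local_solution = growth g0 g1 g n
  for g0 g1 :: real and g :: "real \<Rightarrow> real" and n :: nat +
  fixes C0 C1 :: real and u :: "'n::finite space_time \<Rightarrow> real" and K :: "'n space_time set" and V :: "'n space_time \<Rightarrow> real ^ 'n"
  assumes C0: "0 < C0" and C1: "0 < C1" and lg: "local_gradient C0 C1 g u K V"
    and K: "compact K" and cu: "continuous_on K u" and u0: "\<And>z. z \<in> K \<Longrightarrow> 0 \<le> u z"
begin

abbreviation "Ce \<equiv> energy_const C0 C1 n"

lemma Ce_pos: "0 < Ce" by (rule energy_const_pos[OF C0])

lemma mK [measurable]: "K \<in> sets borel"
  using K by (simp add: borel_closed compact_imp_closed)

lemma V_facts: "V \<in> borel_measurable borel" "integrable lborel V" "integrable lborel (\<lambda>z. G (norm (V z)))"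
  using lg unfolding local_gradient_def by auto

lemma V_meas [measurable]: "V \<in> borel_measurable borel" "(\<lambda>z. G (norm (V z))) \<in> borel_measurable borel"
  "(\<lambda>z. g (norm (V z))) \<in> borel_measurable borel"
  using V_facts(1) borel_measurable_integrable[OF V_facts(3)]
    continuous_nonneg_compose_measurable[OF growth_functionD(1)[OF gf] measurable_compose[OF V_facts(1) borel_measurable_norm]] by auto

lemma compose_bound:
  assumes "continuous_on {0..} (F :: real \<Rightarrow> real)"
  obtains B where "0 < B" "\<forall>z\<in>K. \<bar>F (u z)\<bar> \<le> B"
proof -
  have "continuous_on K (\<lambda>z. F (u z))"
    by (rule continuous_on_compose2[OF assms cu]) (use u0 in auto)
  then have "bounded ((\<lambda>z. F (u z)) ` K)" by (intro compact_imp_bounded compact_continuous_image K)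
  then show thesis using that unfolding bounded_pos by auto
qed

lemma compose_measurable:
  assumes F: "continuous_on {0..} (F :: real \<Rightarrow> real)" and [measurable]: "w \<in> borel_measurable borel" and wK: "\<And>z. z \<notin> K \<Longrightarrow> w z = (0::real)"
  shows "(\<lambda>z. F (u z) * w z) \<in> borel_measurable borel"
proof -
  have "continuous_on K (\<lambda>z. F (u z))"
    by (rule continuous_on_compose2[OF F cu]) (use u0 in auto)
  from borel_measurable_integrable[OF borel_integrable_compact[OF K this]]
  have [measurable]: "(\<lambda>z. indicator K z *\<^sub>R F (u z)) \<in> borel_measurable borel" by simp
  have eq: "F (u z) * w z = (indicator K z *\<^sub>R F (u z)) * w z" for z
    using wK[of z] by (cases "z \<in> K") auto
  show ?thesis unfolding eq by measurable
qed

lemma compose_integrable: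
  assumes F: "continuous_on {0..} (F :: real \<Rightarrow> real)" and w: "w \<in> borel_measurable borel" and wK: "\<And>z. z \<notin> K \<Longrightarrow> w z = (0::real)"
    and wB: "\<And>z. \<bar>w z\<bar> \<le> B"
  shows "integrable lborel (\<lambda>z. F (u z) * w z)"
proof -
  obtain Bf where Bf: "0 < Bf" "\<forall>z\<in>K. \<bar>F (u z)\<bar> \<le> Bf" by (rule compose_bound[OF F])
  have B0: "0 \<le> B" using wB[of undefined] by linarith
  show ?thesis
  proof (rule Bochner_Integration.integrable_bound)
    show "integrable lborel (\<lambda>z. (Bf * B) * indicator K z :: real)"
      by (intro integrable_mult_right) (use emeasure_compact_finite[OF K] in \<open>simp add: integrable_indicator_iff\<close>)
    show "(\<lambda>z. F (u z) * w z) \<in> borel_measurable lborel" using compose_measurable[OF F w wK] by simp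
    have "norm (F (u z) * w z) \<le> norm ((Bf * B) * indicator K z :: real)" for z
    proof (cases "z \<in> K")
      case True
      then have "\<bar>F (u z)\<bar> * \<bar>w z\<bar> \<le> Bf * B" using Bf wB[of z] B0 by (intro mult_mono) auto
      then show ?thesis using True Bf B0 by (simp add: abs_mult)
    qed (use wK[of z] in simp)
    then show "AE z in lborel. norm (F (u z) * w z) \<le> norm ((Bf * B) * indicator K z :: real)" by simp
  qed
qed

lemma compose_G_integrable:
  assumes F: "continuous_on {0..} (F :: real \<Rightarrow> real)" and w: "w \<in> borel_measurable borel" and wK: "\<And>z. z \<notin> K \<Longrightarrow> w z = (0::real)"
    and wB: "\<And>z. \<bar>w z\<bar> \<le> B"
  shows "integrable lborel (\<lambda>z. F (u z) * G (norm (V z)) * w z)"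
proof -
  obtain Bf where Bf: "0 < Bf" "\<forall>z\<in>K. \<bar>F (u z)\<bar> \<le> Bf" by (rule compose_bound[OF F])
  have B0: "0 \<le> B" using wB[of undefined] by linarith
  note [measurable] = compose_measurable[OF F w wK]
  have eq: "F (u z) * G (norm (V z)) * w z = (F (u z) * w z) * G (norm (V z))" for z by simp
  show ?thesis
  proof (rule Bochner_Integration.integrable_bound)
    show "integrable lborel (\<lambda>z. (Bf * B) * G (norm (V z)))" using V_facts(3) by simp
    show "(\<lambda>z. F (u z) * G (norm (V z)) * w z) \<in> borel_measurable lborel" unfolding eq by measurable
    have "norm (F (u z) * G (norm (V z)) * w z) \<le> norm ((Bf * B) * G (norm (V z)))" for z
    proof (cases "z \<in> K")
      case True
      then have "\<bar>F (u z)\<bar> * \<bar>w z\<bar> \<le> Bf * B" using Bf wB[of z] B0 by (intro mult_mono) auto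
      from mult_right_mono[OF this G_nonneg[of "norm (V z)"]]
      show ?thesis using Bf B0 G_nonneg[of "norm (V z)"] unfolding eq by (simp add: abs_mult)
    qed (use wK[of z] in simp)
    then show "AE z in lborel. norm (F (u z) * G (norm (V z)) * w z) \<le> norm ((Bf * B) * G (norm (V z)))" by simp
  qed
qed

lemma compact_support_bounded:
  fixes w :: "'n space_time \<Rightarrow> 'b::real_normed_vector"
  assumes "continuous_on UNIV w" "\<And>z. z \<notin> K \<Longrightarrow> w z = 0"
  obtains B where "0 < B" "\<forall>z. norm (w z) \<le> B"
proof -
  have "bounded (w ` K)" by (intro compact_imp_bounded compact_continuous_image K continuous_on_subset[OF assms(1)]) auto
  then obtain B where B: "0 < B" "\<forall>z\<in>K. norm (w z) \<le> B" unfolding bounded_pos by auto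
  have "norm (w z) \<le> B" for z using B assms(2)[of z] by (cases "z \<in> K") auto
  then show thesis using that B(1) by blast
qed

text \<open>
  The lower time cutoff is \<open>\<tau>\<close>, the upper one is \<open>\<theta>\<close>; since \<open>\<theta>\<close> is nonincreasing, its derivative
  contributes with a favourable sign and later yields the bound on time slices.
\<close>

lemma cutoff_energy:
  assumes k: "0 < k" and s: "0 < s" "s \<le> r" and sub: "cball x0 s \<times> {tb..te} \<subseteq> interior K"
    and \<Phi>: "\<forall>v\<ge>0. (\<Phi> has_real_derivative - p v) (at v)" and p: "\<forall>v\<ge>0. (p has_real_derivative - q v) (at v)"
    and q: "continuous_on {0..} q" and e: "continuous_on {0..} e"
    and sg: "\<forall>v\<ge>0. 0 \<le> p v \<and> 0 \<le> q v \<and> 0 \<le> e v \<and> 0 \<le> \<Phi> v \<and> p v \<le> k * q v \<and> (p v)\<^sup>2 \<le> e v * q v"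
    and \<tau>: "\<forall>t. (\<tau> has_real_derivative \<tau>' t) (at t)" "continuous_on UNIV \<tau>'" "\<forall>t. 0 \<le> \<tau> t" "\<forall>t<tb. \<tau> t = 0 \<and> \<tau>' t = 0"
    and \<theta>: "\<forall>t. (\<theta> has_real_derivative \<theta>' t) (at t)" "continuous_on UNIV \<theta>'" "\<forall>t. 0 \<le> \<theta> t \<and> \<theta> t \<le> 1 \<and> \<theta>' t \<le> 0"
      "\<forall>t\<ge>te. \<theta> t = 0" "\<forall>t>te. \<theta>' t = 0"
    and S: "S \<in> sets borel" "emeasure lborel S < \<infinity>" and M: "0 \<le> M"
    and bound: "\<forall>x\<in>ball x0 s. \<forall>t\<in>{tb..<te}. \<Phi> (u (x, t)) * ball_cutoff x0 s r x ^ n * \<tau>' t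
        + Ce * (G (k / r) / k\<^sup>2) * (e (u (x, t)) * \<tau> t) \<le> M * indicator S (x, t)"
  defines "\<eta> \<equiv> cutoff n x0 s r (\<lambda>t. \<tau> t * \<theta> t)"
  shows "C0 / 2 * (\<integral>z. q (u z) * G (norm (V z)) * \<eta> z \<partial>lborel)
     + (\<integral>z. \<Phi> (u z) * (ball_cutoff x0 s r (fst z) ^ n * \<tau> (snd z)) * (- \<theta>' (snd z)) \<partial>lborel) \<le> M * measure lborel S"
    and "integrable lborel (\<lambda>z. q (u z) * G (norm (V z)) * \<eta> z)" "\<forall>z. 0 \<le> q (u z) * G (norm (V z)) * \<eta> z"
    and "integrable lborel (\<lambda>z. \<Phi> (u z) * (ball_cutoff x0 s r (fst z) ^ n * \<tau> (snd z)) * (- \<theta>' (snd z)))"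
proof -
  define D\<eta> where "D\<eta> = cutoff_grad n x0 s r (\<lambda>t. \<tau> t * \<theta> t) (\<lambda>t. \<tau>' t * \<theta> t + \<theta>' t * \<tau> t)"
  let ?\<zeta> = "\<lambda>z. ball_cutoff x0 s r (fst z)"
  have c\<tau>: "continuous_on UNIV \<tau>" by (rule continuous_at_imp_continuous_on) (use \<tau>(1) DERIV_isCont in blast)
  have c\<theta>: "continuous_on UNIV \<theta>" by (rule continuous_at_imp_continuous_on) (use \<theta>(1) DERIV_isCont in blast)
  have \<tau>\<theta>: "((\<lambda>t. \<tau> t * \<theta> t) has_real_derivative \<tau>' t * \<theta> t + \<theta>' t * \<tau> t) (at t)" for t
    using DERIV_mult[OF \<tau>(1)[rule_format, of t] \<theta>(1)[rule_format, of t]] .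
  have zero: "\<tau> t * \<theta> t = 0" if "t \<notin> {tb..te}" for t using that \<tau>(4) \<theta>(4) by auto
  have C1c: "C1_compact \<eta> D\<eta>" and clos: "closure {z. \<eta> z \<noteq> 0} \<subseteq> cball x0 s \<times> {tb..te}"
    unfolding \<eta>_def D\<eta>_def
    by (rule cutoff_C1_compact[OF n2 s \<tau>\<theta>]; (intro continuous_intros \<tau>(2) \<theta>(2) c\<tau> c\<theta>)?; (rule zero)?; assumption?)+
  have clos': "closure {z. \<eta> z \<noteq> 0} \<subseteq> interior K" using clos sub by blast
  have \<eta>0: "0 \<le> \<eta> z" for z
    unfolding \<eta>_def cutoff_def using \<tau>(3) \<theta>(3)
    by (intro mult_nonneg_nonneg zero_le_power ball_cutoff_range(1)[OF s]) auto
  have inK: "z \<in> K" if "fst z \<in> cball x0 s" "snd z \<in> {tb..te}" for z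
    using sub interior_subset[of K] that by (metis mem_Times_iff subsetD)
  have \<zeta>0: "?\<zeta> z = 0" if "fst z \<notin> ball x0 s" for z using that ball_cutoff_range[OF s, of x0 "fst z"] by linarith
  have outball: "fst z \<notin> ball x0 s \<or> snd z \<notin> {tb..te}" if "z \<notin> K" for z
    using inK[of z] that by (meson ball_subset_cball subsetD)
  have cp: "continuous_on {0..} p" by (rule DERIV_nonneg_continuous_on) (use p in blast)
  have c\<Phi>: "continuous_on {0..} \<Phi>" by (rule DERIV_nonneg_continuous_on) (use \<Phi> in blast)
  have cfst: "continuous_on UNIV (fst :: 'n space_time \<Rightarrow> _)" and csnd: "continuous_on UNIV (snd :: 'n space_time \<Rightarrow> _)"
    by (intro continuous_intros)+
  note cont = continuous_on_compose2[OF c\<tau> csnd] continuous_on_compose2[OF c\<theta> csnd] continuous_on_compose2[OF \<tau>(2) csnd]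
    continuous_on_compose2[OF \<theta>(2) csnd]
  \<comment> \<open>In \<open>w1\<close> the time derivative falls on the lower cutoff, in
    \<open>w2\<close> on the upper one with its sign turned; \<open>w3\<close> carries the error of
    the absorption.\<close>
  define w1 where "w1 z = ?\<zeta> z ^ n * \<tau>' (snd z) * \<theta> (snd z)" for z
  define w2 where "w2 z = (?\<zeta> z ^ n * \<tau> (snd z)) * (- \<theta>' (snd z))" for z
  define w3 where "w3 z = indicator (ball x0 s) (fst z) * (\<tau> (snd z) * \<theta> (snd z))" for z
  have z1: "w1 z = 0" if "z \<notin> K" for z
    using outball[OF that] \<zeta>0[of z] n2 \<tau>(4) \<theta>(4) by (auto simp: w1_def)
  have z2: "w2 z = 0" if "z \<notin> K" for z
    using outball[OF that] \<zeta>0[of z] n2 \<tau>(4) \<theta>(5) by (auto simp: w2_def)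
  have z3: "w3 z = 0" if "z \<notin> K" for z
    using outball[OF that] zero by (auto simp: w3_def)
  have z\<eta>: "\<eta> z = 0" if "z \<notin> K" for z
    using outball[OF that] zero \<zeta>0[of z] n2 by (auto simp: \<eta>_def cutoff_def)
  have c1: "continuous_on UNIV w1" "continuous_on UNIV w2"
    unfolding w1_def[abs_def] w2_def[abs_def] by (intro continuous_intros cont; simp)+
  obtain B1 where B1: "0 < B1" "\<forall>z. norm (w1 z) \<le> B1" by (rule compact_support_bounded[OF c1(1) z1])
  obtain B2 where B2: "0 < B2" "\<forall>z. norm (w2 z) \<le> B2" by (rule compact_support_bounded[OF c1(2) z2])
  obtain B\<eta> where B\<eta>: "0 < B\<eta>" "\<forall>z. norm (\<eta> z) \<le> B\<eta>" by (rule compact_support_bounded[OF C1_compact_continuous[OF C1c] z\<eta>])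
  have cw3: "continuous_on K (\<lambda>z. \<tau> (snd z) * \<theta> (snd z))"
    by (intro continuous_on_mult continuous_on_subset[OF cont(1)] continuous_on_subset[OF cont(2)]) auto
  obtain B3 where B3: "0 < B3" "\<forall>z\<in>K. norm (\<tau> (snd z) * \<theta> (snd z)) \<le> B3"
    using compact_imp_bounded[OF compact_continuous_image[OF cw3 K]] unfolding bounded_pos by auto
  have B3': "\<bar>w3 z\<bar> \<le> B3" for z
  proof (cases "z \<in> K")
    case True
    then show ?thesis using B3(1) B3(2)[rule_format, of z] by (cases "fst z \<in> ball x0 s") (auto simp: w3_def)
  qed (use z3 B3 in simp)
  have mball: "(\<lambda>z :: 'n space_time. indicator (ball x0 s) (fst z) :: real) \<in> borel_measurable borel"
  proof (rule measurable_compose[of fst _ borel])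
    show "fst \<in> borel_measurable (borel :: 'n space_time measure)" by (rule borel_measurable_continuous_onI[OF cfst])
  qed (rule borel_measurable_indicator, simp)
  note [measurable] = mball
  have [measurable]: "(\<lambda>z :: 'n space_time. \<tau> (snd z) * \<theta> (snd z)) \<in> borel_measurable borel"
    by (rule borel_measurable_continuous_onI) (intro continuous_on_mult cont; simp)
  have mw: "w1 \<in> borel_measurable borel" "w2 \<in> borel_measurable borel" "w3 \<in> borel_measurable borel"
    unfolding w3_def[abs_def] using c1 by (auto intro: borel_measurable_continuous_onI)
  have i1: "integrable lborel (\<lambda>z. \<Phi> (u z) * w1 z)" by (rule compose_integrable[OF c\<Phi> mw(1) z1]) (use B1 in auto)
  have i2: "integrable lborel (\<lambda>z. \<Phi> (u z) * w2 z)" by (rule compose_integrable[OF c\<Phi> mw(2) z2]) (use B2 in auto)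
  have i3: "integrable lborel (\<lambda>z. e (u z) * w3 z)" by (rule compose_integrable[OF e mw(3) z3]) (use B3' in auto)
  have i4: "integrable lborel (\<lambda>z. q (u z) * G (norm (V z)) * \<eta> z)"
    by (rule compose_G_integrable[OF q C1_compact_measurable(1)[OF C1c] z\<eta>]) (use B\<eta> in auto)
  let ?c = "Ce * (G (k / r) / k\<^sup>2)"
  define \<delta> where "\<delta> = young_const C0 C1 n"
  have \<delta>: "0 < \<delta>" "C1 * \<delta> * real n \<le> C0 / 2"
    using C0 C1 n2 by (auto simp: \<delta>_def young_const_def field_simps)
  have cc: "C0 / 2 * (G (k * (real n * (2 / r) / \<delta>)) / k\<^sup>2) \<le> ?c"
  proof -
    let ?m = "max 1 (2 * real n / \<delta>)"
    have r0: "0 < r" using s by simp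
    have "k * (real n * (2 / r) / \<delta>) = (2 * real n / \<delta>) * (k / r)" by (simp add: mult_ac)
    also have "\<dots> \<le> ?m * (k / r)" using k r0 by (intro mult_right_mono) auto
    finally have "G (k * (real n * (2 / r) / \<delta>)) \<le> G (?m * (k / r))" by (rule G_mono)
    also have "\<dots> \<le> ?m ^ n * G (k / r)" using k r0 by (intro G_scale_up) auto
    finally have "C0 / 2 * (G (k * (real n * (2 / r) / \<delta>)) / k\<^sup>2) \<le> C0 / 2 * (?m ^ n * G (k / r) / k\<^sup>2)"
      using C0 by (intro mult_left_mono divide_right_mono) auto
    then show ?thesis by (simp add: energy_const_def \<delta>_def)
  qed
  have pt: "C1 * (p (u z) * g (norm (V z)) * norm (fst (D\<eta> z))) \<le> C0 / 2 * (q (u z) * G (norm (V z)) * \<eta> z) + ?c * (e (u z) * w3 z)" for z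
  proof (cases "z \<in> K")
    case True
    let ?\<kappa> = "\<tau> (snd z) * \<theta> (snd z)"
    have sgz: "0 \<le> p (u z)" "0 \<le> q (u z)" "0 \<le> e (u z)" "p (u z) \<le> k * q (u z)" "(p (u z))\<^sup>2 \<le> e (u z) * q (u z)"
      using sg u0[OF True] by auto
    have \<kappa>: "0 \<le> ?\<kappa>" using \<tau>(3) \<theta>(3) by simp
    have d: "norm (fst (D\<eta> z)) \<le> real n * (2 / r) * ?\<zeta> z ^ (n - 1) * ?\<kappa>"
      unfolding D\<eta>_def using cutoff_grad_bound[OF s _ n2, of "\<lambda>t. \<tau> t * \<theta> t" z x0] \<kappa> by simp
    have "C1 * (p (u z) * g (norm (V z)) * norm (fst (D\<eta> z))) \<le> C0 / 2 * (q (u z) * G (norm (V z)) * (?\<zeta> z ^ n * ?\<kappa>))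
     + C0 / 2 * (G (k * (real n * (2 / r) / \<delta>)) / k\<^sup>2) * (e (u z) * ?\<kappa> * (if 0 < ?\<zeta> z then 1 else 0))"
      by (rule caccioppoli_pointwise[OF C0 C1 \<delta> sgz ball_cutoff_range(1,2)[OF s] \<kappa> _ _ d _ k]) (use s in auto)
    also have "e (u z) * ?\<kappa> * (if 0 < ?\<zeta> z then 1 else 0) = e (u z) * w3 z"
      using ball_cutoff_range(3)[OF s, of x0 "fst z"] by (simp add: w3_def)
    also have "C0 / 2 * (G (k * (real n * (2 / r) / \<delta>)) / k\<^sup>2) * (e (u z) * w3 z) \<le> ?c * (e (u z) * w3 z)"
      using sgz \<kappa> by (intro mult_right_mono cc) (auto simp: w3_def)
    finally show ?thesis by (simp add: \<eta>_def cutoff_def)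
  next
    case False
    then have "z \<notin> closure {z. \<eta> z \<noteq> 0}" using clos' interior_subset[of K] by blast
    then have "D\<eta> z = 0" by (rule C1_compact_closure(3)[OF C1c])
    then show ?thesis using z3[OF False] z\<eta>[OF False] by simp
  qed
  have i5: "integrable lborel (\<lambda>z. C1 * (p (u z) * g (norm (V z)) * norm (fst (D\<eta> z))))"
  proof (rule Bochner_Integration.integrable_bound)
    show "integrable lborel (\<lambda>z. C0 / 2 * (q (u z) * G (norm (V z)) * \<eta> z) + ?c * (e (u z) * w3 z))"
      using i4 i3 by (intro Bochner_Integration.integrable_add integrable_mult_right)
    have zD: "norm (fst (D\<eta> z)) = 0" if "z \<notin> K" for z
    proof -
      have "z \<notin> closure {z. \<eta> z \<noteq> 0}" using that clos' interior_subset[of K] by blast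
      then have "D\<eta> z = 0" by (rule C1_compact_closure(3)[OF C1c])
      then show ?thesis by simp
    qed
    have mD: "(\<lambda>z. norm (fst (D\<eta> z))) \<in> borel_measurable borel"
      by (rule borel_measurable_continuous_onI, intro continuous_intros C1_compact_grad_continuous[OF C1c])
    note [measurable] = compose_measurable[OF cp mD zD]
    have eq: "C1 * (p (u z) * g (norm (V z)) * norm (fst (D\<eta> z))) = C1 * ((p (u z) * norm (fst (D\<eta> z))) * g (norm (V z)))" for z by simp
    show "(\<lambda>z. C1 * (p (u z) * g (norm (V z)) * norm (fst (D\<eta> z)))) \<in> borel_measurable lborel" unfolding eq by measurable
    have "norm (C1 * (p (u z) * g (norm (V z)) * norm (fst (D\<eta> z)))) \<le> norm (C0 / 2 * (q (u z) * G (norm (V z)) * \<eta> z) + ?c * (e (u z) * w3 z))" for z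
    proof (cases "z \<in> K")
      case True
      then have "0 \<le> C1 * (p (u z) * g (norm (V z)) * norm (fst (D\<eta> z)))"
        using sg u0[OF True] C1 g_nonneg[of "norm (V z)"] by simp
      then show ?thesis using pt[of z] by simp
    qed (use zD in simp)
    then show "AE z in lborel. norm (C1 * (p (u z) * g (norm (V z)) * norm (fst (D\<eta> z)))) \<le> norm (C0 / 2 * (q (u z) * G (norm (V z)) * \<eta> z) + ?c * (e (u z) * w3 z))" by simp
  qed
  have "C0 * (\<integral>z. q (u z) * G (norm (V z)) * \<eta> z \<partial>lborel)
      \<le> (\<integral>z. \<Phi> (u z) * snd (D\<eta> z) \<partial>lborel) + C1 * (\<integral>z. p (u z) * g (norm (V z)) * norm (fst (D\<eta> z)) \<partial>lborel)"
  proof -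
    have "(\<forall>v\<ge>0. (\<Phi> has_real_derivative - p v) (at v)) \<and> (\<forall>v\<ge>0. (p has_real_derivative - q v) (at v)) \<and>
        continuous_on {0..} q \<and> (\<forall>v\<ge>0. 0 \<le> p v) \<and> (\<forall>v\<ge>0. 0 \<le> q v) \<and>
        C1_compact \<eta> D\<eta> \<and> (\<forall>z. 0 \<le> \<eta> z) \<and> closure {z. \<eta> z \<noteq> 0} \<subseteq> interior K"
      using \<Phi> p q sg C1c \<eta>0 clos' by blast
    then show ?thesis using lg unfolding local_gradient_def by blast
  qed
  also have "(\<integral>z. \<Phi> (u z) * snd (D\<eta> z) \<partial>lborel) = (\<integral>z. \<Phi> (u z) * w1 z - \<Phi> (u z) * w2 z \<partial>lborel)"
    by (simp add: D\<eta>_def cutoff_grad_def w1_def w2_def algebra_simps)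
  also have "\<dots> = (\<integral>z. \<Phi> (u z) * w1 z \<partial>lborel) - (\<integral>z. \<Phi> (u z) * w2 z \<partial>lborel)" using i1 i2 by simp
  also have "C1 * (\<integral>z. p (u z) * g (norm (V z)) * norm (fst (D\<eta> z)) \<partial>lborel)
      = (\<integral>z. C1 * (p (u z) * g (norm (V z)) * norm (fst (D\<eta> z))) \<partial>lborel)" by simp
  also have "\<dots> \<le> (\<integral>z. C0 / 2 * (q (u z) * G (norm (V z)) * \<eta> z) + ?c * (e (u z) * w3 z) \<partial>lborel)"
    using i4 i3 by (intro integral_mono i5 pt Bochner_Integration.integrable_add integrable_mult_right)
  also have "\<dots> = C0 / 2 * (\<integral>z. q (u z) * G (norm (V z)) * \<eta> z \<partial>lborel) + ?c * (\<integral>z. e (u z) * w3 z \<partial>lborel)"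
    using i4 i3 by simp
  finally have main: "C0 / 2 * (\<integral>z. q (u z) * G (norm (V z)) * \<eta> z \<partial>lborel) + (\<integral>z. \<Phi> (u z) * w2 z \<partial>lborel)
      \<le> (\<integral>z. \<Phi> (u z) * w1 z \<partial>lborel) + ?c * (\<integral>z. e (u z) * w3 z \<partial>lborel)" by simp
  also have "\<dots> = (\<integral>z. \<Phi> (u z) * w1 z + ?c * (e (u z) * w3 z) \<partial>lborel)" using i1 i3 by simp
  \<comment> \<open>\<open>bound\<close> is stated without the upper cutoff; multiplying it by
    \<open>\<theta> \<le> 1\<close> recovers both weights.\<close>
  also have "\<dots> \<le> (\<integral>z. M * indicator S z \<partial>lborel)"
  proof (rule integral_mono)
    show "integrable lborel (\<lambda>z. \<Phi> (u z) * w1 z + ?c * (e (u z) * w3 z))" using i1 i3 by simp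
    show "integrable lborel (\<lambda>z. M * indicator S z)" using S by (intro integrable_mult_right) (simp add: integrable_indicator_iff)
    fix z
    show "\<Phi> (u z) * w1 z + ?c * (e (u z) * w3 z) \<le> M * indicator S z"
    proof (cases "fst z \<in> ball x0 s \<and> snd z \<in> {tb..<te}")
      case True
      have "\<Phi> (u z) * w1 z + ?c * (e (u z) * w3 z)
        = \<theta> (snd z) * (\<Phi> (u (fst z, snd z)) * ball_cutoff x0 s r (fst z) ^ n * \<tau>' (snd z) + ?c * (e (u (fst z, snd z)) * \<tau> (snd z)))"
        using True by (simp add: w1_def w3_def algebra_simps)
      also have "\<dots> \<le> \<theta> (snd z) * (M * indicator S (fst z, snd z))"
      proof (rule mult_left_mono)
        have "fst z \<in> ball x0 s" "snd z \<in> {tb..<te}" using True by auto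
        then show "\<Phi> (u (fst z, snd z)) * ball_cutoff x0 s r (fst z) ^ n * \<tau>' (snd z) + ?c * (e (u (fst z, snd z)) * \<tau> (snd z))
            \<le> M * indicator S (fst z, snd z)" using bound by blast
      qed (use \<theta>(3) in auto)
      also have "\<dots> \<le> 1 * (M * indicator S (fst z, snd z))"
        using M \<theta>(3) by (intro mult_right_mono) auto
      finally show ?thesis by simp
    next
      case False
      then have "w1 z = 0 \<and> w3 z = 0"
        using \<zeta>0[of z] n2 \<tau>(4) \<theta>(4) by (auto simp: w1_def w3_def not_le not_less)
      then show ?thesis using M by simp
    qed
  qed
  also have "\<dots> = M * measure lborel S" using S by simp
  finally show "C0 / 2 * (\<integral>z. q (u z) * G (norm (V z)) * \<eta> z \<partial>lborel)
     + (\<integral>z. \<Phi> (u z) * (ball_cutoff x0 s r (fst z) ^ n * \<tau> (snd z)) * (- \<theta>' (snd z)) \<partial>lborel) \<le> M * measure lborel S"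
    by (simp add: w2_def mult.assoc)
  show "integrable lborel (\<lambda>z. q (u z) * G (norm (V z)) * \<eta> z)" by (rule i4)
  have "0 \<le> q (u z) * G (norm (V z)) * \<eta> z" for z
    using sg u0[of z] \<eta>0[of z] G_nonneg[of "norm (V z)"] z\<eta>[of z] by (cases "z \<in> K") auto
  then show "\<forall>z. 0 \<le> q (u z) * G (norm (V z)) * \<eta> z" by blast
  show "integrable lborel (\<lambda>z. \<Phi> (u z) * (ball_cutoff x0 s r (fst z) ^ n * \<tau> (snd z)) * (- \<theta>' (snd z)))"
    using i2 by (simp add: w2_def mult.assoc)
qed

text \<open>The term with \<open>- \<theta>'\<close> in \<open>cutoff_energy\<close> is a time
  average of slice integrals. If the slice at \<open>t\<close> exceeded the bound, then by uniform
  continuity on the compact cylinder a sufficiently short transition of \<open>\<theta>\<close>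
  right after \<open>t\<close> would preserve part of the excess.\<close>

lemma slice_estimate:
  assumes k: "0 < k" and s: "0 < s" "s \<le> r" and sub: "cball x0 s \<times> {tb..te} \<subseteq> interior K"
    and \<Phi>: "\<forall>v\<ge>0. (\<Phi> has_real_derivative - p v) (at v)" and p: "\<forall>v\<ge>0. (p has_real_derivative - q v) (at v)"
    and q: "continuous_on {0..} q" and e: "continuous_on {0..} e"
    and sg: "\<forall>v\<ge>0. 0 \<le> p v \<and> 0 \<le> q v \<and> 0 \<le> e v \<and> 0 \<le> \<Phi> v \<and> p v \<le> k * q v \<and> (p v)\<^sup>2 \<le> e v * q v"
    and \<tau>: "\<forall>t. (\<tau> has_real_derivative \<tau>' t) (at t)" "continuous_on UNIV \<tau>'" "\<forall>t. 0 \<le> \<tau> t" "\<forall>t<tb. \<tau> t = 0 \<and> \<tau>' t = 0"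
    and S: "S \<in> sets borel" "emeasure lborel S < \<infinity>" and M: "0 \<le> M"
    and bound: "\<forall>x\<in>ball x0 s. \<forall>t\<in>{tb..<te}. \<Phi> (u (x, t)) * ball_cutoff x0 s r x ^ n * \<tau>' t
        + Ce * (G (k / r) / k\<^sup>2) * (e (u (x, t)) * \<tau> t) \<le> M * indicator S (x, t)"
    and t: "tb \<le> t" "t < te"
  shows "(\<integral>\<^sup>+x. ennreal (\<Phi> (u (x, t)) * (ball_cutoff x0 s r x ^ n * \<tau> t)) \<partial>lborel) \<le> ennreal (M * measure lborel S)"
proof -
  let ?\<Psi> = "\<lambda>z. \<Phi> (u z) * (ball_cutoff x0 s r (fst z) ^ n * \<tau> (snd z))"
  let ?C = "cball x0 s \<times> {tb..te}"
  have CK: "?C \<subseteq> K" using sub interior_subset by blast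
  have c\<tau>: "continuous_on UNIV \<tau>" by (rule continuous_at_imp_continuous_on) (use \<tau>(1) DERIV_isCont in blast)
  have c\<Phi>: "continuous_on {0..} \<Phi>" by (rule DERIV_nonneg_continuous_on) (use \<Phi> in blast)
  have csnd: "continuous_on UNIV (snd :: 'n space_time \<Rightarrow> _)" by (intro continuous_intros)
  have c\<Psi>: "continuous_on ?C ?\<Psi>"
  proof (rule continuous_on_subset[OF _ CK])
    have "continuous_on K (\<lambda>z. \<Phi> (u z))" by (rule continuous_on_compose2[OF c\<Phi> cu]) (use u0 in auto)
    moreover have "continuous_on K (\<lambda>z. \<tau> (snd z))"
      by (rule continuous_on_subset[OF continuous_on_compose2[OF c\<tau> csnd]]) auto
    ultimately show "continuous_on K ?\<Psi>" by (intro continuous_intros)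
  qed
  have out: "ball_cutoff x0 s r x ^ n = 0" if "x \<notin> ball x0 s" for x
  proof -
    have "ball_cutoff x0 s r x = 0" using that ball_cutoff_range[OF s, of x0 x] by linarith
    then show ?thesis using n2 by simp
  qed
  define \<phi> where "\<phi> x = ?\<Psi> (x, t)" for x
  have \<phi>0: "0 \<le> \<phi> x" for x
  proof (cases "x \<in> ball x0 s")
    case True
    then have "(x, t) \<in> K" using CK t by auto
    then show ?thesis unfolding \<phi>_def using sg u0 \<tau>(3) ball_cutoff_range(1)[OF s, of x0 x]
      by (intro mult_nonneg_nonneg) auto
  qed (simp add: \<phi>_def out)
  have i\<phi>: "integrable lborel \<phi>"
  proof -
    have "continuous_on (cball x0 s) \<phi>"
      unfolding \<phi>_def by (rule continuous_on_compose2[OF c\<Psi>]) (use t in \<open>auto intro!: continuous_intros\<close>)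
    from borel_integrable_compact[OF compact_cball this]
    have "integrable lborel (\<lambda>x. indicator (cball x0 s) x *\<^sub>R \<phi> x)" .
    moreover have "(\<lambda>x. indicator (cball x0 s) x *\<^sub>R \<phi> x) = \<phi>"
    proof
      fix x
      show "indicator (cball x0 s) x *\<^sub>R \<phi> x = \<phi> x"
      proof (cases "x \<in> cball x0 s")
        case False
        then have "x \<notin> ball x0 s" by simp
        then have "\<phi> x = 0" by (simp add: \<phi>_def out)
        then show ?thesis by simp
      qed simp
    qed
    ultimately show ?thesis by simp
  qed
  have eq: "(\<integral>\<^sup>+x. ennreal (\<Phi> (u (x, t)) * (ball_cutoff x0 s r x ^ n * \<tau> t)) \<partial>lborel) = ennreal (\<integral>x. \<phi> x \<partial>lborel)"
  proof -
    have "\<Phi> (u (x, t)) * (ball_cutoff x0 s r x ^ n * \<tau> t) = \<phi> x" for x by (simp add: \<phi>_def)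
    then show ?thesis using nn_integral_eq_integral[OF i\<phi>] \<phi>0 by simp
  qed
  have "(\<integral>x. \<phi> x \<partial>lborel) \<le> M * measure lborel S"
  proof (rule ccontr)
    let ?I = "\<integral>x. \<phi> x \<partial>lborel" and ?N = "M * measure lborel S"
    assume "\<not> ?I \<le> ?N"
    then have gap: "0 < ?I - ?N" by simp
    define cb where "cb = measure lborel (cball x0 s)"
    have cb: "0 \<le> cb" by (simp add: cb_def)
    \<comment> \<open>An error of \<open>\<epsilon>\<close> on the whole ball then uses at most half
      of the gap.\<close>
    define \<epsilon> where "\<epsilon> = (?I - ?N) / (2 * (cb + 1))"
    have \<epsilon>: "0 < \<epsilon>" using gap cb by (simp add: \<epsilon>_def)
    have \<epsilon>cb: "\<epsilon> * cb < ?I - ?N"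
    proof -
      have "\<epsilon> * cb \<le> \<epsilon> * (cb + 1)" using \<epsilon> by simp
      also have "\<dots> = (?I - ?N) / 2" using cb by (simp add: \<epsilon>_def field_simps)
      finally have le: "\<epsilon> * cb \<le> (?I - ?N) / 2" .
      have "a < y" if "a \<le> y / 2" "0 < y" for a y :: real using that by linarith
      from this[OF le gap] show ?thesis .
    qed
    have "uniformly_continuous_on ?C ?\<Psi>"
      by (rule compact_uniformly_continuous[OF c\<Psi>]) (intro compact_Times compact_cball compact_Icc)
    then obtain d where d: "0 < d" "\<forall>z\<in>?C. \<forall>z'\<in>?C. dist z' z < d \<longrightarrow> dist (?\<Psi> z') (?\<Psi> z) < \<epsilon>"
      using \<epsilon> unfolding uniformly_continuous_on_def by meson
    define b where "b = min (t + d / 2) te"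
    have b: "t < b" "b \<le> te" "b - t < d" using d(1) t by (auto simp: b_def)
    obtain \<theta> \<theta>' where \<theta>: "\<forall>t. (\<theta> has_real_derivative \<theta>' t) (at t)" "continuous_on UNIV \<theta>'"
      "\<forall>t. 0 \<le> \<theta> t \<and> \<theta> t \<le> 1 \<and> \<theta>' t \<le> 0" "\<forall>s\<le>t. \<theta> s = 1" "\<forall>s\<ge>b. \<theta> s = 0"
      "\<forall>s. s \<notin> {t..b} \<longrightarrow> \<theta>' s = 0"
      by (rule top_cutoff[OF b(1)])
    have \<theta>te: "\<forall>t\<ge>te. \<theta> t = 0" "\<forall>t>te. \<theta>' t = 0" using \<theta>(5,6) b(2) by auto
    note ce = cutoff_energy[OF k s sub \<Phi> p q e sg \<tau> \<theta>(1,2,3) \<theta>te S M bound]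
    note mass = top_cutoff_mass[OF b(1) \<theta>(1,2) \<theta>(4,5,6)]
    have "0 \<le> (\<integral>z. q (u z) * G (norm (V z)) * cutoff n x0 s r (\<lambda>t. \<tau> t * \<theta> t) z \<partial>lborel)"
      using ce(3) by (intro Bochner_Integration.integral_nonneg) auto
    then have "0 \<le> C0 / 2 * (\<integral>z. q (u z) * G (norm (V z)) * cutoff n x0 s r (\<lambda>t. \<tau> t * \<theta> t) z \<partial>lborel)"
      using C0 by simp
    then have up: "(\<integral>z. ?\<Psi> z * (- \<theta>' (snd z)) \<partial>lborel) \<le> ?N" using ce(1) by linarith
    have ic: "integrable lborel (\<lambda>x. \<phi> x - \<epsilon> * indicator (cball x0 s) x)"
      using i\<phi> emeasure_compact_finite[OF compact_cball[of x0 s]]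
      by (intro Bochner_Integration.integrable_diff integrable_mult_right) (auto simp: integrable_indicator_iff)
    note prod = lborel_integral_product[OF ic mass(1)]
    have "(\<integral>x. \<phi> x - \<epsilon> * indicator (cball x0 s) x \<partial>lborel) = ?I - \<epsilon> * cb"
      using i\<phi> emeasure_compact_finite[OF compact_cball[of x0 s]]
      by (subst Bochner_Integration.integral_diff) (auto simp: integrable_indicator_iff cb_def)
    then have "?I - \<epsilon> * cb = (\<integral>z. (\<phi> (fst z) - \<epsilon> * indicator (cball x0 s) (fst z)) * (- \<theta>' (snd z)) \<partial>lborel)"
      using prod(2) mass(2) by simp
    also have "\<dots> \<le> (\<integral>z. ?\<Psi> z * (- \<theta>' (snd z)) \<partial>lborel)"
    proof (rule integral_mono[OF prod(1) ce(4)])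
      fix z :: "'n space_time"
      show "(\<phi> (fst z) - \<epsilon> * indicator (cball x0 s) (fst z)) * (- \<theta>' (snd z)) \<le> ?\<Psi> z * (- \<theta>' (snd z))"
      proof (cases "snd z \<in> {t..b}")
        case True
        have "\<phi> (fst z) - \<epsilon> * indicator (cball x0 s) (fst z) \<le> ?\<Psi> z"
        proof (cases "fst z \<in> cball x0 s")
          case x: True
          have "z \<in> ?C" "(fst z, t) \<in> ?C" using x True b t by (auto simp: mem_Times_iff)
          moreover have "dist (fst z, t) z < d"
            using True b(3) by (cases z) (simp add: dist_Pair_Pair dist_real_def)
          ultimately have "dist (?\<Psi> (fst z, t)) (?\<Psi> z) < \<epsilon>" using d(2) by blast
          then show ?thesis using x by (simp add: \<phi>_def dist_real_def)
        next
          case False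
          then have "fst z \<notin> ball x0 s" by simp
          then show ?thesis using False by (simp add: \<phi>_def out)
        qed
        then show ?thesis using \<theta>(3) by (intro mult_right_mono) auto
      next
        case False
        then have "\<theta>' (snd z) = 0" using \<theta>(6) by blast
        then show ?thesis by simp
      qed
    qed
    also note up
    finally show False using \<epsilon>cb by linarith
  qed
  then show ?thesis unfolding eq by (rule ennreal_leI)
qed

end

section \<open>The iteration\<close>

text \<open>Coefficient of \<open>k ^ 3 / r\<close> in the translation bound: 3 from differentiating
  a cube, the bracket from \<open>linear_le_G\<close> and the energy bound, \<open>2 * n\<close>
  from the cutoff gradient.\<close>

definition gradient_const :: "real \<Rightarrow> real \<Rightarrow> nat \<Rightarrow> real" where
  "gradient_const C0 C1 n = 3 * (1 + (2 + energy_const C0 C1 n) / C0) + 2 * real n"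

text \<open>Nonpositive up to \<open>t1\<close>, increasing up to \<open>t1 + h\<close>, equal to 1
  afterwards. The sets where it exceeds a level serve as shrinking time intervals, and its
  derivative acts only before \<open>t1 + h\<close>.\<close>

definition ramp :: "real \<Rightarrow> real \<Rightarrow> real \<Rightarrow> real" where
  "ramp t1 h t = 1 - (max 0 ((t1 + h - t) / h))\<^sup>2"

definition ramp_deriv :: "real \<Rightarrow> real \<Rightarrow> real \<Rightarrow> real" where
  "ramp_deriv t1 h t = 2 * max 0 ((t1 + h - t) / h) / h"

lemma ramp_DERIV: "0 < h \<Longrightarrow> (ramp t1 h has_real_derivative ramp_deriv t1 h t) (at t)"
proof -
  assume h: "0 < h"
  have "((\<lambda>t. (t1 + h - t) / h) has_real_derivative - 1 / h) (at t)"
    using h by (auto intro!: derivative_eq_intros simp: divide_simps)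
  from DERIV_diff[OF DERIV_const[of 1] DERIV_chain2[OF DERIV_pos_part_power[of 2] this]]
  show ?thesis unfolding ramp_def[abs_def] ramp_deriv_def by simp
qed

lemma ramp_deriv_continuous: "0 < h \<Longrightarrow> continuous_on S (ramp_deriv t1 h)"
  unfolding ramp_deriv_def[abs_def] by (intro continuous_intros) auto

lemma ramp_continuous: "0 < h \<Longrightarrow> continuous_on S (ramp t1 h)"
  unfolding ramp_def[abs_def] by (intro continuous_intros) auto

lemma ramp_le_1: "ramp t1 h t \<le> 1"
  by (simp add: ramp_def)

lemma ramp_nonpos:
  assumes "0 < h" "t \<le> t1"
  shows "ramp t1 h t \<le> 0"
proof -
  have "1 \<le> (t1 + h - t) / h" using assms by (simp add: field_simps)
  then have "1\<^sup>2 \<le> (max 0 ((t1 + h - t) / h))\<^sup>2" by (intro power_mono) auto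
  then show ?thesis by (simp add: ramp_def)
qed

lemma ramp_half:
  assumes "0 < h" "t1 + h / 2 \<le> t"
  shows "1 / 2 < ramp t1 h t"
proof -
  have "(t1 + h - t) / h \<le> 1 / 2" using assms by (simp add: field_simps)
  then have "max 0 ((t1 + h - t) / h) \<le> 1 / 2" by linarith
  then have "(max 0 ((t1 + h - t) / h))\<^sup>2 \<le> (1 / 2)\<^sup>2" by (rule power_mono) simp
  then show ?thesis by (simp add: ramp_def power2_eq_square)
qed

lemma ramp_deriv_bounds:
  assumes "0 < h"
  shows "0 \<le> ramp_deriv t1 h t" "t1 \<le> t \<Longrightarrow> ramp_deriv t1 h t \<le> 2 / h" "t1 + h \<le> t \<Longrightarrow> ramp_deriv t1 h t = 0"
proof -
  show "0 \<le> ramp_deriv t1 h t" using assms by (simp add: ramp_deriv_def)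
  assume "t1 \<le> t"
  then have "max 0 ((t1 + h - t) / h) \<le> 1" using assms by (simp add: field_simps)
  then show "ramp_deriv t1 h t \<le> 2 / h" using assms by (simp add: ramp_deriv_def divide_right_mono)
next
  assume "t1 + h \<le> t"
  then have "(t1 + h - t) / h \<le> 0" using assms by (simp add: divide_nonpos_pos)
  then show "ramp_deriv t1 h t = 0" by (simp add: ramp_deriv_def)
qed

context local_solution
begin

text \<open>The start of the time interval is encoded by a ramp level \<open>c\<close> instead of a
  time, so that the positive part of \<open>ramp t1 h t - c\<close> itself can serve as lower time
  cutoff.\<close>

definition lower_set :: "real ^ 'n \<Rightarrow> real \<Rightarrow> real \<Rightarrow> real \<Rightarrow> real \<Rightarrow> real \<Rightarrow> real \<Rightarrow> 'n space_time set" where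
  "lower_set x0 t1 h k s c te = {z. fst z \<in> ball x0 s \<and> c < ramp t1 h (snd z) \<and> snd z < te \<and> u z < k}"

lemma lower_set_props:
  assumes h: "0 < h" and c: "0 \<le> c" and sub: "cball x0 s \<times> {t1..te} \<subseteq> interior K"
  shows "lower_set x0 t1 h k s c te \<subseteq> K" "lower_set x0 t1 h k s c te \<in> sets borel" "emeasure lborel (lower_set x0 t1 h k s c te) < \<infinity>"
    "\<And>z. z \<in> lower_set x0 t1 h k s c te \<Longrightarrow> t1 < snd z"
proof -
  let ?D = "lower_set x0 t1 h k s c te"
  have t1: "t1 < t" if "c < ramp t1 h t" for t using ramp_nonpos[OF h, of t t1] that c by (meson le_less_trans leI less_le_not_le)
  then show "\<And>z. z \<in> ?D \<Longrightarrow> t1 < snd z" by (auto simp: lower_set_def)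
  show DK: "?D \<subseteq> K"
  proof
    fix z assume z: "z \<in> ?D"
    then have "z \<in> cball x0 s \<times> {t1..te}" using t1[of "snd z"] by (auto simp: lower_set_def mem_Times_iff)
    then show "z \<in> K" using sub interior_subset by blast
  qed
  have "continuous_on K u" by (rule cu)
  from borel_measurable_integrable[OF borel_integrable_compact[OF K this]]
  have mU: "(\<lambda>z. indicator K z * u z) \<in> borel_measurable borel" by simp
  let ?A = "{z. fst z \<in> ball x0 s \<and> c < ramp t1 h (snd z) \<and> snd z < te}"
  have "open {z :: 'n space_time. c < ramp t1 h (snd z)}"
    by (intro open_Collect_less continuous_intros continuous_on_compose2[OF ramp_continuous[OF h, of UNIV]]) auto
  moreover have "open {z :: 'n space_time. snd z < te}" by (intro open_Collect_less continuous_intros)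
  moreover have "open (fst -` ball x0 s :: 'n space_time set)" by (intro open_vimage_fst open_ball)
  ultimately have "open (fst -` ball x0 s \<inter> {z :: 'n space_time. c < ramp t1 h (snd z)} \<inter> {z. snd z < te})"
    by (intro open_Int)
  also have "fst -` ball x0 s \<inter> {z :: 'n space_time. c < ramp t1 h (snd z)} \<inter> {z. snd z < te} = ?A" by auto
  finally have "?A \<in> sets borel" by simp
  moreover have "?D = ?A \<inter> ((\<lambda>z. indicator K z * u z) -` {..<k} \<inter> space borel)"
  proof (intro set_eqI iffI)
    fix z assume z: "z \<in> ?D"
    then have "z \<in> K" using DK by blast
    then show "z \<in> ?A \<inter> ((\<lambda>z. indicator K z * u z) -` {..<k} \<inter> space borel)"
      using z by (simp add: lower_set_def)
  next
    fix z assume z: "z \<in> ?A \<inter> ((\<lambda>z. indicator K z * u z) -` {..<k} \<inter> space borel)"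
    then have "z \<in> cball x0 s \<times> {t1..te}" using t1[of "snd z"] by (auto simp: mem_Times_iff)
    then have "z \<in> K" using sub interior_subset by blast
    then show "z \<in> ?D" using z by (simp add: lower_set_def)
  qed
  ultimately show mD: "?D \<in> sets borel" using measurable_sets[OF mU, of "{..<k}"] by simp
  have "emeasure lborel ?D \<le> emeasure lborel K" by (rule emeasure_mono[OF DK]) simp
  also have "\<dots> < \<infinity>" by (rule emeasure_compact_finite[OF K])
  finally show "emeasure lborel ?D < \<infinity>" .
qed

text \<open>The function \<open>f\<close>, a cutoff times the cube of the positive part of
  \<open>kj - u\<close>, has slices and spatial differences bounded in terms of the measure
  \<open>Y\<close> of the current set, and it is at least \<open>k ^ 3 * d ^ (n + 5)\<close> on the
  next one; \<open>superlevel_measure_estimate\<close> with radius \<open>r * \<beta>\<close>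
  compares the two. The alternative \<open>alt\<close> names two ways of paying for the initial
  layer: a slow ramp, or \<open>u \<ge> k\<close> there, where the truncation vanishes.\<close>

lemma de_giorgi_step:
  fixes N :: nat
  assumes k: "0 < k" and r: "0 < r" and Gp: "0 < G (k / r)" and sub: "cball x0 r \<times> {t1..t2} \<subseteq> interior K"
    and h: "0 < h"
    and alt: "1 / h \<le> G (k / r) / k\<^sup>2 \<or> (\<forall>x\<in>cball x0 r. \<forall>t\<in>{t1..<t1 + h}. k \<le> u (x, t))"
    and d: "0 < d" and kj: "kj \<le> k" "k * d \<le> kj"
    and rj: "rj \<le> r" "r / 2 \<le> rj - r * d" and cj: "0 \<le> cj" and te: "te' < te" "te \<le> t2"
    and \<beta>: "0 < \<beta>"
  defines "Y \<equiv> measure lborel (lower_set x0 t1 h kj rj cj te)"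
    and "Y' \<equiv> measure lborel (lower_set x0 t1 h (kj - k * d) (rj - r * d) (cj + d) te')"
  assumes small: "6 * (2 + Ce) * (G (k / r) / k\<^sup>2) * Y \<le> d ^ (n + 5) * (r * \<beta>) ^ CARD('n) * measure lborel (ball (0 :: real ^ 'n) 1)"
  shows "Y' * d ^ (n + 5) \<le> 2 * \<beta> * gradient_const C0 C1 n * Y"
proof -
  define \<kappa> where "\<kappa> = G (k / r) / k\<^sup>2"
  have \<kappa>: "0 < \<kappa>" using Gp k by (simp add: \<kappa>_def)
  let ?D = "lower_set x0 t1 h kj rj cj te"
  let ?m = "\<lambda>v. max 0 (kj - v)"
  \<comment> \<open>These satisfy \<open>p\<^sup>2 = e * q\<close> exactly, and
    \<open>p \<le> k * q\<close> because the truncation is at most \<open>k\<close>. The cube is the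
    smallest integer power for which \<open>p\<close> is still differentiable at the level
    \<open>kj\<close>.\<close>
  define \<Phi> p q e F F' where "\<Phi> v = ?m v ^ 3 / 3" and "p v = ?m v ^ 2" and "q v = 2 * ?m v" and "e v = ?m v ^ 3 / 2"
    and "F v = ?m v ^ 3" and "F' v = - 3 * ?m v ^ 2" for v
  have kj0: "0 < kj" using kj k d by (smt (verit) mult_pos_pos)
  have rj0: "0 < rj" using rj r d by (smt (verit) mult_pos_pos half_gt_zero)
  have subj: "cball x0 rj \<times> {t1..te} \<subseteq> interior K"
    using sub te(2) rj(1) by (intro order_trans[OF _ sub] Sigma_mono subset_cball) auto
  note D = lower_set_props[OF h cj subj, where k = kj]
  have dm: "((\<lambda>v. ?m v ^ i) has_real_derivative - real i * ?m v ^ (i - 1)) (at v)" if "2 \<le> i" for i v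
  proof -
    have "((\<lambda>v. kj - v) has_real_derivative - 1) (at v)" by (auto intro!: derivative_eq_intros)
    from DERIV_chain2[OF DERIV_pos_part_power[OF that] this] show ?thesis by simp
  qed
  have d\<Phi>: "\<forall>v\<ge>0. (\<Phi> has_real_derivative - p v) (at v)"
    unfolding \<Phi>_def[abs_def] p_def using DERIV_cdivide[OF dm[of 3], of 3] by simp
  have dp: "\<forall>v\<ge>0. (p has_real_derivative - q v) (at v)"
    unfolding q_def p_def[abs_def] using dm[of 2] by simp
  have dF: "\<forall>v\<ge>0. (F has_real_derivative F' v) (at v)"
    unfolding F_def[abs_def] F'_def using dm[of 3] by simp
  have cq: "continuous_on {0..} q" "continuous_on {0..} e" "continuous_on {0..} F" "continuous_on {0..} F'"
    unfolding q_def[abs_def] e_def[abs_def] F_def[abs_def] F'_def[abs_def] by (intro continuous_intros; simp)+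
  have m_le: "?m v \<le> k" if "0 \<le> v" for v using that kj kj0 k by auto
  have sg: "\<forall>v\<ge>0. 0 \<le> p v \<and> 0 \<le> q v \<and> 0 \<le> e v \<and> 0 \<le> \<Phi> v \<and> p v \<le> k * q v \<and> (p v)\<^sup>2 \<le> e v * q v"
  proof (intro allI impI conjI)
    fix v :: real assume v: "0 \<le> v"
    show "0 \<le> p v" "0 \<le> q v" "0 \<le> e v" "0 \<le> \<Phi> v" by (simp_all add: p_def q_def e_def \<Phi>_def)
    have "?m v * ?m v \<le> k * ?m v" by (intro mult_right_mono m_le v) simp
    moreover have "0 \<le> k * ?m v" using k by simp
    ultimately show "p v \<le> k * q v" unfolding p_def q_def power2_eq_square mult.left_commute[of k 2] by linarith
    show "(p v)\<^sup>2 \<le> e v * q v" by (simp add: p_def q_def e_def power2_eq_square power3_eq_cube)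
  qed
  define \<tau> \<tau>' where "\<tau> t = (max 0 (ramp t1 h t - cj))\<^sup>2" and "\<tau>' t = 2 * max 0 (ramp t1 h t - cj) * ramp_deriv t1 h t" for t
  have d\<tau>: "\<forall>t. (\<tau> has_real_derivative \<tau>' t) (at t)"
  proof
    fix t
    have "((\<lambda>t. ramp t1 h t - cj) has_real_derivative ramp_deriv t1 h t) (at t)"
      using DERIV_diff[OF ramp_DERIV[OF h] DERIV_const[of cj]] by simp
    from DERIV_chain2[OF DERIV_pos_part_power[of 2] this]
    show "(\<tau> has_real_derivative \<tau>' t) (at t)" unfolding \<tau>_def[abs_def] \<tau>'_def by simp
  qed
  have c\<tau>': "continuous_on UNIV \<tau>'"
    unfolding \<tau>'_def[abs_def] by (intro continuous_intros ramp_continuous[OF h] ramp_deriv_continuous[OF h])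
  have \<tau>0: "\<forall>t. 0 \<le> \<tau> t" by (simp add: \<tau>_def)
  have \<tau>z: "\<tau> t = 0 \<and> \<tau>' t = 0" if "ramp t1 h t \<le> cj" for t using that by (simp add: \<tau>_def \<tau>'_def)
  have \<tau>lt: "\<forall>t<t1. \<tau> t = 0 \<and> \<tau>' t = 0"
  proof (intro allI impI)
    fix t assume "t < t1"
    then have "ramp t1 h t \<le> cj" using ramp_nonpos[OF h, of t t1] cj by simp
    then show "\<tau> t = 0 \<and> \<tau>' t = 0" by (rule \<tau>z)
  qed
  have mr: "max 0 (ramp t1 h t - cj) \<le> 1" for t using ramp_le_1[of t1 h t] cj by simp
  have \<tau>1: "\<tau> t \<le> 1" for t unfolding \<tau>_def by (intro power_le_one mr) simp
  \<comment> \<open>The 2 absorbs the ramp contribution \<open>k ^ 3 / 3 * (4 * \<kappa>)\<close>;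
    \<open>Ce\<close> comes from the spatial cutoff.\<close>
  define M where "M = k ^ 3 * \<kappa> * (2 + Ce)"
  have M: "0 \<le> M" using k \<kappa> Ce_pos by (simp add: M_def)
  have inK: "(x, t) \<in> K" if "x \<in> ball x0 rj" "t \<in> {t1..te}" for x t
  proof -
    have "(x, t) \<in> cball x0 rj \<times> {t1..te}" using that by auto
    then show ?thesis using subj interior_subset by blast
  qed
  have bound: "\<forall>x\<in>ball x0 rj. \<forall>t\<in>{t1..<te}. \<Phi> (u (x, t)) * ball_cutoff x0 rj r x ^ n * \<tau>' t
        + Ce * (G (k / r) / k\<^sup>2) * (e (u (x, t)) * \<tau> t) \<le> M * indicator ?D (x, t)"
  proof (intro ballI)
    fix x t assume x: "x \<in> ball x0 rj" and t: "t \<in> {t1..<te}"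
    then have xt: "(x, t) \<in> K" by (intro inK) auto
    have u0': "0 \<le> u (x, t)" by (rule u0[OF xt])
    show "\<Phi> (u (x, t)) * ball_cutoff x0 rj r x ^ n * \<tau>' t + Ce * (G (k / r) / k\<^sup>2) * (e (u (x, t)) * \<tau> t) \<le> M * indicator ?D (x, t)"
    proof (cases "(x, t) \<in> ?D")
      case False
      then have "kj \<le> u (x, t) \<or> ramp t1 h t \<le> cj" using x t by (auto simp: lower_set_def)
      then have "\<Phi> (u (x, t)) * \<tau>' t = 0 \<and> e (u (x, t)) * \<tau> t = 0"
        using \<tau>z[of t] by (auto simp: \<Phi>_def e_def)
      then show ?thesis using False by (auto simp: mult.assoc mult.left_commute)
    next
      case True
      then have ukj: "u (x, t) < kj" by (simp add: lower_set_def)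
      have m3: "?m (u (x, t)) ^ 3 \<le> k ^ 3" by (intro power_mono m_le u0') simp
      have "\<Phi> (u (x, t)) * ball_cutoff x0 rj r x ^ n * \<tau>' t \<le> 2 * (k ^ 3 * \<kappa>)"
      proof (cases "t < t1 + h")
        case False
        then have "\<tau>' t = 0" using ramp_deriv_bounds(3)[OF h, of t1 t] by (simp add: \<tau>'_def)
        then show ?thesis using k \<kappa> by simp
      next
        case th: True
        \<comment> \<open>A point of the lower set inside the initial layer excludes the second case
          of \<open>alt\<close>, so the ramp is slow.\<close>
        have "\<not> k \<le> u (x, t)" using ukj kj(1) by simp
        moreover have "x \<in> cball x0 r" "t \<in> {t1..<t1 + h}" using x t th rj(1) by auto
        ultimately have hk: "1 / h \<le> \<kappa>" using alt by (auto simp: \<kappa>_def)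
        have "\<tau>' t \<le> 2 * 1 * (2 / h)"
          unfolding \<tau>'_def using mr[of t] ramp_deriv_bounds[OF h, of t1 t] t h by (intro mult_mono) auto
        also have "\<dots> \<le> 4 * \<kappa>" using hk by simp
        finally have t4: "\<tau>' t \<le> 4 * \<kappa>" .
        have t0: "0 \<le> \<tau>' t" using ramp_deriv_bounds(1)[OF h] by (simp add: \<tau>'_def)
        have z1: "ball_cutoff x0 rj r x ^ n \<le> 1" "0 \<le> ball_cutoff x0 rj r x ^ n"
          using ball_cutoff_range[OF rj0 rj(1), of x0 x] by (auto intro: power_le_one)
        have "\<Phi> (u (x, t)) * ball_cutoff x0 rj r x ^ n * \<tau>' t \<le> (k ^ 3 / 3 * 1) * (4 * \<kappa>)"
          using m3 z1 t4 t0 k by (intro mult_mono) (auto simp: \<Phi>_def)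
        also have "\<dots> \<le> 2 * (k ^ 3 * \<kappa>)" using k \<kappa> by simp
        finally show ?thesis .
      qed
      moreover have "Ce * (G (k / r) / k\<^sup>2) * (e (u (x, t)) * \<tau> t) \<le> Ce * \<kappa> * (k ^ 3 * 1)"
      proof -
        have "0 \<le> ?m (u (x, t)) ^ 3" by simp
        then have "e (u (x, t)) \<le> k ^ 3" unfolding e_def using m3 by linarith
        then have "e (u (x, t)) * \<tau> t \<le> k ^ 3 * 1" using \<tau>1[of t] \<tau>0 k by (intro mult_mono) auto
        then show ?thesis unfolding \<kappa>_def[symmetric] using Ce_pos \<kappa> by (intro mult_left_mono) auto
      qed
      ultimately show ?thesis using True by (simp add: M_def algebra_simps)
    qed
  qed
  obtain \<theta> \<theta>' where \<theta>: "\<forall>t. (\<theta> has_real_derivative \<theta>' t) (at t)" "continuous_on UNIV \<theta>'"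
      "\<forall>t. 0 \<le> \<theta> t \<and> \<theta> t \<le> 1 \<and> \<theta>' t \<le> 0" "\<forall>t\<le>te'. \<theta> t = 1" "\<forall>t\<ge>te. \<theta> t = 0"
      "\<forall>t. t \<notin> {te'..te} \<longrightarrow> \<theta>' t = 0"
    by (rule top_cutoff[OF te(1)])
  have \<theta>te: "\<forall>t>te. \<theta>' t = 0" using \<theta>(6) by auto
  note ce = cutoff_energy[OF k rj0 rj(1) subj d\<Phi> dp cq(1,2) sg d\<tau> c\<tau>' \<tau>0 \<tau>lt \<theta>(1,2,3) \<theta>(5) \<theta>te D(2,3) M bound]
  define \<eta> where "\<eta> = cutoff n x0 rj r (\<lambda>t. \<tau> t * \<theta> t)"
  define D\<eta> where "D\<eta> = cutoff_grad n x0 rj r (\<lambda>t. \<tau> t * \<theta> t) (\<lambda>t. \<tau>' t * \<theta> t + \<theta>' t * \<tau> t)"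
  have C\<eta>: "C1_compact \<eta> D\<eta>" and clos: "closure {z. \<eta> z \<noteq> 0} \<subseteq> cball x0 rj \<times> {t1..te}"
  proof -
    have 1: "((\<lambda>t. \<tau> t * \<theta> t) has_real_derivative \<tau>' t * \<theta> t + \<theta>' t * \<tau> t) (at t)" for t
      using DERIV_mult[OF d\<tau>[rule_format, of t] \<theta>(1)[rule_format, of t]] .
    have 2: "\<tau> t * \<theta> t = 0" if "t \<notin> {t1..te}" for t using that \<tau>lt \<theta>(5) by auto
    have c1: "continuous_on UNIV \<tau>" "continuous_on UNIV \<theta>"
      by (rule continuous_at_imp_continuous_on, use d\<tau> \<theta>(1) DERIV_isCont in blast)+
    have 3: "continuous_on UNIV (\<lambda>t. \<tau>' t * \<theta> t + \<theta>' t * \<tau> t)" by (intro continuous_intros c1 c\<tau>' \<theta>(2))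
    show "C1_compact \<eta> D\<eta>" "closure {z. \<eta> z \<noteq> 0} \<subseteq> cball x0 rj \<times> {t1..te}"
      unfolding \<eta>_def D\<eta>_def by (rule cutoff_C1_compact[OF n2 rj0 rj(1) 1 3 2]; assumption)+
  qed
  have clos': "closure {z. \<eta> z \<noteq> 0} \<subseteq> interior K" using clos subj by blast
  have outK: "\<eta> z = 0" "D\<eta> z = 0" if "z \<notin> K" for z
  proof -
    have "z \<notin> closure {z. \<eta> z \<noteq> 0}" using that clos' interior_subset[of K] by blast
    then show "\<eta> z = 0" "D\<eta> z = 0" by (rule C1_compact_closure[OF C\<eta>])+
  qed
  have \<tau>\<theta>: "0 \<le> \<tau> t * \<theta> t \<and> \<tau> t * \<theta> t \<le> 1" for t
    using \<tau>0 \<tau>1[of t] \<theta>(3) by (auto intro: mult_le_one)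
  have \<zeta>: "0 \<le> ball_cutoff x0 rj r x" "ball_cutoff x0 rj r x \<le> 1" for x
    by (rule ball_cutoff_range[OF rj0 rj(1)])+
  have \<eta>01: "0 \<le> \<eta> z" "\<eta> z \<le> 1" for z
    unfolding \<eta>_def cutoff_def using \<zeta> \<tau>\<theta>[of "snd z"] by (auto intro!: mult_le_one power_le_one)
  have inD: "z \<in> ?D" if "u z < kj" "fst z \<in> ball x0 rj" "\<tau> (snd z) * \<theta> (snd z) \<noteq> 0" for z
  proof -
    have "snd z < te" using that(3) \<theta>(5) by (metis mult_zero_right not_le)
    moreover have "cj < ramp t1 h (snd z)" using that(3) \<tau>z[of "snd z"] by (metis mult_zero_left not_le)
    ultimately show ?thesis using that by (simp add: lower_set_def)
  qed
  have \<eta>D: "?m (u z) * \<eta> z \<le> k * indicator ?D z" for z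
  proof (cases "z \<in> K \<and> \<eta> z \<noteq> 0 \<and> u z < kj")
    case True
    then have "fst z \<in> ball x0 rj" "\<tau> (snd z) * \<theta> (snd z) \<noteq> 0"
      using ball_cutoff_range(3)[OF rj0 rj(1), of x0 "fst z"] \<zeta>(1)[of "fst z"] n2
      unfolding \<eta>_def cutoff_def by (auto simp: order_le_less)
    then have "z \<in> ?D" using inD True by blast
    moreover have "?m (u z) * \<eta> z \<le> k * 1" using True m_le u0 \<eta>01[of z] k by (intro mult_mono) auto
    ultimately show ?thesis by simp
  next
    case False
    then have "?m (u z) * \<eta> z = 0" using outK(1)[of z] by auto
    moreover have "0 \<le> k * indicator ?D z" using k by simp
    ultimately show ?thesis by linarith
  qed
  have gD: "?m (u z) ^ 3 * norm (fst (D\<eta> z)) \<le> (2 * real n * k ^ 3 / r) * indicator ?D z" for z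
  proof (cases "z \<in> K \<and> norm (fst (D\<eta> z)) \<noteq> 0 \<and> u z < kj")
    case True
    let ?w = "ball_cutoff x0 rj r (fst z) ^ (n - 1) * (\<tau> (snd z) * \<theta> (snd z))"
    have le: "norm (fst (D\<eta> z)) \<le> real n * (2 / r) * ?w"
      unfolding D\<eta>_def using cutoff_grad_bound[OF rj0 rj(1) _ n2, of "\<lambda>t. \<tau> t * \<theta> t" z x0] \<tau>\<theta>[of "snd z"] by (simp add: mult.assoc)
    then have "?w \<noteq> 0" using True by (metis mult_zero_right norm_le_zero_iff norm_eq_zero)
    then have "fst z \<in> ball x0 rj" "\<tau> (snd z) * \<theta> (snd z) \<noteq> 0"
      using ball_cutoff_range(3)[OF rj0 rj(1), of x0 "fst z"] \<zeta>(1)[of "fst z"] n2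
      by (auto simp: order_le_less)
    then have zD: "z \<in> ?D" using inD True by blast
    have "ball_cutoff x0 rj r (fst z) ^ (n - 1) \<le> 1" using \<zeta> by (intro power_le_one) auto
    then have "?w \<le> 1" using \<tau>\<theta>[of "snd z"] by (auto intro!: mult_le_one)
    then have "real n * (2 / r) * ?w \<le> real n * (2 / r) * 1" using r by (intro mult_left_mono) auto
    from order_trans[OF le this] have "norm (fst (D\<eta> z)) \<le> 2 * real n / r" by (simp add: mult.commute)
    moreover have "?m (u z) ^ 3 \<le> k ^ 3" using True m_le u0 by (intro power_mono) auto
    ultimately have "?m (u z) ^ 3 * norm (fst (D\<eta> z)) \<le> k ^ 3 * (2 * real n / r)" using k by (intro mult_mono) auto
    then show ?thesis using zD by (simp add: mult_ac)
  next
    case False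
    then have "?m (u z) ^ 3 * norm (fst (D\<eta> z)) = 0" using outK(2)[of z] by auto
    moreover have "0 \<le> (2 * real n * k ^ 3 / r) * indicator ?D z" using k r by simp
    ultimately show ?thesis by linarith
  qed
  define f where "f z = \<eta> z * F (u z)" for z
  have f_alt: "f = (\<lambda>z. F (u z) * \<eta> z)" by (simp add: f_def fun_eq_iff)
  have mf: "f \<in> borel_measurable borel"
    unfolding f_alt by (rule compose_measurable[OF cq(3) C1_compact_measurable(1)[OF C\<eta>] outK(1)])
  have fi: "integrable lborel f"
    unfolding f_alt by (rule compose_integrable[OF cq(3) C1_compact_measurable(1)[OF C\<eta>] outK(1), of 1]) (use \<eta>01 in auto)
  have f0: "0 \<le> f z" for z using \<eta>01 by (simp add: f_def F_def)
  have MY: "0 \<le> M * Y" using M by (simp add: Y_def)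
  have slice: "(\<integral>\<^sup>+x. ennreal (f (x, t) / 3) \<partial>lborel) \<le> ennreal (M * Y)" for t
  proof (cases "t1 \<le> t \<and> t < te")
    case True
    have "f (x, t) / 3 \<le> \<Phi> (u (x, t)) * (ball_cutoff x0 rj r x ^ n * \<tau> t)" for x
    proof -
      have "ball_cutoff x0 rj r x ^ n * (\<tau> t * \<theta> t) \<le> ball_cutoff x0 rj r x ^ n * \<tau> t"
        using \<zeta>(1)[of x] \<theta>(3) \<tau>0 by (intro mult_left_mono mult_right_le_one_le) auto
      from mult_right_mono[OF this, of "F (u (x, t))"]
      show ?thesis by (simp add: f_def \<eta>_def cutoff_def \<Phi>_def F_def mult_ac)
    qed
    then have "(\<integral>\<^sup>+x. ennreal (f (x, t) / 3) \<partial>lborel) \<le> (\<integral>\<^sup>+x. ennreal (\<Phi> (u (x, t)) * (ball_cutoff x0 rj r x ^ n * \<tau> t)) \<partial>lborel)"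
      by (intro nn_integral_mono ennreal_leI)
    also have "\<dots> \<le> ennreal (M * Y)"
      unfolding Y_def
      by (rule slice_estimate[OF k rj0 rj(1) subj d\<Phi> dp cq(1,2) sg d\<tau> c\<tau>' \<tau>0 \<tau>lt D(2,3) M bound])
        (use True in auto)
    finally show ?thesis .
  next
    case False
    then have "\<tau> t * \<theta> t = 0" using \<tau>lt \<theta>(5) by (auto simp: not_le not_less)
    then have "f (x, t) = 0" for x by (simp add: f_def \<eta>_def cutoff_def)
    then show ?thesis by simp
  qed
  let ?X = "(k ^ 3 / r) * gradient_const C0 C1 n * Y"
  have X: "0 \<le> ?X" using k r C0 Ce_pos by (simp add: gradient_const_def Y_def)
  have shift: "(\<integral>z. \<bar>f (z + (y, 0)) - f z\<bar> \<partial>lborel) \<le> norm y * ?X" for y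
  proof -
    let ?R = "\<lambda>z. norm y * (3 * (k\<^sup>2 / r) * (k * indicator ?D z + (q (u z) * G (norm (V z)) * \<eta> z) / (2 * (k\<^sup>2 * \<kappa>)))
        + (2 * real n * k ^ 3 / r) * indicator ?D z)"
    \<comment> \<open>One power of the truncation is traded for \<open>k\<close>, which leaves the
      weight \<open>q\<close> of the energy up to a constant; \<open>linear_le_G\<close> at
      \<open>m = k / r\<close> then replaces the gradient by \<open>G\<close>.\<close>
    have pt: "\<bar>\<eta> z * F' (u z) * (y \<bullet> V z) + F (u z) * (y \<bullet> fst (D\<eta> z))\<bar> \<le> ?R z" for z
    proof -
      have Gk: "G (k / r) = k\<^sup>2 * \<kappa>" using k by (simp add: \<kappa>_def)
      have a: "norm (V z) \<le> (k / r) * (1 + G (norm (V z)) / (k\<^sup>2 * \<kappa>))"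
        using linear_le_G[of "norm (V z)" "k / r"] k r Gp unfolding Gk by simp
      have t1: "\<bar>\<eta> z * F' (u z) * (y \<bullet> V z)\<bar> \<le> norm y * (3 * (k\<^sup>2 / r) * (k * indicator ?D z + (q (u z) * G (norm (V z)) * \<eta> z) / (2 * (k\<^sup>2 * \<kappa>))))"
      proof (cases "z \<in> K")
        case True
        have mk: "?m (u z) ^ 2 \<le> k * ?m (u z)"
          using mult_right_mono[OF m_le[OF u0[OF True]], of "?m (u z)"] by (simp add: power2_eq_square)
        have "\<bar>\<eta> z * F' (u z) * (y \<bullet> V z)\<bar> = 3 * (\<eta> z * ?m (u z) ^ 2) * \<bar>y \<bullet> V z\<bar>"
          using \<eta>01[of z] by (simp add: F'_def abs_mult)
        also have "\<dots> \<le> 3 * (\<eta> z * (k * ?m (u z))) * (norm y * ((k / r) * (1 + G (norm (V z)) / (k\<^sup>2 * \<kappa>))))"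
        proof (rule mult_mono)
          have "\<bar>y \<bullet> V z\<bar> \<le> norm y * norm (V z)" by (rule Cauchy_Schwarz_ineq2)
          also have "\<dots> \<le> norm y * ((k / r) * (1 + G (norm (V z)) / (k\<^sup>2 * \<kappa>)))" by (intro mult_left_mono a) simp
          finally show "\<bar>y \<bullet> V z\<bar> \<le> norm y * ((k / r) * (1 + G (norm (V z)) / (k\<^sup>2 * \<kappa>)))" .
          show "3 * (\<eta> z * ?m (u z) ^ 2) \<le> 3 * (\<eta> z * (k * ?m (u z)))" using mk \<eta>01[of z] by (intro mult_left_mono) auto
        qed (use \<eta>01[of z] k in auto)
        also have "\<dots> = norm y * (3 * (k\<^sup>2 / r) * (?m (u z) * \<eta> z + (q (u z) * G (norm (V z)) * \<eta> z) / (2 * (k\<^sup>2 * \<kappa>))))"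
          using k r \<kappa> by (simp add: q_def field_simps power2_eq_square)
        also have "\<dots> \<le> norm y * (3 * (k\<^sup>2 / r) * (k * indicator ?D z + (q (u z) * G (norm (V z)) * \<eta> z) / (2 * (k\<^sup>2 * \<kappa>))))"
          using \<eta>D[of z] k r by (intro mult_left_mono add_right_mono) auto
        finally show ?thesis .
      next
        case False
        then show ?thesis using outK(1)[OF False] k r by simp
      qed
      have t2: "\<bar>F (u z) * (y \<bullet> fst (D\<eta> z))\<bar> \<le> norm y * ((2 * real n * k ^ 3 / r) * indicator ?D z)"
      proof -
        have "\<bar>F (u z) * (y \<bullet> fst (D\<eta> z))\<bar> \<le> ?m (u z) ^ 3 * (norm y * norm (fst (D\<eta> z)))"
          unfolding abs_mult by (intro mult_mono Cauchy_Schwarz_ineq2) (auto simp: F_def)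
        also have "\<dots> = norm y * (?m (u z) ^ 3 * norm (fst (D\<eta> z)))" by simp
        also have "\<dots> \<le> norm y * ((2 * real n * k ^ 3 / r) * indicator ?D z)" by (intro mult_left_mono gD) simp
        finally show ?thesis .
      qed
      have tri: "\<bar>a + b\<bar> \<le> c * (d + e)" if "\<bar>a\<bar> \<le> c * d" "\<bar>b\<bar> \<le> c * e" for a b c d e :: real
        using that abs_triangle_ineq[of a b] by (simp add: distrib_left)
      show ?thesis by (rule tri[OF t1 t2])
    qed
    have iD: "integrable lborel (\<lambda>z. indicator ?D z :: real)" using D by (simp add: integrable_indicator_iff)
    have iR: "integrable lborel ?R"
        using iD ce(2)[folded \<eta>_def]
        by (intro integrable_mult_right Bochner_Integration.integrable_add integrable_divide)
    have "(\<integral>z. \<bar>f (z + (y, 0)) - f z\<bar> \<partial>lborel) \<le> (\<integral>z. \<bar>\<eta> z * F' (u z) * (y \<bullet> V z) + F (u z) * (y \<bullet> fst (D\<eta> z))\<bar> \<partial>lborel)"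
      using lg dF cq(4) C\<eta> clos' unfolding local_gradient_def f_def by blast
    also have "\<dots> \<le> (\<integral>z. ?R z \<partial>lborel)"
      by (rule Bochner_Integration.integral_mono'[OF iR pt]) (rule order_trans[OF abs_ge_zero pt])
    also have "\<dots> = norm y * (3 * (k\<^sup>2 / r) * (k * Y + (\<integral>z. q (u z) * G (norm (V z)) * \<eta> z \<partial>lborel) / (2 * (k\<^sup>2 * \<kappa>))) + (2 * real n * k ^ 3 / r) * Y)"
    proof -
      have iD: "integrable lborel (\<lambda>z. indicator ?D z :: real)" using D by (simp add: integrable_indicator_iff)
      have iI: "(\<integral>z. indicator ?D z \<partial>lborel) = Y" using D by (simp add: Y_def)
      have i1: "integrable lborel (\<lambda>z. (q (u z) * G (norm (V z)) * \<eta> z) / (2 * (k\<^sup>2 * \<kappa>)))"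
        by (intro integrable_divide ce(2)[folded \<eta>_def])
      have i2: "integrable lborel (\<lambda>z. k * indicator ?D z + (q (u z) * G (norm (V z)) * \<eta> z) / (2 * (k\<^sup>2 * \<kappa>)))"
        by (intro Bochner_Integration.integrable_add integrable_mult_right iD i1)
      show ?thesis
        unfolding integral_mult_right_zero
        by (subst Bochner_Integration.integral_add[OF integrable_mult_right[OF i2] integrable_mult_right[OF iD]],
            subst integral_mult_right_zero, subst Bochner_Integration.integral_add[OF integrable_mult_right[OF iD] i1],
            subst integral_divide_zero, subst integral_mult_right_zero, subst integral_mult_right_zero, subst (1 2) iI, rule refl)
    qed
    also have "\<dots> \<le> norm y * ?X"
    proof (rule mult_left_mono)
      let ?I = "\<integral>z. q (u z) * G (norm (V z)) * \<eta> z \<partial>lborel"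
      have "0 \<le> (\<integral>z. \<Phi> (u z) * (ball_cutoff x0 rj r (fst z) ^ n * \<tau> (snd z)) * (- \<theta>' (snd z)) \<partial>lborel)"
        by (intro Bochner_Integration.integral_nonneg mult_nonneg_nonneg zero_le_power \<zeta>(1))
          (use \<theta>(3) \<tau>0 in \<open>auto simp: \<Phi>_def\<close>)
      then have I: "C0 / 2 * ?I \<le> M * Y" using ce(1) unfolding \<eta>_def Y_def by linarith
      then have "?I / 2 \<le> M * Y / C0" using C0 by (simp add: field_simps)
      then have "?I / 2 / (k\<^sup>2 * \<kappa>) \<le> M * Y / C0 / (k\<^sup>2 * \<kappa>)" using k \<kappa> by (intro divide_right_mono) auto
      also have "M * Y / C0 / (k\<^sup>2 * \<kappa>) = k * ((2 + Ce) / C0) * Y"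
        using k \<kappa> C0 by (simp add: M_def field_simps power2_eq_square power3_eq_cube)
      finally have I2: "?I / (2 * (k\<^sup>2 * \<kappa>)) \<le> k * ((2 + Ce) / C0) * Y" by simp
      have "3 * (k\<^sup>2 / r) * (k * Y + ?I / (2 * (k\<^sup>2 * \<kappa>))) + (2 * real n * k ^ 3 / r) * Y
         \<le> 3 * (k\<^sup>2 / r) * (k * Y + k * ((2 + Ce) / C0) * Y) + (2 * real n * k ^ 3 / r) * Y"
        using k r by (intro add_right_mono mult_left_mono add_left_mono I2) auto
      also have "\<dots> = ?X"
        using r by (simp add: gradient_const_def algebra_simps power2_eq_square power3_eq_cube add_divide_distrib)
      finally show "3 * (k\<^sup>2 / r) * (k * Y + ?I / (2 * (k\<^sup>2 * \<kappa>))) + (2 * real n * k ^ 3 / r) * Y \<le> ?X" .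
    qed simp
    finally show ?thesis .
  qed
  let ?D' = "lower_set x0 t1 h (kj - k * d) (rj - r * d) (cj + d) te'"
  have sub': "cball x0 (rj - r * d) \<times> {t1..te'} \<subseteq> interior K"
    using te(1) r d by (intro order_trans[OF _ subj] Sigma_mono subset_cball) auto
  have cj': "0 \<le> cj + d" using cj d by simp
  note D' = lower_set_props[OF h cj' sub', where k = "kj - k * d"]
  \<comment> \<open>The exponent collects \<open>d ^ n\<close> from the spatial cutoff,
    \<open>d\<^sup>2\<close> from the time cutoff and \<open>d ^ 3\<close> from the cubed drop in
    level.\<close>
  let ?s = "k ^ 3 * d ^ (n + 5)"
  have s0: "0 < ?s" using k d by simp
  have fs: "?s \<le> f z" if z: "z \<in> ?D'" for z
  proof -
    have zz: "fst z \<in> ball x0 (rj - r * d)" "cj + d < ramp t1 h (snd z)" "snd z < te'" "u z < kj - k * d"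
      using z by (auto simp: lower_set_def)
    have "k * d \<le> ?m (u z)" using zz(4) by simp
    then have 1: "(k * d) ^ 3 \<le> F (u z)" unfolding F_def using k d by (intro power_mono) auto
    have "d \<le> max 0 (ramp t1 h (snd z) - cj)" using zz(2) by simp
    then have "d\<^sup>2 \<le> \<tau> (snd z)" unfolding \<tau>_def using d by (intro power_mono) auto
    then have 2: "d\<^sup>2 \<le> \<tau> (snd z) * \<theta> (snd z)" using \<theta>(4) zz(3) by simp
    have "(fst z - x0) \<bullet> (fst z - x0) \<le> (rj - r * d)\<^sup>2"
      using zz(1) by (auto simp: dot_square_norm dist_norm norm_minus_commute intro!: power_mono)
    \<comment> \<open>The difference of squares is factored; both radii are at least
      \<open>r / 2\<close>.\<close>
    moreover have "r\<^sup>2 * d \<le> rj\<^sup>2 - (rj - r * d)\<^sup>2"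
    proof -
      have "rj\<^sup>2 - (rj - r * d)\<^sup>2 = (r * d) * (rj + (rj - r * d))" by (simp add: power2_eq_square algebra_simps)
      moreover have "r \<le> rj + (rj - r * d)" using rj(2) r d by (smt (verit) field_sum_of_halves mult_pos_pos)
      then have "(r * d) * r \<le> (r * d) * (rj + (rj - r * d))" using r d by (intro mult_left_mono) auto
      ultimately show ?thesis by (simp add: power2_eq_square mult_ac)
    qed
    ultimately have "r\<^sup>2 * d \<le> rj\<^sup>2 - (fst z - x0) \<bullet> (fst z - x0)" by linarith
    then have "d \<le> ball_cutoff x0 rj r (fst z)" using r by (simp add: ball_cutoff_def le_max_iff_disj pos_le_divide_eq mult.commute)
    then have 3: "d ^ n \<le> ball_cutoff x0 rj r (fst z) ^ n" using d by (intro power_mono) auto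
    have "?s = (d ^ n * d\<^sup>2) * (k * d) ^ 3" by (simp add: power_add power_mult_distrib power2_eq_square power3_eq_cube eval_nat_numeral mult_ac)
    also have "\<dots> \<le> (ball_cutoff x0 rj r (fst z) ^ n * (\<tau> (snd z) * \<theta> (snd z))) * F (u z)"
      using 1 2 3 d k \<zeta>(1)[of "fst z"] \<tau>\<theta>[of "snd z"] by (intro mult_mono) auto
    also have "\<dots> = f z" by (simp add: f_def \<eta>_def cutoff_def)
    finally show ?thesis .
  qed
  have \<rho>: "0 < r * \<beta>" using r \<beta> by simp
  have sm: "M * Y \<le> ?s / 3 / 2 * measure lborel (ball (0 :: real ^ 'n) (r * \<beta>))"
  proof -
    have "M * Y = (k ^ 3 / 6) * (6 * (2 + Ce) * \<kappa> * Y)" by (simp add: M_def)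
    also have "\<dots> \<le> (k ^ 3 / 6) * (d ^ (n + 5) * (r * \<beta>) ^ CARD('n) * measure lborel (ball (0 :: real ^ 'n) 1))"
      using small k by (intro mult_left_mono) (auto simp: \<kappa>_def)
    also have "\<dots> = ?s / 3 / 2 * ((r * \<beta>) ^ DIM(real ^ 'n) * measure lborel (ball (0 :: real ^ 'n) 1))" by (simp add: mult_ac)
    also have "(r * \<beta>) ^ DIM(real ^ 'n) * measure lborel (ball (0 :: real ^ 'n) 1) = measure lborel (ball (0 :: real ^ 'n) (r * \<beta>))"
      using content_ball_conv_unit_ball[of "r * \<beta>" "0 :: real ^ 'n"] \<rho> by simp
    finally show ?thesis .
  qed
  \<comment> \<open>The estimate is applied to \<open>f / 3\<close>, because the slice bound is
    available for \<open>\<Phi>\<close>, which carries the factor one third.\<close>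
  have "measure lborel ?D' * (?s / 3 / 2) \<le> (r * \<beta>) * (?X / 3)"
  proof (rule superlevel_measure_estimate[OF _ _ _ \<rho> _ _ slice MY D'(2) _ _ sm])
    show "(\<lambda>z. f z / 3) \<in> borel_measurable borel" using mf by measurable
    show "integrable lborel (\<lambda>z. f z / 3)" using fi by simp
    show "0 \<le> f z / 3" for z using f0[of z] by simp
    show "0 \<le> ?X / 3" by (rule divide_nonneg_pos[OF X]) simp
    show "?s / 3 \<le> f z / 3" if "z \<in> ?D'" for z using fs[OF that] by simp
    show "0 < ?s / 3" using s0 by simp
    fix y
    have e: "\<bar>f (z + (y, 0)) / 3 - f z / 3\<bar> = \<bar>f (z + (y, 0)) - f z\<bar> / 3" for z by (simp flip: diff_divide_distrib)
    show "(\<integral>z. \<bar>f (z + (y, 0)) / 3 - f z / 3\<bar> \<partial>lborel) \<le> norm y * (?X / 3)"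
      unfolding e using shift[of y] by simp
  qed
  then have "k ^ 3 / 6 * (Y' * d ^ (n + 5)) \<le> k ^ 3 / 6 * (2 * \<beta> * gradient_const C0 C1 n * Y)"
    using r by (simp add: Y'_def mult_ac)
  from mult_left_le_imp_le[OF this] show ?thesis using k by simp
qed

end

text \<open>
  \<open>de_giorgi_const\<close> is chosen such that \<open>de_giorgi_step\<close>, applied with step size \<open>2\<^sup>-\<^sup>j / 4\<close>, can be
  repeated: the measure of the sets \<open>{u < k\<^sub>j}\<close> then decreases by the factor \<open>iteration_rate\<close> in each step.
\<close>

definition iteration_rate :: "nat \<Rightarrow> nat \<Rightarrow> real" where
  "iteration_rate n N = (2 ^ (n + 5)) ^ (N + 1)"

definition de_giorgi_const :: "real \<Rightarrow> real \<Rightarrow> nat \<Rightarrow> nat \<Rightarrow> real \<Rightarrow> real" where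
  "de_giorgi_const C0 C1 n N v =
     v / (6 * (2 + energy_const C0 C1 n) * (2 * gradient_const C0 C1 n * iteration_rate n N) ^ N * (iteration_rate n N)\<^sup>2)"

text \<open>This comes from \<open>M / m\<close> in \<open>log_estimate\<close>: the numbers
  \<open>3 * 8 * 4 = 96\<close> and \<open>(4 / 3) ^ n\<close>, times \<open>2 ^ n / 4\<close> for
  passing from the level \<open>2 * k\<close> back to \<open>k\<close>.\<close>

definition log_const :: "real \<Rightarrow> real \<Rightarrow> nat \<Rightarrow> real" where
  "log_const C0 C1 n = 24 * (8 / 3) ^ n * energy_const C0 C1 n"

section \<open>Pointwise lower bounds and their propagation in time\<close>

context local_solution
begin

lemma unit_ball_pos: "0 < measure lborel (ball (0 :: real ^ 'n) 1)" by (rule content_ball_pos) simp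

lemma measure_ball_scale: "0 \<le> \<rho> \<Longrightarrow> measure lborel (ball (x :: real ^ 'n) \<rho>) = \<rho> ^ CARD('n) * measure lborel (ball (0 :: real ^ 'n) 1)"
  using content_ball_conv_unit_ball[of \<rho> x] by simp

text \<open>By continuity a single point with \<open>u < k / 2\<close> has a neighbourhood contained
  in all the sets \<open>D j\<close>, whose measures tend to 0; the bound therefore holds at every
  point. The averaging radius shrinks with \<open>j\<close> in such a way that geometric decay
  reproduces the smallness condition of \<open>de_giorgi_step\<close>.\<close>

lemma de_giorgi:
  assumes k: "0 < k" and r: "0 < r" and Gp: "0 < G (k / r)" and sub: "cball x0 r \<times> {t1..t2} \<subseteq> interior K"
    and h: "0 < h"
    and alt: "1 / h \<le> G (k / r) / k\<^sup>2 \<or> (\<forall>x\<in>cball x0 r. \<forall>t\<in>{t1..<t1 + h}. k \<le> u (x, t))"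
    and small: "measure lborel (lower_set x0 t1 h k r 0 t2) * (G (k / r) / k\<^sup>2) \<le> de_giorgi_const C0 C1 n CARD('n) (measure lborel (ball (0 :: real ^ 'n) 1)) * r ^ CARD('n)"
    and x: "x \<in> ball x0 (r / 2)" and t: "t1 + h / 2 \<le> t" "t < t2"
  shows "k / 2 \<le> u (x, t)"
proof (rule ccontr)
  assume "\<not> k / 2 \<le> u (x, t)"
  then have neg: "u (x, t) < k / 2" by simp
  \<comment> \<open>The end times decrease from \<open>t2\<close> towards \<open>t3\<close>,
    strictly after \<open>t\<close>: every step has room for an upper time cutoff while
    \<open>t\<close> stays inside.\<close>
  define t3 where "t3 = (t + t2) / 2"
  have t3: "t < t3" "t3 < t2" using t by (auto simp: t3_def)
  define \<kappa> where "\<kappa> = G (k / r) / k\<^sup>2"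
  have \<kappa>: "0 < \<kappa>" using Gp k by (simp add: \<kappa>_def)
  define \<mu> where "\<mu> = iteration_rate n CARD('n)"
  define C3 where "C3 = gradient_const C0 C1 n"
  have \<mu>: "1 < \<mu>" unfolding \<mu>_def iteration_rate_def by (intro one_less_power) auto
  have C3: "0 < C3" using C0 Ce_pos n2 by (simp add: C3_def gradient_const_def add_pos_pos)
  define P where "P = (2 * C3 * \<mu>) ^ CARD('n)"
  have P: "0 < P" unfolding P_def by (rule zero_less_power) (use C3 \<mu> in simp)
  have \<nu>: "de_giorgi_const C0 C1 n CARD('n) (measure lborel (ball (0 :: real ^ 'n) 1)) = measure lborel (ball (0 :: real ^ 'n) 1) / (6 * (2 + Ce) * P * \<mu>\<^sup>2)" by (simp add: de_giorgi_const_def C3_def \<mu>_def P_def)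
  define D where "D j = lower_set x0 t1 h (k / 2 * (1 + (1 / 2) ^ j)) (r / 2 * (1 + (1 / 2) ^ j)) (1 / 2 * (1 - (1 / 2) ^ j)) (t3 + (t2 - t3) * (1 / 2) ^ j)" for j :: nat
  have D0: "D 0 = lower_set x0 t1 h k r 0 t2" by (simp add: D_def)
  have pw: "0 < (1 / 2 :: real) ^ j \<and> (1 / 2 :: real) ^ j \<le> 1" for j :: nat by (simp add: power_le_one)
  have decay: "measure lborel (D j) \<le> de_giorgi_const C0 C1 n CARD('n) (measure lborel (ball (0 :: real ^ 'n) 1)) * r ^ CARD('n) / \<kappa> * (1 / \<mu>) ^ j" for j
  proof (induction j)
    case 0
    show ?case using small \<kappa> unfolding D0 by (simp add: \<kappa>_def[symmetric] pos_le_divide_eq)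
  next
    case (Suc j)
    \<comment> \<open>This is the difference between consecutive levels, radii and ramp levels, in
      units of \<open>k\<close>, \<open>r\<close> and 1.\<close>
    define d :: real where "d = (1 / 2) ^ j / 4"
    define b :: real where "b = (2 ^ (n + 5)) ^ (j + 2)"
    have b: "0 < b" by (simp add: b_def)
    have d: "0 < d" using pw[of j] by (simp add: d_def)
    have db: "d ^ (n + 5) = 1 / b"
    proof -
      have "d = 1 / 2 ^ (j + 2)" by (simp add: d_def power_one_over)
      then have "d ^ (n + 5) = 1 / (2 ^ (j + 2)) ^ (n + 5)" by (simp add: power_one_over)
      also have "(2 ^ (j + 2)) ^ (n + 5) = b" unfolding b_def by (simp only: power_mult[symmetric] mult.commute)
      finally show ?thesis .
    qed
    have b\<mu>: "b ^ (CARD('n) + 1) = \<mu> ^ (j + 2)"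
      unfolding b_def \<mu>_def iteration_rate_def by (simp only: power_mult[symmetric] mult_ac)
    \<comment> \<open>Chosen so that \<open>2 * \<beta> * C3 / d ^ (n + 5) = 1 / \<mu>\<close>, the
      desired decay. Then \<open>d ^ (n + 5) * \<beta> ^ CARD('n)\<close> equals
      \<open>1 / (P * \<mu> ^ (j + 2))\<close>, whose dependence on \<open>j\<close> is that of the
      induction hypothesis.\<close>
    define \<beta> where "\<beta> = 1 / (2 * C3 * \<mu> * b)"
    have \<beta>: "0 < \<beta>" using C3 \<mu> b by (simp add: \<beta>_def)
    let ?Y = "measure lborel (D j)"
    have e1: "k / 2 * (1 + (1 / 2) ^ Suc j) = k / 2 * (1 + (1 / 2) ^ j) - k * d"
      "r / 2 * (1 + (1 / 2) ^ Suc j) = r / 2 * (1 + (1 / 2) ^ j) - r * d"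
      "1 / 2 * (1 - (1 / 2) ^ Suc j) = 1 / 2 * (1 - (1 / 2) ^ j) + d"
      by (simp_all add: d_def algebra_simps)
    have "measure lborel (D (Suc j)) * d ^ (n + 5) \<le> 2 * \<beta> * gradient_const C0 C1 n * ?Y"
      unfolding D_def e1
    proof (rule de_giorgi_step[OF k r Gp sub h alt d])
      show "k / 2 * (1 + (1 / 2) ^ j) \<le> k" "r / 2 * (1 + (1 / 2) ^ j) \<le> r" using pw[of j] k r by auto
      have "k * (d + d) \<le> k * (1 + (1 / 2) ^ j)" using pw[of j] k by (intro mult_left_mono) (auto simp: d_def)
      then show "k * d \<le> k / 2 * (1 + (1 / 2) ^ j)" by (simp add: algebra_simps)
      have "0 \<le> r * ((1 / 2) ^ j / 4)" using r by simp
      then show "r / 2 \<le> r / 2 * (1 + (1 / 2) ^ j) - r * d" by (simp add: d_def algebra_simps)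
      show "0 \<le> 1 / 2 * (1 - (1 / 2 :: real) ^ j)" using pw[of j] by simp
      have "(t2 - t3) * (1 / 2) ^ Suc j < (t2 - t3) * (1 / 2) ^ j" using t3 pw[of j] by (intro mult_strict_left_mono) auto
      then show "t3 + (t2 - t3) * (1 / 2) ^ Suc j < t3 + (t2 - t3) * (1 / 2) ^ j" by simp
      have "(t2 - t3) * (1 / 2) ^ j \<le> (t2 - t3) * 1" using t3 pw[of j] by (intro mult_left_mono) auto
      then show "t3 + (t2 - t3) * (1 / 2) ^ j \<le> t2" by simp
      show "0 < \<beta>" by (rule \<beta>)
      have "6 * (2 + Ce) * \<kappa> * ?Y \<le> 6 * (2 + Ce) * \<kappa> * (de_giorgi_const C0 C1 n CARD('n) (measure lborel (ball (0 :: real ^ 'n) 1)) * r ^ CARD('n) / \<kappa> * (1 / \<mu>) ^ j)"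
        using Suc.IH Ce_pos \<kappa> by (intro mult_left_mono) auto
      also have "\<dots> = measure lborel (ball (0 :: real ^ 'n) 1) / P * r ^ CARD('n) / \<mu> ^ (j + 2)"
      proof -
        have A: "A * \<kappa> * (c / (A * P * \<mu>\<^sup>2) * R / \<kappa> * (1 / \<mu>) ^ j) = c / P * R / \<mu> ^ (j + 2)" if "0 < A" for A c R
          using that \<kappa> P \<mu> by (simp add: power_add power_one_over power2_eq_square field_simps)
        show ?thesis unfolding \<nu> by (rule A) (use Ce_pos in simp)
      qed
      also have "\<dots> = measure lborel (ball (0 :: real ^ 'n) 1) / P * r ^ CARD('n) / (b * b ^ CARD('n))" unfolding b\<mu>[symmetric] by simp
      also have "\<dots> = d ^ (n + 5) * (r * \<beta>) ^ CARD('n) * measure lborel (ball (0 :: real ^ 'n) 1)"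
        unfolding db \<beta>_def P_def by (simp add: power_mult_distrib power_divide mult_ac)
      finally show "6 * (2 + Ce) * (G (k / r) / k\<^sup>2) * measure lborel (lower_set x0 t1 h (k / 2 * (1 + (1 / 2) ^ j)) (r / 2 * (1 + (1 / 2) ^ j)) (1 / 2 * (1 - (1 / 2) ^ j)) (t3 + (t2 - t3) * (1 / 2) ^ j))
          \<le> d ^ (n + 5) * (r * \<beta>) ^ CARD('n) * measure lborel (ball (0 :: real ^ 'n) 1)"
        by (simp only: \<kappa>_def D_def)
    qed
    also have "\<dots> = ?Y / \<mu> * (1 / b)" using C3 \<mu> b by (simp add: \<beta>_def C3_def[symmetric])
    finally have "measure lborel (D (Suc j)) * (1 / b) \<le> ?Y / \<mu> * (1 / b)" unfolding db .
    then have "measure lborel (D (Suc j)) \<le> ?Y / \<mu>" by (rule mult_right_le_imp_le) (use b in simp)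
    also have "\<dots> \<le> de_giorgi_const C0 C1 n CARD('n) (measure lborel (ball (0 :: real ^ 'n) 1)) * r ^ CARD('n) / \<kappa> * (1 / \<mu>) ^ j / \<mu>" using Suc.IH \<mu> by (intro divide_right_mono) auto
    also have "\<dots> = de_giorgi_const C0 C1 n CARD('n) (measure lborel (ball (0 :: real ^ 'n) 1)) * r ^ CARD('n) / \<kappa> * (1 / \<mu>) ^ Suc j" by simp
    finally show ?case .
  qed
  have subt: "cball x0 r \<times> {t1..t3 + (t2 - t3) * (1 / 2) ^ j} \<subseteq> interior K" for j
  proof -
    have "(t2 - t3) * (1 / 2) ^ j \<le> (t2 - t3) * 1" using t3 pw[of j] by (intro mult_left_mono) auto
    then show ?thesis by (intro order_trans[OF _ sub] Sigma_mono) auto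
  qed
  let ?O = "{z \<in> interior K. u z < k / 2} \<inter> fst -` ball x0 (r / 2) \<inter> snd -` {..<t3} \<inter> {z. 1 / 2 < ramp t1 h (snd z)}"
  have oO: "open ?O"
  proof (intro open_Int)
    show "open {z \<in> interior K. u z < k / 2}"
    proof -
      have "continuous_on (interior K) u" by (rule continuous_on_subset[OF cu interior_subset])
      from continuous_open_preimage[OF this open_interior open_lessThan[of "k / 2"]]
      show ?thesis by (simp add: Int_def vimage_def)
    qed
    show "open (fst -` ball x0 (r / 2) :: 'n space_time set)" by (intro open_vimage_fst open_ball)
    show "open (snd -` {..<t3} :: 'n space_time set)" by (intro open_vimage_snd open_lessThan)
    show "open {z :: 'n space_time. 1 / 2 < ramp t1 h (snd z)}"
      by (intro open_Collect_less continuous_intros continuous_on_compose2[OF ramp_continuous[OF h, of UNIV]]) auto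
  qed
  have xO: "(x, t) \<in> ?O"
  proof -
    have "t1 < t" using t h by simp
    then have "(x, t) \<in> cball x0 r \<times> {t1..t2}" using x t r by auto
    then show ?thesis using sub x neg t3 ramp_half[OF h t(1)] by auto
  qed
  have OD: "?O \<subseteq> D j" for j
  proof
    fix z assume z: "z \<in> ?O"
    have "r / 2 \<le> r / 2 * (1 + (1 / 2) ^ j)" "k / 2 \<le> k / 2 * (1 + (1 / 2) ^ j)" using r k by (simp_all add: distrib_left)
    moreover have "t3 \<le> t3 + (t2 - t3) * (1 / 2) ^ j" using t3 by simp
    moreover have "1 / 2 * (1 - (1 / 2) ^ j) < ramp t1 h (snd z)"
    proof -
      have "1 / 2 * (1 - p) < q" if "0 < p" "1 / 2 < q" for p q :: real using that by simp
      from this[of "(1 / 2) ^ j"] show ?thesis using pw[of j] z by blast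
    qed
    ultimately show "z \<in> D j" using z unfolding D_def lower_set_def by auto
  qed
  obtain \<epsilon> where \<epsilon>: "0 < \<epsilon>" "ball (x, t) \<epsilon> \<subseteq> ?O" using oO xO open_contains_ball by blast
  have le: "measure lborel (ball (x, t) \<epsilon>) \<le> de_giorgi_const C0 C1 n CARD('n) (measure lborel (ball (0 :: real ^ 'n) 1)) * r ^ CARD('n) / \<kappa> * (1 / \<mu>) ^ j" for j
  proof -
    have sj: "cball x0 (r / 2 * (1 + (1 / 2) ^ j)) \<times> {t1..t3 + (t2 - t3) * (1 / 2) ^ j} \<subseteq> interior K"
      using pw[of j] r by (intro order_trans[OF _ subt[of j]] Sigma_mono subset_cball) auto
    have cj: "0 \<le> 1 / 2 * (1 - (1 / 2 :: real) ^ j)" using pw[of j] by simp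
    note p = lower_set_props[OF h cj sj, where k = "k / 2 * (1 + (1 / 2) ^ j)", folded D_def]
    have "measure lborel (ball (x, t) \<epsilon>) \<le> measure lborel (D j)"
      by (rule measure_mono_fmeasurable) (use \<epsilon> OD[of j] p in \<open>auto simp: fmeasurable_def\<close>)
    then show ?thesis using decay[of j] by linarith
  qed
  have "(\<lambda>j. de_giorgi_const C0 C1 n CARD('n) (measure lborel (ball (0 :: real ^ 'n) 1)) * r ^ CARD('n) / \<kappa> * (1 / \<mu>) ^ j) \<longlonglongrightarrow> de_giorgi_const C0 C1 n CARD('n) (measure lborel (ball (0 :: real ^ 'n) 1)) * r ^ CARD('n) / \<kappa> * 0"
    by (intro tendsto_mult tendsto_const LIMSEQ_power_zero) (use \<mu> in auto)
  then have "measure lborel (ball (x, t) \<epsilon>) \<le> 0"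
    using le by (intro LIMSEQ_le_const[of _ _ "measure lborel (ball (x, t) \<epsilon>)"]) auto
  moreover have "0 < measure lborel (ball (x, t) \<epsilon>)" using \<epsilon>(1) by (rule content_ball_pos)
  ultimately show False by simp
qed

text \<open>The slice bound controls the integral of the cubed logarithm, which is of order
  \<open>\<Lambda> ^ 3\<close> on the low set, while the right-hand side grows only like
  \<open>\<Lambda>\<^sup>2\<close>, because \<open>e\<close> is quadratic in the logarithm. The
  quotient gives the factor \<open>1 / ln (1 + 1 / s)\<close>.\<close>

lemma log_estimate:
  assumes k: "0 < k" and r: "0 < r" and sub: "cball x0 r \<times> {t1..t2} \<subseteq> interior K"
    and h: "0 < h" and above: "\<forall>x\<in>cball x0 r. \<forall>t\<in>{t1..<t1 + h}. k \<le> u (x, t)"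
    and s: "0 < s" "s \<le> 1 / 3" and t: "t1 + h / 2 \<le> t" "t < t2"
  shows "emeasure lborel {x \<in> ball x0 (r / 2). u (x, t) < s * k}
      \<le> ennreal (log_const C0 C1 n * (G (k / r) / k\<^sup>2) * (t2 - t1) / ln (1 + 1 / s) * (r ^ CARD('n) * measure lborel (ball (0 :: real ^ 'n) 1)))"
proof -
  define \<sigma> where "\<sigma> = s * k"
  have \<sigma>: "0 < \<sigma>" "\<sigma> \<le> k" using s k by (auto simp: \<sigma>_def mult_left_le_one_le)
  have t12: "t1 < t2" "t1 < t" using t h by auto
  define l where "l v = ln ((k + \<sigma>) / (v + \<sigma>))" for v
  \<comment> \<open>The second summand of \<open>q\<close>, from differentiating
    \<open>1 / (v + \<sigma>)\<close>, yields both conditions of \<open>cutoff_energy\<close>: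
    multiplied by \<open>e\<close> it is \<open>p\<^sup>2\<close>, and multiplied by
    \<open>v + \<sigma>\<close> it is \<open>p\<close>. Where \<open>p\<close> is nonzero,
    \<open>v + \<sigma> \<le> 2 * k\<close>; hence the energy is used at the level
    \<open>2 * k\<close>.\<close>
  define \<Phi> p q e where "\<Phi> v = max 0 (l v) ^ 3" and "p v = 3 * max 0 (l v) ^ 2 / (v + \<sigma>)"
    and "q v = 6 * max 0 (l v) / (v + \<sigma>)\<^sup>2 + 3 * max 0 (l v) ^ 2 / (v + \<sigma>)\<^sup>2" and "e v = 3 * max 0 (l v) ^ 2" for v
  define \<Lambda> where "\<Lambda> = ln (1 + 1 / s)"
  have dl: "(l has_real_derivative - 1 / (v + \<sigma>)) (at v)" if "0 \<le> v" for v
  proof -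
    have 1: "((\<lambda>v. v + \<sigma>) has_real_derivative 1) (at v)" by (auto intro!: derivative_eq_intros)
    have "((\<lambda>v. (k + \<sigma>) / (v + \<sigma>)) has_real_derivative (0 * (v + \<sigma>) - (k + \<sigma>) * 1) / ((v + \<sigma>) * (v + \<sigma>))) (at v)"
      by (rule DERIV_divide[OF DERIV_const 1]) (use that \<sigma> in simp)
    from DERIV_chain2[OF DERIV_ln this] have "(l has_real_derivative inverse ((k + \<sigma>) / (v + \<sigma>)) * ((0 * (v + \<sigma>) - (k + \<sigma>) * 1) / ((v + \<sigma>) * (v + \<sigma>)))) (at v)"
      unfolding l_def[abs_def] using that \<sigma> k by simp
    moreover have "inverse ((k + \<sigma>) / (v + \<sigma>)) * ((0 * (v + \<sigma>) - (k + \<sigma>) * 1) / ((v + \<sigma>) * (v + \<sigma>))) = - 1 / (v + \<sigma>)"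
    proof -
      have "inverse (a / b) * ((0 * b - a * 1) / (b * b)) = - 1 / b" if "0 < a" "0 < b" for a b :: real using that by simp
      then show ?thesis using that \<sigma> k by (simp only: add_pos_pos add_nonneg_pos)
    qed
    ultimately show ?thesis by (simp only:)
  qed
  have d\<Phi>: "\<forall>v\<ge>0. (\<Phi> has_real_derivative - p v) (at v)"
  proof (intro allI impI)
    fix v :: real assume "0 \<le> v"
    from DERIV_chain2[OF DERIV_pos_part_power[of 3] dl[OF this]]
    show "(\<Phi> has_real_derivative - p v) (at v)" unfolding \<Phi>_def[abs_def] p_def by simp
  qed
  have dp: "\<forall>v\<ge>0. (p has_real_derivative - q v) (at v)"
  proof (intro allI impI)
    fix v :: real assume v: "0 \<le> v"
    have 1: "((\<lambda>v. 3 * max 0 (l v) ^ 2) has_real_derivative 3 * (2 * max 0 (l v) * (- 1 / (v + \<sigma>)))) (at v)"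
      using DERIV_cmult[OF DERIV_chain2[OF DERIV_pos_part_power[of 2] dl[OF v]], of 3] by simp
    have 2: "((\<lambda>v. v + \<sigma>) has_real_derivative 1) (at v)" by (auto intro!: derivative_eq_intros)
    have "(p has_real_derivative ((3 * (2 * max 0 (l v) * (- 1 / (v + \<sigma>)))) * (v + \<sigma>) - (3 * max 0 (l v) ^ 2) * 1) / ((v + \<sigma>) * (v + \<sigma>))) (at v)"
      unfolding p_def[abs_def] by (rule DERIV_divide[OF 1 2]) (use v \<sigma> in simp)
    moreover have "((3 * (2 * max 0 (l v) * (- 1 / (v + \<sigma>)))) * (v + \<sigma>) - (3 * max 0 (l v) ^ 2) * 1) / ((v + \<sigma>) * (v + \<sigma>)) = - q v"
      using v \<sigma> by (simp add: q_def power2_eq_square diff_divide_distrib)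
    ultimately show "(p has_real_derivative - q v) (at v)" by simp
  qed
  have cl: "continuous_on {0..} l" by (rule DERIV_nonneg_continuous_on[OF dl])
  have cq: "continuous_on {0..} q" "continuous_on {0..} e"
    unfolding q_def[abs_def] e_def[abs_def] using \<sigma> by (intro continuous_intros cl; simp)+
  have l0: "max 0 (l v) = 0" if "k \<le> v" for v
  proof -
    have "(k + \<sigma>) / (v + \<sigma>) \<le> 1" using that k \<sigma> by simp
    then have "l v \<le> 0" unfolding l_def using that k \<sigma> by (subst ln_le_zero_iff) auto
    then show ?thesis by simp
  qed
  have sg: "\<forall>v\<ge>0. 0 \<le> p v \<and> 0 \<le> q v \<and> 0 \<le> e v \<and> 0 \<le> \<Phi> v \<and> p v \<le> (2 * k) * q v \<and> (p v)\<^sup>2 \<le> e v * q v"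
  proof (intro allI impI conjI)
    fix v :: real assume v: "0 \<le> v"
    let ?L = "max 0 (l v)" and ?y = "v + \<sigma>"
    have y: "0 < ?y" using v \<sigma> by simp
    show "0 \<le> p v" "0 \<le> q v" "0 \<le> e v" "0 \<le> \<Phi> v" using y by (simp_all add: p_def q_def e_def \<Phi>_def)
    have q3: "3 * ?L ^ 2 / ?y\<^sup>2 \<le> q v" using y by (simp add: q_def)
    show "p v \<le> (2 * k) * q v"
    proof (cases "k \<le> v")
      case True
      then show ?thesis using l0[OF True] by (simp add: p_def q_def)
    next
      case False
      then have "?y \<le> 2 * k" using \<sigma> by simp
      have "p v = ?y * (3 * ?L ^ 2 / ?y\<^sup>2)" using y by (simp add: p_def power2_eq_square)
      also have "\<dots> \<le> (2 * k) * (3 * ?L ^ 2 / ?y\<^sup>2)" using \<open>?y \<le> 2 * k\<close> by (intro mult_right_mono) auto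
      also have "\<dots> \<le> (2 * k) * q v" using q3 k by (intro mult_left_mono) auto
      finally show ?thesis .
    qed
    have "(p v)\<^sup>2 = e v * (3 * ?L ^ 2 / ?y\<^sup>2)" by (simp add: p_def e_def power_divide power_mult_distrib power2_eq_square)
    also have "\<dots> \<le> e v * q v" by (intro mult_left_mono q3) (simp add: e_def)
    finally show "(p v)\<^sup>2 \<le> e v * q v" .
  qed
  have \<Lambda>0: "0 < \<Lambda>" unfolding \<Lambda>_def using s by (intro ln_gt_zero) simp
  have \<Lambda>ln: "ln ((k + \<sigma>) / \<sigma>) = \<Lambda>" using s k by (simp add: \<Lambda>_def \<sigma>_def add_divide_distrib add.commute)
  have l_le: "max 0 (l v) \<le> \<Lambda>" if "0 \<le> v" for v
  proof -
    have "l v \<le> ln ((k + \<sigma>) / \<sigma>)" unfolding l_def using that \<sigma> k by (subst ln_le_cancel_iff) (auto intro!: divide_left_mono)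
    then show ?thesis using \<Lambda>0 \<Lambda>ln by simp
  qed
  define \<tau> \<tau>' where "\<tau> t = (max 0 (ramp t1 h t))\<^sup>2" and "\<tau>' t = 2 * max 0 (ramp t1 h t) * ramp_deriv t1 h t" for t
  have d\<tau>: "\<forall>t. (\<tau> has_real_derivative \<tau>' t) (at t)"
  proof
    fix t
    from DERIV_chain2[OF DERIV_pos_part_power[of 2] ramp_DERIV[OF h, of t1 t]]
    show "(\<tau> has_real_derivative \<tau>' t) (at t)" unfolding \<tau>_def[abs_def] \<tau>'_def by simp
  qed
  have c\<tau>': "continuous_on UNIV \<tau>'"
    unfolding \<tau>'_def[abs_def] by (intro continuous_intros ramp_continuous[OF h] ramp_deriv_continuous[OF h])
  have \<tau>0: "\<forall>t. 0 \<le> \<tau> t" by (simp add: \<tau>_def)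
  have \<tau>lt: "\<forall>t<t1. \<tau> t = 0 \<and> \<tau>' t = 0"
    using ramp_nonpos[OF h, of _ t1] by (auto simp: \<tau>_def \<tau>'_def max_def intro!: antisym)
  have \<tau>1: "\<tau> t \<le> 1" for t unfolding \<tau>_def using ramp_le_1[of t1 h t] by (intro power_le_one) auto
  define \<kappa>2 where "\<kappa>2 = G (2 * k / r) / (2 * k)\<^sup>2"
  have \<kappa>2: "0 \<le> \<kappa>2" using G_nonneg by (simp add: \<kappa>2_def)
  define M where "M = Ce * \<kappa>2 * (3 * \<Lambda>\<^sup>2)"
  have M: "0 \<le> M" using Ce_pos \<kappa>2 by (simp add: M_def)
  let ?S = "ball x0 r \<times> {t1..<t2}"
  have mS: "?S \<in> sets borel" unfolding borel_prod[symmetric] by (intro pair_measureI) auto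
  have eb: "emeasure lborel (ball x0 r) = ennreal (r ^ CARD('n) * measure lborel (ball (0 :: real ^ 'n) 1))"
  proof -
    have "emeasure lborel (ball x0 r) = ennreal (measure lborel (ball x0 r))"
      by (rule emeasure_eq_ennreal_measure) (use emeasure_lborel_ball_finite[of x0 r] in simp)
    then show ?thesis using measure_ball_scale[of r x0] r by simp
  qed
  have eS: "emeasure lborel ?S = ennreal (r ^ CARD('n) * measure lborel (ball (0 :: real ^ 'n) 1) * (t2 - t1))"
  proof -
    have "emeasure lborel ?S = emeasure (lborel \<Otimes>\<^sub>M lborel) ?S" by (simp add: lborel_prod)
    also have "\<dots> = emeasure lborel (ball x0 r) * emeasure lborel {t1..<t2}" by (rule lborel.emeasure_pair_measure_Times) auto
    also have "\<dots> = ennreal (r ^ CARD('n) * measure lborel (ball (0 :: real ^ 'n) 1) * (t2 - t1))"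
      unfolding eb using t12 r unit_ball_pos by (simp add: ennreal_mult)
    finally show ?thesis .
  qed
  have fS: "emeasure lborel ?S < \<infinity>" unfolding eS by simp
  have mS': "measure lborel ?S = r ^ CARD('n) * measure lborel (ball (0 :: real ^ 'n) 1) * (t2 - t1)"
    using eS t12 r unit_ball_pos by (simp add: measure_def)
  have "0 < 2 * k" using k by simp
  have inK: "(x, t) \<in> K" if "x \<in> ball x0 r" "t \<in> {t1..t2}" for x t
  proof -
    have "(x, t) \<in> cball x0 r \<times> {t1..t2}" using that by auto
    then show ?thesis using sub interior_subset by blast
  qed
  have bound: "\<forall>x\<in>ball x0 r. \<forall>t\<in>{t1..<t2}. \<Phi> (u (x, t)) * ball_cutoff x0 r r x ^ n * \<tau>' t
        + Ce * (G (2 * k / r) / (2 * k)\<^sup>2) * (e (u (x, t)) * \<tau> t) \<le> M * indicator ?S (x, t)"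
  proof (intro ballI)
    fix x t assume x: "x \<in> ball x0 r" and t: "t \<in> {t1..<t2}"
    have u0': "0 \<le> u (x, t)" by (rule u0[OF inK]) (use x t in auto)
    \<comment> \<open>While the ramp rises, \<open>u \<ge> k\<close> makes the positive part of the
      logarithm vanish; afterwards the ramp is constant. So \<open>M\<close> contains no
      contribution of \<open>1 / h\<close>.\<close>
    have z: "\<Phi> (u (x, t)) * \<tau>' t = 0"
    proof (cases "t < t1 + h")
      case True
      then have "k \<le> u (x, t)" using above x t by auto
      from l0[OF this] show ?thesis by (simp add: \<Phi>_def)
    next
      case False
      then show ?thesis using ramp_deriv_bounds(3)[OF h, of t1 t] by (simp add: \<tau>'_def)
    qed
    have "e (u (x, t)) \<le> 3 * \<Lambda>\<^sup>2" unfolding e_def using l_le[OF u0'] by (intro mult_left_mono power_mono) auto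
    then have "e (u (x, t)) * \<tau> t \<le> 3 * \<Lambda>\<^sup>2 * 1" using \<tau>1[of t] \<tau>0 by (intro mult_mono) auto
    then have "Ce * \<kappa>2 * (e (u (x, t)) * \<tau> t) \<le> Ce * \<kappa>2 * (3 * \<Lambda>\<^sup>2)"
      using Ce_pos \<kappa>2 by (intro mult_left_mono) auto
    moreover have "\<Phi> (u (x, t)) * ball_cutoff x0 r r x ^ n * \<tau>' t = 0" using z by (metis mult.assoc mult.commute mult_zero_left)
    moreover have "M * indicator ?S (x, t) = Ce * \<kappa>2 * (3 * \<Lambda>\<^sup>2)" using x t by (simp add: M_def)
    ultimately show "\<Phi> (u (x, t)) * ball_cutoff x0 r r x ^ n * \<tau>' t
        + Ce * (G (2 * k / r) / (2 * k)\<^sup>2) * (e (u (x, t)) * \<tau> t) \<le> M * indicator ?S (x, t)"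
      unfolding \<kappa>2_def[symmetric] by linarith
  qed
  have slice: "(\<integral>\<^sup>+x. ennreal (\<Phi> (u (x, t)) * (ball_cutoff x0 r r x ^ n * \<tau> t)) \<partial>lborel) \<le> ennreal (M * measure lborel ?S)"
    using t12 by (intro slice_estimate[OF \<open>0 < 2 * k\<close> r order_refl sub d\<Phi> dp cq sg d\<tau> c\<tau>' \<tau>0 \<tau>lt mS fS M bound] t(2)) simp
  define B where "B = {x \<in> ball x0 (r / 2). u (x, t) < s * k}"
  \<comment> \<open>On the low set in half the radius the logarithm is at least
    \<open>\<Lambda> / 2\<close>, the spatial cutoff at least \<open>3 / 4\<close>, and
    \<open>\<tau>\<close> at least \<open>1 / 4\<close> after half the ramp.\<close>
  define m where "m = (\<Lambda> / 2) ^ 3 * ((3 / 4) ^ n * (1 / 4))"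
  have m: "0 < m" using \<Lambda>0 by (simp add: m_def)
  have low: "m \<le> \<Phi> (u (x, t)) * (ball_cutoff x0 r r x ^ n * \<tau> t)" if x: "x \<in> B" for x
  proof -
    have xx: "x \<in> ball x0 (r / 2)" "u (x, t) < \<sigma>" using x by (auto simp: B_def \<sigma>_def)
    have u0': "0 \<le> u (x, t)" by (rule u0[OF inK]) (use xx t t12 r in auto)
    have "\<Lambda> / 2 \<le> l (u (x, t))"
    proof -
      have "ln ((k + \<sigma>) / (2 * \<sigma>)) \<le> l (u (x, t))"
        unfolding l_def using xx u0' \<sigma> k by (subst ln_le_cancel_iff) (auto intro!: divide_left_mono)
      moreover have "ln ((k + \<sigma>) / (2 * \<sigma>)) = \<Lambda> - ln 2"
      proof -
        have "ln ((k + \<sigma>) / (2 * \<sigma>)) = ln (((k + \<sigma>) / \<sigma>) / 2)" by (simp add: mult.commute)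
        also have "\<dots> = ln ((k + \<sigma>) / \<sigma>) - ln 2" using k \<sigma> by (subst ln_div) auto
        finally show ?thesis unfolding \<Lambda>ln .
      qed
      \<comment> \<open>\<open>s \<le> 1 / 3\<close> means \<open>1 + 1 / s \<ge> 4\<close>, so
        losing \<open>ln 2\<close> costs at most half of \<open>\<Lambda>\<close>.\<close>
      moreover have "2 * ln 2 \<le> \<Lambda>"
      proof -
        have "2 * ln 2 = ln (2 ^ 2 :: real)" by (subst ln_realpow) auto
        also have "\<dots> \<le> \<Lambda>" unfolding \<Lambda>_def using s by (subst ln_le_cancel_iff) (auto simp: field_simps)
        finally show ?thesis .
      qed
      ultimately show ?thesis by linarith
    qed
    then have 1: "(\<Lambda> / 2) ^ 3 \<le> \<Phi> (u (x, t))" unfolding \<Phi>_def using \<Lambda>0 by (intro power_mono) auto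
    have "(x - x0) \<bullet> (x - x0) \<le> (r / 2)\<^sup>2"
      using xx(1) by (auto simp: dot_square_norm dist_norm norm_minus_commute intro!: power_mono)
    then have "3 / 4 * r\<^sup>2 \<le> r\<^sup>2 - (x - x0) \<bullet> (x - x0)" by (simp add: power2_eq_square)
    then have "3 / 4 \<le> ball_cutoff x0 r r x" using r by (simp add: ball_cutoff_def le_max_iff_disj pos_le_divide_eq)
    then have 2: "(3 / 4) ^ n \<le> ball_cutoff x0 r r x ^ n" by (intro power_mono) auto
    have "(1 / 2)\<^sup>2 \<le> \<tau> t" unfolding \<tau>_def using ramp_half[OF h t(1)] by (intro power_mono) auto
    then have 3: "1 / 4 \<le> \<tau> t" by (simp add: power2_eq_square)
    have 4: "(3 / 4) ^ n * (1 / 4) \<le> ball_cutoff x0 r r x ^ n * \<tau> t" using 2 3 by (intro mult_mono) (auto simp: ball_cutoff_def)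
    show ?thesis unfolding m_def by (rule mult_mono[OF 1 4]) (use \<Lambda>0 1 in \<open>auto simp: \<Phi>_def\<close>)
  qed
  have mB: "B \<in> sets borel"
  proof -
    have "continuous_on (ball x0 (r / 2)) (\<lambda>x. u (x, t))"
    proof (rule continuous_on_compose2[OF cu])
      show "(\<lambda>x. (x, t)) ` ball x0 (r / 2) \<subseteq> K" using inK t t12 r by auto
    qed (intro continuous_intros)
    from continuous_open_preimage[OF this open_ball open_lessThan[of "s * k"]]
    have "open B" by (simp add: B_def Int_def vimage_def)
    then show ?thesis by simp
  qed
  have "ennreal m * emeasure lborel B = (\<integral>\<^sup>+x. ennreal m * indicator B x \<partial>lborel)"
    by (rule nn_integral_cmult_indicator[symmetric]) (use mB in simp)
  also have "\<dots> \<le> (\<integral>\<^sup>+x. ennreal (\<Phi> (u (x, t)) * (ball_cutoff x0 r r x ^ n * \<tau> t)) \<partial>lborel)"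
    by (rule nn_integral_mono) (use low in \<open>auto simp: indicator_def intro!: ennreal_leI\<close>)
  also note slice
  finally have main: "ennreal m * emeasure lborel B \<le> ennreal (M * measure lborel ?S)" .
  have "emeasure lborel B = ennreal (1 / m) * (ennreal m * emeasure lborel B)"
    using m by (simp add: mult.assoc[symmetric] ennreal_mult[symmetric])
  also have "\<dots> \<le> ennreal (1 / m) * ennreal (M * measure lborel ?S)" by (intro mult_left_mono main) simp
  also have "\<dots> = ennreal (M * measure lborel ?S / m)" using m M by (simp add: ennreal_mult[symmetric])
  also have "\<dots> \<le> ennreal (log_const C0 C1 n * (G (k / r) / k\<^sup>2) * (t2 - t1) / \<Lambda> * (r ^ CARD('n) * measure lborel (ball (0 :: real ^ 'n) 1)))"
  proof (rule ennreal_leI)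
    have G2: "G (2 * k / r) \<le> 2 ^ n * G (k / r)" using G_scale_up[of 2 "k / r"] k r by simp
    have p4: "(4 / 3 :: real) ^ n * (3 / 4) ^ n = 1" by (simp flip: power_mult_distrib)
    have "M * measure lborel ?S / m = (96 * (4 / 3) ^ n * Ce * \<kappa>2 / \<Lambda>) * (r ^ CARD('n) * measure lborel (ball (0 :: real ^ 'n) 1) * (t2 - t1))"
    proof -
      have "M / m = 96 * (4 / 3) ^ n * Ce * \<kappa>2 / \<Lambda>"
        unfolding M_def m_def using \<Lambda>0 p4 by (simp add: field_simps power2_eq_square power3_eq_cube)
      then have "M / m * measure lborel ?S = 96 * (4 / 3) ^ n * Ce * \<kappa>2 / \<Lambda> * measure lborel ?S" by simp
      then show ?thesis unfolding mS' by simp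
    qed
    also have "\<dots> \<le> (96 * (4 / 3) ^ n * Ce * (2 ^ n / 4 * (G (k / r) / k\<^sup>2)) / \<Lambda>) * (r ^ CARD('n) * measure lborel (ball (0 :: real ^ 'n) 1) * (t2 - t1))"
    proof (intro mult_right_mono divide_right_mono mult_left_mono)
      show "\<kappa>2 \<le> 2 ^ n / 4 * (G (k / r) / k\<^sup>2)"
        unfolding \<kappa>2_def using G2 k by (simp add: power_mult_distrib divide_right_mono)
    qed (use Ce_pos \<Lambda>0 r unit_ball_pos t12 in auto)
    also have "\<dots> = log_const C0 C1 n * (G (k / r) / k\<^sup>2) * (t2 - t1) / \<Lambda> * (r ^ CARD('n) * measure lborel (ball (0 :: real ^ 'n) 1))"
    proof -
      have "(8 / 3 :: real) ^ n = (4 / 3) ^ n * 2 ^ n" by (simp flip: power_mult_distrib)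
      then show ?thesis by (simp add: log_const_def)
    qed
    finally show "M * measure lborel ?S / m \<le> log_const C0 C1 n * (G (k / r) / k\<^sup>2) * (t2 - t1) / \<Lambda> * (r ^ CARD('n) * measure lborel (ball (0 :: real ^ 'n) 1))" .
  qed
  finally show ?thesis unfolding B_def \<Lambda>_def .
qed

text \<open>
  Positivity spreads forward in time: the logarithmic estimate makes the set where \<open>u < s k\<close> small on every
  time slice, and the iteration at the level \<open>s k\<close> needs no further cutoff in time.
\<close>

lemma forward_positivity:
  assumes k: "0 < k" and r: "0 < r" and Gp: "\<And>\<sigma>. 0 < \<sigma> \<Longrightarrow> 0 < G \<sigma>" and sub: "cball x0 r \<times> {t1..t2} \<subseteq> interior K"
    and h: "0 < h" and above: "\<forall>x\<in>cball x0 r. \<forall>t\<in>{t1..<t1 + h}. k \<le> u (x, t)"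
    and s: "0 < s" "s \<le> 1 / 3"
    and small: "log_const C0 C1 n * (G (k / r) / k\<^sup>2 * (t2 - t1))\<^sup>2 * 4 * 2 ^ CARD('n) * measure lborel (ball (0 :: real ^ 'n) 1) \<le> de_giorgi_const C0 C1 n CARD('n) (measure lborel (ball (0 :: real ^ 'n) 1)) * ln (1 + 1 / s)"
    and x: "x \<in> ball x0 (r / 4)" and t: "t1 + h / 2 \<le> t" "t < t2"
  shows "s * k / 2 \<le> u (x, t)"
proof -
  define k' r' where "k' = s * k" and "r' = r / 2"
  have k': "0 < k'" and r': "0 < r'" using s k r by (auto simp: k'_def r'_def)
  define \<kappa> where "\<kappa> = G (k / r) / k\<^sup>2"
  have \<kappa>: "0 < \<kappa>" using Gp[of "k / r"] k r by (simp add: \<kappa>_def)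
  have Gp': "0 < G (k' / r')" using Gp k' r' by simp
  have sub': "cball x0 r' \<times> {t1..t2} \<subseteq> interior K"
    using r by (intro order_trans[OF _ sub] Sigma_mono subset_cball) (auto simp: r'_def)
  have k'k: "k' \<le> k" using s k by (simp add: k'_def mult_left_le_one_le)
  have above': "\<forall>x\<in>cball x0 r'. \<forall>t\<in>{t1..<t1 + h}. k' \<le> u (x, t)"
  proof (intro ballI)
    fix x t assume "x \<in> cball x0 r'" and t: "t \<in> {t1..<t1 + h}"
    then have "x \<in> cball x0 r" using r by (simp add: r'_def)
    then show "k' \<le> u (x, t)" using above t k'k order_trans by blast
  qed
  \<comment> \<open>Lowering the level by \<open>s\<close> and halving the radius multiplies the
    argument of \<open>G\<close> by \<open>2 * s \<le> 1\<close>; the quadratic gain cancels the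
    loss in \<open>k'\<^sup>2\<close> up to the factor 4.\<close>
  have \<kappa>': "G (k' / r') / k'\<^sup>2 \<le> 4 * \<kappa>"
  proof -
    have "k' / r' = (2 * s) * (k / r)" by (simp add: k'_def r'_def)
    then have "G (k' / r') \<le> (2 * s)\<^sup>2 * G (k / r)" using G_scale_down[of "2 * s" "k / r"] s k r by simp
    then have "G (k' / r') / k'\<^sup>2 \<le> (2 * s)\<^sup>2 * G (k / r) / k'\<^sup>2" using k' by (intro divide_right_mono) auto
    also have "\<dots> = 4 * \<kappa>" using s k by (simp add: k'_def \<kappa>_def power_mult_distrib)
    finally show ?thesis .
  qed
  have \<Lambda>: "0 < ln (1 + 1 / s)" using s by (intro ln_gt_zero) simp
  let ?D = "lower_set x0 t1 h k' r' 0 t2"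
  have t12: "t1 < t2" using t h by simp
  note D = lower_set_props[OF h order_refl sub', where k = k']
  let ?c = "log_const C0 C1 n * \<kappa> * (t2 - t1) / ln (1 + 1 / s) * (r ^ CARD('n) * measure lborel (ball (0 :: real ^ 'n) 1))"
  have lc: "0 \<le> log_const C0 C1 n" using Ce_pos by (simp add: log_const_def)
  have c0: "0 \<le> ?c" using lc \<kappa> t12 \<Lambda> r unit_ball_pos by simp
  have "emeasure lborel ?D = emeasure (lborel \<Otimes>\<^sub>M lborel) ?D" by (simp add: lborel_prod)
  also have "\<dots> = (\<integral>\<^sup>+t. emeasure lborel ((\<lambda>x. (x, t)) -` ?D) \<partial>lborel)"
    by (rule lborel_pair.emeasure_pair_measure_alt2) (use D(2) in \<open>simp only: lborel_prod sets_lborel\<close>)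
  also have "\<dots> \<le> (\<integral>\<^sup>+t. ennreal ?c * indicator {t1..t2} t \<partial>lborel)"
  proof (rule nn_integral_mono)
    fix t
    show "emeasure lborel ((\<lambda>x. (x, t)) -` ?D) \<le> ennreal ?c * indicator {t1..t2} t"
    \<comment> \<open>Late slices are covered by the logarithmic estimate; the remaining ones are
      empty, because \<open>u \<ge> k'\<close> in the initial layer.\<close>
    proof (cases "t1 + h / 2 \<le> t \<and> t < t2")
      case True
      have "(\<lambda>x. (x, t)) -` ?D \<subseteq> {x \<in> ball x0 (r / 2). u (x, t) < s * k}"
        by (auto simp: lower_set_def k'_def r'_def)
      then have "emeasure lborel ((\<lambda>x. (x, t)) -` ?D) \<le> emeasure lborel {x \<in> ball x0 (r / 2). u (x, t) < s * k}"
      proof (rule emeasure_mono)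
        have "continuous_on (ball x0 (r / 2)) (\<lambda>x. u (x, t))"
        proof (rule continuous_on_compose2[OF cu])
          have "(\<lambda>x. (x, t)) ` ball x0 (r / 2) \<subseteq> cball x0 r' \<times> {t1..t2}" using True h by (auto simp: r'_def)
          then show "(\<lambda>x. (x, t)) ` ball x0 (r / 2) \<subseteq> K" using sub' interior_subset by blast
        qed (intro continuous_intros)
        from continuous_open_preimage[OF this open_ball open_lessThan[of "s * k"]]
        have "open {x \<in> ball x0 (r / 2). u (x, t) < s * k}" by (simp add: Int_def vimage_def)
        then show "{x \<in> ball x0 (r / 2). u (x, t) < s * k} \<in> sets lborel" by simp
      qed
      also have "\<dots> \<le> ennreal ?c" unfolding \<kappa>_def by (rule log_estimate[OF k r sub h above s]) (use True in auto)
      finally show ?thesis using True h by simp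
    next
      case False
      have "(x, t) \<notin> ?D" for x
      proof
        assume "(x, t) \<in> ?D"
        then have *: "x \<in> ball x0 r'" "u (x, t) < k'" "t1 < t" "t < t2" using D(4) by (auto simp: lower_set_def)
        then have "t \<in> {t1..<t1 + h}" using False h by auto
        have "x \<in> cball x0 r'" using *(1) by simp
        then have "k' \<le> u (x, t)" using above' \<open>t \<in> {t1..<t1 + h}\<close> by blast
        then show False using *(2) by simp
      qed
      then have "(\<lambda>x. (x, t)) -` ?D = {}" by auto
      then show ?thesis by simp
    qed
  qed
  also have "\<dots> = ennreal ?c * emeasure lborel {t1..t2}" by (rule nn_integral_cmult_indicator) simp
  also have "\<dots> = ennreal (?c * (t2 - t1))" using c0 t12 by (simp only: ennreal_mult emeasure_lborel_Icc diff_ge_0_iff_ge less_imp_le)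
  finally have eD: "emeasure lborel ?D \<le> ennreal (?c * (t2 - t1))" .
  have mD: "measure lborel ?D \<le> ?c * (t2 - t1)"
  proof -
    have "0 \<le> ?c * (t2 - t1)" by (rule mult_nonneg_nonneg[OF c0]) (use t12 in simp)
    then show ?thesis unfolding measure_def[of lborel ?D] using enn2real_mono[OF eD] by (simp only: ennreal_less_top enn2real_ennreal)
  qed
  have "k' / 2 \<le> u (x, t)"
  proof (rule de_giorgi[OF k' r' Gp' sub' h])
    show "1 / h \<le> G (k' / r') / k'\<^sup>2 \<or> (\<forall>x\<in>cball x0 r'. \<forall>t\<in>{t1..<t1 + h}. k' \<le> u (x, t))" using above' by blast
    have "measure lborel ?D * (G (k' / r') / k'\<^sup>2) \<le> (?c * (t2 - t1)) * (4 * \<kappa>)"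
    proof (rule mult_mono[OF mD \<kappa>'])
      show "0 \<le> ?c * (t2 - t1)" by (rule mult_nonneg_nonneg[OF c0]) (use t12 in simp)
    qed (use Gp' in simp)
    also have "\<dots> = (log_const C0 C1 n * (\<kappa> * (t2 - t1))\<^sup>2 * 4 * 2 ^ CARD('n) * measure lborel (ball (0 :: real ^ 'n) 1)) / ln (1 + 1 / s) * r' ^ CARD('n)"
      using \<Lambda> by (simp add: r'_def power2_eq_square power_divide field_simps)
    also have "\<dots> \<le> de_giorgi_const C0 C1 n CARD('n) (measure lborel (ball (0 :: real ^ 'n) 1)) * r' ^ CARD('n)"
      using small \<Lambda> r' unfolding \<kappa>_def by (intro mult_right_mono) (auto simp: pos_divide_le_eq)
    finally show "measure lborel ?D * (G (k' / r') / k'\<^sup>2) \<le> de_giorgi_const C0 C1 n CARD('n) (measure lborel (ball (0 :: real ^ 'n) 1)) * r' ^ CARD('n)" .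
    show "x \<in> ball x0 (r' / 2)" using x by (simp add: r'_def)
  qed (use t in auto)
  then show ?thesis by (simp add: k'_def)
qed

end

lemma de_giorgi_const_pos:
  assumes "0 < C0" "2 \<le> n" "0 < v"
  shows "0 < de_giorgi_const C0 C1 n N v"
proof -
  have "0 < gradient_const C0 C1 n"
    using assms energy_const_pos[of C0 C1 n] by (simp add: gradient_const_def add_pos_pos)
  moreover have "0 < iteration_rate n N" unfolding iteration_rate_def by (intro zero_less_power) simp
  ultimately have "0 < 6 * (2 + energy_const C0 C1 n) * (2 * gradient_const C0 C1 n * iteration_rate n N) ^ N * (iteration_rate n N)\<^sup>2"
    using energy_const_pos[OF assms(1), of C1 n] by (intro mult_pos_pos zero_less_power) auto
  then show ?thesis unfolding de_giorgi_const_def using assms(3) by (intro divide_pos_pos)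
qed

section \<open>Cubes and cylinders\<close>

lemma inverse_le_scaled_inverse: "a \<le> c * b \<Longrightarrow> 0 < a \<Longrightarrow> 0 < b \<Longrightarrow> inverse b \<le> c * inverse a" for a b c :: real
  by (simp add: field_simps)

lemma divide_eq_inverse_scaled: "y / c = 1 / (c * inverse y)" for c y :: real
  by (simp add: divide_inverse mult.commute)

lemma cube_eq_box: "cube \<rho> = box (\<chi> i. - \<rho>) (\<chi> i. \<rho>)"
  by (auto simp: cube_def mem_box_cart abs_less_iff minus_less_iff)

lemma open_cube: "open (cube \<rho>)" unfolding cube_eq_box by (rule open_box)

lemma cball_subset_cube:
  assumes "x \<in> cube a"
  shows "cball x b \<subseteq> cube (a + b)"
proof
  fix y assume "y \<in> cball x b"
  then have d: "norm (y - x) \<le> b" by (simp add: dist_norm norm_minus_commute)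
  show "y \<in> cube (a + b)"
    unfolding cube_def
  proof (intro CollectI allI)
    fix i
    have "\<bar>y $ i - x $ i\<bar> \<le> b" using component_le_norm_cart[of "y - x" i] d by simp
    moreover have "\<bar>x $ i\<bar> < a" using assms by (simp add: cube_def)
    ultimately show "\<bar>y $ i\<bar> < a + b" by linarith
  qed
qed

lemma cube_mono: "a \<le> b \<Longrightarrow> cube a \<subseteq> cube b"
  by (auto simp: cube_def intro: less_le_trans)

lemma measure_cube:
  assumes "0 \<le> \<rho>"
  shows "measure lebesgue (cube \<rho> :: (real ^ 'n::finite) set) = (2 * \<rho>) ^ CARD('n)"
proof -
  have "measure lebesgue (cube \<rho> :: (real ^ 'n) set) = measure lborel (cbox (\<chi> i. - \<rho>) (\<chi> i. \<rho>) :: (real ^ 'n) set)"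
    unfolding cube_eq_box by (simp add: measure_lborel_box_eq measure_lborel_cbox_eq)
  also have "\<dots> = (\<Prod>i\<in>(UNIV :: 'n set). (2 * \<rho>))"
  proof (subst content_cbox_cart)
    show "cbox (\<chi> i. - \<rho>) (\<chi> i. \<rho>) \<noteq> ({} :: (real ^ 'n) set)"
    proof -
      have "0 \<in> cbox (\<chi> i. - \<rho>) (\<chi> i. \<rho>)" using assms by (simp add: mem_box_cart)
      then show ?thesis by blast
    qed
  qed simp
  also have "\<dots> = (2 * \<rho>) ^ CARD('n)" by simp
  finally show ?thesis .
qed

lemma emeasure_cube:
  assumes "0 \<le> \<rho>"
  shows "emeasure lborel (cube \<rho> :: (real ^ 'n::finite) set) = ennreal ((2 * \<rho>) ^ CARD('n))"
proof -
  have "emeasure lborel (cube \<rho> :: (real ^ 'n) set) < \<infinity>"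
    unfolding cube_eq_box using emeasure_lborel_box_finite by simp
  moreover have "measure lborel (cube \<rho> :: (real ^ 'n) set) = (2 * \<rho>) ^ CARD('n)"
  proof -
    have "(cube \<rho> :: (real ^ 'n) set) \<in> sets lborel" unfolding sets_lborel by (rule borel_open[OF open_cube])
    from measure_completion[OF this] show ?thesis using measure_cube[OF assms, where 'n = 'n] by (simp only:)
  qed
  ultimately show ?thesis by (metis emeasure_eq_ennreal_measure infinity_ennreal_def less_irrefl)
qed

lemma measure_cube_times:
  assumes "0 \<le> \<rho>" "0 \<le> T"
  shows "measure lebesgue (cube \<rho> \<times> {- T..0} :: 'n::finite space_time set) = (2 * \<rho>) ^ CARD('n) * T"
proof -
  have c: "cube \<rho> \<in> sets (lborel :: (real ^ 'n) measure)" using borel_open[OF open_cube] by simp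
  have "emeasure lborel (cube \<rho> \<times> {- T..0} :: 'n space_time set) = emeasure (lborel \<Otimes>\<^sub>M lborel) (cube \<rho> \<times> {- T..0} :: 'n space_time set)"
    by (simp add: lborel_prod)
  also have "\<dots> = emeasure lborel (cube \<rho> :: (real ^ 'n) set) * emeasure lborel {- T..0}"
    by (rule lborel.emeasure_pair_measure_Times) (use c in auto)
  also have "\<dots> = ennreal ((2 * \<rho>) ^ CARD('n) * T)"
    using assms by (simp add: emeasure_cube ennreal_mult)
  finally have "measure lborel (cube \<rho> \<times> {- T..0} :: 'n space_time set) = (2 * \<rho>) ^ CARD('n) * T"
    using assms by (simp add: measure_def)
  moreover have "(cube \<rho> \<times> {- T..0} :: 'n space_time set) \<in> sets lborel"
    using c by (simp add: borel_Times borel_open open_cube)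
  ultimately show ?thesis by (simp add: measure_completion)
qed

lemma bounded_cube_times: "bounded (cube \<rho> \<times> {a..b} :: 'n::finite space_time set)"
  unfolding cube_eq_box by (intro bounded_Times bounded_box bounded_closed_interval)

lemma interior_cylinder: "interior (cube \<rho> \<times> {a..b::real}) = cube \<rho> \<times> {a<..<b}"
  by (simp add: interior_Times interior_open open_cube)

lemma negligible_time_slice: "negligible {z :: 'n::finite space_time. snd z = c}"
  using negligible_hyperplane[of "(0, 1) :: 'n space_time" c] by (simp add: inner_prod_def zero_prod_def)

lemma negligible_cylinder_bases:
  "negligible ((cube \<rho> \<times> {a..b}) - (cube \<rho> \<times> {a<..<b}) :: 'n::finite space_time set)"
  by (rule negligible_subset[OF negligible_Un[OF negligible_time_slice[of a] negligible_time_slice[of b]]]) auto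

text \<open>Nothing is known about \<open>u\<close> on the bases of the cylinder, but they are null
  sets, so all their subsets are Lebesgue measurable.\<close>

lemma cylinder_preimage_measurable:
  fixes u :: "'n::finite space_time \<Rightarrow> real"
  assumes cu: "continuous_on (cube \<rho> \<times> {a<..<b}) u" and B: "B \<in> sets borel"
  shows "{z \<in> cube \<rho> \<times> {a..b}. u z \<in> B} \<in> sets lebesgue"
proof -
  let ?S = "cube \<rho> \<times> {a<..<b}" and ?N = "(cube \<rho> \<times> {a..b}) - (cube \<rho> \<times> {a<..<b})"
  have S: "?S \<in> sets borel" by (intro borel_open open_Times open_cube) simp
  have "u \<in> borel_measurable (restrict_space borel ?S)" by (rule borel_measurable_continuous_on_restrict[OF cu])
  from measurable_sets[OF this B] have "u -` B \<inter> ?S \<in> sets (restrict_space borel ?S)" by (simp add: space_restrict_space)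
  then have "u -` B \<inter> ?S \<in> sets borel" by (subst (asm) sets_restrict_space_iff) (use S in auto)
  then have 1: "u -` B \<inter> ?S \<in> sets lebesgue" by simp
  have "negligible (u -` B \<inter> ?N)" by (rule negligible_subset[OF negligible_cylinder_bases]) auto
  then have 2: "u -` B \<inter> ?N \<in> sets lebesgue" by (rule negligible_imp_sets)
  have "{z \<in> cube \<rho> \<times> {a..b}. u z \<in> B} = (u -` B \<inter> ?S) \<union> (u -` B \<inter> ?N)" by auto
  then show ?thesis using 1 2 by simp
qed

lemma ess_inf_on_ge:
  fixes u :: "'n::finite space_time \<Rightarrow> real"
  assumes cu: "continuous_on (cube \<rho> \<times> {a<..<b}) u" and ge: "\<forall>x\<in>cube \<rho>. \<forall>t\<in>{a<..<b}. c \<le> u (x, t)"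
  shows "ereal c \<le> ess_inf_on (cube \<rho> \<times> {a..b}) u"
proof -
  let ?C = "cube \<rho> \<times> {a..b} :: 'n space_time set"
  have C: "?C \<in> sets lebesgue" using cylinder_preimage_measurable[OF cu, of UNIV] by simp
  have "u \<in> borel_measurable (lebesgue_on ?C)"
  proof (rule measurableI)
    fix B :: "real set" assume "B \<in> sets borel"
    from cylinder_preimage_measurable[OF cu this] have "{z \<in> ?C. u z \<in> B} \<in> sets lebesgue" .
    moreover have "u -` B \<inter> space (lebesgue_on ?C) = {z \<in> ?C. u z \<in> B}" by (auto simp: space_restrict_space)
    ultimately show "u -` B \<inter> space (lebesgue_on ?C) \<in> sets (lebesgue_on ?C)"
      using C by (simp add: sets_restrict_space_iff)
  qed simp
  then have m: "(\<lambda>z. - ereal (u z)) \<in> borel_measurable (lebesgue_on ?C)" by measurable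
  have "AE z in lebesgue_on ?C. - ereal (u z) \<le> - ereal c"
    unfolding AE_restrict_space_iff[where M = lebesgue and \<Omega> = ?C, simplified, OF C]
  proof (rule AE_I')
    show "(cube \<rho> \<times> {a..b}) - (cube \<rho> \<times> {a<..<b}) \<in> null_sets (lebesgue :: 'n space_time measure)"
      using negligible_cylinder_bases negligible_iff_null_sets by blast
    show "{z \<in> space lebesgue. \<not> (z \<in> ?C \<longrightarrow> - ereal (u z) \<le> - ereal c)} \<subseteq> (cube \<rho> \<times> {a..b}) - (cube \<rho> \<times> {a<..<b})"
      using ge by auto
  qed
  then have "esssup (lebesgue_on ?C) (\<lambda>z. - ereal (u z)) \<le> - ereal c" by (rule esssup_I[OF m])
  then have "- (- ereal c) \<le> ess_inf_on ?C u" unfolding ess_inf_on_def by (simp only: ereal_minus_le_minus)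
  then show ?thesis by simp
qed

section \<open>Transfer to supersolutions on cylinders\<close>

context growth
begin

text \<open>By \<open>G_scale_up\<close>, positivity at one point forces positivity at all positive
  arguments. In the vanishing case the intrinsic times are 0, and it is treated separately
  below.\<close>

lemma G_pos_or_zero: "(\<forall>\<sigma>>0. 0 < G \<sigma>) \<or> (\<forall>\<sigma>. G \<sigma> = 0)"
proof (rule disjCI)
  assume "\<not> (\<forall>\<sigma>. G \<sigma> = 0)"
  then obtain \<tau> where \<tau>: "0 < G \<tau>" using G_nonneg by (metis less_eq_real_def)
  show "\<forall>\<sigma>>0. 0 < G \<sigma>"
  proof (intro allI impI)
    fix \<sigma> :: real assume \<sigma>: "0 < \<sigma>"
    define c where "c = max 1 (\<tau> / \<sigma>)"
    have "\<tau> / \<sigma> \<le> c" by (simp add: c_def)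
    then have "\<tau> \<le> c * \<sigma>" using \<sigma> by (simp add: pos_divide_le_eq)
    then have "G \<tau> \<le> c ^ n * G \<sigma>"
      using G_mono[of \<tau> "c * \<sigma>"] G_scale_up[of c \<sigma>] \<sigma> by (simp add: c_def)
    then have "c ^ n * G \<sigma> \<noteq> 0" using \<tau> by linarith
    then have "G \<sigma> \<noteq> 0" by force
    then show "0 < G \<sigma>" using G_nonneg[of \<sigma>] by linarith
  qed
qed

text \<open>\<open>K\<close> is a closed neighbourhood of \<open>S\<close> of fixed width, written
  as a sum of two compact sets to see that it is compact.\<close>

lemma supersolution_local_solution:
  fixes u :: "'n::finite space_time \<Rightarrow> real" and A :: "'n vector_field"
  assumes sc: "structure_conditions C0 C1 g A" and C: "0 < C0" "0 < C1"
    and ws: "weak_supersolution g A \<Omega> u" and nn: "\<forall>z\<in>\<Omega>. 0 \<le> u z" and S: "compact S" "S \<subseteq> \<Omega>"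
  obtains K V where "local_solution g0 g1 g n C0 C1 u K V" "S \<subseteq> interior K" "K \<subseteq> \<Omega>"
proof -
  have o\<Omega>: "open \<Omega>" and cu: "continuous_on \<Omega> u" using ws by (auto simp: weak_supersolution_def)
  obtain \<epsilon> where \<epsilon>: "0 < \<epsilon>" "(\<Union>z\<in>S. cball z \<epsilon>) \<subseteq> \<Omega>"
    using compact_subset_open_imp_cball_epsilon_subset[OF S(1) o\<Omega> S(2)] .
  define K where "K = {z + y | z y. z \<in> S \<and> y \<in> cball 0 \<epsilon>}"
  have K: "compact K" unfolding K_def by (intro compact_sums S compact_cball)
  have K_eq: "K = (\<Union>z\<in>S. cball z \<epsilon>)"
  proof (intro set_eqI iffI)
    fix w assume "w \<in> (\<Union>z\<in>S. cball z \<epsilon>)"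
    then obtain z where z: "z \<in> S" "w \<in> cball z \<epsilon>" by blast
    then have "w = z + (w - z)" "w - z \<in> cball 0 \<epsilon>" by (auto simp: dist_norm norm_minus_commute)
    then show "w \<in> K" unfolding K_def using z by blast
  next
    fix w assume "w \<in> K"
    then obtain z y where zy: "w = z + y" "z \<in> S" "y \<in> cball 0 \<epsilon>" unfolding K_def by blast
    then have "w \<in> cball z \<epsilon>" by (simp add: dist_norm)
    then show "w \<in> (\<Union>z\<in>S. cball z \<epsilon>)" using zy by blast
  qed
  have K\<Omega>: "K \<subseteq> \<Omega>" using \<epsilon> K_eq by simp
  have SK: "S \<subseteq> interior K"
  proof
    fix z assume z: "z \<in> S"
    then have "ball z \<epsilon> \<subseteq> K" unfolding K_eq by (auto simp: less_imp_le)
    then show "z \<in> interior K" using \<epsilon>(1) by (meson centre_in_ball interior_maximal open_ball subsetD)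
  qed
  obtain V where "local_gradient C0 C1 g u K V" by (rule supersolution_local_gradient[OF gf sc C ws nn K K\<Omega>])
  then have "local_solution g0 g1 g n C0 C1 u K V"
    using C K nn K\<Omega> continuous_on_subset[OF cu K\<Omega>] growth_axioms
    by (auto simp: local_solution_def local_solution_axioms_def)
  then show ?thesis using that SK K\<Omega> by blast
qed

text \<open>The bound is taken at the centre of a ball, and the low set is measured by any
  \<open>E\<close> containing it. A single hypothesis on a cylinder can thus be used around each of
  its points.\<close>

lemma supersolution_de_giorgi:
  fixes u :: "'n::finite space_time \<Rightarrow> real" and A :: "'n vector_field"
  assumes sc: "structure_conditions C0 C1 g A" and C: "0 < C0" "0 < C1"
    and ws: "weak_supersolution g A \<Omega> u" and nn: "\<forall>z\<in>\<Omega>. 0 \<le> u z"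
    and sub: "cball x r \<times> {t1..t2} \<subseteq> \<Omega>" and k: "0 < k" and r: "0 < r" and Gp: "0 < G (k / r)"
    and h: "0 < h" "1 / h \<le> G (k / r) / k\<^sup>2"
    and E: "E \<in> lmeasurable" "\<forall>z\<in>ball x r \<times> {t1<..<t2}. u z < k \<longrightarrow> z \<in> E"
    and small: "measure lebesgue E * (G (k / r) / k\<^sup>2)
      \<le> de_giorgi_const C0 C1 n CARD('n) (measure lborel (ball (0 :: real ^ 'n) 1)) * r ^ CARD('n)"
    and t: "t1 + h / 2 \<le> t" "t < t2"
  shows "k / 2 \<le> u (x, t)"
proof -
  have "compact (cball x r \<times> {t1..t2})" by (intro compact_Times compact_cball compact_Icc)
  from supersolution_local_solution[OF sc C ws nn this sub]
  obtain K V where ls: "local_solution g0 g1 g n C0 C1 u K V" and inK: "cball x r \<times> {t1..t2} \<subseteq> interior K" .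
  interpret local_solution g0 g1 g n C0 C1 u K V by (rule ls)
  let ?D = "lower_set x t1 h k r 0 t2"
  note D = lower_set_props[OF h(1) order_refl inK, where k = k]
  have "?D \<subseteq> E"
  proof
    fix z assume z: "z \<in> ?D"
    then have "z \<in> ball x r \<times> {t1<..<t2}" "u z < k" using D(4)[OF z] by (auto simp: lower_set_def mem_Times_iff)
    then show "z \<in> E" using E(2) by blast
  qed
  moreover have "?D \<in> sets lebesgue" using D(2) by (rule sets_completionI_sets[of _ lborel, unfolded sets_lborel])
  ultimately have "measure lebesgue ?D \<le> measure lebesgue E" by (intro measure_mono_fmeasurable E)
  then have "measure lborel ?D \<le> measure lebesgue E" using D(2) by (simp add: measure_completion)
  then have "measure lborel ?D * (G (k / r) / k\<^sup>2) \<le> measure lebesgue E * (G (k / r) / k\<^sup>2)"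
    using Gp by (intro mult_right_mono) auto
  from order_trans[OF this small] show ?thesis
    using h(2) r t by (intro de_giorgi[OF k r Gp inK h(1)]) auto
qed

text \<open>Every point of the inner cylinder becomes the centre of its own ball of radius
  \<open>\<rho>\<close>, which fits into the outer cube. In \<open>small\<close>, the power of 4
  compares the volume of the outer cube with a power of \<open>\<rho>\<close>, and
  \<open>2 ^ n\<close> bounds the ratio of the two intrinsic times.\<close>

lemma supersolution_property_P:
  fixes A :: "'n::finite vector_field"
  assumes sc: "structure_conditions C0 C1 g A" and C: "0 < C0" "0 < C1" and \<nu>0: "0 < \<nu>"
    and small: "\<nu> * (4 ^ CARD('n) * 2 ^ n) \<le> de_giorgi_const C0 C1 n CARD('n) (measure lborel (ball (0 :: real ^ 'n) 1))"
  shows "property_P g A \<nu>"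
  unfolding property_P_def
proof (intro allI impI, elim conjE)
  fix k \<rho> :: real and u :: "'n space_time \<Rightarrow> real"
  assume k: "0 < k" and \<rho>: "0 < \<rho>"
    and ws: "weak_supersolution g A (interior (cylinder g k (2 * \<rho>) 1)) u"
    and nn: "\<forall>z\<in>interior (cylinder g k (2 * \<rho>) 1). 0 \<le> u z"
    and m: "measure lebesgue {z \<in> cylinder g k (2 * \<rho>) 1. u z < k} < \<nu> * measure lebesgue (cylinder g k (2 * \<rho>) 1 :: 'n space_time set)"
  define T T2 where "T = intrinsic_time g k \<rho> 1" and "T2 = intrinsic_time g k (2 * \<rho>) 1"
  have T_eq: "T = k\<^sup>2 * inverse (G (k / \<rho>))" "T2 = k\<^sup>2 * inverse (G (k / (2 * \<rho>)))" by (simp_all add: T_def T2_def intrinsic_time_def)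
  have cyl: "cylinder g k \<rho> 1 = cube \<rho> \<times> {- T..0}" "cylinder g k (2 * \<rho>) 1 = cube (2 * \<rho>) \<times> {- T2..0}"
    by (simp_all add: cylinder_def T_def T2_def)
  note ws = ws[unfolded cyl interior_cylinder] and nn = nn[unfolded cyl interior_cylinder]
  have cu: "continuous_on (cube (2 * \<rho>) \<times> {- T2<..<0}) u" using ws by (simp add: weak_supersolution_def)
  show "ereal (k / 2) \<le> ess_inf_on (cylinder g k \<rho> 1) u"
  proof (cases "\<forall>\<sigma>. G \<sigma> = 0")
    case True
    \<comment> \<open>Since \<open>inverse 0 = 0\<close>, the cylinder degenerates to a time slice,
      which is a null set.\<close>
    then have "T = 0" by (simp add: T_eq)
    then show ?thesis unfolding cyl by (intro ess_inf_on_ge) auto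
  next
    case False
    then have Gpos: "0 < G \<sigma>" if "0 < \<sigma>" for \<sigma> using G_pos_or_zero that by blast
    have Gp: "0 < G (k / \<rho>)" "0 < G (k / (2 * \<rho>))" using Gpos k \<rho> by simp_all
    have Tp: "0 < T" "0 < T2" using Gp k by (simp_all add: T_eq)
    have T2_le: "T2 \<le> 2 ^ n * T"
    proof -
      have "G (k / \<rho>) \<le> 2 ^ n * G (k / (2 * \<rho>))" using G_scale_up[of 2 "k / (2 * \<rho>)"] k \<rho> by simp
      from inverse_le_scaled_inverse[OF this Gp]
      have "k\<^sup>2 * inverse (G (k / (2 * \<rho>))) \<le> k\<^sup>2 * (2 ^ n * inverse (G (k / \<rho>)))" by (intro mult_left_mono) auto
      then show ?thesis unfolding T_eq by (simp add: mult_ac)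
    qed
    have T2_ge: "4 * T \<le> T2"
    proof -
      have "G (k / (2 * \<rho>)) \<le> (1 / 2)\<^sup>2 * G (k / \<rho>)" using G_scale_down[of "1 / 2" "k / \<rho>"] k \<rho> by simp
      from inverse_le_scaled_inverse[OF this Gp(2,1)]
      have "k\<^sup>2 * inverse (G (k / \<rho>)) \<le> k\<^sup>2 * ((1 / 2)\<^sup>2 * inverse (G (k / (2 * \<rho>))))" by (intro mult_left_mono) auto
      then show ?thesis unfolding T_eq by (simp add: power2_eq_square)
    qed
    have \<kappa>: "G (k / \<rho>) / k\<^sup>2 = 1 / T" unfolding T_eq by (rule divide_eq_inverse_scaled)
    define E where "E = {z \<in> cube (2 * \<rho>) \<times> {- T2..0}. u z < k}"
    have "E \<in> sets lebesgue" unfolding E_def using cylinder_preimage_measurable[OF cu, of "{..<k}"] by simp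
    moreover have "bounded E" unfolding E_def by (rule bounded_subset[OF bounded_cube_times]) auto
    ultimately have E: "E \<in> lmeasurable" by (rule bounded_set_imp_lmeasurable[rotated])
    have "measure lebesgue E \<le> \<nu> * ((4 * \<rho>) ^ CARD('n) * T2)"
      using m measure_cube_times[of "2 * \<rho>" T2, where 'n = 'n] \<rho> Tp unfolding cyl E_def by simp
    also have "\<dots> \<le> \<nu> * ((4 * \<rho>) ^ CARD('n) * (2 ^ n * T))"
      using T2_le \<nu>0 \<rho> by (intro mult_left_mono) auto
    also have "\<dots> = (\<nu> * (4 ^ CARD('n) * 2 ^ n)) * \<rho> ^ CARD('n) * T" by (simp add: power_mult_distrib)
    also have "\<dots> \<le> de_giorgi_const C0 C1 n CARD('n) (measure lborel (ball (0 :: real ^ 'n) 1)) * \<rho> ^ CARD('n) * T"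
      using small \<rho> Tp by (intro mult_right_mono) auto
    finally have mE: "measure lebesgue E * (G (k / \<rho>) / k\<^sup>2) \<le> de_giorgi_const C0 C1 n CARD('n) (measure lborel (ball (0 :: real ^ 'n) 1)) * \<rho> ^ CARD('n)"
      using Tp unfolding \<kappa> by (simp add: pos_divide_le_eq)
    have "\<forall>x\<in>cube \<rho>. \<forall>t\<in>{- T<..<0}. k / 2 \<le> u (x, t)"
    proof (intro ballI)
      fix x :: "real ^ 'n" and t assume x: "x \<in> cube \<rho>" and t: "t \<in> {- T<..<0}"
      have "cball x \<rho> \<subseteq> cube (2 * \<rho>)" using cball_subset_cube[OF x, of \<rho>] by simp
      \<comment> \<open>The interval has length \<open>T\<close>, the reciprocal of
        \<open>G (k / \<rho>) / k\<^sup>2\<close>, which permits a ramp with \<open>h = T\<close>.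
        Its end \<open>t / 2\<close> lies strictly between \<open>t\<close> and 0, and half the ramp
        is over at \<open>t / 2 - T / 2 \<le> t\<close> because \<open>t > - T\<close>. By
        \<open>T2_ge\<close> it stays in the open outer cylinder.\<close>
      then have sub: "cball x \<rho> \<times> {t / 2 - T..t / 2} \<subseteq> cube (2 * \<rho>) \<times> {- T2<..<0}"
        using t T2_ge Tp by (intro Sigma_mono) auto
      show "k / 2 \<le> u (x, t)"
      proof (rule supersolution_de_giorgi[OF sc C ws nn sub k \<rho> Gp(1) Tp(1) _ E _ mE])
        show "1 / T \<le> G (k / \<rho>) / k\<^sup>2" unfolding \<kappa> by simp
        show "\<forall>z\<in>ball x \<rho> \<times> {t / 2 - T<..<t / 2}. u z < k \<longrightarrow> z \<in> E"
        proof (intro ballI impI)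
          fix z assume "z \<in> ball x \<rho> \<times> {t / 2 - T<..<t / 2}" and z: "u z < k"
          then have "z \<in> cball x \<rho> \<times> {t / 2 - T..t / 2}" by (auto simp: mem_Times_iff)
          then have "z \<in> cube (2 * \<rho>) \<times> {- T2<..<0}" using sub by blast
          then show "z \<in> E" using z by (auto simp: E_def)
        qed
      qed (use t in auto)
    qed
    moreover have "continuous_on (cube \<rho> \<times> {- T<..<0}) u"
      by (rule continuous_on_subset[OF cu], intro Sigma_mono cube_mono) (use \<rho> T2_ge Tp in auto)
    ultimately show ?thesis unfolding cyl by (intro ess_inf_on_ge)
  qed
qed

text \<open>Levels and radii are paired so that \<open>k / r\<close> is
  \<open>\<omega> / (2 * R)\<close> both times \<open>G (k / r) / k\<^sup>2\<close> is evaluated;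
  this quotient is \<open>4 / \<Delta>\<close> at the level \<open>\<omega> / 2\<close> and
  \<open>16 / \<Delta>\<close> at the level \<open>\<omega> / 4\<close>. The time to be bridged is
  at most \<open>\<theta> * \<Delta>\<close>, whence the term
  \<open>(16 * \<theta>)\<^sup>2\<close>.\<close>

lemma supersolution_positivity:
  fixes u :: "'n::finite space_time \<Rightarrow> real" and A :: "'n vector_field"
  assumes sc: "structure_conditions C0 C1 g A" and C: "0 < C0" "0 < C1" and \<nu>0: "0 < \<nu>"
    and small: "\<nu> * (4 ^ CARD('n) * 4) \<le> de_giorgi_const C0 C1 n CARD('n) (measure lborel (ball (0 :: real ^ 'n) 1))"
    and s: "0 < s" "s \<le> 1 / 3" and \<theta>: "1 < \<theta>"
    and log_small: "log_const C0 C1 n * (16 * \<theta>)\<^sup>2 * 4 * 2 ^ CARD('n) * measure lborel (ball (0 :: real ^ 'n) 1)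
      \<le> de_giorgi_const C0 C1 n CARD('n) (measure lborel (ball (0 :: real ^ 'n) 1)) * ln (1 + 1 / s)"
    and \<omega>: "0 < \<omega>" and R: "0 < R" and \<Delta>: "\<Delta> = \<omega>\<^sup>2 * inverse (G (\<omega> / (2 * R)))"
    and ws: "weak_supersolution g A (cube (2 * R) \<times> {- \<theta> * \<Delta><..<0}) u"
    and nn: "\<forall>z\<in>cube (2 * R) \<times> {- \<theta> * \<Delta><..<0}. 0 \<le> u z"
    and T0: "T0 \<in> {- \<theta> * \<Delta>..- \<Delta>}"
    and m: "measure lebesgue ((cube (2 * R) \<times> {T0<..<T0 + \<Delta>}) \<inter> {z. u z < \<omega> / 2})
      \<le> \<nu> * measure lebesgue (cube (2 * R) :: (real ^ 'n) set) * \<Delta>"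
  shows "ereal (s / 8 * \<omega>) \<le> ess_inf_on (cylinder g (\<omega> / 2) (R / 2) (1 / 2)) u"
proof -
  define \<tau> where "\<tau> = intrinsic_time g (\<omega> / 2) (R / 2) (1 / 2)"
  have \<tau>_eq: "\<tau> = \<omega>\<^sup>2 * inverse (G (\<omega> / R)) / 8" by (simp add: \<tau>_def intrinsic_time_def power_divide)
  have cyl: "cylinder g (\<omega> / 2) (R / 2) (1 / 2) = cube (R / 2) \<times> {- \<tau>..0}" by (simp add: cylinder_def \<tau>_def)
  have cu: "continuous_on (cube (2 * R) \<times> {- \<theta> * \<Delta><..<0}) u" using ws by (simp add: weak_supersolution_def)
  show ?thesis
  proof (cases "\<forall>\<sigma>. G \<sigma> = 0")
    case True
    then have "\<tau> = 0" by (simp add: \<tau>_eq)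
    then show ?thesis unfolding cyl by (intro ess_inf_on_ge) auto
  next
    case False
    then have Gpos: "0 < G \<sigma>" if "0 < \<sigma>" for \<sigma> using G_pos_or_zero that by blast
    have Gp: "0 < G (\<omega> / R)" "0 < G (\<omega> / (2 * R))" using Gpos \<omega> R by simp_all
    have \<Delta>p: "0 < \<Delta>" using Gp \<omega> by (simp add: \<Delta>)
    have \<kappa>: "G (\<omega> / (2 * R)) = \<omega>\<^sup>2 / \<Delta>"
      using divide_eq_inverse_scaled[of "G (\<omega> / (2 * R))" "\<omega>\<^sup>2"] \<omega> unfolding \<Delta>[symmetric] by (simp add: divide_eq_eq)
    have \<tau>\<Delta>: "\<tau> \<le> \<Delta> / 32"
    proof -
      have "G (\<omega> / (2 * R)) \<le> (1 / 2)\<^sup>2 * G (\<omega> / R)" using G_scale_down[of "1 / 2" "\<omega> / R"] \<omega> R by simp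
      from inverse_le_scaled_inverse[OF this Gp(2,1)]
      have "\<omega>\<^sup>2 * inverse (G (\<omega> / R)) \<le> \<omega>\<^sup>2 * ((1 / 2)\<^sup>2 * inverse (G (\<omega> / (2 * R))))" by (intro mult_left_mono) auto
      then show ?thesis unfolding \<tau>_eq \<Delta> by (simp add: power2_eq_square)
    qed
    have \<theta>\<Delta>: "\<Delta> < \<theta> * \<Delta>" using \<theta> \<Delta>p by simp
    define E where "E = (cube (2 * R) \<times> {T0<..<T0 + \<Delta>}) \<inter> {z. u z < \<omega> / 2}"
    have slab: "cube (2 * R) \<times> {T0<..<T0 + \<Delta>} \<subseteq> cube (2 * R) \<times> {- \<theta> * \<Delta><..<0}"
      using T0 by (intro Sigma_mono) auto
    have "open (cube (2 * R) \<times> {T0<..<T0 + \<Delta>} :: 'n space_time set)" by (intro open_Times open_cube) simp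
    from continuous_open_preimage[OF continuous_on_subset[OF cu slab] this open_lessThan[of "\<omega> / 2"]]
    have "open E" by (simp add: E_def Int_def vimage_def)
    then have "E \<in> sets lebesgue" by (simp add: borel_open)
    moreover have "bounded E"
      unfolding E_def by (rule bounded_subset[OF bounded_cube_times[of "2 * R" T0 "T0 + \<Delta>"]]) auto
    ultimately have E: "E \<in> lmeasurable" by (rule bounded_set_imp_lmeasurable[rotated])
    \<comment> \<open>The open slab may touch the ends of the domain in time, so a closed
      subinterval is used. With \<open>h = 3 * \<Delta> / 4\<close>, half the ramp that starts at
      \<open>T0 + \<Delta> / 8\<close> is over at \<open>T0 + \<Delta> / 2\<close>.\<close>
    have pos1: "\<omega> / 4 \<le> u (x, t)" if x: "x \<in> cube R" and t: "T0 + \<Delta> / 2 \<le> t" "t < T0 + 7 * \<Delta> / 8" for x t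
    proof -
      have kr: "\<omega> / 2 / R = \<omega> / (2 * R)" by simp
      have \<kappa>1: "G (\<omega> / 2 / R) / (\<omega> / 2)\<^sup>2 = 4 / \<Delta>" unfolding kr \<kappa> using \<omega> by (simp add: power_divide)
      have "cball x R \<subseteq> cube (2 * R)" using cball_subset_cube[OF x, of R] by simp
      then have sub0: "cball x R \<times> {T0 + \<Delta> / 8..T0 + 7 * \<Delta> / 8} \<subseteq> cube (2 * R) \<times> {T0<..<T0 + \<Delta>}"
        using \<Delta>p by (intro Sigma_mono) auto
      note sub = order_trans[OF sub0 slab]
      have "\<omega> / 2 / 2 \<le> u (x, t)"
      proof (rule supersolution_de_giorgi[OF sc C ws nn sub _ R _ _ _ E])
        show "0 < \<omega> / 2" "0 < 3 * \<Delta> / 4" using \<omega> \<Delta>p by simp_all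
        show "0 < G (\<omega> / 2 / R)" unfolding kr by (rule Gp)
        show "1 / (3 * \<Delta> / 4) \<le> G (\<omega> / 2 / R) / (\<omega> / 2)\<^sup>2" unfolding \<kappa>1 using \<Delta>p by (simp add: field_simps)
        show "\<forall>z\<in>ball x R \<times> {T0 + \<Delta> / 8<..<T0 + 7 * \<Delta> / 8}. u z < \<omega> / 2 \<longrightarrow> z \<in> E"
        proof (intro ballI impI)
          fix z assume "z \<in> ball x R \<times> {T0 + \<Delta> / 8<..<T0 + 7 * \<Delta> / 8}" and z: "u z < \<omega> / 2"
          then have "z \<in> cball x R \<times> {T0 + \<Delta> / 8..T0 + 7 * \<Delta> / 8}" by (auto simp: mem_Times_iff)
          then have "z \<in> cube (2 * R) \<times> {T0<..<T0 + \<Delta>}" using sub0 by blast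
          then show "z \<in> E" using z by (auto simp: E_def)
        qed
        have "measure lebesgue E \<le> \<nu> * (4 * R) ^ CARD('n) * \<Delta>" using m R by (simp add: E_def measure_cube)
        then have "measure lebesgue E * (4 / \<Delta>) \<le> \<nu> * (4 * R) ^ CARD('n) * \<Delta> * (4 / \<Delta>)" using \<Delta>p by (intro mult_right_mono) auto
        also have "\<dots> = (\<nu> * (4 ^ CARD('n) * 4)) * R ^ CARD('n)" using \<Delta>p by (simp add: power_mult_distrib)
        also have "\<dots> \<le> de_giorgi_const C0 C1 n CARD('n) (measure lborel (ball (0 :: real ^ 'n) 1)) * R ^ CARD('n)"
          using small R by (intro mult_right_mono) auto
        finally show "measure lebesgue E * (G (\<omega> / 2 / R) / (\<omega> / 2)\<^sup>2)
            \<le> de_giorgi_const C0 C1 n CARD('n) (measure lborel (ball (0 :: real ^ 'n) 1)) * R ^ CARD('n)" unfolding \<kappa>1 .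
        show "T0 + \<Delta> / 8 + 3 * \<Delta> / 4 / 2 \<le> t" using t by simp
      qed (rule t)
      then show ?thesis by simp
    qed
    have "\<forall>x\<in>cube (R / 2). \<forall>t\<in>{- \<tau><..<0}. s / 8 * \<omega> \<le> u (x, t)"
    proof (intro ballI)
      fix x :: "real ^ 'n" and t assume x: "x \<in> cube (R / 2)" and t: "t \<in> {- \<tau><..<0}"
      \<comment> \<open>\<open>t1\<close> is the time from which \<open>pos1\<close> holds, and an
        initial layer of length \<open>\<Delta> / 8\<close> is used. Since
        \<open>T0 \<le> - \<Delta>\<close> and \<open>\<tau> \<le> \<Delta> / 32\<close>, every
        \<open>t\<close> considered lies beyond that layer.\<close>
      define t1 t2 where "t1 = T0 + \<Delta> / 2" and "t2 = t / 2"
      have cR: "cball x (R / 2) \<subseteq> cube R" using cball_subset_cube[OF x, of "R / 2"] by simp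
      then have "cball x (R / 2) \<subseteq> cube (2 * R)" using cube_mono[of R "2 * R"] R by auto
      then have sub: "cball x (R / 2) \<times> {t1..t2} \<subseteq> cube (2 * R) \<times> {- \<theta> * \<Delta><..<0}"
        using t T0 \<Delta>p by (intro Sigma_mono) (auto simp: t1_def t2_def)
      have "compact (cball x (R / 2) \<times> {t1..t2})" by (intro compact_Times compact_cball compact_Icc)
      from supersolution_local_solution[OF sc C ws nn this sub]
      obtain K V where ls: "local_solution g0 g1 g n C0 C1 u K V" and inK: "cball x (R / 2) \<times> {t1..t2} \<subseteq> interior K" .
      interpret local_solution g0 g1 g n C0 C1 u K V by (rule ls)
      have kr: "\<omega> / 4 / (R / 2) = \<omega> / (2 * R)" by simp
      have \<kappa>2: "G (\<omega> / 4 / (R / 2)) / (\<omega> / 4)\<^sup>2 = 16 / \<Delta>" unfolding kr \<kappa> using \<omega> by (simp add: power_divide)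
      have tle: "t1 + \<Delta> / 8 / 2 \<le> t" "t < t2" using t T0 \<tau>\<Delta> \<Delta>p by (auto simp: t1_def t2_def)
      have "0 \<le> 16 / \<Delta> * (t2 - t1)" using tle \<Delta>p by simp
      moreover have "16 / \<Delta> * (t2 - t1) \<le> 16 / \<Delta> * (\<theta> * \<Delta>)"
        using t T0 \<Delta>p by (intro mult_left_mono) (auto simp: t1_def t2_def)
      then have "16 / \<Delta> * (t2 - t1) \<le> 16 * \<theta>" using \<Delta>p by simp
      ultimately have sq: "(16 / \<Delta> * (t2 - t1))\<^sup>2 \<le> (16 * \<theta>)\<^sup>2" by (rule power_mono[rotated])
      have lc: "0 \<le> log_const C0 C1 n" using Ce_pos by (simp add: log_const_def)
      have "s * (\<omega> / 4) / 2 \<le> u (x, t)"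
      proof (rule forward_positivity[OF _ _ _ inK _ _ s _ _ tle])
        show "0 < \<omega> / 4" "0 < R / 2" "0 < \<Delta> / 8" using \<omega> R \<Delta>p by simp_all
        show "0 < G \<sigma>" if "0 < \<sigma>" for \<sigma> by (rule Gpos[OF that])
        show "\<forall>y\<in>cball x (R / 2). \<forall>t\<in>{t1..<t1 + \<Delta> / 8}. \<omega> / 4 \<le> u (y, t)"
          using cR \<Delta>p by (intro ballI pos1) (auto simp: t1_def)
        show "log_const C0 C1 n * (G (\<omega> / 4 / (R / 2)) / (\<omega> / 4)\<^sup>2 * (t2 - t1))\<^sup>2 * 4 * 2 ^ CARD('n) * measure lborel (ball (0 :: real ^ 'n) 1)
            \<le> de_giorgi_const C0 C1 n CARD('n) (measure lborel (ball (0 :: real ^ 'n) 1)) * ln (1 + 1 / s)"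
          unfolding \<kappa>2 by (rule order_trans[OF _ log_small], intro mult_right_mono mult_left_mono sq lc) auto
        show "x \<in> ball x (R / 2 / 4)" using R by simp
      qed
      then show "s / 8 * \<omega> \<le> u (x, t)" by simp
    qed
    moreover have "continuous_on (cube (R / 2) \<times> {- \<tau><..<0}) u"
    proof (rule continuous_on_subset[OF cu], intro Sigma_mono cube_mono)
      have "- \<theta> * \<Delta> \<le> - \<tau>" using \<tau>\<Delta> \<theta>\<Delta> \<Delta>p by linarith
      then show "{- \<tau><..<0} \<subseteq> {- \<theta> * \<Delta><..<0}" by (auto simp del: mult_minus_left)
    qed (use R in simp)
    ultimately show ?thesis unfolding cyl by (intro ess_inf_on_ge)
  qed
qed

end

theorem lemma2p2:
  fixes g0 g1 C0 C1 :: real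
  assumes "1 < g0" and "g0 \<le> g1" and "0 < C0" and "0 < C1"
    and "2 \<le> g0"
  shows "\<exists>\<nu>\<^sub>0\<in>{0<..<1}.
    (\<forall>g (A :: 'n::finite vector_field).
       growth_function g0 g1 g \<and> structure_conditions C0 C1 g A \<longrightarrow> property_P g A \<nu>\<^sub>0) \<and>
    (\<forall>\<theta>\<^sub>0>1. \<exists>\<delta>\<^sub>1\<in>{0<..<1}.
       \<forall>g (A :: 'n vector_field) \<omega> R \<Delta> T\<^sub>0 u.
         growth_function g0 g1 g \<and> structure_conditions C0 C1 g A \<and>
         0 < \<omega> \<and> 0 < R \<and> \<Delta> = \<omega>\<^sup>2 * inverse (primitive g (\<omega> / (2 * R))) \<and>
         weak_supersolution g A (cube (2 * R) \<times> {- \<theta>\<^sub>0 * \<Delta><..<0}) u \<and>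
         (\<forall>z\<in>cube (2 * R) \<times> {- \<theta>\<^sub>0 * \<Delta><..<0}. 0 \<le> u z) \<and>
         T\<^sub>0 \<in> {- \<theta>\<^sub>0 * \<Delta>..- \<Delta>} \<and>
         measure lebesgue ((cube (2 * R) \<times> {T\<^sub>0<..<T\<^sub>0 + \<Delta>}) \<inter> {z. u z < \<omega> / 2})
           \<le> \<nu>\<^sub>0 * measure lebesgue (cube (2 * R) :: (real ^ 'n) set) * \<Delta>
         \<longrightarrow> ess_inf_on (cylinder g (\<omega> / 2) (R / 2) (1 / 2)) u \<ge> ereal (\<delta>\<^sub>1 * \<omega>))"
proof -
  define n where "n = max 2 (nat \<lceil>g1\<rceil>)"
  have n2: "2 \<le> n" and ng: "g1 \<le> real n" unfolding n_def by linarith+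
  define cN where "cN = measure lborel (ball (0 :: real ^ 'n) 1)"
  have cN: "0 < cN" unfolding cN_def by (rule content_ball_pos) simp
  define \<mu> where "\<mu> = de_giorgi_const C0 C1 n CARD('n) cN"
  have \<mu>: "0 < \<mu>" unfolding \<mu>_def by (rule de_giorgi_const_pos[OF assms(3) n2 cN])
  define a :: real where "a = 4 ^ CARD('n) * 2 ^ n"
  have a: "0 < a" by (simp add: a_def)
  \<comment> \<open>The bound \<open>1 / 2\<close> ensures \<open>\<nu> < 1\<close>. The other one
    is the condition of \<open>supersolution_property_P\<close>, which implies that of
    \<open>supersolution_positivity\<close> because \<open>4 \<le> 2 ^ n\<close>; neither involves
    \<open>\<theta>\<close>.\<close>
  define \<nu> where "\<nu> = min (1 / 2) (\<mu> / a)"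
  have \<nu>: "0 < \<nu>" "\<nu> < 1" using \<mu> a by (auto simp: \<nu>_def)
  have \<nu>a: "\<nu> * a \<le> \<mu>"
  proof -
    have "\<nu> \<le> \<mu> / a" by (simp add: \<nu>_def)
    then show ?thesis using a by (simp add: pos_le_divide_eq)
  qed
  have \<nu>4: "\<nu> * (4 ^ CARD('n) * 4) \<le> \<mu>"
  proof -
    have "(2 :: real) ^ 2 \<le> 2 ^ n" by (rule power_increasing[OF n2]) simp
    then have "(4 :: real) \<le> 2 ^ n" by (simp add: power2_eq_square del: power_increasing_iff)
    then have "4 ^ CARD('n) * 4 \<le> a" unfolding a_def by (rule mult_left_mono) simp
    then have "\<nu> * (4 ^ CARD('n) * 4) \<le> \<nu> * a" by (rule mult_left_mono) (use \<nu> in simp)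
    then show ?thesis using \<nu>a by linarith
  qed
  have gr: "growth g0 g1 g n" if "growth_function g0 g1 g" for g
    using that assms n2 ng by (simp add: growth_def)
  have main: "\<exists>\<delta>\<in>{0<..<1}. \<forall>g (A :: 'n vector_field) \<omega> R \<Delta> T\<^sub>0 u.
         growth_function g0 g1 g \<and> structure_conditions C0 C1 g A \<and>
         0 < \<omega> \<and> 0 < R \<and> \<Delta> = \<omega>\<^sup>2 * inverse (primitive g (\<omega> / (2 * R))) \<and>
         weak_supersolution g A (cube (2 * R) \<times> {- \<theta> * \<Delta><..<0}) u \<and>
         (\<forall>z\<in>cube (2 * R) \<times> {- \<theta> * \<Delta><..<0}. 0 \<le> u z) \<and>
         T\<^sub>0 \<in> {- \<theta> * \<Delta>..- \<Delta>} \<and>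
         measure lebesgue ((cube (2 * R) \<times> {T\<^sub>0<..<T\<^sub>0 + \<Delta>}) \<inter> {z. u z < \<omega> / 2})
           \<le> \<nu> * measure lebesgue (cube (2 * R) :: (real ^ 'n) set) * \<Delta>
         \<longrightarrow> ess_inf_on (cylinder g (\<omega> / 2) (R / 2) (1 / 2)) u \<ge> ereal (\<delta> * \<omega>)"
    if \<theta>: "1 < \<theta>" for \<theta>
  proof -
    define b where "b = log_const C0 C1 n * (16 * \<theta>)\<^sup>2 * 4 * 2 ^ CARD('n) * cN"
    \<comment> \<open>The exponential solves the smallness condition
      \<open>b \<le> \<mu> * ln (1 + 1 / s)\<close> of the logarithmic estimate. The witness
      \<open>s / 8\<close> below combines the level \<open>\<omega> / 4\<close> with the factor
      \<open>s / 2\<close> of \<open>forward_positivity\<close>.\<close>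
    define s where "s = min (1 / 3) (1 / exp (b / \<mu>))"
    have s: "0 < s" "s \<le> 1 / 3" by (simp_all add: s_def)
    have "s \<le> 1 / exp (b / \<mu>)" by (simp add: s_def)
    then have "exp (b / \<mu>) \<le> 1 / s" using s by (simp add: field_simps)
    then have "exp (b / \<mu>) \<le> 1 + 1 / s" by simp
    then have "b / \<mu> \<le> ln (1 + 1 / s)" using s by (subst ln_ge_iff) (auto intro: add_pos_pos)
    then have small: "b \<le> \<mu> * ln (1 + 1 / s)" using \<mu> by (simp add: pos_divide_le_eq mult.commute)
    show ?thesis
    proof (intro bexI[of _ "s / 8"] allI impI, elim conjE)
      fix g and A :: "'n vector_field" and \<omega> R \<Delta> T0 u
      assume gf: "growth_function g0 g1 g" and h: "structure_conditions C0 C1 g A"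
        "0 < \<omega>" "0 < R" "\<Delta> = \<omega>\<^sup>2 * inverse (primitive g (\<omega> / (2 * R)))"
        "weak_supersolution g A (cube (2 * R) \<times> {- \<theta> * \<Delta><..<0}) u"
        "\<forall>z\<in>cube (2 * R) \<times> {- \<theta> * \<Delta><..<0}. 0 \<le> u z"
        "T0 \<in> {- \<theta> * \<Delta>..- \<Delta>}"
        "measure lebesgue ((cube (2 * R) \<times> {T0<..<T0 + \<Delta>}) \<inter> {z. u z < \<omega> / 2})
           \<le> \<nu> * measure lebesgue (cube (2 * R) :: (real ^ 'n) set) * \<Delta>"
      interpret growth g0 g1 g n by (rule gr[OF gf])
      show "ereal (s / 8 * \<omega>) \<le> ess_inf_on (cylinder g (\<omega> / 2) (R / 2) (1 / 2)) u"
        by (rule supersolution_positivity[OF h(1) assms(3,4) \<nu>(1) \<nu>4[unfolded \<mu>_def cN_def] s \<theta>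
            small[unfolded \<mu>_def cN_def b_def] h(2-)])
    qed (use s in auto)
  qed
  have P: "property_P g A \<nu>" if "growth_function g0 g1 g" "structure_conditions C0 C1 g A" for g and A :: "'n vector_field"
    by (rule growth.supersolution_property_P[OF gr[OF that(1)] that(2) assms(3,4) \<nu>(1)])
      (use \<nu>a in \<open>simp add: a_def \<mu>_def cN_def\<close>)
  show ?thesis
  proof (rule bexI[of _ \<nu>], rule conjI)
    show "\<forall>g (A :: 'n vector_field). growth_function g0 g1 g \<and> structure_conditions C0 C1 g A \<longrightarrow> property_P g A \<nu>"
      using P by blast
  qed (use \<nu> main in simp_all)
qed

end
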